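(* Let $\Omega\subseteq\mathbb{R}^n$ be an open domain, let $N\ge 1$, $p\ge 3$ and $p'=\frac{p}{p-1}$. Assume that $u\in W^{1,p}(\Omega,\mathbb{R}^N)$ is a weak solution of the system \[ \operatorname{div}\left(|\nabla u|^{p-2}\nabla u^\alpha\right)=f^\alpha\qquad\text{in }\Omega\text{ for }\alpha=1,\ldots,N, \] where $f\in W^{1,p'}(\Omega,\mathbb{R}^N)$. Then $\nabla u\in\mathcal{N}^{\theta,2/\theta}_{\mathrm{loc}}(\Omega,\mathbb{R}^{N\times n})$ for every $\theta\in\left[\frac{2}{p},\frac{2}{p-1}\right)$, and for every such $\theta$ and every $\Omega'\Subset\Omega$, \[ \|\nabla u\|_{\mathcal{N}^{\theta,2/\theta}(\Omega')}\le C\left(\|u\|_{W^{1,p}(\Omega)}+\|f\|_{W^{1,p'}(\Omega)}^{\frac{1}{p-1}}\right), \] where the constant $C$ may depend on $\Omega',\Omega,n,N,p,\theta$, but not on the functions $u,f$.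
   Context: $u^\alpha$, $f^\alpha$ denote the components of $u$, $f$, and $|\nabla u|$ is the Euclidean (Frobenius) norm of the full gradient $\nabla u$. Nikol'skiĭ spaces: for an open set $\Omega\subseteq\mathbb{R}^n$ and $\delta>0$ put $\Omega_\delta=\{x\in\Omega:\mathbf{B}(x,\delta)\subseteq\Omega\}$, where $\mathbf{B}(x,\delta)$ is the ball of center $x$ and radius $\delta$. Fix some $\delta>0$. For $w\in L^q(\Omega)$ (possibly vector-valued) and $\theta\in[0,1]$, the seminorm $[w]_{\mathcal{N}^{\theta,q}(\Omega)}$ is the smallest constant $A$ such that \[ \left(\int_{\Omega_{|v|}}|w(x+v)-w(x)|^q\,dx\right)^{1/q}\le A|v|^\theta \] for all vectors $v\in\mathbb{R}^n$ with $|v|\le\delta$. The norm is $\|w\|_{\mathcal{N}^{\theta,q}(\Omega)}=\|w\|_{L^q(\Omega)}+[w]_{\mathcal{N}^{\theta,q}(\Omega)}$; changing $\delta$ gives an equivalent norm (for a subdomain $\Omega'\Subset\Omega$ one may take $\delta=\operatorname{dist}(\Omega',\partial\Omega)$). $\mathcal{N}^{\theta,q}_{\mathrm{loc}}(\Omega)$ consists of functions belonging to $\mathcal{N}^{\theta,q}(\Omega')$ for every $\Omega'\Subset\Omega$ (i.e. $\Omega'$ open with compact closure contained in $\Omega$). *)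

theory Defs
  imports "HOL-Analysis.Analysis"
begin

subsection \<open>Lebesgue and Sobolev spaces\<close>

text \<open>
  Members of function spaces over \<open>\<Omega>\<close> are represented by total functions; only their values on
  \<open>\<Omega>\<close> (up to null sets) matter. The norms below are real-valued and meaningful only together
  with the corresponding membership predicate. The matrix type \<open>real^'n^'N\<close> of a gradient has
  \<open>\<nabla>u^\<alpha>\<close> as its row \<open>\<alpha>\<close>, and its library norm is the Frobenius norm.
\<close>

definition in_Lp :: "real \<Rightarrow> 'a::euclidean_space set \<Rightarrow> ('a \<Rightarrow> 'b::euclidean_space) \<Rightarrow> bool" where
  "in_Lp q \<Omega> w \<longleftrightarrow> w \<in> borel_measurable (lebesgue_on \<Omega>) \<and>
     integrable (lebesgue_on \<Omega>) (\<lambda>x. norm (w x) powr q)"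

definition Lp_norm :: "real \<Rightarrow> 'a::euclidean_space set \<Rightarrow> ('a \<Rightarrow> 'b::euclidean_space) \<Rightarrow> real" where
  "Lp_norm q \<Omega> w = (\<integral>x. norm (w x) powr q \<partial>lebesgue_on \<Omega>) powr (1 / q)"

primrec Ck :: "nat \<Rightarrow> ('a::euclidean_space \<Rightarrow> 'b::euclidean_space) \<Rightarrow> bool" where
  "Ck 0 \<phi> \<longleftrightarrow> continuous_on UNIV \<phi>"
| "Ck (Suc k) \<phi> \<longleftrightarrow> (\<forall>x. \<phi> differentiable at x) \<and>
     (\<forall>v. Ck k (\<lambda>x. frechet_derivative \<phi> (at x) v))"

definition test_function :: "'a::euclidean_space set \<Rightarrow> ('a \<Rightarrow> real) \<Rightarrow> bool" where
  "test_function \<Omega> \<phi> \<longleftrightarrow> (\<forall>k. Ck k \<phi>) \<and>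
     compact (closure {x. \<phi> x \<noteq> 0}) \<and> closure {x. \<phi> x \<noteq> 0} \<subseteq> \<Omega>"

definition grad :: "(real^'n \<Rightarrow> real) \<Rightarrow> real^'n \<Rightarrow> real^'n" where
  "grad \<phi> x = (\<chi> i. frechet_derivative \<phi> (at x) (axis i 1))"

definition locally_integrable :: "'a::euclidean_space set \<Rightarrow> ('a \<Rightarrow> 'b::euclidean_space) \<Rightarrow> bool" where
  "locally_integrable \<Omega> w \<longleftrightarrow> (\<forall>K. compact K \<and> K \<subseteq> \<Omega> \<longrightarrow> w absolutely_integrable_on K)"

definition has_weak_gradient ::
  "(real^'n) set \<Rightarrow> (real^'n \<Rightarrow> real^'N) \<Rightarrow> (real^'n \<Rightarrow> real^'n^'N) \<Rightarrow> bool" where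
  "has_weak_gradient \<Omega> u G \<longleftrightarrow> locally_integrable \<Omega> u \<and> locally_integrable \<Omega> G \<and>
     (\<forall>\<phi>. test_function \<Omega> \<phi> \<longrightarrow> (\<forall>\<alpha> i.
        (\<integral>x. u x $ \<alpha> * grad \<phi> x $ i \<partial>lebesgue_on \<Omega>) = - (\<integral>x. G x $ \<alpha> $ i * \<phi> x \<partial>lebesgue_on \<Omega>)))"

text \<open>
  A weak gradient on an open set is unique up to a null set, so that the choice of a representative
  is immaterial.
\<close>
definition weak_gradient :: "(real^'n) set \<Rightarrow> (real^'n \<Rightarrow> real^'N) \<Rightarrow> real^'n \<Rightarrow> real^'n^'N" where
  "weak_gradient \<Omega> u = (SOME G. has_weak_gradient \<Omega> u G)"

definition in_W1p :: "real \<Rightarrow> (real^'n) set \<Rightarrow> (real^'n \<Rightarrow> real^'N) \<Rightarrow> bool" where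
  "in_W1p q \<Omega> u \<longleftrightarrow> in_Lp q \<Omega> u \<and> (\<exists>G. has_weak_gradient \<Omega> u G) \<and> in_Lp q \<Omega> (weak_gradient \<Omega> u)"

definition W1p_norm :: "real \<Rightarrow> (real^'n) set \<Rightarrow> (real^'n \<Rightarrow> real^'N) \<Rightarrow> real" where
  "W1p_norm q \<Omega> u = Lp_norm q \<Omega> u + Lp_norm q \<Omega> (weak_gradient \<Omega> u)"

subsection \<open>Nikol'skii spaces\<close>

text \<open>
  Closed balls are used, so that \<open>x + v\<close> lies in \<open>\<Omega>\<close> for every \<open>x\<close> in \<open>inner_set \<Omega> (norm v)\<close>.
  Open balls would change this set only by a null set.
\<close>
definition inner_set :: "'a::euclidean_space set \<Rightarrow> real \<Rightarrow> 'a set" where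
  "inner_set \<Omega> d = {x \<in> \<Omega>. cball x d \<subseteq> \<Omega>}"

definition nikolskii_bound ::
  "real \<Rightarrow> real \<Rightarrow> real \<Rightarrow> 'a::euclidean_space set \<Rightarrow> ('a \<Rightarrow> 'b::euclidean_space) \<Rightarrow> real \<Rightarrow> bool" where
  "nikolskii_bound \<delta> \<theta> q \<Omega> w A \<longleftrightarrow> (\<forall>v. norm v \<le> \<delta> \<longrightarrow>
     Lp_norm q (inner_set \<Omega> (norm v)) (\<lambda>x. w (x + v) - w x) \<le> A * norm v powr \<theta>)"

definition in_nikolskii ::
  "real \<Rightarrow> real \<Rightarrow> real \<Rightarrow> 'a::euclidean_space set \<Rightarrow> ('a \<Rightarrow> 'b::euclidean_space) \<Rightarrow> bool" where
  "in_nikolskii \<delta> \<theta> q \<Omega> w \<longleftrightarrow> in_Lp q \<Omega> w \<and> (\<exists>A. nikolskii_bound \<delta> \<theta> q \<Omega> w A)"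

definition nikolskii_seminorm ::
  "real \<Rightarrow> real \<Rightarrow> real \<Rightarrow> 'a::euclidean_space set \<Rightarrow> ('a \<Rightarrow> 'b::euclidean_space) \<Rightarrow> real" where
  "nikolskii_seminorm \<delta> \<theta> q \<Omega> w = Inf {A. nikolskii_bound \<delta> \<theta> q \<Omega> w A}"

definition nikolskii_norm ::
  "real \<Rightarrow> real \<Rightarrow> real \<Rightarrow> 'a::euclidean_space set \<Rightarrow> ('a \<Rightarrow> 'b::euclidean_space) \<Rightarrow> real" where
  "nikolskii_norm \<delta> \<theta> q \<Omega> w = Lp_norm q \<Omega> w + nikolskii_seminorm \<delta> \<theta> q \<Omega> w"

definition compactly_inside :: "'a::euclidean_space set \<Rightarrow> 'a set \<Rightarrow> bool" (infix "\<Subset>" 50) where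
  "\<Omega>' \<Subset> \<Omega> \<longleftrightarrow> open \<Omega>' \<and> compact (closure \<Omega>') \<and> closure \<Omega>' \<subseteq> \<Omega>"

definition in_nikolskii_loc ::
  "real \<Rightarrow> real \<Rightarrow> real \<Rightarrow> 'a::euclidean_space set \<Rightarrow> ('a \<Rightarrow> 'b::euclidean_space) \<Rightarrow> bool" where
  "in_nikolskii_loc \<delta> \<theta> q \<Omega> w \<longleftrightarrow> (\<forall>\<Omega>'. \<Omega>' \<Subset> \<Omega> \<longrightarrow> in_nikolskii \<delta> \<theta> q \<Omega>' w)"

subsection \<open>The inhomogeneous p-Laplace system\<close>

definition p_laplace_weak_solution ::
  "real \<Rightarrow> (real^'n) set \<Rightarrow> (real^'n \<Rightarrow> real^'N) \<Rightarrow> (real^'n \<Rightarrow> real^'N) \<Rightarrow> bool" where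
  "p_laplace_weak_solution p \<Omega> u f \<longleftrightarrow> (\<forall>\<alpha> \<phi>. test_function \<Omega> \<phi> \<longrightarrow>
     (\<integral>x. norm (weak_gradient \<Omega> u x) powr (p - 2) * (weak_gradient \<Omega> u x $ \<alpha> \<bullet> grad \<phi> x) \<partial>lebesgue_on \<Omega>)
       = - (\<integral>x. f x $ \<alpha> * \<phi> x \<partial>lebesgue_on \<Omega>))"

end

theory Submission
  imports Defs
begin

text \<open>
  Put \<open>c = 1 - 2 / p\<close>, \<open>V = |\<nabla>u|^(p/2-1) \<nabla>u\<close>, so that \<open>\<nabla>u = |V|^(-c) V\<close> and the flux is \<open>A = |V|^c V\<close>.
  Testing with second differences of \<open>u\<close> shows that \<open>V\<close> is locally in \<open>W^(1,2)\<close>; this is used only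
  qualitatively, to differentiate the system. Let \<open>\<gamma> = p - 2 / \<theta>\<close>, which lies in \<open>[0,1)\<close>. The differentiated
  system \<open>div (\<partial>\<^sub>k A) = \<partial>\<^sub>k f\<close> is tested with \<open>\<eta>\<^sup>2 F\<^sub>k\<close> for \<open>F = \<zeta> \<nabla>u\<close>, where \<open>\<zeta>\<close> is a regularisation of
  \<open>|V|^(-2\<gamma>/p)\<close>. As second derivatives of \<open>u\<close> are symmetric, the leading term is bounded below by
  \<open>(1 - \<gamma>) \<zeta> |V|^(2c) |D\<^sup>2u|\<^sup>2\<close>, and \<open>f\<close> enters only through \<open>\<nabla>f\<close>. This controls the \<open>W^(1,2)\<close> norm of
  \<open>|\<nabla>u|^(q/2-1) \<nabla>u\<close> for \<open>q = p - \<gamma> = 2 / \<theta>\<close>, and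
  \<open>|x - y|^q \<le> C ||x|^(q/2-1) x - |y|^(q/2-1) y|\<^sup>2\<close> turns it into the Nikol'skii bound.
\<close>

subsection \<open>Smooth functions\<close>

text \<open>At the zeros of \<open>V\<close> the negative exponent -c makes \<nabla>u a
  non-differentiable function of \<open>V\<close>, so \<nabla>u itself need not have weak
  derivatives. Its formal derivative \<open>H\<close> is used only under weights vanishing there.
  The weight \<zeta> = s^2 (\<epsilon> + s)^(-2-\<delta>) with s = |V| and \<delta> = 2\<gamma>/p is
  built for this: s^2 makes \<zeta> \<nabla>u a Lipschitz function of \<open>V\<close>, and \<zeta>
  tends to |V|^(-\<delta>) = |\<nabla>u|^(-\<gamma>). Measured in |\<nabla>u|, the logarithmic slope
  of \<zeta> is at least -\<gamma>; this is the loss of ellipticity, and \<gamma> < 1 is the upper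
  bound on \<theta>. The condition p \<ge> 3 ensures q \<ge> 2 for all these \<gamma>. Limits are
  taken without weak compactness: difference quotients of \<open>V\<close> along a dyadic sequence
  converge almost everywhere, so nonlinear chain rules hold pointwise, and bounded norms with almost
  everywhere convergence pass to the limit in integrals. In the energy inequality only
  |\<nabla>u|^(p-\<gamma>) and |\<nabla>f| |\<nabla>u|^(1-\<gamma>) survive. Both have degree p -
  \<gamma> if \<nabla>f is counted with degree p - 1, which is where the power 1/(p-1) of the norm
  of f comes from.\<close>

definition smooth :: "('a::euclidean_space \<Rightarrow> 'b::euclidean_space) \<Rightarrow> bool" where
  "smooth f \<longleftrightarrow> (\<forall>k. Ck k f)"

text \<open>The direction comes first, so that \<open>dderiv v f\<close> is a function of the point
  and can be differentiated again; \<open>Ck\<close> unfolds to a statement about these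
  functions.\<close>

definition dderiv :: "'a \<Rightarrow> ('a::euclidean_space \<Rightarrow> 'b::euclidean_space) \<Rightarrow> 'a \<Rightarrow> 'b" where
  "dderiv v f x = frechet_derivative f (at x) v"

lemma dderiv_eqI: "(f has_derivative f') (at x) \<Longrightarrow> dderiv v f x = f' v"
  unfolding dderiv_def by (simp add: frechet_derivative_at[symmetric])

lemma Ck_Suc_iff: "Ck (Suc k) f \<longleftrightarrow> (\<forall>x. f differentiable at x) \<and> (\<forall>v. Ck k (dderiv v f))"
  by (simp add: dderiv_def[abs_def])

lemma Ck_SucD: "Ck (Suc k) f \<Longrightarrow> Ck k f"
proof (induction k arbitrary: f)
  case 0
  then show ?case
    by (auto intro!: continuous_at_imp_continuous_on differentiable_imp_continuous_within)
next
  case (Suc k)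
  then show ?case unfolding Ck_Suc_iff[of "Suc k"] Ck_Suc_iff[of k] by blast
qed

lemma smoothD_has_derivative:
  assumes "smooth f" shows "(f has_derivative (\<lambda>v. dderiv v f x)) (at x)"
proof -
  have "Ck (Suc 0) f" using assms unfolding smooth_def by blast
  then have "f differentiable at x" by simp
  then show ?thesis unfolding dderiv_def by (simp add: frechet_derivative_works)
qed

lemma smooth_dderiv: "smooth f \<Longrightarrow> smooth (dderiv v f)"
  unfolding smooth_def by (metis Ck_Suc_iff)

lemma smooth_continuous_on: "smooth f \<Longrightarrow> continuous_on S f"
  unfolding smooth_def by (metis Ck.simps(1) continuous_on_subset subset_UNIV)

lemma smooth_measurable [measurable_dest]: "smooth f \<Longrightarrow> f \<in> borel_measurable borel"
  by (simp add: borel_measurable_continuous_onI smooth_continuous_on)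

lemma dderiv_linear:
  assumes "smooth f"
  shows "dderiv (a *\<^sub>R v) f x = a *\<^sub>R dderiv v f x" "dderiv (v + w) f x = dderiv v f x + dderiv w f x"
  using linear_scale[OF has_derivative_linear[OF smoothD_has_derivative[OF assms, of x]]]
    linear_add[OF has_derivative_linear[OF smoothD_has_derivative[OF assms, of x]]]
  by auto

lemma dderiv_basis_expand:
  assumes "smooth f"
  shows "dderiv v f x = (\<Sum>b\<in>Basis. (v \<bullet> b) *\<^sub>R dderiv b f x)"
proof -
  have l: "linear (\<lambda>v. dderiv v f x)"
    using has_derivative_linear[OF smoothD_has_derivative[OF assms, of x]] .
  have "dderiv v f x = dderiv (\<Sum>b\<in>Basis. (v \<bullet> b) *\<^sub>R b) f x"
    by (simp add: euclidean_representation)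
  also have "\<dots> = (\<Sum>b\<in>Basis. dderiv ((v \<bullet> b) *\<^sub>R b) f x)"
    using linear_sum[OF l, of "\<lambda>b. (v \<bullet> b) *\<^sub>R b" Basis] by simp
  finally show ?thesis by (simp add: dderiv_linear[OF assms])
qed

section \<open>Closure of smooth functions under algebraic operations\<close>

lemma Ck_const: "Ck k (\<lambda>x. c)"
proof (induction k arbitrary: c)
  case (Suc k)
  have "dderiv v (\<lambda>x. c) = (\<lambda>x. 0)" for v :: 'a by (rule ext, rule dderiv_eqI) simp
  then show ?case unfolding Ck_Suc_iff using Suc by simp
qed simp

lemma smooth_const: "smooth (\<lambda>x. c)"
  unfolding smooth_def by (simp add: Ck_const)

lemma Ck_add: "Ck k f \<Longrightarrow> Ck k g \<Longrightarrow> Ck k (\<lambda>x. f x + g x)"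
proof (induction k arbitrary: f g)
  case (Suc k)
  have d: "(f has_derivative (\<lambda>v. dderiv v f x)) (at x)" "(g has_derivative (\<lambda>v. dderiv v g x)) (at x)" for x
    using Suc.prems unfolding dderiv_def by (simp_all add: frechet_derivative_works)
  have "dderiv v (\<lambda>x. f x + g x) = (\<lambda>x. dderiv v f x + dderiv v g x)" for v
    by (rule ext, rule dderiv_eqI) (intro derivative_intros d)
  then show ?case using Suc unfolding Ck_Suc_iff by (auto intro: differentiable_add)
qed (auto intro: continuous_intros)

lemma smooth_add: "smooth f \<Longrightarrow> smooth g \<Longrightarrow> smooth (\<lambda>x. f x + g x)"
  unfolding smooth_def by (simp add: Ck_add)

lemma Ck_scaleR:
  fixes f :: "'a::euclidean_space \<Rightarrow> real"
  shows "Ck k f \<Longrightarrow> Ck k g \<Longrightarrow> Ck k (\<lambda>x. f x *\<^sub>R g x)"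
proof (induction k arbitrary: f g)
  case (Suc k)
  have d: "(f has_derivative (\<lambda>v. dderiv v f x)) (at x)" "(g has_derivative (\<lambda>v. dderiv v g x)) (at x)" for x
    using Suc.prems unfolding dderiv_def by (simp_all add: frechet_derivative_works)
  have "dderiv v (\<lambda>x. f x *\<^sub>R g x) = (\<lambda>x. f x *\<^sub>R dderiv v g x + dderiv v f x *\<^sub>R g x)" for v
    by (rule ext, rule dderiv_eqI) (intro derivative_intros d)
  moreover have "Ck k f" "Ck k g" using Suc.prems Ck_SucD by blast+
  ultimately show ?case
    using Suc unfolding Ck_Suc_iff
    by (auto intro!: Ck_add differentiable_scaleR)
qed (auto intro: continuous_intros)

lemma smooth_scaleR:
  fixes f :: "'a::euclidean_space \<Rightarrow> real"
  shows "smooth f \<Longrightarrow> smooth g \<Longrightarrow> smooth (\<lambda>x. f x *\<^sub>R g x)"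
  unfolding smooth_def by (simp add: Ck_scaleR)

lemma smooth_mult:
  fixes f g :: "'a::euclidean_space \<Rightarrow> real"
  shows "smooth f \<Longrightarrow> smooth g \<Longrightarrow> smooth (\<lambda>x. f x * g x)"
  using smooth_scaleR[of f g] by simp

lemma smooth_minus: "smooth f \<Longrightarrow> smooth (\<lambda>x. - f x)"
  using smooth_scaleR[OF smooth_const[of "-1::real"], of f] by simp

lemma smooth_diff: "smooth f \<Longrightarrow> smooth g \<Longrightarrow> smooth (\<lambda>x. f x - g x)"
  using smooth_add[of f "\<lambda>x. - g x"] smooth_minus[of g] by simp

lemma smooth_prod:
  fixes f :: "'i \<Rightarrow> 'a::euclidean_space \<Rightarrow> real"
  shows "(\<And>i. i \<in> I \<Longrightarrow> smooth (f i)) \<Longrightarrow> smooth (\<lambda>x. \<Prod>i\<in>I. f i x)"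
  by (induction I rule: infinite_finite_induct) (auto intro!: smooth_mult smooth_const)

lemma dderiv_mult:
  fixes f g :: "'a::euclidean_space \<Rightarrow> real"
  assumes "smooth f" "smooth g"
  shows "dderiv v (\<lambda>x. f x * g x) x = f x * dderiv v g x + dderiv v f x * g x"
  by (rule dderiv_eqI) (intro derivative_intros smoothD_has_derivative assms)

lemma dderiv_diff:
  assumes "smooth f" "smooth g"
  shows "dderiv v (\<lambda>x. f x - g x) x = dderiv v f x - dderiv v g x"
  by (rule dderiv_eqI) (intro derivative_intros smoothD_has_derivative assms)

section \<open>Affine substitutions and symmetry of second derivatives\<close>

lemma has_derivative_affine:
  assumes "(f has_derivative f') (at (c + s *\<^sub>R x))"
  shows "((\<lambda>x. f (c + s *\<^sub>R x)) has_derivative (\<lambda>v. f' (s *\<^sub>R v))) (at x)"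
  by (rule has_derivative_compose[where f="\<lambda>x. c + s *\<^sub>R x", OF _ assms])
     (auto intro!: derivative_eq_intros)

lemma Ck_affine: "Ck k f \<Longrightarrow> Ck k (\<lambda>x. f (c + s *\<^sub>R x))"
proof (induction k arbitrary: f)
  case (Suc k)
  have d: "(f has_derivative (\<lambda>v. dderiv v f x)) (at x)" for x
    using Suc.prems unfolding dderiv_def by (simp_all add: frechet_derivative_works)
  have "dderiv v (\<lambda>x. f (c + s *\<^sub>R x)) = (\<lambda>x. dderiv (s *\<^sub>R v) f (c + s *\<^sub>R x))" for v
    by (rule ext, rule dderiv_eqI) (rule has_derivative_affine[OF d])
  moreover have "(\<lambda>x. f (c + s *\<^sub>R x)) differentiable at x" for x
    using has_derivative_affine[OF d] differentiable_def by blast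
  ultimately show ?case using Suc unfolding Ck_Suc_iff by auto
next
  case 0
  then show ?case
    by (auto intro!: continuous_on_compose2[of UNIV f] continuous_intros)
qed

lemma smooth_affine: "smooth f \<Longrightarrow> smooth (\<lambda>x. f (c + s *\<^sub>R x))"
  unfolding smooth_def by (simp add: Ck_affine)

lemma dderiv_affine:
  assumes "smooth f" shows "dderiv v (\<lambda>x. f (c + s *\<^sub>R x)) x = s *\<^sub>R dderiv v f (c + s *\<^sub>R x)"
  using dderiv_eqI[OF has_derivative_affine[OF smoothD_has_derivative[OF assms]]]
  by (simp add: dderiv_linear[OF assms])

lemma smooth_translate: "smooth f \<Longrightarrow> smooth (\<lambda>x. f (x + c))"
  using smooth_affine[of f c 1] by (simp add: add.commute)

lemma dderiv_translate: "smooth f \<Longrightarrow> dderiv v (\<lambda>x. f (x + c)) x = dderiv v f (x + c)"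
  using dderiv_affine[of f v c 1] by (simp add: add.commute)

lemma smooth_reflect: "smooth f \<Longrightarrow> smooth (\<lambda>x. f (c - x))"
  using smooth_affine[of f c "-1"] by simp

lemma dderiv_reflect: "smooth f \<Longrightarrow> dderiv v (\<lambda>x. f (c - x)) x = - dderiv v f (c - x)"
  using dderiv_affine[of f v c "-1"] by simp

text \<open>The second difference f(x+tv+tw) - f(x+tv) - f(x+tw) + f(x) is symmetric in v and w. Two
  applications of the mean value theorem express it as t^2 times a mixed derivative at a point
  within O(t) of x, and continuity of the mixed derivative identifies the limit for either
  order.\<close>

lemma dderiv_commute:
  fixes f :: "'a::euclidean_space \<Rightarrow> real"
  assumes "smooth f" shows "dderiv v (dderiv w f) x = dderiv w (dderiv v f) x"
proof -
  have key: "\<exists>y. norm (y - x) \<le> \<bar>t\<bar> * (norm v + norm w) \<and>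
      f (x + t *\<^sub>R v + t *\<^sub>R w) - f (x + t *\<^sub>R v) - f (x + t *\<^sub>R w) + f x = t\<^sup>2 * dderiv w (dderiv v f) y"
    if t: "t > 0" for t :: real and v w
  proof -
    define g where "g s = f (x + s *\<^sub>R v + t *\<^sub>R w) - f (x + s *\<^sub>R v)" for s
    have dg: "(g has_real_derivative dderiv v f (x + s *\<^sub>R v + t *\<^sub>R w) - dderiv v f (x + s *\<^sub>R v)) (at s)" for s
    proof -
      have 1: "((\<lambda>s. f (c + s *\<^sub>R v)) has_derivative (\<lambda>h. dderiv (h *\<^sub>R v) f (c + s *\<^sub>R v))) (at s)" for c
        by (rule has_derivative_compose[of "\<lambda>s. c + s *\<^sub>R v" "\<lambda>h. h *\<^sub>R v", OF _ smoothD_has_derivative[OF assms]])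
           (auto intro!: derivative_eq_intros)
      have "(g has_derivative (\<lambda>h. dderiv (h *\<^sub>R v) f ((x + t *\<^sub>R w) + s *\<^sub>R v) - dderiv (h *\<^sub>R v) f (x + s *\<^sub>R v))) (at s)"
        unfolding g_def using has_derivative_diff[OF 1[of "x + t *\<^sub>R w"] 1[of x]] by (simp add: algebra_simps)
      moreover have "(\<lambda>h. dderiv (h *\<^sub>R v) f ((x + t *\<^sub>R w) + s *\<^sub>R v) - dderiv (h *\<^sub>R v) f (x + s *\<^sub>R v))
         = (*) (dderiv v f (x + s *\<^sub>R v + t *\<^sub>R w) - dderiv v f (x + s *\<^sub>R v))"
        by (rule ext) (simp add: dderiv_linear[OF assms] algebra_simps)
      ultimately show ?thesis by (simp add: has_field_derivative_def)
    qed
    obtain s where s: "0 < s" "s < t"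
      "g t - g 0 = (t - 0) * (dderiv v f (x + s *\<^sub>R v + t *\<^sub>R w) - dderiv v f (x + s *\<^sub>R v))"
      using MVT2[OF t, of g, OF dg] by blast
    define k where "k r = dderiv v f (x + s *\<^sub>R v + r *\<^sub>R w)" for r
    have dk: "(k has_real_derivative dderiv w (dderiv v f) (x + s *\<^sub>R v + r *\<^sub>R w)) (at r)" for r
    proof -
      have "(k has_derivative (\<lambda>h. dderiv (h *\<^sub>R w) (dderiv v f) (x + s *\<^sub>R v + r *\<^sub>R w))) (at r)"
        unfolding k_def
        by (rule has_derivative_compose[of "\<lambda>r. x + s *\<^sub>R v + r *\<^sub>R w" "\<lambda>h. h *\<^sub>R w", OF _ smoothD_has_derivative[OF smooth_dderiv[OF assms]]])
           (auto intro!: derivative_eq_intros)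
      moreover have "(\<lambda>h. dderiv (h *\<^sub>R w) (dderiv v f) (x + s *\<^sub>R v + r *\<^sub>R w)) = (*) (dderiv w (dderiv v f) (x + s *\<^sub>R v + r *\<^sub>R w))"
        by (rule ext) (simp add: dderiv_linear[OF smooth_dderiv[OF assms]])
      ultimately show ?thesis by (simp add: has_field_derivative_def)
    qed
    obtain r where r: "0 < r" "r < t" "k t - k 0 = (t - 0) * dderiv w (dderiv v f) (x + s *\<^sub>R v + r *\<^sub>R w)"
      using MVT2[OF t, of k, OF dk] by blast
    have "norm (s *\<^sub>R v + r *\<^sub>R w) \<le> norm (s *\<^sub>R v) + norm (r *\<^sub>R w)" by (rule norm_triangle_ineq)
    also have "\<dots> \<le> t * norm v + t * norm w"
      using s r by (auto intro!: add_mono mult_right_mono)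
    finally have "norm (x + s *\<^sub>R v + r *\<^sub>R w - x) \<le> \<bar>t\<bar> * (norm v + norm w)"
      using t by (simp add: algebra_simps)
    moreover have "f (x + t *\<^sub>R v + t *\<^sub>R w) - f (x + t *\<^sub>R v) - f (x + t *\<^sub>R w) + f x = g t - g 0"
      by (simp add: g_def)
    ultimately show ?thesis using s(3) r(3) t
      by (intro exI[of _ "x + s *\<^sub>R v + r *\<^sub>R w"]) (simp add: k_def power2_eq_square)
  qed
  have lim: "(\<lambda>n. (f (x + (1/real (Suc n)) *\<^sub>R v + (1/real (Suc n)) *\<^sub>R w) - f (x + (1/real (Suc n)) *\<^sub>R v) - f (x + (1/real (Suc n)) *\<^sub>R w) + f x) / (1/real (Suc n))\<^sup>2)
      \<longlonglongrightarrow> dderiv w (dderiv v f) x" for v w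
  proof -
    have "\<forall>n. \<exists>y. norm (y - x) \<le> \<bar>1/real (Suc n)\<bar> * (norm v + norm w) \<and>
      f (x + (1/real (Suc n)) *\<^sub>R v + (1/real (Suc n)) *\<^sub>R w) - f (x + (1/real (Suc n)) *\<^sub>R v) - f (x + (1/real (Suc n)) *\<^sub>R w) + f x
       = (1/real (Suc n))\<^sup>2 * dderiv w (dderiv v f) y"
      by (intro allI key) simp
    then obtain y where y: "\<And>n. norm (y n - x) \<le> \<bar>1/real (Suc n)\<bar> * (norm v + norm w)"
      "\<And>n. f (x + (1/real (Suc n)) *\<^sub>R v + (1/real (Suc n)) *\<^sub>R w) - f (x + (1/real (Suc n)) *\<^sub>R v) - f (x + (1/real (Suc n)) *\<^sub>R w) + f x
       = (1/real (Suc n))\<^sup>2 * dderiv w (dderiv v f) (y n)"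
      by metis
    have "(\<lambda>n. \<bar>1/real (Suc n)\<bar> * (norm v + norm w)) \<longlonglongrightarrow> 0 * (norm v + norm w)"
      using LIMSEQ_inverse_real_of_nat by (intro tendsto_intros) (simp add: inverse_eq_divide)
    then have "(\<lambda>n. \<bar>1/real (Suc n)\<bar> * (norm v + norm w)) \<longlonglongrightarrow> 0" by simp
    then have "(\<lambda>n. y n - x) \<longlonglongrightarrow> 0"
      by (rule Lim_null_comparison[OF always_eventually[OF allI[OF y(1)]]])
    then have "y \<longlonglongrightarrow> x" by (simp add: LIM_zero_iff)
    moreover have "isCont (dderiv w (dderiv v f)) x"
      using smooth_continuous_on[OF smooth_dderiv[OF smooth_dderiv[OF assms]], of UNIV]
      by (simp add: continuous_on_eq_continuous_at)
    ultimately have "(\<lambda>n. dderiv w (dderiv v f) (y n)) \<longlonglongrightarrow> dderiv w (dderiv v f) x"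
      by (rule isCont_tendsto_compose[rotated])
    then show ?thesis unfolding y(2) by simp
  qed
  have "(\<lambda>n. (f (x + (1/real (Suc n)) *\<^sub>R v + (1/real (Suc n)) *\<^sub>R w) - f (x + (1/real (Suc n)) *\<^sub>R v) - f (x + (1/real (Suc n)) *\<^sub>R w) + f x) / (1/real (Suc n))\<^sup>2)
      \<longlonglongrightarrow> dderiv v (dderiv w f) x"
    using lim[of w v] by (simp add: algebra_simps)
  then show ?thesis using lim[of v w] LIMSEQ_unique by blast
qed

subsection \<open>A mollifier\<close>

text \<open>Dividing by powers of t keeps the family closed under differentiation: a derivative is a
  combination of two other members, so all orders of smoothness follow from one induction in which k
  varies. \<open>flat 0\<close> is the usual exp(-1/t).\<close>

definition flat :: "nat \<Rightarrow> real \<Rightarrow> real" where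
  "flat k t = (if t > 0 then exp (- 1 / t) / t ^ k else 0)"

lemma flat_tendsto_0: "(flat k \<longlongrightarrow> 0) (at_right 0)"
proof -
  have "((\<lambda>x::real. x ^ k / exp x) \<longlongrightarrow> 0) at_top" by (rule tendsto_power_div_exp_0)
  then have "((\<lambda>t. inverse t ^ k / exp (inverse t)) \<longlongrightarrow> (0::real)) (at_right 0)"
    by (rule filterlim_compose[OF _ filterlim_inverse_at_top_right])
  moreover have "\<forall>\<^sub>F t in at_right 0. inverse t ^ k / exp (inverse t) = flat k t"
    using eventually_at_right_less[of 0]
    by eventually_elim (simp add: flat_def exp_minus field_simps)
  ultimately show ?thesis by (rule Lim_transform_eventually)
qed

lemma flat_has_derivative: "(flat k has_real_derivative flat (k + 2) t - real k * flat (k + 1) t) (at t)"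
proof -
  consider "t > 0" | "t < 0" | "t = 0" by linarith
  then show ?thesis
  proof cases
    case 1
    have "((\<lambda>t. - 1 / t) has_real_derivative 1 / t\<^sup>2) (at t)"
      using DERIV_cmult[OF DERIV_inverse[of t UNIV], where c="-1"] 1
      by (simp add: divide_inverse power2_eq_square)
    then have "((\<lambda>t. exp (- 1 / t)) has_real_derivative exp (- 1 / t) * (1 / t\<^sup>2)) (at t)"
      by (rule DERIV_fun_exp)
    then have "((\<lambda>t. exp (- 1 / t) / t ^ k) has_real_derivative
        (exp (- 1 / t) * (1 / t\<^sup>2) * t ^ k - exp (- 1 / t) * (real k * t ^ (k - Suc 0))) / (t ^ k * t ^ k)) (at t)"
      by (rule DERIV_divide[OF _ DERIV_pow]) (use 1 in simp)
    moreover have "(exp (- 1 / t) * (1 / t\<^sup>2) * t ^ k - exp (- 1 / t) * (real k * t ^ (k - Suc 0))) / (t ^ k * t ^ k)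
        = flat (k + 2) t - real k * flat (k + 1) t"
    proof (cases k)
      case (Suc j)
      then show ?thesis using 1
        by (simp add: flat_def field_simps power2_eq_square del: of_nat_Suc)
    qed (use 1 in \<open>simp add: flat_def power2_eq_square\<close>)
    ultimately have "((\<lambda>t. exp (- 1 / t) / t ^ k) has_real_derivative flat (k + 2) t - real k * flat (k + 1) t) (at t)"
      by simp
    then show ?thesis
      by (rule has_field_derivative_transform_within_open[where S="{0<..}"]) (use 1 in \<open>auto simp: flat_def\<close>)
  next
    case 2
    have "((\<lambda>_. 0) has_real_derivative 0) (at t)" by simp
    then have "(flat k has_real_derivative 0) (at t)"
      by (rule has_field_derivative_transform_within_open[where S="{..<0}"]) (use 2 in \<open>auto simp: flat_def\<close>)
    then show ?thesis using 2 by (simp add: flat_def)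
  next
    case 3
    \<comment> \<open>To the right of 0 the difference quotient of \<open>flat k\<close> is exactly
      \<open>flat (Suc k)\<close>, which tends to 0; to the left it vanishes.\<close>
    have R: "((\<lambda>y. (flat k y - flat k 0) / (y - 0)) \<longlongrightarrow> 0) (at_right 0)"
    proof (rule Lim_transform_eventually[OF flat_tendsto_0[of "Suc k"]])
      show "\<forall>\<^sub>F t in at_right 0. flat (Suc k) t = (flat k t - flat k 0) / (t - 0)"
        using eventually_at_right_less[of 0]
        by eventually_elim (simp add: flat_def field_simps)
    qed
    have L: "((\<lambda>y. (flat k y - flat k 0) / (y - 0)) \<longlongrightarrow> 0) (at_left 0)"
    proof (rule Lim_transform_eventually[OF tendsto_const])
      show "\<forall>\<^sub>F t in at_left 0. 0 = (flat k t - flat k 0) / (t - 0)"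
        by (rule eventually_at_leftI[of "-1"]) (simp_all add: flat_def)
    qed
    show ?thesis
      using filterlim_split_at[OF L R] 3 by (simp add: has_field_derivative_iff flat_def)
  qed
qed

lemma Ck_flat: "Ck n (\<lambda>x::'a::euclidean_space. flat k (c + x \<bullet> b))"
proof (induction n arbitrary: k)
  case 0
  have "continuous_on UNIV (flat k)"
    using DERIV_isCont[OF flat_has_derivative] by (simp add: continuous_at_imp_continuous_on)
  then show ?case by (auto intro!: continuous_on_compose2[of UNIV "flat k"] continuous_intros)
next
  case (Suc n)
  have d: "((\<lambda>x::'a. flat k (c + x \<bullet> b)) has_derivative
      (\<lambda>v. (flat (k + 2) (c + x \<bullet> b) - real k * flat (k + 1) (c + x \<bullet> b)) * (v \<bullet> b))) (at x)" for x
    by (rule has_derivative_compose[of "\<lambda>x. c + x \<bullet> b" "\<lambda>v. v \<bullet> b", OF _ flat_has_derivative[unfolded has_field_derivative_def]])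
       (auto intro!: derivative_eq_intros)
  have "dderiv v (\<lambda>x::'a. flat k (c + x \<bullet> b)) =
      (\<lambda>x. (v \<bullet> b) *\<^sub>R (flat (k + 2) (c + x \<bullet> b) + (- real k) *\<^sub>R flat (k + 1) (c + x \<bullet> b)))" for v
    by (rule ext, subst dderiv_eqI[OF d]) (simp add: algebra_simps)
  moreover have "Ck n (\<lambda>x::'a. (v \<bullet> b) *\<^sub>R (flat (k + 2) (c + x \<bullet> b) + (- real k) *\<^sub>R flat (k + 1) (c + x \<bullet> b)))" for v
    by (intro Ck_scaleR Ck_add Ck_const Suc)
  ultimately have "\<And>v. Ck n (dderiv v (\<lambda>x::'a. flat k (c + x \<bullet> b)))" by simp
  then show ?case
    unfolding Ck_Suc_iff using d by (blast intro: differentiableI)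
qed

text \<open>Each pair of factors is a one-dimensional bump supported in |x \<bullet> b| \<le> 1/n,
  where n is the dimension. With this width the l1 norm, hence the Euclidean norm, is at most 1 on
  the support.\<close>

definition bump :: "'a::euclidean_space \<Rightarrow> real" where
  "bump x = (\<Prod>b\<in>Basis. flat 0 (1 / real DIM('a) + x \<bullet> b) * flat 0 (1 / real DIM('a) + x \<bullet> (- b)))"

lemma smooth_bump: "smooth bump"
  unfolding bump_def by (intro smooth_prod smooth_mult) (simp_all add: smooth_def Ck_flat del: inner_minus_right)

lemma flat_nonneg: "flat k t \<ge> 0" by (simp add: flat_def)

lemma bump_nonneg: "bump x \<ge> 0"
  unfolding bump_def by (intro prod_nonneg mult_nonneg_nonneg ballI flat_nonneg)

lemma bump_0_pos: "bump (0::'a::euclidean_space) > 0"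
  unfolding bump_def by (intro prod_pos) (simp add: flat_def)

lemma bump_eq_0:
  fixes x :: "'a::euclidean_space"
  assumes "norm x > 1" shows "bump x = 0"
proof (rule ccontr)
  assume "bump x \<noteq> 0"
  then have nz: "\<And>b. b \<in> Basis \<Longrightarrow> flat 0 (1 / real DIM('a) + x \<bullet> b) \<noteq> 0 \<and> flat 0 (1 / real DIM('a) + x \<bullet> (- b)) \<noteq> 0"
    unfolding bump_def by (auto simp: prod_zero_iff)
  have "\<bar>x \<bullet> b\<bar> \<le> 1 / real DIM('a)" if "b \<in> Basis" for b
    using nz[OF that] by (auto simp: flat_def split: if_splits)
  then have "(\<Sum>b\<in>Basis. \<bar>x \<bullet> b\<bar>) \<le> (\<Sum>b\<in>(Basis::'a set). 1 / real DIM('a))" by (intro sum_mono)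
  then show False using norm_le_l1[of x] assms by simp
qed

subsection \<open>Test functions\<close>

lemma test_function_smooth: "test_function U \<phi> \<Longrightarrow> smooth \<phi>"
  by (simp add: test_function_def smooth_def)

lemma test_functionI:
  assumes "smooth \<phi>" "compact K" "K \<subseteq> U" "\<And>x. x \<notin> K \<Longrightarrow> \<phi> x = 0"
  shows "test_function U \<phi>"
proof -
  have "{x. \<phi> x \<noteq> 0} \<subseteq> K" using assms(4) by auto
  then have "closure {x. \<phi> x \<noteq> 0} \<subseteq> K"
    using assms(2) by (simp add: closure_minimal compact_imp_closed)
  then show ?thesis
    unfolding test_function_def using assms
    by (metis (no_types, lifting) closed_closure compact_Int_closed inf.absorb_iff2 inf.order_iff order_trans smooth_def)
qed

lemma test_functionE:
  assumes "test_function U \<phi>"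
  obtains K where "compact K" "K \<subseteq> U" "\<And>x. x \<notin> K \<Longrightarrow> \<phi> x = 0"
  using assms closure_subset[of "{x. \<phi> x \<noteq> 0}"] that[of "closure {x. \<phi> x \<noteq> 0}"]
  unfolding test_function_def by blast

lemma test_function_mono: "test_function U \<phi> \<Longrightarrow> U \<subseteq> U' \<Longrightarrow> test_function U' \<phi>"
  by (auto simp: test_function_def)

lemma test_function_mult:
  assumes "smooth f" "test_function U \<phi>" shows "test_function U (\<lambda>x. \<phi> x * f x)"
proof -
  obtain K where "compact K" "K \<subseteq> U" "\<And>x. x \<notin> K \<Longrightarrow> \<phi> x = 0" by (rule test_functionE[OF assms(2)]) blast
  then show ?thesis using assms test_function_smooth[OF assms(2)]
    by (intro test_functionI[of _ K U] smooth_mult) simp_all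
qed

lemma test_function_dderiv_eq_0:
  assumes "smooth \<phi>" "compact K" "\<And>x. x \<notin> K \<Longrightarrow> \<phi> x = 0" "x \<notin> K"
  shows "dderiv v \<phi> x = 0"
proof -
  have "open (- K)" using assms(2) compact_imp_closed by auto
  then have "(\<phi> has_derivative (\<lambda>_. 0)) (at x)"
    using has_derivative_transform_within_open[OF has_derivative_const[of 0] \<open>open (- K)\<close>, of x \<phi> UNIV] assms(3,4)
    by simp
  then show ?thesis by (rule dderiv_eqI)
qed

lemma test_function_dderiv: "test_function U \<phi> \<Longrightarrow> test_function U (dderiv v \<phi>)"
proof -
  assume t: "test_function U \<phi>"
  obtain K where K: "compact K" "K \<subseteq> U" "\<And>x. x \<notin> K \<Longrightarrow> \<phi> x = 0" by (rule test_functionE[OF t]) blast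
  show ?thesis
    using test_function_dderiv_eq_0[OF test_function_smooth[OF t] K(1,3)] K test_function_smooth[OF t]
    by (intro test_functionI[of _ K U] smooth_dderiv) simp_all
qed

lemma test_function_bounded:
  assumes "test_function U \<phi>"
  obtains B where "B > 0" "\<And>x. \<bar>\<phi> x\<bar> \<le> B"
proof -
  obtain K where K: "compact K" "K \<subseteq> U" "\<And>x. x \<notin> K \<Longrightarrow> \<phi> x = 0" by (rule test_functionE[OF assms]) blast
  have "bounded (\<phi> ` K)"
    using K(1) smooth_continuous_on[OF test_function_smooth[OF assms]]
    by (intro compact_imp_bounded compact_continuous_image) auto
  then obtain B where "\<And>x. x \<in> K \<Longrightarrow> \<bar>\<phi> x\<bar> \<le> B" by (auto simp: bounded_iff)
  then have "\<bar>\<phi> x\<bar> \<le> max B 1" for x using K(3)[of x] by (cases "x \<in> K") (force simp: max_def)+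
  then show ?thesis using that[of "max B 1"] by simp
qed

lemma test_function_integrable:
  assumes "test_function U \<phi>" shows "integrable lborel \<phi>"
proof -
  obtain K where K: "compact K" "K \<subseteq> U" "\<And>x. x \<notin> K \<Longrightarrow> \<phi> x = 0" by (rule test_functionE[OF assms]) blast
  have "integrable lborel (\<lambda>x. indicator K x *\<^sub>R \<phi> x)"
    by (rule borel_integrable_compact[OF K(1) smooth_continuous_on[OF test_function_smooth[OF assms]]])
  moreover have "(\<lambda>x. indicator K x *\<^sub>R \<phi> x) = \<phi>" using K(3) by (force simp: indicator_def)
  ultimately show ?thesis by simp
qed

lemma integrable_test_function_scaleR:
  fixes w :: "'a::euclidean_space \<Rightarrow> 'b::euclidean_space"
  assumes "test_function U \<phi>" "integrable lborel w"
  shows "integrable lborel (\<lambda>x. \<phi> x *\<^sub>R w x)"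
proof -
  obtain B where B: "B > 0" "\<And>x. \<bar>\<phi> x\<bar> \<le> B" using test_function_bounded[OF assms(1)] by blast
  show ?thesis
    by (rule Bochner_Integration.integrable_bound[where f="\<lambda>x. B *\<^sub>R w x"])
       (use assms B smooth_measurable[OF test_function_smooth[OF assms(1)]]
        in \<open>auto intro!: mult_right_mono AE_I2 simp: abs_of_pos\<close>)
qed

section \<open>Uniform first- and second-order bounds for test functions\<close>

lemma smooth_mvt:
  fixes f :: "'a::euclidean_space \<Rightarrow> real"
  assumes "smooth f"
  obtains s where "0 < s" "s < 1" "f (x + h) - f x = dderiv h f (x + s *\<^sub>R h)"
proof -
  have d: "((\<lambda>s. f (x + s *\<^sub>R h)) has_real_derivative dderiv h f (x + s *\<^sub>R h)) (at s)" for s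
  proof -
    have "((\<lambda>s. f (x + s *\<^sub>R h)) has_derivative (\<lambda>r. dderiv (r *\<^sub>R h) f (x + s *\<^sub>R h))) (at s)"
      by (rule has_derivative_compose[of "\<lambda>s. x + s *\<^sub>R h" "\<lambda>r. r *\<^sub>R h", OF _ smoothD_has_derivative[OF assms]])
         (auto intro!: derivative_eq_intros)
    moreover have "(\<lambda>r. dderiv (r *\<^sub>R h) f (x + s *\<^sub>R h)) = (*) (dderiv h f (x + s *\<^sub>R h))"
      by (rule ext) (simp add: dderiv_linear[OF assms])
    ultimately show ?thesis by (simp add: has_field_derivative_def)
  qed
  obtain s where "0 < s" "s < 1" "f (x + 1 *\<^sub>R h) - f (x + 0 *\<^sub>R h) = (1 - 0) * dderiv h f (x + s *\<^sub>R h)"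
    using MVT2[of 0 1 "\<lambda>s. f (x + s *\<^sub>R h)", OF _ d] by auto
  then show ?thesis using that by simp
qed

lemma test_function_dderiv_bounded:
  assumes "test_function U \<phi>"
  obtains L where "L > 0" "\<And>x h. \<bar>dderiv h \<phi> x\<bar> \<le> L * norm h"
proof -
  have "\<exists>B. \<forall>b::'a. B b > 0 \<and> (\<forall>x. \<bar>dderiv b \<phi> x\<bar> \<le> B b)"
    by (intro choice allI) (metis test_function_bounded[OF test_function_dderiv[OF assms]])
  then obtain B where B: "\<And>b::'a. B b > 0" "\<And>b x. \<bar>dderiv b \<phi> x\<bar> \<le> B b" by blast
  have sm: "smooth \<phi>" by (rule test_function_smooth[OF assms])
  have "\<bar>dderiv h \<phi> x\<bar> \<le> (\<Sum>b\<in>Basis. B b) * norm h" for x h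
  proof -
    have "\<bar>dderiv h \<phi> x\<bar> \<le> (\<Sum>b\<in>Basis. \<bar>(h \<bullet> b) *\<^sub>R dderiv b \<phi> x\<bar>)"
      unfolding dderiv_basis_expand[OF sm, of h x] by (rule sum_abs)
    also have "\<dots> \<le> (\<Sum>b\<in>Basis. norm h * B b)"
      by (intro sum_mono) (auto simp: abs_mult intro!: mult_mono B Basis_le_norm)
    finally show ?thesis by (simp add: sum_distrib_left mult.commute)
  qed
  moreover have "(\<Sum>b\<in>Basis. B b) > 0" using B by (intro sum_pos) auto
  ultimately show ?thesis using that by blast
qed

lemma test_function_lipschitz:
  assumes "test_function U \<phi>"
  obtains L where "L > 0" "\<And>x h. \<bar>\<phi> (x + h) - \<phi> x\<bar> \<le> L * norm h"
  using test_function_dderiv_bounded[OF assms] smooth_mvt[OF test_function_smooth[OF assms]] by metis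

text \<open>The first derivatives are again test functions and so globally Lipschitz, which makes
  the remainder constant uniform in the point. Uniformity is what allows the expansion to be
  integrated against an arbitrary integrable function in \<open>conv_has_derivative\<close>.\<close>

lemma test_function_taylor:
  assumes "test_function U \<phi>"
  obtains L where "L > 0" "\<And>x h. \<bar>\<phi> (x + h) - \<phi> x - dderiv h \<phi> x\<bar> \<le> L * (norm h)\<^sup>2"
proof -
  have sm: "smooth \<phi>" by (rule test_function_smooth[OF assms])
  have "\<exists>B. \<forall>b::'a. B b > 0 \<and> (\<forall>x h. \<bar>dderiv b \<phi> (x + h) - dderiv b \<phi> x\<bar> \<le> B b * norm h)"
    by (intro choice allI) (metis test_function_lipschitz[OF test_function_dderiv[OF assms]])
  then obtain B where B: "\<And>b::'a. B b > 0" "\<And>b x h. \<bar>dderiv b \<phi> (x + h) - dderiv b \<phi> x\<bar> \<le> B b * norm h" by blast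
  have "\<bar>\<phi> (x + h) - \<phi> x - dderiv h \<phi> x\<bar> \<le> (\<Sum>b\<in>Basis. B b) * (norm h)\<^sup>2" for x h
  proof -
    obtain s where s: "0 < s" "s < 1" "\<phi> (x + h) - \<phi> x = dderiv h \<phi> (x + s *\<^sub>R h)"
      using smooth_mvt[OF sm] by blast
    have "\<bar>\<phi> (x + h) - \<phi> x - dderiv h \<phi> x\<bar> = \<bar>\<Sum>b\<in>Basis. (h \<bullet> b) *\<^sub>R (dderiv b \<phi> (x + s *\<^sub>R h) - dderiv b \<phi> x)\<bar>"
      unfolding s(3) by (subst (1 2) dderiv_basis_expand[OF sm]) (simp add: sum_subtractf algebra_simps)
    also have "\<dots> \<le> (\<Sum>b\<in>Basis. \<bar>(h \<bullet> b) *\<^sub>R (dderiv b \<phi> (x + s *\<^sub>R h) - dderiv b \<phi> x)\<bar>)" by (rule sum_abs)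
    also have "\<dots> \<le> (\<Sum>b\<in>Basis. norm h * (B b * norm h))"
    proof (intro sum_mono)
      fix b :: 'a assume b: "b \<in> Basis"
      have "\<bar>dderiv b \<phi> (x + s *\<^sub>R h) - dderiv b \<phi> x\<bar> \<le> B b * norm (s *\<^sub>R h)" by (rule B)
      also have "\<dots> \<le> B b * norm h" using s B(1)[of b] by (auto intro!: mult_left_mono mult_left_le_one_le)
      finally show "\<bar>(h \<bullet> b) *\<^sub>R (dderiv b \<phi> (x + s *\<^sub>R h) - dderiv b \<phi> x)\<bar> \<le> norm h * (B b * norm h)"
        using b by (auto simp: abs_mult intro!: mult_mono Basis_le_norm)
    qed
    finally show ?thesis by (simp add: sum_distrib_left sum_distrib_right power2_eq_square mult_ac)
  qed
  moreover have "(\<Sum>b\<in>Basis. B b) > 0" using B by (intro sum_pos) auto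
  ultimately show ?thesis using that by blast
qed

text \<open>The reflected kernel becomes an admissible test function once its ball about x lies in
  U; this is how weak formulations are evaluated at a single point.\<close>

lemma test_function_reflect:
  assumes "test_function UNIV \<phi>" "\<And>y. \<phi> y \<noteq> 0 \<Longrightarrow> norm y \<le> r" "cball x r \<subseteq> U"
  shows "test_function U (\<lambda>y. \<phi> (x - y))"
proof (rule test_functionI[OF smooth_reflect[OF test_function_smooth[OF assms(1)]] compact_cball assms(3)])
  show "\<phi> (x - y) = 0" if "y \<notin> cball x r" for y
    using that assms(2)[of "x - y"] by (auto simp: dist_norm)
qed

subsection \<open>Translations in Lebesgue integrals\<close>

lemma nn_integral_translate:
  fixes f :: "'a::euclidean_space \<Rightarrow> ennreal"
  assumes [measurable]: "f \<in> borel_measurable borel"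
  shows "(\<integral>\<^sup>+x. f (x + c) \<partial>lborel) = (\<integral>\<^sup>+x. f x \<partial>lborel)"
proof -
  have "(\<integral>\<^sup>+x. f x \<partial>lborel) = (\<integral>\<^sup>+x. f x \<partial>distr lborel borel ((+) c))" by (simp add: lborel_distr_plus)
  also have "\<dots> = (\<integral>\<^sup>+x. f (c + x) \<partial>lborel)" by (subst nn_integral_distr) auto
  finally show ?thesis by (simp add: add.commute)
qed

lemma integral_translate:
  fixes f :: "'a::euclidean_space \<Rightarrow> 'b::euclidean_space"
  assumes [measurable]: "f \<in> borel_measurable borel"
  shows "(LBINT x. f (x + c)) = (LBINT x. f x)"
proof -
  have "(LBINT x. f x) = (\<integral>x. f x \<partial>distr lborel borel ((+) c))" by (simp add: lborel_distr_plus)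
  also have "\<dots> = (LBINT x. f (c + x))" by (subst integral_distr) auto
  finally show ?thesis by (simp add: add.commute)
qed

lemma integrable_translate:
  fixes f :: "'a::euclidean_space \<Rightarrow> 'b::euclidean_space"
  assumes "integrable lborel f"
  shows "integrable lborel (\<lambda>x. f (x + c))"
proof -
  have [measurable]: "f \<in> borel_measurable borel" using borel_measurable_integrable[OF assms] by simp
  have "integrable (distr lborel borel ((+) c)) f" using assms by (simp add: lborel_distr_plus)
  then show ?thesis by (subst (asm) integrable_distr_eq) (auto simp: add.commute)
qed

lemma AE_translate:
  assumes "AE x in lborel. P (x::'a::euclidean_space)" shows "AE x in lborel. P (x + c)"
proof -
  obtain N where N: "{x. \<not> P x} \<subseteq> N" "N \<in> sets borel" "emeasure lborel N = 0"
    using assms by (auto elim!: AE_E)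
  have [measurable]: "N \<in> sets borel" by (rule N)
  have "(\<integral>\<^sup>+x. indicator N (x + c) \<partial>lborel) = (\<integral>\<^sup>+x. indicator N x \<partial>lborel)"
    by (rule nn_integral_translate) simp
  then have "(\<integral>\<^sup>+x. indicator N (x + c) \<partial>lborel) = 0" using N by simp
  then have "AE x in lborel. indicator N (x + c) = (0::ennreal)"
    by (subst (asm) nn_integral_0_iff_AE) auto
  then show ?thesis by eventually_elim (use N(1) in \<open>auto simp: indicator_def split: if_splits\<close>)
qed

lemma nn_integral_reflect:
  fixes f :: "'a::euclidean_space \<Rightarrow> ennreal"
  assumes [measurable]: "f \<in> borel_measurable borel"
  shows "(\<integral>\<^sup>+x. f (c - x) \<partial>lborel) = (\<integral>\<^sup>+x. f x \<partial>lborel)"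
proof -
  have "lborel = density (distr lborel borel (\<lambda>x::'a. c - x)) (\<lambda>_. 1)"
    using lborel_affine[of "-1" c] by simp
  then have "(\<integral>\<^sup>+x. f x \<partial>lborel) = (\<integral>\<^sup>+x. f x \<partial>distr lborel borel (\<lambda>x::'a. c - x))"
    by (metis density_1)
  also have "\<dots> = (\<integral>\<^sup>+x. f (c - x) \<partial>lborel)"
    by (simp add: nn_integral_distr)
  finally show ?thesis by simp
qed

lemma nn_integral_scale:
  fixes f :: "'a::euclidean_space \<Rightarrow> ennreal"
  assumes [measurable]: "f \<in> borel_measurable borel" and c: "c > 0"
  shows "(\<integral>\<^sup>+x. f ((1 / c) *\<^sub>R x) \<partial>lborel) = ennreal (c ^ DIM('a)) * (\<integral>\<^sup>+x. f x \<partial>lborel)"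
proof -
  have eq: "lborel = density (distr lborel borel (\<lambda>x::'a. 0 + c *\<^sub>R x)) (\<lambda>_. \<bar>c\<bar>^DIM('a))"
    using c by (intro lborel_affine) simp
  have "(\<integral>\<^sup>+x. f ((1 / c) *\<^sub>R x) \<partial>lborel) = (\<integral>\<^sup>+x. ennreal (\<bar>c\<bar>^DIM('a)) * f ((1/c) *\<^sub>R (c *\<^sub>R x)) \<partial>lborel)"
    by (subst eq) (simp add: nn_integral_density nn_integral_distr)
  also have "\<dots> = ennreal (c ^ DIM('a)) * (\<integral>\<^sup>+x. f x \<partial>lborel)"
    using c by (simp add: nn_integral_cmult)
  finally show ?thesis .
qed

text \<open>Argument by \<open>integrable_induct\<close>. For an open set of finite measure the
  translated indicators converge at every point of the set; for a measurable set outer regularity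
  supplies an approximating open set; sums and dominated limits then reach every integrable
  function.\<close>

lemma translation_continuous_L1:
  fixes w :: "'a::euclidean_space \<Rightarrow> 'b::euclidean_space"
  assumes "integrable lborel w" "h \<longlonglongrightarrow> 0"
  shows "(\<lambda>n. LBINT x. norm (w (x + h n) - w x)) \<longlonglongrightarrow> 0"
  using assms(1)
proof (induction w rule: integrable_induct)
  case (base A c)
  define T where "T B n = (LBINT x. norm (indicator B (x + h n) - indicator B x :: real))" for B :: "'a set" and n
  have [measurable]: "A \<in> sets borel" using base by simp
  have int: "integrable lborel (\<lambda>x. indicator B (x + y) :: real)" if "B \<in> sets borel" "emeasure lborel B < \<infinity>" for B y
    using integrable_translate[of "\<lambda>x. indicator B x :: real" y] that by (simp add: integrable_indicator_iff)
  have Topen: "(\<lambda>n. T O' n) \<longlonglongrightarrow> 0" if O': "open O'" "emeasure lborel O' < \<infinity>" for O' :: "'a set"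
  proof -
    have [measurable]: "O' \<in> sets borel" using O' by simp
    have lim: "(\<lambda>n. LBINT x. indicator O' (x + h n) * indicator O' x) \<longlonglongrightarrow> (LBINT x. (indicator O' x::real))"
    proof (rule integral_dominated_convergence[where w="\<lambda>x. indicator O' x"])
      show "AE x in lborel. (\<lambda>n. indicator O' (x + h n) * indicator O' x :: real) \<longlonglongrightarrow> indicator O' x"
      proof (rule AE_I2)
        fix x
        show "(\<lambda>n. indicator O' (x + h n) * indicator O' x :: real) \<longlonglongrightarrow> indicator O' x"
        proof (cases "x \<in> O'")
          case True
          have "(\<lambda>n. x + h n) \<longlonglongrightarrow> x" using tendsto_add[OF tendsto_const assms(2), of x] by simp
          then have "\<forall>\<^sub>F n in sequentially. x + h n \<in> O'" using O' True topological_tendstoD by blast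
          then show ?thesis
            by (intro tendsto_eventually) (auto elim!: eventually_mono simp: True)
        qed simp
      qed
    qed (use O' int[of O' 0] in \<open>auto simp: indicator_def\<close>)
    \<comment> \<open>For indicators |a - b| = a + b - 2ab, and translation preserves the integral.
      Only the product has to converge, and openness gives this at the points of the set.\<close>
    have "T O' n = 2 * ((LBINT x. (indicator O' x::real)) - (LBINT x. indicator O' (x + h n) * indicator O' x))" for n
    proof -
      have i1: "integrable lborel (\<lambda>x. indicator O' x :: real)" "integrable lborel (\<lambda>x. indicator O' (x + h n) :: real)"
        using int[OF _ O'(2), of 0] int[OF _ O'(2), of "h n"] by simp_all
      have i2: "integrable lborel (\<lambda>x. indicator O' (x + h n) * indicator O' x :: real)"
        by (rule Bochner_Integration.integrable_bound[OF i1(1)]) (auto simp: indicator_def)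
      have e: "norm (indicator O' (x + h n) - indicator O' x :: real) = indicator O' (x + h n) + indicator O' x - 2 * (indicator O' (x + h n) * indicator O' x)" for x
        by (auto simp: indicator_def)
      have "T O' n = (LBINT x. (indicator O' (x + h n)::real)) + (LBINT x. (indicator O' x::real)) - 2 * (LBINT x. indicator O' (x + h n) * indicator O' x)"
        unfolding T_def e using i1 i2 by simp
      then show ?thesis using integral_translate[of "\<lambda>x. indicator O' x :: real" "h n"] by simp
    qed
    moreover have "(\<lambda>n. 2 * ((LBINT x. (indicator O' x::real)) - (LBINT x. indicator O' (x + h n) * indicator O' x)))
        \<longlonglongrightarrow> 2 * ((LBINT x. (indicator O' x::real)) - (LBINT x. (indicator O' x::real)))"
      by (intro tendsto_intros lim)
    ultimately show ?thesis by simp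
  qed
  have TA: "(\<lambda>n. T A n) \<longlonglongrightarrow> 0"
  proof (rule LIMSEQ_I)
    fix e :: real assume e: "e > 0"
    obtain O' where O': "open O'" "A \<subseteq> O'" "emeasure lborel (O' - A) < e / 4"
      using outer_regular_lborel[of A "e/4"] e by auto
    have [measurable]: "O' \<in> sets borel" using O' by simp
    have "emeasure lborel O' \<le> emeasure lborel A + emeasure lborel (O' - A)"
      using emeasure_subadditive[of A lborel "O' - A"] O'(2) by (simp add: Un_absorb1)
    also have "\<dots> < \<infinity>" using base O'(3) by (simp add: less_top[symmetric] ennreal_add_eq_top) (metis ennreal_less_top less_trans order_less_irrefl)
    finally have fin: "emeasure lborel O' < \<infinity>" .
    have finD: "emeasure lborel (O' - A) < \<infinity>" using O'(3) by (metis ennreal_less_top infinity_ennreal_def less_trans)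
    have mD: "(LBINT x. (indicator (O' - A) x :: real)) \<le> e / 4"
      using O'(3) finD e enn2real_leI[of "e / 4" "emeasure lborel (O' - A)"] by (simp add: measure_def)
    obtain N where N: "\<And>n. n \<ge> N \<Longrightarrow> T O' n < e / 2"
      using order_tendstoD(2)[OF Topen[OF O'(1) fin], of "e/2"] e by (auto simp: eventually_sequentially)
    have "norm (T A n - 0) < e" if n: "n \<ge> N" for n
    proof -
      have i: "integrable lborel (\<lambda>x. indicator B (x + y) :: real)" if "B \<in> {A, O', O' - A}" for B y
        by (rule int) (use that fin finD base in auto)
      have "T A n \<le> (LBINT x. norm (indicator O' (x + h n) - indicator O' x :: real) + (indicator (O' - A) (x + h n) + indicator (O' - A) x))"
        unfolding T_def
      proof (rule integral_mono)
        show "integrable lborel (\<lambda>x. norm (indicator A (x + h n) - indicator A x :: real))"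
          using i[of A "h n"] i[of A 0] by (intro integrable_norm Bochner_Integration.integrable_diff) simp_all
        show "integrable lborel (\<lambda>x. norm (indicator O' (x + h n) - indicator O' x :: real) + (indicator (O' - A) (x + h n) + indicator (O' - A) x))"
          using i[of O' "h n"] i[of O' 0] i[of "O' - A" "h n"] i[of "O' - A" 0]
          by (intro integrable_norm Bochner_Integration.integrable_diff Bochner_Integration.integrable_add) simp_all
      qed (use O'(2) in \<open>auto simp: indicator_def split: if_splits\<close>)
      also have "\<dots> = T O' n + ((LBINT x. (indicator (O' - A) (x + h n)::real)) + (LBINT x. (indicator (O' - A) x::real)))"
        unfolding T_def using i[of _ "h n"] i[of _ 0] by simp
      also have "\<dots> \<le> T O' n + (e / 4 + e / 4)"
        using mD integral_translate[of "\<lambda>x. indicator (O' - A) x :: real" "h n"] by simp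
      also have "\<dots> < e" using N[OF n] by simp
      finally show ?thesis by (simp add: T_def)
    qed
    then show "\<exists>N. \<forall>n\<ge>N. norm (T A n - 0) < e" by blast
  qed
  have "norm (indicator A (x + h n) *\<^sub>R c - indicator A x *\<^sub>R c) = norm (indicator A (x + h n) - indicator A x :: real) * norm c" for x n
    by (simp add: indicator_def)
  then have "(LBINT x. norm (indicator A (x + h n) *\<^sub>R c - indicator A x *\<^sub>R c)) = T A n * norm c" for n
    unfolding T_def by simp
  then show ?case using tendsto_mult[OF TA tendsto_const[of "norm c"]] by simp
next
  case (add f g)
  show ?case
  proof (rule tendsto_sandwich[OF _ _ tendsto_const])
    have i: "integrable lborel (\<lambda>x. f (x + h n))" "integrable lborel (\<lambda>x. g (x + h n))" for n
      using add.hyps integrable_translate by blast+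
    show "\<forall>\<^sub>F n in sequentially. (LBINT x. norm (f (x + h n) + g (x + h n) - (f x + g x)))
        \<le> (LBINT x. norm (f (x + h n) - f x)) + (LBINT x. norm (g (x + h n) - g x))"
    proof (intro always_eventually allI)
      fix n
      have "(LBINT x. norm (f (x + h n) + g (x + h n) - (f x + g x)))
          \<le> (LBINT x. norm (f (x + h n) - f x) + norm (g (x + h n) - g x))"
        using i[of n] add.hyps by (intro integral_mono) (auto intro: norm_diff_triangle_ineq)
      then show "(LBINT x. norm (f (x + h n) + g (x + h n) - (f x + g x)))
          \<le> (LBINT x. norm (f (x + h n) - f x)) + (LBINT x. norm (g (x + h n) - g x))"
        using i[of n] add.hyps by simp
    qed
    show "(\<lambda>n. (LBINT x. norm (f (x + h n) - f x)) + (LBINT x. norm (g (x + h n) - g x))) \<longlonglongrightarrow> 0"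
      using tendsto_add[OF add.IH(1) add.IH(2)] by simp
  qed auto
next
  case (lim f s)
  have [measurable]: "f \<in> borel_measurable borel" "\<And>i. s i \<in> borel_measurable borel"
    using borel_measurable_integrable[OF lim.hyps(4)] borel_measurable_integrable[OF lim.hyps(1)] by simp_all
  have L: "(\<lambda>i. LBINT x. norm (s i x - f x)) \<longlonglongrightarrow> (\<integral>x. 0 \<partial>(lborel::'a measure))"
  proof (rule integral_dominated_convergence[where w="\<lambda>x. 3 * norm (f x)"])
    show "AE x in lborel. (\<lambda>i. norm (s i x - f x)) \<longlonglongrightarrow> 0"
      using lim.hyps(2) by (intro AE_I2 tendsto_norm_zero) (simp add: LIM_zero)
    show "AE x in lborel. norm (norm (s i x - f x)) \<le> 3 * norm (f x)" for i
    proof (rule AE_I2)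
      fix x
      show "norm (norm (s i x - f x)) \<le> 3 * norm (f x)"
        using norm_triangle_ineq4[of "s i x" "f x"] lim.hyps(3)[of x i] by simp
    qed
  qed (use lim in auto)
  show ?case
  proof (rule LIMSEQ_I)
    fix e :: real assume e: "e > 0"
    obtain i where i: "(LBINT x. norm (s i x - f x)) < e / 3"
      using order_tendstoD(2)[OF L, of "e/3"] e by (auto simp: eventually_sequentially)
    obtain N where N: "\<And>n. n \<ge> N \<Longrightarrow> (LBINT x. norm (s i (x + h n) - s i x)) < e / 3"
      using order_tendstoD(2)[OF lim.IH[of i], of "e/3"] e by (auto simp: eventually_sequentially)
    have "norm ((LBINT x. norm (f (x + h n) - f x)) - 0) < e" if n: "n \<ge> N" for n
    proof -
      have ii: "integrable lborel (\<lambda>x. f (x + h n))" "integrable lborel (\<lambda>x. s i (x + h n))" "integrable lborel f" "integrable lborel (s i)"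
        using lim.hyps integrable_translate by blast+
      have "(LBINT x. norm (f (x + h n) - f x)) \<le>
          (LBINT x. norm (s i (x + h n) - f (x + h n)) + norm (s i x - f x) + norm (s i (x + h n) - s i x))"
      proof (rule integral_mono)
        fix x
        have "f (x + h n) - f x = (s i x - f x) + (s i (x + h n) - s i x) - (s i (x + h n) - f (x + h n))" by simp
        then show "norm (f (x + h n) - f x) \<le> norm (s i (x + h n) - f (x + h n)) + norm (s i x - f x) + norm (s i (x + h n) - s i x)"
          by (smt (verit) norm_triangle_ineq norm_triangle_ineq4)
      qed (use ii in auto)
      also have "\<dots> = (LBINT x. norm (s i (x + h n) - f (x + h n))) + (LBINT x. norm (s i x - f x)) + (LBINT x. norm (s i (x + h n) - s i x))"
        using ii by simp
      also have "(LBINT x. norm (s i (x + h n) - f (x + h n))) = (LBINT x. norm (s i x - f x))"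
        by (rule integral_translate) simp
      finally show ?thesis using i N[OF n] by simp
    qed
    then show "\<exists>N. \<forall>n\<ge>N. norm ((LBINT x. norm (f (x + h n) - f x)) - 0) < e" by blast
  qed
qed

subsection \<open>Mollification\<close>

text \<open>Scaled to unit mass with support in the ball of radius t; the division by the integral
  is there because \<open>bump\<close> is not normalised.\<close>

definition moll :: "real \<Rightarrow> 'a::euclidean_space \<Rightarrow> real" where
  "moll t x = bump ((1 / t) *\<^sub>R x) / (t ^ DIM('a) * (LBINT y. bump (y::'a)))"

lemma test_function_bump: "test_function UNIV bump"
proof (rule test_functionI[OF smooth_bump compact_cball[of 0 1]])
  show "bump x = 0" if "x \<notin> cball 0 1" for x :: 'a using that bump_eq_0[of x] by simp
qed simp

lemma integral_bump_pos: "(LBINT x. bump (x::'a::euclidean_space)) > 0"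
proof -
  have "isCont (bump::'a \<Rightarrow> real) 0"
    by (rule has_derivative_continuous[OF smoothD_has_derivative[OF smooth_bump]])
  then have "\<forall>\<^sub>F x in nhds (0::'a). bump x > bump (0::'a) / 2"
    using bump_0_pos[where 'a='a] by (intro order_tendstoD(1)[where y="bump 0"]) (auto simp: isCont_def tendsto_at_iff_tendsto_nhds)
  then obtain r where r: "r > 0" "\<And>x::'a. dist x 0 < r \<Longrightarrow> bump x > bump (0::'a) / 2"
    by (auto simp: eventually_nhds_metric)
  have "0 < bump (0::'a) / 2 * measure lborel (ball (0::'a) r)"
    using r bump_0_pos[where 'a='a] content_ball_pos[OF r(1), of "0::'a"] by simp
  also have "\<dots> = (LBINT x. bump (0::'a) / 2 * indicator (ball (0::'a) r) x)" by simp
  also have "\<dots> \<le> (LBINT x. bump (x::'a))"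
  proof (rule integral_mono)
    show "integrable lborel (\<lambda>x. bump (0::'a) / 2 * indicator (ball (0::'a) r) x)"
      by (intro integrable_mult_right integrable_real_indicator) (simp_all add: emeasure_lborel_ball_finite[simplified])
    show "integrable lborel (bump :: 'a \<Rightarrow> real)" by (rule test_function_integrable[OF test_function_bump])
    show "bump (0::'a) / 2 * indicator (ball (0::'a) r) x \<le> bump x" for x
      using r(2)[of x] bump_nonneg[of x] by (auto simp: indicator_def dist_commute less_imp_le)
  qed
  finally show ?thesis .
qed

lemma moll_nonneg: "t > 0 \<Longrightarrow> moll t x \<ge> 0"
  unfolding moll_def using integral_bump_pos[where 'a='a] bump_nonneg[of "(1/t) *\<^sub>R x"] by simp

lemma moll_eq_0: "t > 0 \<Longrightarrow> norm x > t \<Longrightarrow> moll t x = 0"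
  unfolding moll_def using bump_eq_0[of "(1/t) *\<^sub>R x"] by (simp add: field_simps)

lemma moll_alt: "moll t = (\<lambda>x::'a::euclidean_space. inverse (t ^ DIM('a) * (LBINT y. bump (y::'a))) * bump (0 + (1 / t) *\<^sub>R x))"
  by (rule ext) (simp add: moll_def divide_inverse)

lemma smooth_moll: "smooth (moll t)"
  unfolding moll_alt by (intro smooth_mult smooth_const smooth_affine smooth_bump)

lemma test_function_moll: "t > 0 \<Longrightarrow> test_function UNIV (moll t)"
  by (rule test_functionI[OF smooth_moll compact_cball[of 0 t]]) (simp_all add: moll_eq_0)

lemma moll_measurable [measurable]: "moll t \<in> borel_measurable borel"
  by (rule smooth_measurable[OF smooth_moll])

lemma dderiv_moll:
  "dderiv v (moll t) (x::'a::euclidean_space) =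
    inverse (t ^ DIM('a) * (LBINT y. bump (y::'a))) * ((1 / t) * dderiv v bump ((1 / t) *\<^sub>R x))"
  unfolding moll_alt using smooth_bump smooth_affine[OF smooth_bump, of 0 "1/t"]
  by (subst dderiv_mult) (use dderiv_affine[OF smooth_bump, of v 0 "1/t" x] in \<open>simp_all add: smooth_const dderiv_eqI[OF has_derivative_const]\<close>)

lemma nn_integral_moll:
  assumes "t > 0" shows "(\<integral>\<^sup>+x. ennreal (moll t (x::'a::euclidean_space)) \<partial>lborel) = 1"
proof -
  let ?I = "LBINT y. bump (y::'a)"
  have [measurable]: "(bump::'a\<Rightarrow>real) \<in> borel_measurable borel" by (rule smooth_measurable[OF smooth_bump])
  have I: "?I > 0" by (rule integral_bump_pos)
  have "(\<integral>\<^sup>+x. ennreal (moll t (x::'a)) \<partial>lborel) = (\<integral>\<^sup>+x. ennreal (inverse (t ^ DIM('a) * ?I)) * ennreal (bump ((1/t) *\<^sub>R (x::'a))) \<partial>lborel)"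
    unfolding moll_alt using I assms by (simp add: ennreal_mult')
  also have "\<dots> = ennreal (inverse (t ^ DIM('a) * ?I)) * (ennreal (t ^ DIM('a)) * (\<integral>\<^sup>+x. ennreal (bump (x::'a)) \<partial>lborel))"
    using nn_integral_scale[of "\<lambda>x::'a. ennreal (bump x)" t] assms by (simp add: nn_integral_cmult)
  also have "(\<integral>\<^sup>+x. ennreal (bump (x::'a)) \<partial>lborel) = ennreal ?I"
    by (rule nn_integral_eq_integral[OF test_function_integrable[OF test_function_bump]]) (simp add: bump_nonneg)
  finally show ?thesis using I assms by (simp add: ennreal_mult'[symmetric] field_simps)
qed

text \<open>Scaling: differentiation costs one factor 1/t in L1. The exact power matters, since two
  such factors will later be cancelled by the t^2 of a squared L2 increment.\<close>

lemma moll_dderiv_bound: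
  obtains K where "K > 0" "\<And>t. t > 0 \<Longrightarrow> (\<integral>\<^sup>+x. ennreal \<bar>dderiv v (moll t) (x::'a::euclidean_space)\<bar> \<partial>lborel) \<le> ennreal (K / t)"
proof -
  let ?I = "LBINT y. bump (y::'a)"
  let ?J = "LBINT y. \<bar>dderiv v bump (y::'a)\<bar>"
  have I: "?I > 0" by (rule integral_bump_pos)
  have td: "test_function UNIV (dderiv v (bump::'a\<Rightarrow>real))" by (rule test_function_dderiv[OF test_function_bump])
  have [measurable]: "(dderiv v (bump::'a\<Rightarrow>real)) \<in> borel_measurable borel" by (rule smooth_measurable[OF smooth_dderiv[OF smooth_bump]])
  have J: "?J \<ge> 0" by simp
  have eq: "(\<integral>\<^sup>+x. ennreal \<bar>dderiv v (moll t) (x::'a)\<bar> \<partial>lborel) = ennreal (?J / ?I / t)" if t: "t > 0" for t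
  proof -
    have "(\<integral>\<^sup>+x. ennreal \<bar>dderiv v (moll t) (x::'a)\<bar> \<partial>lborel)
      = (\<integral>\<^sup>+x. ennreal (inverse (t ^ DIM('a) * ?I) * (1/t)) * ennreal \<bar>dderiv v bump ((1/t) *\<^sub>R (x::'a))\<bar> \<partial>lborel)"
      using I t by (intro nn_integral_cong) (simp add: dderiv_moll abs_mult ennreal_mult'[symmetric] mult.assoc abs_of_pos)
    also have "\<dots> = ennreal (inverse (t ^ DIM('a) * ?I) * (1/t)) * (ennreal (t ^ DIM('a)) * (\<integral>\<^sup>+x. ennreal \<bar>dderiv v bump (x::'a)\<bar> \<partial>lborel))"
      using nn_integral_scale[of "\<lambda>x::'a. ennreal \<bar>dderiv v bump x\<bar>" t] t by (simp add: nn_integral_cmult)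
    also have "(\<integral>\<^sup>+x. ennreal \<bar>dderiv v bump (x::'a)\<bar> \<partial>lborel) = ennreal ?J"
      by (rule nn_integral_eq_integral) (use test_function_integrable[OF td] in auto)
    finally show ?thesis using I t J by (simp add: ennreal_mult'[symmetric] field_simps)
  qed
  show ?thesis
  proof (rule that[of "?J / ?I + 1"])
    show "?J / ?I + 1 > 0" using I J by (smt (verit) divide_nonneg_pos)
    show "(\<integral>\<^sup>+x. ennreal \<bar>dderiv v (moll t) (x::'a)\<bar> \<partial>lborel) \<le> ennreal ((?J / ?I + 1) / t)" if "t > 0" for t
      unfolding eq[OF that] using that by (intro ennreal_leI divide_right_mono) auto
  qed
qed

section \<open>Convolution and weak derivatives\<close>

definition conv :: "('a::euclidean_space \<Rightarrow> 'b::euclidean_space) \<Rightarrow> ('a \<Rightarrow> real) \<Rightarrow> 'a \<Rightarrow> 'b" where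
  "conv w \<rho> x = (LBINT y. \<rho> (x - y) *\<^sub>R w y)"

lemma conv_measurable [measurable]:
  assumes [measurable]: "w \<in> borel_measurable borel" "\<rho> \<in> borel_measurable borel"
  shows "conv w \<rho> \<in> borel_measurable borel"
  unfolding conv_def[abs_def] by measurable

lemma conv_integrable:
  fixes w :: "'a::euclidean_space \<Rightarrow> 'b::euclidean_space"
  assumes "test_function UNIV \<rho>" "integrable lborel w"
  shows "integrable lborel (\<lambda>y. \<rho> (x - y) *\<^sub>R w y)"
proof -
  obtain K where K: "compact K" "\<And>x. x \<notin> K \<Longrightarrow> \<rho> x = 0" using test_functionE[OF assms(1)] by metis
  have "test_function UNIV (\<lambda>y. \<rho> (x - y))"
  proof (rule test_functionI[OF smooth_reflect[OF test_function_smooth[OF assms(1)]]])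
    show "compact ((\<lambda>z. x - z) ` K)" by (intro compact_continuous_image continuous_intros K)
    show "\<rho> (x - y) = 0" if "y \<notin> (\<lambda>z. x - z) ` K" for y
      using that K(2)[of "x - y"] by (metis (no_types, lifting) add_diff_cancel diff_diff_eq2 diff_add_cancel image_eqI minus_diff_eq uminus_add_conv_diff)
  qed simp
  then show ?thesis by (rule integrable_test_function_scaleR[OF _ assms(2)])
qed

text \<open>The Taylor remainder of \<rho> is at most L |h|^2 uniformly in the point, so after
  integration against w the error is at most L |h|^2 times the L1 norm of w.\<close>

lemma conv_has_derivative:
  assumes \<rho>: "test_function UNIV \<rho>" and w: "integrable lborel w"
  shows "(conv w \<rho> has_derivative (\<lambda>v. conv w (dderiv v \<rho>) x)) (at x)"
proof -
  have sm: "smooth \<rho>" by (rule test_function_smooth[OF \<rho>])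
  have i: "integrable lborel (\<lambda>y. \<rho> (x - y) *\<^sub>R w y)" "integrable lborel (\<lambda>y. dderiv v \<rho> (x - y) *\<^sub>R w y)" for x v
    by (intro conv_integrable w \<rho> test_function_dderiv)+
  obtain L where L: "L > 0" "\<And>x h. \<bar>\<rho> (x + h) - \<rho> x - dderiv h \<rho> x\<bar> \<le> L * (norm h)\<^sup>2"
    using test_function_taylor[OF \<rho>] by blast
  let ?W = "LBINT y. norm (w y)"
  have bnd: "norm (conv w \<rho> (x + h) - conv w \<rho> x - conv w (dderiv h \<rho>) x) \<le> L * ?W * (norm h)\<^sup>2" for h
  proof -
    let ?g = "\<lambda>y. (\<rho> (x - y + h) - \<rho> (x - y) - dderiv h \<rho> (x - y)) *\<^sub>R w y"
    have e: "?g = (\<lambda>y. \<rho> (x + h - y) *\<^sub>R w y - \<rho> (x - y) *\<^sub>R w y - dderiv h \<rho> (x - y) *\<^sub>R w y)"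
      by (rule ext) (simp add: scaleR_diff_left algebra_simps)
    have ig: "integrable lborel ?g"
      unfolding e by (intro Bochner_Integration.integrable_diff i)
    have "conv w \<rho> (x + h) - conv w \<rho> x - conv w (dderiv h \<rho>) x = integral\<^sup>L lborel ?g"
      unfolding conv_def e using i(1)[of "x + h"] i(1)[of x] i(2)[of h x] by simp
    moreover have "norm (integral\<^sup>L lborel ?g) \<le> (LBINT y. norm (?g y))"
      by (rule integral_norm_bound)
    moreover have "(LBINT y. norm (?g y)) \<le> (LBINT y. L * (norm h)\<^sup>2 * norm (w y))"
      by (rule integral_mono) (use w L(2) integrable_norm[OF ig] in \<open>auto intro!: mult_right_mono\<close>)
    ultimately show ?thesis using w by (simp add: mult_ac)
  qed
  have lin: "linear (\<lambda>v. conv w (dderiv v \<rho>) x)"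
    by (rule linearI) (use i(2) in \<open>simp_all add: conv_def dderiv_linear[OF sm] scaleR_add_left scaleR_scaleR[symmetric] del: scaleR_scaleR\<close>)
  have "isCont (\<lambda>h::'a. L * ?W * norm h) 0" by (intro continuous_intros)
  then have z: "((\<lambda>h::'a. L * ?W * norm h) \<longlongrightarrow> 0) (at 0)" by (simp add: isCont_def)
  have "((\<lambda>h. norm (conv w \<rho> (x + h) - conv w \<rho> x - conv w (dderiv h \<rho>) x) / norm h) \<longlongrightarrow> 0) (at 0)"
  proof (rule Lim_null_comparison[OF _ z])
    show "\<forall>\<^sub>F h in at 0. norm (norm (conv w \<rho> (x + h) - conv w \<rho> x - conv w (dderiv h \<rho>) x) / norm h) \<le> L * ?W * norm h"
    proof (rule eventually_at_filter[THEN iffD2], rule always_eventually, intro allI impI)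
      fix h :: 'a assume "h \<noteq> 0"
      then show "norm (norm (conv w \<rho> (x + h) - conv w \<rho> x - conv w (dderiv h \<rho>) x) / norm h) \<le> L * ?W * norm h"
        using bnd[of h] by (simp add: divide_le_eq power2_eq_square mult.assoc)
    qed
  qed
  then show ?thesis
    unfolding has_derivative_at using lin linear_conv_bounded_linear by blast
qed

lemma dderiv_conv:
  assumes "test_function UNIV \<rho>" "integrable lborel w"
  shows "dderiv v (conv w \<rho>) = conv w (dderiv v \<rho>)"
  by (rule ext, rule dderiv_eqI[OF conv_has_derivative[OF assms]])

lemma smooth_conv:
  assumes "test_function UNIV \<rho>" "integrable lborel w"
  shows "smooth (conv w \<rho>)"
proof -
  have "Ck k (conv w \<rho>)" for k
    using assms(1)
  proof (induction k arbitrary: \<rho>)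
    case 0
    then show ?case using conv_has_derivative[OF _ assms(2)]
      by (auto intro!: continuous_at_imp_continuous_on has_derivative_continuous)
  next
    case (Suc k)
    then show ?case
      unfolding Ck_Suc_iff using dderiv_conv[OF Suc.prems assms(2)] conv_has_derivative[OF Suc.prems assms(2)]
      by (auto intro: differentiableI test_function_dderiv)
  qed
  then show ?thesis by (simp add: smooth_def)
qed

text \<open>Only the test functions see U. The integrals run over the whole space, so that functions
  can be translated and mollified without leaving their domain; integrability is assumed separately
  where it is used.\<close>

definition weak_dderiv :: "'a set \<Rightarrow> 'a \<Rightarrow> ('a::euclidean_space \<Rightarrow> 'b::euclidean_space) \<Rightarrow> ('a \<Rightarrow> 'b) \<Rightarrow> bool" where
  "weak_dderiv U v w Y \<longleftrightarrow> (\<forall>\<phi>. test_function U \<phi> \<longrightarrow>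
     (LBINT x. dderiv v \<phi> x *\<^sub>R w x) = - (LBINT x. \<phi> x *\<^sub>R Y x))"

text \<open>Reflecting the kernel flips the sign of its derivative, which cancels the sign of
  integration by parts. Hence mollification turns a weak derivative into a classical one at every
  point whose r-ball stays in U.\<close>

lemma conv_weak_dderiv:
  assumes "weak_dderiv U v w Y" "test_function UNIV \<rho>" "\<And>y. \<rho> y \<noteq> 0 \<Longrightarrow> norm y \<le> r" "cball x r \<subseteq> U"
  shows "conv w (dderiv v \<rho>) x = conv Y \<rho> x"
proof -
  have "test_function U (\<lambda>y. \<rho> (x - y))" by (rule test_function_reflect[OF assms(2-4)])
  then have "(LBINT y. dderiv v (\<lambda>y. \<rho> (x - y)) y *\<^sub>R w y) = - (LBINT y. \<rho> (x - y) *\<^sub>R Y y)"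
    using assms(1) unfolding weak_dderiv_def by blast
  then show ?thesis
    unfolding conv_def dderiv_reflect[OF test_function_smooth[OF assms(2)]] by simp
qed

section \<open>Norm bounds and convergence of mollifications\<close>

lemma conv_diff_const:
  fixes w :: "'a::euclidean_space \<Rightarrow> 'b::euclidean_space"
  assumes w: "integrable lborel w" and t: "t > 0"
  shows "conv w (moll t) x - w x = (LBINT y. moll t (x - y) *\<^sub>R (w y - w x))"
proof -
  have nz: "norm y \<le> t" if "moll t y \<noteq> 0" for y :: 'a
    using that moll_eq_0[OF t, of y] by force
  have i: "integrable lborel (\<lambda>y. moll t (x - y))"
    by (rule test_function_integrable[OF test_function_reflect[OF test_function_moll[OF t] nz subset_UNIV]])
  have [measurable]: "(moll t :: 'a \<Rightarrow> real) \<in> borel_measurable borel" by simp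
  have "(\<integral>\<^sup>+y. ennreal (moll t (x - y)) \<partial>lborel) = 1"
    using nn_integral_reflect[of "\<lambda>y::'a. ennreal (moll t y)" x] nn_integral_moll[OF t, where 'a='a] by simp
  then have "(LBINT y. moll t (x - y)) = 1"
    using t by (simp add: integral_eq_nn_integral moll_nonneg)
  then show ?thesis
    using conv_integrable[OF test_function_moll[OF t] w, of x] i unfolding conv_def
    by (simp add: scaleR_diff_right)
qed

text \<open>Jensen's inequality from Young's: with m the \<rho>-mean of f, integrate f m^(q-1) \<le>
  f^q/q + m^q/q' against the probability weight \<rho> and collect the multiples of m^q. The right
  side is an extended integral, so it may be infinite.\<close>

lemma powr_jensen:
  assumes [measurable]: "f \<in> borel_measurable M"
    and \<rho>: "integrable M \<rho>" "\<And>x. \<rho> x \<ge> 0" "(\<integral>x. \<rho> x \<partial>M) = (1::real)"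
    and f: "integrable M (\<lambda>x. \<rho> x * f x)" "\<And>x. f x \<ge> 0" and q: "q > (1::real)"
  shows "ennreal ((\<integral>x. \<rho> x * f x \<partial>M) powr q) \<le> (\<integral>\<^sup>+x. ennreal (\<rho> x * f x powr q) \<partial>M)"
proof (cases "(\<integral>\<^sup>+x. ennreal (\<rho> x * f x powr q) \<partial>M) = \<infinity>")
  case False
  have [measurable]: "\<rho> \<in> borel_measurable M" using \<rho>(1) by simp
  define m where "m = (\<integral>x. \<rho> x * f x \<partial>M)"
  have m: "m \<ge> 0" unfolding m_def using \<rho>(2) f(2) by (intro Bochner_Integration.integral_nonneg) simp
  have i: "integrable M (\<lambda>x. \<rho> x * f x powr q)"
    using False \<rho>(2) by (intro integrableI_nonneg) (auto simp: less_top[symmetric])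
  define q' where "q' = q / (q - 1)"
  have q': "q' > 1" "1 / q + 1 / q' = 1" using q by (auto simp: q'_def field_simps)
  have e: "(m powr (q - 1)) powr q' = m powr q"
    using q by (simp add: powr_powr q'_def)
  have "m * m powr (q - 1) = (\<integral>x. \<rho> x * f x * m powr (q - 1) \<partial>M)" unfolding m_def by simp
  also have "\<dots> \<le> (\<integral>x. \<rho> x * f x powr q / q + \<rho> x * (m powr q / q') \<partial>M)"
  proof (rule integral_mono)
    show "\<rho> x * f x * m powr (q - 1) \<le> \<rho> x * f x powr q / q + \<rho> x * (m powr q / q')" for x
    proof -
      have "f x * m powr (q - 1) \<le> f x powr q / q + m powr q / q'"
        using Youngs_inequality[OF q q', of "f x" "m powr (q - 1)"] f(2) e by simp
      from mult_left_mono[OF this \<rho>(2)[of x]] show ?thesis by (simp add: algebra_simps)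
    qed
  qed (use f i \<rho>(1) in auto)
  also have "\<dots> = (\<integral>x. \<rho> x * f x powr q \<partial>M) / q + m powr q / q'"
    using i \<rho> by simp
  finally have "m * m powr (q - 1) \<le> (\<integral>x. \<rho> x * f x powr q \<partial>M) / q + m powr q / q'" .
  moreover have "m * m powr (q - 1) = m powr q"
    using m by (cases "m = 0") (simp_all add: powr_diff)
  moreover have "m powr q / q' = m powr q - m powr q / q"
    using q by (simp add: q'_def field_simps)
  ultimately have "m powr q / q \<le> (\<integral>x. \<rho> x * f x powr q \<partial>M) / q" by linarith
  then have "m powr q \<le> (\<integral>x. \<rho> x * f x powr q \<partial>M)" using q by (simp add: divide_le_cancel)
  moreover have "(\<integral>\<^sup>+x. ennreal (\<rho> x * f x powr q) \<partial>M) = ennreal (\<integral>x. \<rho> x * f x powr q \<partial>M)"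
    using \<rho>(2) by (intro nn_integral_eq_integral[OF i]) simp
  ultimately show ?thesis by (simp add: m_def ennreal_leI)
qed simp

lemma conv_norm_powr_le:
  fixes w :: "'a::euclidean_space \<Rightarrow> 'b::euclidean_space"
  assumes w: "integrable lborel w" and t: "t > 0" and q: "q > 1"
  shows "ennreal (norm (conv w (moll t) x) powr q) \<le> (\<integral>\<^sup>+y. ennreal (moll t (x - y) * norm (w y) powr q) \<partial>lborel)"
proof -
  have [measurable]: "w \<in> borel_measurable borel" using borel_measurable_integrable[OF w] by simp
  have nz: "norm y \<le> t" if "moll t y \<noteq> 0" for y :: 'a
    using that moll_eq_0[OF t, of y] by force
  have i: "integrable lborel (\<lambda>y. moll t (x - y))"
    by (rule test_function_integrable[OF test_function_reflect[OF test_function_moll[OF t] nz subset_UNIV]])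
  have "(\<integral>\<^sup>+y. ennreal (moll t (x - y)) \<partial>lborel) = 1"
    using nn_integral_reflect[of "\<lambda>y::'a. ennreal (moll t y)" x] nn_integral_moll[OF t, where 'a='a] by simp
  then have 1: "(LBINT y. moll t (x - y)) = 1"
    using t by (simp add: integral_eq_nn_integral moll_nonneg)
  have i2: "integrable lborel (\<lambda>y. moll t (x - y) * norm (w y))"
    using integrable_norm[OF conv_integrable[OF test_function_moll[OF t] w, of x]] by (simp add: abs_of_nonneg[OF moll_nonneg[OF t]])
  have "norm (conv w (moll t) x) \<le> (LBINT y. moll t (x - y) * norm (w y))"
    unfolding conv_def using integral_norm_bound[of lborel "\<lambda>y. moll t (x - y) *\<^sub>R w y"]
    by (simp add: abs_of_nonneg[OF moll_nonneg[OF t]])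
  then have "norm (conv w (moll t) x) powr q \<le> (LBINT y. moll t (x - y) * norm (w y)) powr q"
    using q by (intro powr_mono2) auto
  then have "ennreal (norm (conv w (moll t) x) powr q) \<le> ennreal ((LBINT y. moll t (x - y) * norm (w y)) powr q)"
    by (rule ennreal_leI)
  also have "\<dots> \<le> (\<integral>\<^sup>+y. ennreal (moll t (x - y) * norm (w y) powr q) \<partial>lborel)"
    by (rule powr_jensen[OF _ i _ 1 i2 _ q]) (auto simp: moll_nonneg[OF t])
  finally show ?thesis .
qed

lemma nn_integral_moll_conv:
  fixes f :: "'a::euclidean_space \<Rightarrow> ennreal"
  assumes [measurable]: "f \<in> borel_measurable borel" and t: "t > 0"
  shows "(\<integral>\<^sup>+x. (\<integral>\<^sup>+y. ennreal (moll t (x - y)) * f y \<partial>lborel) \<partial>lborel) = (\<integral>\<^sup>+x. f x \<partial>lborel)"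
proof -
  have "(\<integral>\<^sup>+x. (\<integral>\<^sup>+y. ennreal (moll t (x - y)) * f y \<partial>lborel) \<partial>lborel)
     = (\<integral>\<^sup>+y. (\<integral>\<^sup>+x. ennreal (moll t (x - y)) * f y \<partial>lborel) \<partial>lborel)"
    by (rule lborel_pair.Fubini') measurable
  also have "\<dots> = (\<integral>\<^sup>+y. f y \<partial>lborel)"
  proof (rule nn_integral_cong)
    fix y :: 'a
    have "(\<integral>\<^sup>+x. ennreal (moll t (x - y)) * f y \<partial>lborel) = (\<integral>\<^sup>+x. ennreal (moll t (x + (- y))) \<partial>lborel) * f y"
      by (simp add: nn_integral_multc)
    also have "(\<integral>\<^sup>+x. ennreal (moll t (x + (- y))) \<partial>lborel) = 1"
      by (subst nn_integral_translate) (simp_all add: nn_integral_moll[OF t])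
    finally show "(\<integral>\<^sup>+x. ennreal (moll t (x - y)) * f y \<partial>lborel) = f y" by simp
  qed
  finally show ?thesis .
qed

text \<open>Jensen pointwise, then Fubini: the unit mass of the kernel disappears in the outer
  integral.\<close>

lemma conv_Lq_bound:
  fixes w :: "'a::euclidean_space \<Rightarrow> 'b::euclidean_space"
  assumes w: "integrable lborel w" and t: "t > 0" and q: "q > 1"
  shows "(\<integral>\<^sup>+x. ennreal (norm (conv w (moll t) x) powr q) \<partial>lborel) \<le> (\<integral>\<^sup>+x. ennreal (norm (w x) powr q) \<partial>lborel)"
proof -
  have [measurable]: "w \<in> borel_measurable borel" using borel_measurable_integrable[OF w] by simp
  have "(\<integral>\<^sup>+x. ennreal (norm (conv w (moll t) x) powr q) \<partial>lborel)
      \<le> (\<integral>\<^sup>+x. (\<integral>\<^sup>+y. ennreal (moll t (x - y)) * ennreal (norm (w y) powr q) \<partial>lborel) \<partial>lborel)"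
    using conv_norm_powr_le[OF assms] by (intro nn_integral_mono) (simp add: ennreal_mult' moll_nonneg[OF t])
  also have "\<dots> = (\<integral>\<^sup>+x. ennreal (norm (w x) powr q) \<partial>lborel)"
    by (rule nn_integral_moll_conv[OF _ t]) simp
  finally show ?thesis .
qed

lemma translation_continuous_L1':
  fixes w :: "'a::euclidean_space \<Rightarrow> 'b::euclidean_space"
  assumes "integrable lborel w" "e > 0"
  obtains d where "d > 0" "\<And>h. norm h < d \<Longrightarrow> (LBINT x. norm (w (x + h) - w x)) < e"
proof (rule ccontr)
  assume "\<not> thesis"
  then have "\<forall>d>0. \<exists>h. norm h < d \<and> \<not> (LBINT x. norm (w (x + h) - w x)) < e" using that by blast
  then have "\<forall>n. \<exists>h. norm h < inverse (real (Suc n)) \<and> \<not> (LBINT x. norm (w (x + h) - w x)) < e"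
    by (metis inverse_positive_iff_positive of_nat_0_less_iff zero_less_Suc)
  then obtain h where h: "\<And>n. norm (h n) < inverse (real (Suc n))" "\<And>n. \<not> (LBINT x. norm (w (x + h n) - w x)) < e"
    by metis
  have "h \<longlonglongrightarrow> 0"
    by (rule Lim_null_comparison[OF always_eventually LIMSEQ_inverse_real_of_nat]) (use h(1) less_imp_le in blast)
  from order_tendstoD(2)[OF translation_continuous_L1[OF assms(1) this] assms(2)] h(2)
  show False by (auto simp: eventually_sequentially)
qed

text \<open>By Fubini the L1 error is at most the kernel average of the modulus of continuity
  \<omega>(h), the L1 norm of w(x+h) - w(x). The kernel only sees |h| \<le> t, where \<omega> is
  small.\<close>

lemma conv_L1_convergence:
  fixes w :: "'a::euclidean_space \<Rightarrow> 'b::euclidean_space"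
  assumes w: "integrable lborel w" and t: "\<And>n. t n > 0" "t \<longlonglongrightarrow> 0"
  shows "integrable lborel (\<lambda>x. conv w (moll (t n)) x - w x)"
    and "(\<lambda>n. LBINT x. norm (conv w (moll (t n)) x - w x)) \<longlonglongrightarrow> 0"
proof -
  have [measurable]: "w \<in> borel_measurable borel" using borel_measurable_integrable[OF w] by simp
  define \<omega> where "\<omega> h = (LBINT x. norm (w (x + h) - w x))" for h
  have w': "(\<integral>\<^sup>+x. ennreal (norm (w (x + h) - w x)) \<partial>lborel) = ennreal (\<omega> h)" for h
    unfolding \<omega>_def using w integrable_translate[OF w, of h] by (intro nn_integral_eq_integral) auto
  have key: "(\<integral>\<^sup>+x. ennreal (norm (conv w (moll (t n)) x - w x)) \<partial>lborel)
      \<le> (\<integral>\<^sup>+h. ennreal (moll (t n) (- h)) * ennreal (\<omega> h) \<partial>lborel)" for n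
  proof -
    have "(\<integral>\<^sup>+x. ennreal (norm (conv w (moll (t n)) x - w x)) \<partial>lborel)
      \<le> (\<integral>\<^sup>+x. (\<integral>\<^sup>+h. ennreal (moll (t n) (- h)) * ennreal (norm (w (x + h) - w x)) \<partial>lborel) \<partial>lborel)"
    proof (rule nn_integral_mono)
      fix x
      have "conv w (moll (t n)) x - w x = (LBINT y. moll (t n) (- y) *\<^sub>R (w (x + y) - w x))"
        unfolding conv_diff_const[OF w t(1)]
        using integral_translate[of "\<lambda>y. moll (t n) (x - y) *\<^sub>R (w y - w x)" x] by (simp add: add.commute)
      then have "ennreal (norm (conv w (moll (t n)) x - w x)) \<le> (\<integral>\<^sup>+y. ennreal (norm (moll (t n) (- y) *\<^sub>R (w (x + y) - w x))) \<partial>lborel)"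
        using integral_norm_bound_ennreal[of lborel "\<lambda>y. moll (t n) (- y) *\<^sub>R (w (x + y) - w x)"]
        by (cases "integrable lborel (\<lambda>y. moll (t n) (- y) *\<^sub>R (w (x + y) - w x))") (auto simp: not_integrable_integral_eq)
      also have "\<dots> = (\<integral>\<^sup>+h. ennreal (moll (t n) (- h)) * ennreal (norm (w (x + h) - w x)) \<partial>lborel)"
        by (simp add: ennreal_mult' moll_nonneg[OF t(1)])
      finally show "ennreal (norm (conv w (moll (t n)) x - w x)) \<le> \<dots>" .
    qed
    also have "\<dots> = (\<integral>\<^sup>+h. (\<integral>\<^sup>+x. ennreal (moll (t n) (- h)) * ennreal (norm (w (x + h) - w x)) \<partial>lborel) \<partial>lborel)"
      by (rule lborel_pair.Fubini') measurable
    also have "\<dots> = (\<integral>\<^sup>+h. ennreal (moll (t n) (- h)) * ennreal (\<omega> h) \<partial>lborel)"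
      by (simp add: nn_integral_cmult w')
    finally show ?thesis .
  qed
  have m1: "(\<integral>\<^sup>+h. ennreal (moll (t n) (- h::'a)) \<partial>lborel) = 1" for n
    using nn_integral_reflect[of "\<lambda>y::'a. ennreal (moll (t n) y)" 0] nn_integral_moll[OF t(1), where 'a='a] by simp
  have bnd: "(\<integral>\<^sup>+x. ennreal (norm (conv w (moll (t n)) x - w x)) \<partial>lborel) \<le> ennreal B"
    if B: "\<And>h. norm h \<le> t n \<Longrightarrow> \<omega> h \<le> B" for n B
  proof -
    have "ennreal (moll (t n) (- h)) * ennreal (\<omega> h) \<le> ennreal (moll (t n) (- h)) * ennreal B" for h :: 'a
      using B[of h] moll_eq_0[OF t(1)[of n], of "- h"]
      by (cases "norm h \<le> t n") (auto intro!: mult_left_mono ennreal_leI)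
    then have "(\<integral>\<^sup>+h. ennreal (moll (t n) (- h)) * ennreal (\<omega> h) \<partial>lborel) \<le> (\<integral>\<^sup>+h. ennreal (moll (t n) (- h::'a)) * ennreal B \<partial>lborel)"
      by - (rule nn_integral_mono)
    also have "\<dots> = ennreal B" using m1 by (simp add: nn_integral_multc)
    finally show ?thesis using key[of n] by simp
  qed
  \<comment> \<open>A crude bound, wanted only for the integrability of the error.\<close>
  have w2: "\<omega> h \<le> 2 * (LBINT x. norm (w x))" for h
  proof -
    have i: "integrable lborel (\<lambda>x. w (x + h))" by (rule integrable_translate[OF w])
    have "\<omega> h \<le> (LBINT x. norm (w (x + h)) + norm (w x))"
      unfolding \<omega>_def using w i by (intro integral_mono) (auto intro: norm_triangle_ineq4)
    also have "\<dots> = (LBINT x. norm (w (x + h))) + (LBINT x. norm (w x))" using w i by simp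
    also have "(LBINT x. norm (w (x + h))) = (LBINT x. norm (w x))"
      by (rule integral_translate) simp
    finally show ?thesis by simp
  qed
  show int: "integrable lborel (\<lambda>x. conv w (moll (t n)) x - w x)" for n
  proof (rule integrableI_bounded)
    show "(\<integral>\<^sup>+x. ennreal (norm (conv w (moll (t n)) x - w x)) \<partial>lborel) < \<infinity>"
      using bnd[OF w2, of n] by (metis ennreal_less_top infinity_ennreal_def le_less_trans)
  qed measurable
  show "(\<lambda>n. LBINT x. norm (conv w (moll (t n)) x - w x)) \<longlonglongrightarrow> 0"
  proof (rule LIMSEQ_I)
    fix e :: real assume e: "e > 0"
    then obtain d where d: "d > 0" "\<And>h. norm h < d \<Longrightarrow> \<omega> h < e / 2"
      unfolding \<omega>_def using translation_continuous_L1'[OF w, of "e/2"] by auto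
    obtain N where N: "\<And>n. n \<ge> N \<Longrightarrow> t n < d"
      using order_tendstoD(2)[OF t(2) d(1)] by (auto simp: eventually_sequentially)
    have "norm ((LBINT x. norm (conv w (moll (t n)) x - w x)) - 0) < e" if "n \<ge> N" for n
    proof -
      have "ennreal (LBINT x. norm (conv w (moll (t n)) x - w x)) = (\<integral>\<^sup>+x. ennreal (norm (conv w (moll (t n)) x - w x)) \<partial>lborel)"
        using int[of n] by (intro nn_integral_eq_integral[symmetric]) auto
      also have "\<dots> \<le> ennreal (e / 2)"
        by (rule bnd) (use d(2) N[OF that] in \<open>auto intro: less_imp_le\<close>)
      finally have "(LBINT x. norm (conv w (moll (t n)) x - w x)) \<le> e / 2"
        using e by (subst (asm) ennreal_le_iff) auto
      then show ?thesis using e by simp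
    qed
    then show "\<exists>N. \<forall>n\<ge>N. norm ((LBINT x. norm (conv w (moll (t n)) x - w x)) - 0) < e" by blast
  qed
qed

lemma conv_AE_subseq:
  fixes w :: "'a::euclidean_space \<Rightarrow> 'b::euclidean_space"
  assumes w: "integrable lborel w" and t: "\<And>n. t n > 0" "t \<longlonglongrightarrow> 0"
  obtains r :: "nat \<Rightarrow> nat" where "strict_mono r" "AE x in lborel. (\<lambda>n. conv w (moll (t (r n))) x) \<longlonglongrightarrow> w x"
proof -
  obtain r :: "nat \<Rightarrow> nat" where r: "strict_mono r" "AE x in lborel. (\<lambda>n. conv w (moll (t (r n))) x - w x) \<longlonglongrightarrow> 0"
    using tendsto_L1_AE_subseq[OF conv_L1_convergence(1)[OF assms] conv_L1_convergence(2)[OF assms]] by blast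
  show ?thesis
    by (rule that[OF r(1)]) (use r(2) in \<open>simp add: LIM_zero_iff\<close>)
qed

text \<open>Successive extraction: a further subsequence keeps the limits already obtained. A common
  index sequence is needed because several mollified derivatives occur in one identity.\<close>

lemma conv_AE_subseq_finite:
  assumes I: "finite I" "\<And>i. i \<in> I \<Longrightarrow> integrable lborel (w i)" and t: "\<And>n. t n > 0" "t \<longlonglongrightarrow> 0"
  obtains r :: "nat \<Rightarrow> nat" where "strict_mono r"
    "\<And>i. i \<in> I \<Longrightarrow> AE x in lborel. (\<lambda>n. conv (w i) (moll (t (r n))) x) \<longlonglongrightarrow> w i x"
proof -
  have "\<exists>r::nat\<Rightarrow>nat. strict_mono r \<and> (\<forall>i\<in>I. AE x in lborel. (\<lambda>n. conv (w i) (moll (t (r n))) x) \<longlonglongrightarrow> w i x)"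
    using I
  proof (induction I rule: finite_induct)
    case empty
    show ?case by (auto intro!: exI[of _ id] simp: strict_mono_def)
  next
    case (insert j J)
    then obtain r :: "nat \<Rightarrow> nat" where r: "strict_mono r"
      "\<And>i. i \<in> J \<Longrightarrow> AE x in lborel. (\<lambda>n. conv (w i) (moll (t (r n))) x) \<longlonglongrightarrow> w i x" by auto
    have t': "\<And>n. t (r n) > 0" "(\<lambda>n. t (r n)) \<longlonglongrightarrow> 0"
      using t LIMSEQ_subseq_LIMSEQ[OF t(2) r(1)] by (auto simp: o_def)
    obtain r' :: "nat \<Rightarrow> nat" where r': "strict_mono r'"
      "AE x in lborel. (\<lambda>n. conv (w j) (moll (t (r (r' n)))) x) \<longlonglongrightarrow> w j x"
      using conv_AE_subseq[OF _ t', of "w j"] insert.prems by blast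
    have "AE x in lborel. (\<lambda>n. conv (w i) (moll (t (r (r' n)))) x) \<longlonglongrightarrow> w i x" if "i \<in> J" for i
      using r(2)[OF that] by eventually_elim (use LIMSEQ_subseq_LIMSEQ[OF _ r'(1)] in \<open>force simp: o_def\<close>)
    then show ?case using r' r(1)
      by (intro exI[of _ "r \<circ> r'"]) (auto simp: strict_mono_def)
  qed
  then show ?thesis using that by blast
qed

text \<open>The indicator of the closed 2r-neighbourhood of K is mollified with radius r. The result
  is 1 on the r-neighbourhood V and 0 outside the 3r-neighbourhood, which stays in U because r is a
  quarter of the margin e. An open set on which the cutoff equals 1 allows further cutoffs to be
  nested inside.\<close>

lemma compact_cutoff:
  fixes K U :: "'a::euclidean_space set"
  assumes K: "compact K" and U: "open U" "K \<subseteq> U"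
  obtains \<eta> V where "test_function U \<eta>" "\<And>x. 0 \<le> \<eta> x" "\<And>x. \<eta> x \<le> 1"
    "open V" "K \<subseteq> V" "V \<subseteq> U" "\<And>x. x \<in> V \<Longrightarrow> \<eta> x = 1"
proof -
  obtain e where e: "e > 0" "(\<Union>x\<in>K. ball x e) \<subseteq> U"
    using compact_subset_open_imp_ball_epsilon_subset[OF K U] by blast
  define r where "r = e / 4"
  have r: "r > 0" using e by (simp add: r_def)
  define S where "S = {x + y |x y. x \<in> K \<and> y \<in> cball 0 (2 * r)}"
  have cS: "compact S" unfolding S_def by (rule compact_sums[OF K compact_cball])
  define w where "w x = (indicator S x :: real)" for x
  have w: "integrable lborel w"
    unfolding w_def using cS by (intro integrable_real_indicator) (use emeasure_bounded_finite[OF compact_imp_bounded[OF cS]] in \<open>auto simp: compact_imp_closed\<close>)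
  define \<eta> where "\<eta> = conv w (moll r)"
  define S' where "S' = {x + y |x y. x \<in> K \<and> y \<in> cball 0 (3 * r)}"
  have cS': "compact S'" unfolding S'_def by (rule compact_sums[OF K compact_cball])
  have S'U: "S' \<subseteq> U"
  proof
    fix z assume "z \<in> S'"
    then obtain x y where "z = x + y" "x \<in> K" "norm y \<le> 3 * r" by (auto simp: S'_def)
    then have "z \<in> ball x e" using e(1) by (simp add: dist_norm r_def)
    then show "z \<in> U" using e(2) \<open>x \<in> K\<close> by blast
  qed
  have mz: "norm y \<le> r" if "moll r y \<noteq> 0" for y :: 'a
    using that moll_eq_0[OF r, of y] by force
  have im: "integrable lborel (\<lambda>y. moll r (x - y))" for x :: 'a
    by (rule test_function_integrable[OF test_function_reflect[OF test_function_moll[OF r] mz subset_UNIV]])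
  have i1: "(LBINT y. moll r (x - y)) = 1" for x :: 'a
  proof -
    have "(\<integral>\<^sup>+y. ennreal (moll r (x - y)) \<partial>lborel) = 1"
      using nn_integral_reflect[of "\<lambda>y::'a. ennreal (moll r y)" x] nn_integral_moll[OF r, where 'a='a] by simp
    then show ?thesis using r by (simp add: integral_eq_nn_integral moll_nonneg)
  qed
  have iw: "integrable lborel (\<lambda>y. moll r (x - y) *\<^sub>R w y)" for x
    by (rule conv_integrable[OF test_function_moll[OF r] w])
  have \<eta>0: "0 \<le> \<eta> x" for x
    unfolding \<eta>_def conv_def w_def by (intro Bochner_Integration.integral_nonneg) (simp add: indicator_def moll_nonneg[OF r])
  have \<eta>1: "\<eta> x \<le> 1" for x
  proof -
    have "\<eta> x \<le> (LBINT y. moll r (x - y))"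
      unfolding \<eta>_def conv_def using iw im moll_nonneg[OF r]
      by (intro integral_mono) (auto simp: w_def indicator_def)
    then show ?thesis using i1 by simp
  qed
  have \<eta>z: "\<eta> x = 0" if "x \<notin> S'" for x
  proof -
    have z: "moll r (x - y) *\<^sub>R w y = 0" for y
    proof (rule ccontr)
      assume "moll r (x - y) *\<^sub>R w y \<noteq> 0"
      then have y: "norm (x - y) \<le> r" "y \<in> S" using mz[of "x - y"] by (auto simp: w_def indicator_def split: if_splits)
      then obtain a b where ab: "y = a + b" "a \<in> K" "norm b \<le> 2 * r" by (auto simp: S_def)
      have "x = a + (b + (x - y))" using ab by simp
      moreover have "norm (b + (x - y)) \<le> 3 * r" using norm_triangle_ineq[of b "x - y"] y ab by simp
      ultimately have "\<exists>a b. x = a + b \<and> a \<in> K \<and> b \<in> cball 0 (3 * r)"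
        using ab(2) by (intro exI[of _ a] exI[of _ "b + (x - y)"]) (simp only: mem_cball_0 simp_thms)
      then have "x \<in> S'" unfolding S'_def by blast
      then show False using that by simp
    qed
    show ?thesis unfolding \<eta>_def conv_def z by simp
  qed
  define V where "V = (\<Union>k\<in>K. ball k r)"
  have \<eta>V: "\<eta> x = 1" if "x \<in> V" for x
  proof -
    obtain k where k: "k \<in> K" "dist k x < r" using \<open>x \<in> V\<close> by (auto simp: V_def)
    have z: "moll r (x - y) *\<^sub>R w y = moll r (x - y)" for y
    proof (cases "moll r (x - y) = 0")
      case False
      then have "norm (x - y) \<le> r" by (rule mz)
      then have "norm (y - k) \<le> 2 * r" using k(2) norm_triangle_ineq[of "x - k" "y - x"]
        by (simp add: dist_norm norm_minus_commute)
      then have "\<exists>a b. y = a + b \<and> a \<in> K \<and> b \<in> cball 0 (2 * r)"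
        using k(1) by (intro exI[of _ k] exI[of _ "y - k"]) simp
      then have "y \<in> S" unfolding S_def by blast
      then show ?thesis by (simp add: w_def)
    qed simp
    show ?thesis unfolding \<eta>_def conv_def z by (rule i1)
  qed
  have "V \<subseteq> U" using e by (auto simp: V_def r_def intro!: subsetD[OF e(2)])
  moreover have "K \<subseteq> V" using r by (auto simp: V_def)
  moreover have "open V" by (auto simp: V_def)
  moreover have "test_function U \<eta>"
    by (rule test_functionI[OF _ cS' S'U \<eta>z]) (simp add: \<eta>_def smooth_conv[OF test_function_moll[OF r] w])
  ultimately show ?thesis using that \<eta>0 \<eta>1 \<eta>V by blast
qed

subsection \<open>Powers and Lebesgue spaces\<close>

definition Lq :: "real \<Rightarrow> ('a::euclidean_space \<Rightarrow> 'b::euclidean_space) \<Rightarrow> bool" where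
  "Lq p w \<longleftrightarrow> w \<in> borel_measurable borel \<and> integrable lborel (\<lambda>x. norm (w x) powr p)"

text \<open>The p-th power of the norm: being an integral, it adds up and scales without roots,
  which enter only where \<open>Lp_norm\<close> is met.\<close>

abbreviation Iq :: "real \<Rightarrow> ('a::euclidean_space \<Rightarrow> 'b::euclidean_space) \<Rightarrow> real" where
  "Iq p w \<equiv> LBINT x. norm (w x) powr p"

lemma Lq_measurable: "Lq p w \<Longrightarrow> w \<in> borel_measurable borel"
  by (simp add: Lq_def)

lemma Lq_integrable: "Lq p w \<Longrightarrow> integrable lborel (\<lambda>x. norm (w x) powr p)"
  by (simp add: Lq_def)

lemma LqI:
  assumes "w \<in> borel_measurable borel" "(\<integral>\<^sup>+x. ennreal (norm (w x) powr p) \<partial>lborel) \<le> ennreal B"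
  shows "Lq p w" "B \<ge> 0 \<Longrightarrow> Iq p w \<le> B"
proof -
  have [measurable]: "w \<in> borel_measurable borel" by fact
  have i: "integrable lborel (\<lambda>x. norm (w x) powr p)"
  proof (rule integrableI_bounded)
    show "(\<integral>\<^sup>+x. ennreal (norm (norm (w x) powr p)) \<partial>lborel) < \<infinity>"
      using assms(2) by (simp add: order_le_less_trans)
  qed measurable
  then show "Lq p w" using assms(1) by (simp add: Lq_def)
  have "ennreal (Iq p w) \<le> ennreal B"
    using assms(2) nn_integral_eq_integral[OF i] by simp
  then show "B \<ge> 0 \<Longrightarrow> Iq p w \<le> B" by (simp add: ennreal_le_iff)
qed

lemma nn_integral_Lq: "Lq p w \<Longrightarrow> (\<integral>\<^sup>+x. ennreal (norm (w x) powr p) \<partial>lborel) = ennreal (Iq p w)"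
  by (rule nn_integral_eq_integral) (auto simp: Lq_def)

lemma Iq_nonneg: "Iq p w \<ge> 0" by (intro Bochner_Integration.integral_nonneg) simp

lemma Lq_dominated_AE:
  assumes f: "Lq p f" and g: "g \<in> borel_measurable borel"
    and le: "AE x in lborel. norm (g x) \<le> C * norm (f x)" and C: "C \<ge> 0" and p: "p > 0"
  shows "Lq p g" "Iq p g \<le> C powr p * Iq p f"
proof -
  have [measurable]: "g \<in> borel_measurable borel" by fact
  have i: "integrable lborel (\<lambda>x. C powr p * norm (f x) powr p)"
    using Lq_integrable[OF f] by simp
  have AE: "AE x in lborel. norm (g x) powr p \<le> C powr p * norm (f x) powr p"
    using le
  proof eventually_elim
    case (elim x)
    then have "norm (g x) powr p \<le> (C * norm (f x)) powr p" using p by (intro powr_mono2) auto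
    then show ?case using C by (simp add: powr_mult)
  qed
  have ig: "integrable lborel (\<lambda>x. norm (g x) powr p)"
    by (rule Bochner_Integration.integrable_bound[OF i]) (use AE in auto)
  then show "Lq p g" using g by (simp add: Lq_def)
  have "Iq p g \<le> (LBINT x. C powr p * norm (f x) powr p)"
    by (rule integral_mono_AE[OF ig i AE])
  then show "Iq p g \<le> C powr p * Iq p f" by simp
qed

lemmas Lq_dominated = Lq_dominated_AE[OF _ _ AE_I2]

lemma powr_add_le:
  assumes "a \<ge> 0" "b \<ge> 0" "p > (0::real)"
  shows "(a + b) powr p \<le> 2 powr p * (a powr p + b powr p)"
proof -
  have "(a + b) powr p \<le> (2 * max a b) powr p" using assms by (intro powr_mono2) auto
  also have "\<dots> = 2 powr p * (max a b) powr p" using assms by (simp add: powr_mult)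
  also have "\<dots> \<le> 2 powr p * (a powr p + b powr p)" by (intro mult_left_mono) (auto simp: max_def)
  finally show ?thesis .
qed

lemma Lq_add:
  assumes f: "Lq p f" and g: "Lq p g" and p: "p > 0"
  shows "Lq p (\<lambda>x. f x + g x)" "Iq p (\<lambda>x. f x + g x) \<le> 2 powr p * (Iq p f + Iq p g)"
proof -
  have [measurable]: "f \<in> borel_measurable borel" "g \<in> borel_measurable borel"
    using assms by (auto simp: Lq_def)
  have i: "integrable lborel (\<lambda>x. 2 powr p * (norm (f x) powr p + norm (g x) powr p))"
    using Lq_integrable[OF f] Lq_integrable[OF g] by simp
  have le: "norm (f x + g x) powr p \<le> 2 powr p * (norm (f x) powr p + norm (g x) powr p)" for x
  proof -
    have "norm (f x + g x) powr p \<le> (norm (f x) + norm (g x)) powr p"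
      using p by (intro powr_mono2 norm_triangle_ineq) auto
    also have "\<dots> \<le> 2 powr p * (norm (f x) powr p + norm (g x) powr p)" using p by (intro powr_add_le) auto
    finally show ?thesis .
  qed
  have ig: "integrable lborel (\<lambda>x. norm (f x + g x) powr p)"
    by (rule Bochner_Integration.integrable_bound[OF i]) (use le in auto)
  then show "Lq p (\<lambda>x. f x + g x)" by (simp add: Lq_def)
  have "Iq p (\<lambda>x. f x + g x) \<le> (LBINT x. 2 powr p * (norm (f x) powr p + norm (g x) powr p))"
    by (rule integral_mono[OF ig i le])
  then show "Iq p (\<lambda>x. f x + g x) \<le> 2 powr p * (Iq p f + Iq p g)"
    using Lq_integrable[OF f] Lq_integrable[OF g] by simp
qed

lemma Lq_diff:
  assumes f: "Lq p f" and g: "Lq p g" and p: "p > 0"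
  shows "Lq p (\<lambda>x. f x - g x)" "Iq p (\<lambda>x. f x - g x) \<le> 2 powr p * (Iq p f + Iq p g)"
proof -
  have "Lq p (\<lambda>x. - g x)" using g by (simp add: Lq_def)
  from Lq_add[OF f this p] show "Lq p (\<lambda>x. f x - g x)" "Iq p (\<lambda>x. f x - g x) \<le> 2 powr p * (Iq p f + Iq p g)" by simp_all
qed

lemma Lq_translate:
  assumes "Lq p f"
  shows "Lq p (\<lambda>x. f (x + c))" "Iq p (\<lambda>x. f (x + c)) = Iq p f"
proof -
  have [measurable]: "f \<in> borel_measurable borel" using assms by (simp add: Lq_def)
  show "Lq p (\<lambda>x. f (x + c))"
    using integrable_translate[of "\<lambda>x. norm (f x) powr p" c] assms by (simp add: Lq_def)
  show "Iq p (\<lambda>x. f (x + c)) = Iq p f"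
    using integral_translate[of "\<lambda>x. norm (f x) powr p" c] by simp
qed

lemma le_1_plus_powr: "(a::real) \<ge> 0 \<Longrightarrow> p \<ge> 1 \<Longrightarrow> a \<le> 1 + a powr p"
proof (cases "a \<le> 1")
  case False
  assume "p \<ge> 1"
  then have "a powr 1 \<le> a powr p" using False by (intro powr_mono) auto
  then show ?thesis using False by simp
qed (simp add: add_increasing2)

lemma bounded_finite_measure:
  fixes S :: "'a::euclidean_space set"
  assumes "bounded S" "S \<in> sets borel" shows "emeasure lborel S < \<infinity>"
  using emeasure_bounded_finite[OF assms(1)] by simp

text \<open>From t^r \<le> 1 + t^p, where the constant is integrable over a ball containing the
  support.\<close>

lemma Lq_lower_exponent:
  assumes f: "Lq p f" and S: "bounded S" "\<And>x. x \<notin> S \<Longrightarrow> f x = 0" and r: "0 < r" "r \<le> p"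
  shows "Lq r f"
proof -
  have [measurable]: "f \<in> borel_measurable borel" using f by (simp add: Lq_def)
  obtain R where R: "S \<subseteq> cball 0 R" using S(1) by (auto simp: bounded_iff subset_iff)
  have i: "integrable lborel (\<lambda>x. indicator (cball 0 R) x + norm (f x) powr p)"
    using Lq_integrable[OF f] bounded_finite_measure[OF bounded_cball[of "0::'a" R]]
    by (intro Bochner_Integration.integrable_add integrable_real_indicator) auto
  have "norm (f x) powr r \<le> indicator (cball 0 R) x + norm (f x) powr p" for x
  proof (cases "x \<in> S")
    case True
    have "norm (f x) powr r \<le> 1 + (norm (f x) powr r) powr (p / r)"
      using r by (intro le_1_plus_powr) auto
    then show ?thesis using True R r by (auto simp: powr_powr indicator_def)
  qed (use S(2) r in auto)
  then have "integrable lborel (\<lambda>x. norm (f x) powr r)"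
    by (intro Bochner_Integration.integrable_bound[OF i]) auto
  then show ?thesis by (simp add: Lq_def)
qed

lemma Lq_1: "Lq 1 f \<longleftrightarrow> integrable lborel f"
proof
  assume "Lq 1 f"
  then have "f \<in> borel_measurable borel" "integrable lborel (\<lambda>x. norm (f x))"
    by (simp_all add: Lq_def powr_one_gt_zero_iff[THEN iffD2])
  then show "integrable lborel f" using integrable_norm_iff[of f lborel] by simp
next
  assume f: "integrable lborel f"
  then show "Lq 1 f" using borel_measurable_integrable[OF f] by (simp add: Lq_def)
qed

lemma Lq_imp_integrable:
  assumes f: "Lq p f" and S: "bounded S" "\<And>x. x \<notin> S \<Longrightarrow> f x = 0" and p: "p \<ge> 1"
  shows "integrable lborel f"
  using Lq_lower_exponent[OF f S, of 1] p by (simp add: Lq_1)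

section \<open>Limits of bounded sequences and their pairings\<close>

lemma Lq_Fatou:
  assumes f: "\<And>n::nat. Lq p (f n)" "\<And>n. Iq p (f n) \<le> B" and g: "g \<in> borel_measurable borel"
    and lim: "AE x in lborel. (\<lambda>n. f n x) \<longlonglongrightarrow> g x" and p: "p > 0"
  shows "Lq p g" "Iq p g \<le> B"
proof -
  have B: "B \<ge> 0" using f(2)[of 0] Iq_nonneg[of "f 0" p] by linarith
  have [measurable]: "\<And>n. f n \<in> borel_measurable borel" "g \<in> borel_measurable borel" using f g by (auto simp: Lq_def)
  have "(\<integral>\<^sup>+x. ennreal (norm (g x) powr p) \<partial>lborel) = (\<integral>\<^sup>+x. liminf (\<lambda>n. ennreal (norm (f n x) powr p)) \<partial>lborel)"
  proof (rule nn_integral_cong_AE)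
    show "AE x in lborel. ennreal (norm (g x) powr p) = liminf (\<lambda>n. ennreal (norm (f n x) powr p))"
      using lim
    proof eventually_elim
      case (elim x)
      have "(\<lambda>n. norm (f n x) powr p) \<longlonglongrightarrow> norm (g x) powr p"
        using p by (intro tendsto_powr2 tendsto_norm elim tendsto_const) auto
      then have "(\<lambda>n. ennreal (norm (f n x) powr p)) \<longlonglongrightarrow> ennreal (norm (g x) powr p)" by (rule tendsto_ennrealI)
      then show ?case by (rule lim_imp_Liminf[OF sequentially_bot, symmetric])
    qed
  qed
  also have "\<dots> \<le> liminf (\<lambda>n. \<integral>\<^sup>+x. ennreal (norm (f n x) powr p) \<partial>lborel)"
    by (rule nn_integral_liminf) measurable
  also have "\<dots> \<le> ennreal B"
    by (rule Liminf_le) (auto simp: nn_integral_Lq[OF f(1)] f(2) ennreal_leI)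
  finally show "Lq p g" "Iq p g \<le> B" using LqI[OF g] B by auto
qed

lemma Youngs_le:
  assumes "a \<ge> 0" "b \<ge> 0" "p > 1" "q > 1" "1 / p + 1 / q = (1::real)"
  shows "a * b \<le> a powr p + b powr q"
proof -
  have "a powr p / p \<le> a powr p" "b powr q / q \<le> b powr q"
    using assms mult_left_mono[of 1 p "a powr p"] mult_left_mono[of 1 q "b powr q"] by (simp_all add: divide_le_eq)
  then show ?thesis using Youngs_inequality[OF assms(3-5) assms(1,2)] by linarith
qed

lemma Lq_prod_integrable:
  fixes prod :: "'b::euclidean_space \<Rightarrow> 'c::euclidean_space \<Rightarrow> 'd::euclidean_space"
  assumes pr: "bounded_bilinear prod" and f: "Lq p f" and g: "Lq q g"
    and pq: "p > 1" "q > 1" "1 / p + 1 / q = 1"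
  shows "integrable lborel (\<lambda>x. prod (f x) (g x))"
proof -
  interpret bounded_bilinear prod by fact
  obtain K where K: "K > 0" "\<And>a b. norm (prod a b) \<le> norm a * norm b * K" using pos_bounded by blast
  have [measurable]: "f \<in> borel_measurable borel" "g \<in> borel_measurable borel"
    using assms by (auto simp: Lq_def)
  have i: "integrable lborel (\<lambda>x. (norm (f x) powr p + norm (g x) powr q) * K)"
    using Lq_integrable[OF f] Lq_integrable[OF g] by simp
  have m: "(\<lambda>x. prod (f x) (g x)) \<in> borel_measurable borel"
    by (rule borel_measurable_continuous_Pair) (auto intro!: continuous_intros bounded_bilinear.continuous_on[OF pr])
  have "norm (prod (f x) (g x)) \<le> (norm (f x) powr p + norm (g x) powr q) * K" for x
    by (rule order_trans[OF K(2) mult_right_mono[OF Youngs_le[OF norm_ge_zero norm_ge_zero pq]]]) (use K(1) in simp)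
  then show ?thesis using m
    by (intro Bochner_Integration.integrable_bound[OF i]) (auto intro: order_trans[OF _ abs_ge_self])
qed

text \<open>Truncating \<open>f\<close> at height \<open>R w powr (q - 1)\<close> leaves a dominated sequence, and the
  remainder is at most \<open>f powr p / R powr (p - 1)\<close> by the choice of the conjugate exponent.\<close>
lemma pairing_tendsto_0:
  fixes f :: "nat \<Rightarrow> 'a::euclidean_space \<Rightarrow> real" and w :: "'a \<Rightarrow> real"
  assumes f: "\<And>n. Lq p (f n)" "\<And>n. Iq p (f n) \<le> B" "\<And>n x. f n x \<ge> 0"
    and w: "Lq q w" "\<And>x. w x \<ge> 0" and lim: "AE x in lborel. (\<lambda>n. f n x) \<longlonglongrightarrow> 0"
    and pq: "p > 1" "q > 1" "1 / p + 1 / q = 1"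
  shows "(\<lambda>n. LBINT x. w x * f n x) \<longlonglongrightarrow> 0"
proof (rule LIMSEQ_I)
  fix e :: real assume e: "e > 0"
  have B: "B \<ge> 0" using f(2)[of 0] Iq_nonneg[of "f 0" p] by linarith
  have [measurable]: "\<And>n. f n \<in> borel_measurable borel" "w \<in> borel_measurable borel" using f w by (auto simp: Lq_def)
  have q: "q = p / (p - 1)" using pq by (simp add: field_simps)
  have qp: "(q - 1) * (p - 1) = 1" unfolding q using pq by (simp add: field_simps)
  \<comment> \<open>Chosen so that B / R^(p-1) \<le> e/2; the summand 1 keeps R positive when B =
    0.\<close>
  define R where "R = (2 * B / e + 1) powr (1 / (p - 1))"
  have "2 * B / e \<ge> 0" using B e by simp
  then have R: "R > 0" "R powr (p - 1) = 2 * B / e + 1"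
    using pq by (auto simp: R_def powr_powr)
  have "(\<lambda>n. LBINT x. w x * min (f n x) (R * w x powr (q - 1))) \<longlonglongrightarrow> (\<integral>x. 0 \<partial>(lborel::'a measure))"
  proof (rule integral_dominated_convergence[where w="\<lambda>x. R * norm (w x) powr q"])
    show "integrable lborel (\<lambda>x. R * norm (w x) powr q)" using Lq_integrable[OF w(1)] by simp
    show "AE x in lborel. (\<lambda>n. w x * min (f n x) (R * w x powr (q - 1))) \<longlonglongrightarrow> 0"
      using lim
    proof eventually_elim
      case (elim x)
      have "(\<lambda>n. w x * min (f n x) (R * w x powr (q - 1))) \<longlonglongrightarrow> w x * min 0 (R * w x powr (q - 1))"
        by (intro tendsto_intros elim tendsto_min)
      then show ?case using R(1) by (simp add: min_absorb1)
    qed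
    show "AE x in lborel. norm (w x * min (f n x) (R * w x powr (q - 1))) \<le> R * norm (w x) powr q" for n
    proof (rule AE_I2)
      fix x
      have "norm (w x * min (f n x) (R * w x powr (q - 1))) \<le> w x * (R * w x powr (q - 1))"
        using w(2)[of x] f(3)[of n x] R(1) by (simp add: abs_mult mult_left_mono)
      also have "\<dots> = R * norm (w x) powr q"
        using w(2)[of x] pq by (cases "w x = 0") (auto simp: powr_diff)
      finally show "norm (w x * min (f n x) (R * w x powr (q - 1))) \<le> R * norm (w x) powr q" .
    qed
  qed auto
  then obtain N where N: "\<And>n. n \<ge> N \<Longrightarrow> (LBINT x. w x * min (f n x) (R * w x powr (q - 1))) < e / 2"
    using order_tendstoD(2)[of _ 0 sequentially "e/2"] e by (auto simp: eventually_sequentially)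
  have "norm ((LBINT x. w x * f n x) - 0) < e" if n: "n \<ge> N" for n
  proof -
    have i1: "integrable lborel (\<lambda>x. w x * min (f n x) (R * w x powr (q - 1)))"
      by (rule Bochner_Integration.integrable_bound[OF integrable_mult_right[OF Lq_prod_integrable[OF bounded_bilinear_mult w(1) f(1)[of n]], of 1]])
         (use pq w(2) f(3) R(1) in \<open>auto simp: abs_mult add.commute intro!: mult_left_mono\<close>)
    have i2: "integrable lborel (\<lambda>x. norm (f n x) powr p / R powr (p - 1))" using Lq_integrable[OF f(1)[of n]] by simp
    have i3: "integrable lborel (\<lambda>x. w x * f n x)"
      by (rule Lq_prod_integrable[OF bounded_bilinear_mult w(1) f(1)]) (use pq in auto)
    have le: "w x * f n x \<le> w x * min (f n x) (R * w x powr (q - 1)) + norm (f n x) powr p / R powr (p - 1)" for x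
    proof (cases "f n x \<le> R * w x powr (q - 1)")
      case False
      then have lt: "w x powr (q - 1) < f n x / R" using R(1) by (simp add: field_simps)
      have fp: "f n x > 0" using False R(1) by (smt (verit) mult_nonneg_nonneg powr_ge_zero)
      have "w x = (w x powr (q - 1)) powr (p - 1)"
        using w(2)[of x] qp by (simp add: powr_powr)
      also have "\<dots> \<le> (f n x / R) powr (p - 1)" using lt pq by (intro powr_mono2) auto
      finally have "w x * f n x \<le> (f n x / R) powr (p - 1) * f n x" using fp by (simp add: mult_right_mono)
      also have "\<dots> = norm (f n x) powr p / R powr (p - 1)"
        using fp R(1) by (simp add: powr_divide powr_diff)
      also have "\<dots> \<le> w x * min (f n x) (R * w x powr (q - 1)) + norm (f n x) powr p / R powr (p - 1)"
        using w(2)[of x] fp R(1) by simp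
      finally show ?thesis .
    qed (simp add: min_absorb1)
    have "(LBINT x. w x * f n x) \<le> (LBINT x. w x * min (f n x) (R * w x powr (q - 1)) + norm (f n x) powr p / R powr (p - 1))"
      by (rule integral_mono[OF i3 Bochner_Integration.integrable_add[OF i1 i2] le])
    also have "\<dots> = (LBINT x. w x * min (f n x) (R * w x powr (q - 1))) + Iq p (f n) / R powr (p - 1)"
      using i1 i2 by simp
    also have "\<dots> < e / 2 + B / R powr (p - 1)"
      using N[OF n] f(2)[of n] by (intro add_less_le_mono divide_right_mono) auto
    also have "B / R powr (p - 1) \<le> e / 2"
    proof -
      have "B * 2 \<le> e * (2 * B / e + 1)" using e by (simp add: field_simps)
      moreover have "2 * B / e + 1 > 0" using B e by (simp add: add_nonneg_pos)
      ultimately show ?thesis unfolding R(2) by (simp add: divide_le_eq)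
    qed
    finally have "(LBINT x. w x * f n x) < e" by simp
    moreover have "(LBINT x. w x * f n x) \<ge> 0" using w(2) f(3) by (intro Bochner_Integration.integral_nonneg) simp
    ultimately show ?thesis by simp
  qed
  then show "\<exists>N. \<forall>n\<ge>N. norm ((LBINT x. w x * f n x) - 0) < e" by blast
qed

text \<open>By Fatou the limit obeys the same bound, so \<open>pairing_tendsto_0\<close> applies to
  |f n - g|. Bounded norms and almost everywhere convergence thus give weak convergence, which is
  how the tested equations are carried to the limit.\<close>

lemma pairing_tendsto:
  fixes prod :: "'b::euclidean_space \<Rightarrow> 'c::euclidean_space \<Rightarrow> 'd::euclidean_space"
  assumes pr: "bounded_bilinear prod" and f: "\<And>n. Lq p (f n)" "\<And>n. Iq p (f n) \<le> B"
    and w: "Lq q w" and g: "g \<in> borel_measurable borel"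
    and lim: "AE x in lborel. (\<lambda>n. f n x) \<longlonglongrightarrow> g x"
    and pq: "p > 1" "q > 1" "1 / p + 1 / q = 1"
  shows "(\<lambda>n. LBINT x. prod (w x) (f n x)) \<longlonglongrightarrow> (LBINT x. prod (w x) (g x))"
proof -
  interpret bounded_bilinear prod by fact
  obtain K where K: "K > 0" "\<And>a b. norm (prod a b) \<le> norm a * norm b * K" using pos_bounded by blast
  have [measurable]: "\<And>n. f n \<in> borel_measurable borel" "g \<in> borel_measurable borel" "w \<in> borel_measurable borel"
    using f w g by (auto simp: Lq_def)
  have G: "Lq p g" "Iq p g \<le> B" using Lq_Fatou[OF f g lim] pq by auto
  define h where "h n x = norm (f n x - g x)" for n x
  have D: "Lq p (\<lambda>x. f n x - g x)" "Iq p (\<lambda>x. f n x - g x) \<le> 2 powr p * (B + B)" for n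
  proof -
    show "Lq p (\<lambda>x. f n x - g x)" using Lq_diff(1)[OF f(1) G(1)] pq by simp
    have "Iq p (\<lambda>x. f n x - g x) \<le> 2 powr p * (Iq p (f n) + Iq p g)" using Lq_diff(2)[OF f(1) G(1)] pq by simp
    also have "\<dots> \<le> 2 powr p * (B + B)" using f(2) G(2) by (intro mult_left_mono add_mono) auto
    finally show "Iq p (\<lambda>x. f n x - g x) \<le> 2 powr p * (B + B)" .
  qed
  have h: "Lq p (h n)" "Iq p (h n) \<le> 2 powr p * (B + B)" for n
    using D[of n] by (auto simp: Lq_def h_def[abs_def])
  have hl: "AE x in lborel. (\<lambda>n. h n x) \<longlonglongrightarrow> 0"
    using lim by eventually_elim (auto simp: h_def LIM_zero intro!: tendsto_norm_zero)
  have wn: "Lq q (\<lambda>x. norm (w x))" using w by (auto simp: Lq_def)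
  have P: "(\<lambda>n. K * (LBINT x. norm (w x) * h n x)) \<longlonglongrightarrow> K * 0"
    by (intro tendsto_intros pairing_tendsto_0[OF h _ wn _ hl]) (use pq in \<open>auto simp: h_def\<close>)
  have qp: "1 / q + 1 / p = 1" using pq by simp
  have ii: "integrable lborel (\<lambda>x. prod (w x) (f n x))" "integrable lborel (\<lambda>x. prod (w x) (g x))" for n
    using Lq_prod_integrable[OF pr w f(1) pq(2,1) qp] Lq_prod_integrable[OF pr w G(1) pq(2,1) qp] by auto
  have "(\<lambda>n. (LBINT x. prod (w x) (f n x)) - (LBINT x. prod (w x) (g x))) \<longlonglongrightarrow> 0"
  proof (rule Lim_null_comparison[OF always_eventually])
    show "\<forall>n. norm ((LBINT x. prod (w x) (f n x)) - (LBINT x. prod (w x) (g x))) \<le> K * (LBINT x. norm (w x) * h n x)"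
    proof
      fix n
      have "(LBINT x. prod (w x) (f n x)) - (LBINT x. prod (w x) (g x)) = (LBINT x. prod (w x) (f n x - g x))"
        using ii by (simp add: diff_right)
      moreover have e2: "norm (LBINT x. prod (w x) (f n x - g x)) \<le> (LBINT x. norm (prod (w x) (f n x - g x)))"
        by (rule integral_norm_bound)
      moreover have e3: "(LBINT x. norm (prod (w x) (f n x - g x))) \<le> (LBINT x. K * (norm (w x) * h n x))"
      proof (rule integral_mono)
        show "integrable lborel (\<lambda>x. norm (prod (w x) (f n x - g x)))"
          using ii(1)[of n] ii(2) by (simp add: diff_right)
        show "integrable lborel (\<lambda>x. K * (norm (w x) * h n x))"
          using Lq_prod_integrable[OF bounded_bilinear_mult wn h(1) pq(2,1) qp] by simp
      qed (use K(2) in \<open>simp add: h_def mult_ac\<close>)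
      ultimately show "norm ((LBINT x. prod (w x) (f n x)) - (LBINT x. prod (w x) (g x))) \<le> K * (LBINT x. norm (w x) * h n x)"
        using order_trans[OF e2 e3] by (simp only: integral_mult_right_zero)
    qed
  qed (use P in simp)
  then show ?thesis by (simp add: LIM_zero_iff)
qed

subsection \<open>Weak derivatives and difference quotients\<close>

text \<open>For a mollification the increment is the integral of the derivative along the segment
  from x to x + h. Jensen in the segment parameter and translation invariance give the bound, and
  Fatou removes the mollification. Since Y is the derivative along the vector h itself, no factor
  |h| appears. The tube condition \<open>sub\<close> keeps the kernel inside U, where the weak
  derivative is known.\<close>

lemma diff_bound_weak_dderiv:
  fixes w Y :: "'a::euclidean_space \<Rightarrow> 'b::euclidean_space"
  assumes w: "integrable lborel w" and Y: "integrable lborel Y" and U: "open U"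
    and wd: "weak_dderiv U h w Y" and S: "S \<in> sets borel" and r: "r > 0"
    and sub: "\<And>x s. x \<in> S \<Longrightarrow> 0 \<le> s \<Longrightarrow> s \<le> 1 \<Longrightarrow> cball (x + s *\<^sub>R h) r \<subseteq> U" and q: "q > 1"
  shows "(\<integral>\<^sup>+x. indicator S x * ennreal (norm (w (x + h) - w x) powr q) \<partial>lborel)
    \<le> (\<integral>\<^sup>+x. indicator U x * ennreal (norm (Y x) powr q) \<partial>lborel)"
proof -
  have [measurable]: "w \<in> borel_measurable borel" "Y \<in> borel_measurable borel" "S \<in> sets borel" "U \<in> sets borel"
    using borel_measurable_integrable[OF w] borel_measurable_integrable[OF Y] S U by simp_all
  \<comment> \<open>Cutting Y off outside U makes the final integral run over U only; kernels
    centred on the segments never reach the discarded values.\<close>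
  define Y' where "Y' x = indicator U x *\<^sub>R Y x" for x
  have [measurable]: "Y' \<in> borel_measurable borel" unfolding Y'_def by measurable
  have Y': "integrable lborel Y'"
    unfolding Y'_def using integrable_mult_indicator[OF _ Y, of U] by simp
  have Y'q: "(\<integral>\<^sup>+x. ennreal (norm (Y' x) powr q) \<partial>lborel) = (\<integral>\<^sup>+x. indicator U x * ennreal (norm (Y x) powr q) \<partial>lborel)"
    using q by (intro nn_integral_cong) (simp add: Y'_def indicator_def)
  have main: "(\<integral>\<^sup>+x. indicator S x * ennreal (norm (conv w (moll t) (x + h) - conv w (moll t) x) powr q) \<partial>lborel)
      \<le> (\<integral>\<^sup>+x. ennreal (norm (Y' x) powr q) \<partial>lborel)" if t: "0 < t" "t \<le> r" for t
  proof -
    have mz: "norm y \<le> r" if "moll t y \<noteq> 0" for y :: 'a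
      using that moll_eq_0[OF t(1), of y] t(2) by force
    let ?c = "conv Y' (moll t)"
    have smc: "smooth ?c" by (rule smooth_conv[OF test_function_moll[OF t(1)] Y'])
    have [measurable]: "?c \<in> borel_measurable borel" by measurable
    have pt: "indicator S x * ennreal (norm (conv w (moll t) (x + h) - conv w (moll t) x) powr q)
        \<le> (\<integral>\<^sup>+s. ennreal (indicator {0..1} s * norm (?c (x + s *\<^sub>R h)) powr q) \<partial>lborel)" for x
    proof (cases "x \<in> S")
      case True
      have c: "dderiv h (conv w (moll t)) (x + s *\<^sub>R h) = ?c (x + s *\<^sub>R h)" if s: "0 \<le> s" "s \<le> 1" for s
      proof -
        have "dderiv h (conv w (moll t)) (x + s *\<^sub>R h) = conv Y (moll t) (x + s *\<^sub>R h)"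
          unfolding dderiv_conv[OF test_function_moll[OF t(1)] w]
          by (rule conv_weak_dderiv[OF wd test_function_moll[OF t(1)] mz sub[OF True s]])
        also have "\<dots> = ?c (x + s *\<^sub>R h)"
        proof -
          have z: "moll t (x + s *\<^sub>R h - y) *\<^sub>R Y y = moll t (x + s *\<^sub>R h - y) *\<^sub>R Y' y" for y
          proof (cases "y \<in> U")
            case False
            then have "y \<notin> cball (x + s *\<^sub>R h) r" using sub[OF True s] by blast
            then have "moll t (x + s *\<^sub>R h - y) = 0"
              using mz[of "x + s *\<^sub>R h - y"] by (auto simp: dist_norm)
            then show ?thesis by simp
          qed (simp add: Y'_def)
          show ?thesis unfolding conv_def z ..
        qed
        finally show ?thesis .
      qed
      have cont: "continuous_on {0..1} (\<lambda>s. ?c (x + s *\<^sub>R h))"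
        by (intro continuous_on_compose2[OF smooth_continuous_on[OF smc, of UNIV]] continuous_intros) auto
      have "(LBINT s. indicator {0..1} s *\<^sub>R ?c (x + s *\<^sub>R h))
          = conv w (moll t) (x + 1 *\<^sub>R h) - conv w (moll t) (x + 0 *\<^sub>R h)"
      proof (rule integral_FTC_Icc[of 0 1 "\<lambda>s. conv w (moll t) (x + s *\<^sub>R h)"])
        fix s :: real assume s: "0 \<le> s" "s \<le> 1"
        have sm: "smooth (conv w (moll t))" by (rule smooth_conv[OF test_function_moll[OF t(1)] w])
        have "((\<lambda>s. conv w (moll t) (x + s *\<^sub>R h)) has_derivative (\<lambda>k. dderiv (k *\<^sub>R h) (conv w (moll t)) (x + s *\<^sub>R h))) (at s within {0..1})"
          by (rule has_derivative_compose[of "\<lambda>s. x + s *\<^sub>R h" "\<lambda>k. k *\<^sub>R h", OF _ smoothD_has_derivative[OF sm]])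
             (auto intro!: derivative_eq_intros)
        then show "((\<lambda>s. conv w (moll t) (x + s *\<^sub>R h)) has_vector_derivative ?c (x + s *\<^sub>R h)) (at s within {0..1})"
          unfolding has_vector_derivative_def by (simp add: dderiv_linear[OF sm] c[OF s])
      qed (use cont in auto)
      then have d: "norm (conv w (moll t) (x + h) - conv w (moll t) x) = norm (LBINT s. indicator {0..1} s *\<^sub>R ?c (x + s *\<^sub>R h))"
        by simp
      have i: "integrable lborel (\<lambda>s. indicator {0..1} s *\<^sub>R ?c (x + s *\<^sub>R h))"
        by (rule borel_integrable_compact[OF compact_Icc cont])
      have i': "integrable lborel (\<lambda>s. indicator {0..1} s * norm (?c (x + s *\<^sub>R h)))"
        using integrable_norm[OF i] by simp
      have "norm (conv w (moll t) (x + h) - conv w (moll t) x) \<le> (LBINT s. indicator {0..1} s * norm (?c (x + s *\<^sub>R h)))"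
        unfolding d using integral_norm_bound[of lborel "\<lambda>s. indicator {0..1} s *\<^sub>R ?c (x + s *\<^sub>R h)"] by simp
      then have "norm (conv w (moll t) (x + h) - conv w (moll t) x) powr q \<le> (LBINT s. indicator {0..1} s * norm (?c (x + s *\<^sub>R h))) powr q"
        using q by (intro powr_mono2) auto
      then have "ennreal (norm (conv w (moll t) (x + h) - conv w (moll t) x) powr q) \<le> ennreal ((LBINT s. indicator {0..1} s * norm (?c (x + s *\<^sub>R h))) powr q)"
        by (rule ennreal_leI)
      also have "\<dots> \<le> (\<integral>\<^sup>+s. ennreal (indicator {0..1} s * norm (?c (x + s *\<^sub>R h)) powr q) \<partial>lborel)"
        by (rule powr_jensen[OF _ _ _ _ i' _ q]) auto
      finally show ?thesis using True by simp
    qed simp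
    have "(\<integral>\<^sup>+x. indicator S x * ennreal (norm (conv w (moll t) (x + h) - conv w (moll t) x) powr q) \<partial>lborel)
      \<le> (\<integral>\<^sup>+x. (\<integral>\<^sup>+s. ennreal (indicator {0..1} s * norm (?c (x + s *\<^sub>R h)) powr q) \<partial>lborel) \<partial>lborel)"
      by (rule nn_integral_mono[OF pt])
    also have "\<dots> = (\<integral>\<^sup>+s. (\<integral>\<^sup>+x. ennreal (indicator {0..1} s * norm (?c (x + s *\<^sub>R h)) powr q) \<partial>lborel) \<partial>lborel)"
      by (rule lborel_pair.Fubini') measurable
    also have "\<dots> = (\<integral>\<^sup>+s. indicator {0..1} s * (\<integral>\<^sup>+x. ennreal (norm (?c x) powr q) \<partial>lborel) \<partial>(lborel::real measure))"
    proof (rule nn_integral_cong)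
      fix s :: real
      show "(\<integral>\<^sup>+x. ennreal (indicator {0..1} s * norm (?c (x + s *\<^sub>R h)) powr q) \<partial>lborel) = indicator {0..1} s * (\<integral>\<^sup>+x. ennreal (norm (?c x) powr q) \<partial>lborel)"
        using nn_integral_translate[of "\<lambda>x. ennreal (norm (?c x) powr q)" "s *\<^sub>R h"]
        by (cases "s \<in> {0..1}") simp_all
    qed
    also have "\<dots> = (\<integral>\<^sup>+x. ennreal (norm (?c x) powr q) \<partial>lborel)"
      by (simp add: nn_integral_multc)
    also have "\<dots> \<le> (\<integral>\<^sup>+x. ennreal (norm (Y' x) powr q) \<partial>lborel)"
      by (rule conv_Lq_bound[OF Y' t(1) q])
    finally show ?thesis .
  qed
  define t where "t n = r / real (Suc n)" for n
  have tp: "t n > 0" "t n \<le> r" for n using r by (auto simp: t_def divide_le_eq)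
  have t0: "t \<longlonglongrightarrow> 0"
    using tendsto_mult[OF tendsto_const[of r] LIMSEQ_inverse_real_of_nat] by (simp add: t_def[abs_def] divide_inverse)
  obtain k :: "nat \<Rightarrow> nat" where k: "strict_mono k" "AE x in lborel. (\<lambda>n. conv w (moll (t (k n))) x) \<longlonglongrightarrow> w x"
    using conv_AE_subseq[OF w tp(1) t0] by blast
  have kh: "AE x in lborel. (\<lambda>n. conv w (moll (t (k n))) (x + h)) \<longlonglongrightarrow> w (x + h)"
    by (rule AE_translate[OF k(2)])
  have "(\<integral>\<^sup>+x. indicator S x * ennreal (norm (w (x + h) - w x) powr q) \<partial>lborel)
      = (\<integral>\<^sup>+x. liminf (\<lambda>n. indicator S x * ennreal (norm (conv w (moll (t (k n))) (x + h) - conv w (moll (t (k n))) x) powr q)) \<partial>lborel)"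
  proof (rule nn_integral_cong_AE)
    show "AE x in lborel. indicator S x * ennreal (norm (w (x + h) - w x) powr q)
      = liminf (\<lambda>n. indicator S x * ennreal (norm (conv w (moll (t (k n))) (x + h) - conv w (moll (t (k n))) x) powr q))"
      using k(2) kh
    proof eventually_elim
      case (elim x)
      have "(\<lambda>n. norm (conv w (moll (t (k n))) (x + h) - conv w (moll (t (k n))) x) powr q) \<longlonglongrightarrow> norm (w (x + h) - w x) powr q"
        using q by (intro tendsto_powr2 tendsto_norm tendsto_diff elim tendsto_const) auto
      then have *: "(\<lambda>n. ennreal (norm (conv w (moll (t (k n))) (x + h) - conv w (moll (t (k n))) x) powr q)) \<longlonglongrightarrow> ennreal (norm (w (x + h) - w x) powr q)"
        by (rule tendsto_ennrealI)
      show ?case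
      proof (cases "x \<in> S")
        case True
        then show ?thesis using lim_imp_Liminf[OF sequentially_bot *] by simp
      qed (simp add: Liminf_const)
    qed
  qed
  also have "\<dots> \<le> liminf (\<lambda>n. \<integral>\<^sup>+x. indicator S x * ennreal (norm (conv w (moll (t (k n))) (x + h) - conv w (moll (t (k n))) x) powr q) \<partial>lborel)"
    by (rule nn_integral_liminf) measurable
  also have "\<dots> \<le> (\<integral>\<^sup>+x. ennreal (norm (Y' x) powr q) \<partial>lborel)"
    by (intro Liminf_le always_eventually allI main tp) simp
  finally show ?thesis unfolding Y'q .
qed

lemma test_function_Lq:
  assumes "test_function U \<phi>" "p > 0" shows "Lq p \<phi>"
proof -
  obtain K where K: "compact K" "K \<subseteq> U" "\<And>x. x \<notin> K \<Longrightarrow> \<phi> x = 0" using test_functionE[OF assms(1)] by metis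
  obtain B where B: "B > 0" "\<And>x. \<bar>\<phi> x\<bar> \<le> B" using test_function_bounded[OF assms(1)] by blast
  have [measurable]: "\<phi> \<in> borel_measurable borel" by (rule smooth_measurable[OF test_function_smooth[OF assms(1)]])
  have i: "integrable lborel (\<lambda>x. B powr p * indicator K x)"
    using K(1) emeasure_bounded_finite[OF compact_imp_bounded[OF K(1)]]
    by (intro integrable_mult_right integrable_real_indicator) (auto simp: compact_imp_closed)
  have "norm (\<phi> x) powr p \<le> B powr p * indicator K x" for x
    using K(3)[of x] B(2)[of x] assms(2) by (cases "x \<in> K") (auto intro!: powr_mono2)
  then have "integrable lborel (\<lambda>x. norm (\<phi> x) powr p)"
    by (intro Bochner_Integration.integrable_bound[OF i]) auto
  then show ?thesis by (simp add: Lq_def)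
qed

text \<open>Discrete integration by parts moves the difference quotient onto the test function,
  where dominated convergence applies. On the other side boundedness in Lp and almost everywhere
  convergence suffice, by \<open>pairing_tendsto\<close>.\<close>

lemma weak_dderivI_difference_quotient:
  fixes w Y :: "'a::euclidean_space \<Rightarrow> 'b::euclidean_space"
  assumes w: "integrable lborel w" and t: "\<And>n. t n \<noteq> 0" "t \<longlonglongrightarrow> 0" and Y: "Y \<in> borel_measurable borel"
    and lim: "AE x in lborel. (\<lambda>n. (1 / t n) *\<^sub>R (w (x + t n *\<^sub>R e) - w x)) \<longlonglongrightarrow> Y x"
    and L: "\<And>n. Lq p (\<lambda>x. (1 / t n) *\<^sub>R (w (x + t n *\<^sub>R e) - w x))"
      "\<And>n. Iq p (\<lambda>x. (1 / t n) *\<^sub>R (w (x + t n *\<^sub>R e) - w x)) \<le> B" and p: "p > 1"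
  shows "weak_dderiv U e w Y"
  unfolding weak_dderiv_def
proof (intro allI impI)
  fix \<phi> :: "'a \<Rightarrow> real" assume \<phi>: "test_function U \<phi>"
  have sm: "smooth \<phi>" by (rule test_function_smooth[OF \<phi>])
  have [measurable]: "w \<in> borel_measurable borel" "\<phi> \<in> borel_measurable borel" "dderiv e \<phi> \<in> borel_measurable borel"
    using borel_measurable_integrable[OF w] smooth_measurable[OF sm] smooth_measurable[OF smooth_dderiv[OF sm]] by simp_all
  obtain K where K: "K > 0" "\<And>x h. \<bar>\<phi> (x + h) - \<phi> x\<bar> \<le> K * norm h" using test_function_lipschitz[OF \<phi>] by blast
  have q: "p / (p - 1) > 1" "1 / p + 1 / (p / (p - 1)) = 1" using p by (auto simp: field_simps)
  have 1: "(\<lambda>n. LBINT x. \<phi> x *\<^sub>R ((1 / t n) *\<^sub>R (w (x + t n *\<^sub>R e) - w x))) \<longlonglongrightarrow> (LBINT x. \<phi> x *\<^sub>R Y x)"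
    by (rule pairing_tendsto[OF bounded_bilinear_scaleR L test_function_Lq[OF \<phi>] Y lim p q]) (use q in auto)
  have 2: "(LBINT x. \<phi> x *\<^sub>R ((1 / t n) *\<^sub>R (w (x + t n *\<^sub>R e) - w x)))
      = (LBINT x. ((1 / t n) * (\<phi> (x - t n *\<^sub>R e) - \<phi> x)) *\<^sub>R w x)" for n
  proof -
    have i1: "integrable lborel (\<lambda>x. \<phi> x *\<^sub>R w x)" by (rule integrable_test_function_scaleR[OF \<phi> w])
    have i2: "integrable lborel (\<lambda>x. \<phi> x *\<^sub>R w (x + t n *\<^sub>R e))"
      by (rule integrable_test_function_scaleR[OF \<phi> integrable_translate[OF w]])
    have tr: "(LBINT x. \<phi> x *\<^sub>R w (x + t n *\<^sub>R e)) = (LBINT x. \<phi> (x - t n *\<^sub>R e) *\<^sub>R w x)"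
      using integral_translate[of "\<lambda>x. \<phi> (x - t n *\<^sub>R e) *\<^sub>R w x" "t n *\<^sub>R e"] by simp
    have i3: "integrable lborel (\<lambda>x. \<phi> (x - t n *\<^sub>R e) *\<^sub>R w x)"
      using integrable_translate[OF i2, of "- (t n *\<^sub>R e)"] by simp
    have "(LBINT x. \<phi> x *\<^sub>R ((1 / t n) *\<^sub>R (w (x + t n *\<^sub>R e) - w x)))
       = (LBINT x. (1 / t n) *\<^sub>R (\<phi> x *\<^sub>R w (x + t n *\<^sub>R e) - \<phi> x *\<^sub>R w x))"
      by (simp add: algebra_simps)
    also have "\<dots> = (1 / t n) *\<^sub>R ((LBINT x. \<phi> (x - t n *\<^sub>R e) *\<^sub>R w x) - (LBINT x. \<phi> x *\<^sub>R w x))"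
      using i1 i2 tr by simp
    also have "\<dots> = (LBINT x. (1 / t n) *\<^sub>R (\<phi> (x - t n *\<^sub>R e) *\<^sub>R w x - \<phi> x *\<^sub>R w x))"
      using i1 i3 by simp
    finally show ?thesis by (simp add: algebra_simps)
  qed
  have 3: "(\<lambda>n. LBINT x. ((1 / t n) * (\<phi> (x - t n *\<^sub>R e) - \<phi> x)) *\<^sub>R w x) \<longlonglongrightarrow> (LBINT x. (- dderiv e \<phi> x) *\<^sub>R w x)"
  proof (rule integral_dominated_convergence[where w="\<lambda>x. K * norm e * norm (w x)"])
    show "AE x in lborel. (\<lambda>n. ((1 / t n) * (\<phi> (x - t n *\<^sub>R e) - \<phi> x)) *\<^sub>R w x) \<longlonglongrightarrow> (- dderiv e \<phi> x) *\<^sub>R w x"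
    proof (intro AE_I2 tendsto_scaleR tendsto_const)
      fix x
      have "((\<lambda>s. \<phi> (x + s *\<^sub>R (- e))) has_derivative (\<lambda>k. dderiv (k *\<^sub>R (- e)) \<phi> (x + 0 *\<^sub>R (- e)))) (at 0)"
        by (rule has_derivative_compose[of "\<lambda>s. x + s *\<^sub>R (- e)" "\<lambda>k. k *\<^sub>R (- e)", OF _ smoothD_has_derivative[OF sm]])
           (auto intro!: derivative_eq_intros)
      moreover have "(\<lambda>k. dderiv (k *\<^sub>R (- e)) \<phi> (x + 0 *\<^sub>R (- e))) = (*) (- dderiv e \<phi> x)"
      proof (rule ext)
        fix k show "dderiv (k *\<^sub>R (- e)) \<phi> (x + 0 *\<^sub>R (- e)) = - dderiv e \<phi> x * k"
          using dderiv_linear(1)[OF sm, of "- k" e x] by simp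
      qed
      ultimately have "((\<lambda>s. \<phi> (x + s *\<^sub>R (- e))) has_real_derivative - dderiv e \<phi> x) (at 0)"
        by (simp add: has_field_derivative_def)
      then have "((\<lambda>s. (\<phi> (x - s *\<^sub>R e) - \<phi> x) / s) \<longlongrightarrow> - dderiv e \<phi> x) (at 0)"
        by (simp add: has_field_derivative_iff)
      from filterlim_compose[OF this, of t sequentially] t
      have "(\<lambda>n. (\<phi> (x - t n *\<^sub>R e) - \<phi> x) / t n) \<longlonglongrightarrow> - dderiv e \<phi> x"
        by (simp add: filterlim_at)
      then show "(\<lambda>n. (1 / t n) * (\<phi> (x - t n *\<^sub>R e) - \<phi> x)) \<longlonglongrightarrow> - dderiv e \<phi> x" by simp
    qed
    show "AE x in lborel. norm (((1 / t n) * (\<phi> (x - t n *\<^sub>R e) - \<phi> x)) *\<^sub>R w x) \<le> K * norm e * norm (w x)" for n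
    proof (rule AE_I2)
      fix x
      have "\<bar>\<phi> (x - t n *\<^sub>R e) - \<phi> x\<bar> \<le> \<bar>t n\<bar> * (K * norm e)"
        using K(2)[of x "- (t n *\<^sub>R e)"] by (simp add: mult_ac)
      then have "\<bar>(1 / t n) * (\<phi> (x - t n *\<^sub>R e) - \<phi> x)\<bar> \<le> K * norm e"
        using t(1)[of n] by (simp add: abs_mult divide_le_eq mult.commute)
      then show "norm (((1 / t n) * (\<phi> (x - t n *\<^sub>R e) - \<phi> x)) *\<^sub>R w x) \<le> K * norm e * norm (w x)"
        unfolding norm_scaleR real_norm_def by (rule mult_right_mono[OF _ norm_ge_zero])
    qed
  qed (use w in auto)
  have "(LBINT x. \<phi> x *\<^sub>R Y x) = (LBINT x. (- dderiv e \<phi> x) *\<^sub>R w x)"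
    using LIMSEQ_unique[OF 1[unfolded 2] 3] .
  then show "(LBINT x. dderiv e \<phi> x *\<^sub>R w x) = - (LBINT x. \<phi> x *\<^sub>R Y x)" by simp
qed

section \<open>Square-integrable functions with Lipschitz translates\<close>

lemma norm_powr_2: "norm x powr 2 = (norm x)\<^sup>2"
  by (cases "x = 0") (simp_all add: powr_numeral)

lemma sq_add_le: "(norm (a + b))\<^sup>2 \<le> 2 * (norm a)\<^sup>2 + 2 * (norm b)\<^sup>2"
proof -
  have "(norm (a + b))\<^sup>2 \<le> (norm a + norm b)\<^sup>2" by (intro power_mono norm_triangle_ineq) auto
  also have "\<dots> \<le> 2 * (norm a)\<^sup>2 + 2 * (norm b)\<^sup>2"
    using sum_squares_bound[of "norm a" "norm b"] by (simp add: power2_sum)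
  finally show ?thesis .
qed

lemma Iq2_add_le:
  assumes "Lq 2 f" "Lq 2 g"
  shows "Iq 2 (\<lambda>x. f x + g x) \<le> 2 * Iq 2 f + 2 * Iq 2 g"
proof -
  have "Iq 2 (\<lambda>x. f x + g x) \<le> (LBINT x. 2 * norm (f x) powr 2 + 2 * norm (g x) powr 2)"
    using Lq_integrable[OF Lq_add(1)[OF assms]] Lq_integrable[OF assms(1)] Lq_integrable[OF assms(2)]
    by (intro integral_mono) (auto simp: norm_powr_2 sq_add_le)
  then show ?thesis using Lq_integrable[OF assms(1)] Lq_integrable[OF assms(2)] by simp
qed

lemma Lq_uminus: "Lq p f \<Longrightarrow> Lq p (\<lambda>x. - f x)"
  by (simp add: Lq_def)

lemma Iq2_diff_le:
  assumes "Lq 2 f" "Lq 2 g"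
  shows "Iq 2 (\<lambda>x. f x - g x) \<le> 2 * Iq 2 f + 2 * Iq 2 g"
  using Iq2_add_le[OF assms(1) Lq_uminus[OF assms(2)]] by simp

lemma Lq_scaleR: "Lq p f \<Longrightarrow> Lq p (\<lambda>x. c *\<^sub>R f x)"
  by (auto simp: Lq_def powr_mult)

text \<open>The dyadic difference quotient \<open>D n\<close> is the mean of the translates of \<open>D m\<close> by
  \<open>j / 2 ^ m\<close>, \<open>j < 2 ^ (m - n)\<close>, so the total variance of these translates around
  \<open>D n\<close> is the increment of the norms, and the bounded increasing norms converge.
  Restricting to small \<open>j\<close> makes the shift negligible.\<close>
lemma dyadic_difference_quotients_Cauchy:
  fixes V :: "'a::euclidean_space \<Rightarrow> 'b::euclidean_space" and e :: 'a
  assumes V: "Lq 2 V" and M: "\<And>h. Iq 2 (\<lambda>x. V (x + h) - V x) \<le> M * (norm h)\<^sup>2"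
  defines "D \<equiv> \<lambda>n x. (2 ^ n :: real) *\<^sub>R (V (x + (1 / 2 ^ n) *\<^sub>R e) - V x)"
  shows "Lq 2 (D n)" "Iq 2 (D n) \<le> M * (norm e)\<^sup>2"
    "\<epsilon> > 0 \<Longrightarrow> \<exists>N. \<forall>m\<ge>N. \<forall>n\<ge>N. Iq 2 (\<lambda>x. D m x - D n x) \<le> \<epsilon>"
proof -
  have [measurable]: "V \<in> borel_measurable borel" using V by (simp add: Lq_def)
  have VD: "Lq 2 (\<lambda>x. V (x + h) - V x)" for h
    by (rule Lq_diff(1)[OF Lq_translate(1)[OF V] V]) simp
  have LD: "Lq 2 (D n)" for n unfolding D_def by (rule Lq_scaleR[OF VD])
  then show "Lq 2 (D n)" .
  define N where "N n = Iq 2 (D n)" for n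
  have sc: "Iq 2 (\<lambda>x. c *\<^sub>R f x) = c\<^sup>2 * Iq 2 f" for c and f :: "'a \<Rightarrow> 'b"
    by (simp add: norm_powr_2 power_mult_distrib)
  have NM: "N n \<le> M * (norm e)\<^sup>2" for n
  proof -
    have "N n \<le> (2^n)\<^sup>2 * (M * (norm ((1 / 2 ^ n) *\<^sub>R e))\<^sup>2)"
      unfolding N_def D_def sc by (intro mult_left_mono M) auto
    also have "\<dots> = M * (norm e)\<^sup>2" by (simp add: power_mult_distrib power_divide)
    finally show ?thesis .
  qed
  then show "Iq 2 (D n) \<le> M * (norm e)\<^sup>2" unfolding N_def .
  have M0: "M * (norm e)\<^sup>2 \<ge> 0" using NM[of 0] Iq_nonneg[of "D 0" 2] unfolding N_def by linarith
  define T where "T m j x = D m (x + (real j / 2 ^ m) *\<^sub>R e)" for m j x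
  have LT: "Lq 2 (T m j)" "Iq 2 (T m j) = N m" for m j
    unfolding T_def N_def by (rule Lq_translate(1)[OF LD], rule Lq_translate(2)[OF LD])
  have LTD: "Lq 2 (\<lambda>x. T m j x - D n x)" for m j n by (rule Lq_diff(1)[OF LT(1) LD]) simp
  have mean: "(\<Sum>j<2^k. T (n + k) j x) = (2 ^ k :: real) *\<^sub>R D n x" for n k x
  proof -
    have "(\<Sum>j<2^k. T (n + k) j x) = (2 ^ (n + k) :: real) *\<^sub>R (\<Sum>j<2^k. V (x + (real (Suc j) / 2 ^ (n + k)) *\<^sub>R e) - V (x + (real j / 2 ^ (n + k)) *\<^sub>R e))"
      unfolding scaleR_sum_right T_def D_def
      by (intro sum.cong refl arg_cong2[where f=scaleR] arg_cong2[where f="(-)"] arg_cong[where f=V])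
         (simp_all add: scaleR_add_left[symmetric] add.assoc add_divide_distrib add.commute)
    also have "(\<Sum>j<2^k. V (x + (real (Suc j) / 2 ^ (n + k)) *\<^sub>R e) - V (x + (real j / 2 ^ (n + k)) *\<^sub>R e))
        = V (x + (real (2^k) / 2 ^ (n + k)) *\<^sub>R e) - V (x + (real 0 / 2 ^ (n + k)) *\<^sub>R e)"
      by (rule sum_lessThan_telescope)
    also have "real (2^k) / 2 ^ (n + k) = 1 / 2 ^ n" by (simp add: power_add)
    finally show ?thesis by (simp add: D_def power_add mult.commute)
  qed
  have var: "(\<Sum>j<2^k. Iq 2 (\<lambda>x. T (n + k) j x - D n x)) = 2 ^ k * (N (n + k) - N n)" for n k
  proof -
    have pt: "(\<Sum>j<2^k. (norm (T (n + k) j x - D n x))\<^sup>2) = (\<Sum>j<2^k. (norm (T (n + k) j x))\<^sup>2) - 2 ^ k * (norm (D n x))\<^sup>2" for x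
    proof -
      have "(\<Sum>j<2^k. (norm (T (n + k) j x - D n x))\<^sup>2)
        = (\<Sum>j<2^k. (norm (T (n + k) j x))\<^sup>2) - 2 * ((\<Sum>j<2^k. T (n + k) j x) \<bullet> D n x) + 2 ^ k * (norm (D n x))\<^sup>2"
        by (simp add: power2_norm_eq_inner inner_diff_left inner_diff_right sum_subtractf sum.distrib inner_sum_left inner_sum_right inner_commute algebra_simps sum_distrib_left)
      then show ?thesis unfolding mean by (simp add: power2_norm_eq_inner)
    qed
    have "(\<Sum>j<2^k. Iq 2 (\<lambda>x. T (n + k) j x - D n x)) = (LBINT x. (\<Sum>j<2^k. norm (T (n + k) j x - D n x) powr 2))"
      using Lq_integrable[OF LTD] by simp
    also have "\<dots> = (LBINT x. (\<Sum>j<2^k. norm (T (n + k) j x) powr 2) - 2 ^ k * norm (D n x) powr 2)"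
      unfolding norm_powr_2 pt ..
    also have "\<dots> = (\<Sum>j<2^k. Iq 2 (T (n + k) j)) - 2 ^ k * N n"
      unfolding N_def using Lq_integrable[OF LT(1)] Lq_integrable[OF LD] by simp
    finally show ?thesis unfolding LT(2) by (simp add: algebra_simps)
  qed
  have mono: "N n \<le> N (n + k)" for n k
  proof -
    have "0 \<le> (\<Sum>j<2^k. Iq 2 (\<lambda>x. T (n + k) j x - D n x))" by (intro sum_nonneg Iq_nonneg)
    then have "(2::real) ^ k * 0 \<le> 2 ^ k * (N (n + k) - N n)" unfolding var by simp
    then show ?thesis by (simp only: mult_le_cancel_left_pos zero_less_power zero_less_numeral)
  qed
  have inc: "incseq N" by (intro incseq_SucI) (use mono[of _ 1] in simp)
  obtain L where L: "N \<longlonglongrightarrow> L"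
    using incseq_convergent[OF inc, of "M * (norm e)\<^sup>2"] NM by blast
  \<comment> \<open>Among the first 2^k of the 2^(k+d) translates one has deviation at most 2^d
    times the mean. Its shift is at most |e| / 2^(n+d), which costs a term of order 4^(-d).\<close>
  have step: "Iq 2 (\<lambda>x. D n x - D (n + k + d) x) \<le> 8 * (M * (norm e)\<^sup>2) / 4 ^ d + 2 * 2 ^ d * (N (n + k + d) - N n)" for n k d
  proof -
    have ex: "\<exists>j<2^k. Iq 2 (\<lambda>x. T (n + k + d) j x - D n x) \<le> 2 ^ d * (N (n + k + d) - N n)"
    proof (rule ccontr)
      assume "\<not> ?thesis"
      then have lt: "2 ^ d * (N (n + k + d) - N n) < Iq 2 (\<lambda>x. T (n + k + d) j x - D n x)" if "j < 2^k" for j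
        using that by force
      have "2 ^ (k + d) * (N (n + k + d) - N n) = (\<Sum>j<(2::nat)^k. 2 ^ d * (N (n + k + d) - N n))"
        by (simp add: power_add)
      also have "\<dots> < (\<Sum>j<2^k. Iq 2 (\<lambda>x. T (n + k + d) j x - D n x))"
      proof (rule sum_strict_mono)
        have "0 \<in> {..<(2::nat)^k}" by simp
        then show "{..<(2::nat)^k} \<noteq> {}" by blast
      qed (use lt in auto)
      also have "\<dots> \<le> (\<Sum>j<2^(k+d). Iq 2 (\<lambda>x. T (n + k + d) j x - D n x))"
      proof (rule sum_mono2)
        show "{..<(2::nat)^k} \<subseteq> {..<2^(k+d)}" by (auto intro: less_le_trans power_increasing)
      qed (auto intro: Iq_nonneg)
      also have "\<dots> = 2 ^ (k + d) * (N (n + k + d) - N n)" using var[where k="k + d" and n=n] by (simp add: add.assoc)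
      finally show False by simp
    qed
    then obtain j where j: "j < 2^k" "Iq 2 (\<lambda>x. T (n + k + d) j x - D n x) \<le> 2 ^ d * (N (n + k + d) - N n)" by blast
    define y where "y = (real j / 2 ^ (n + k + d)) *\<^sub>R e"
    have "real j / 2 ^ (n + k + d) \<le> 2 ^ k / 2 ^ (n + k + d)" using j(1)
      by (intro divide_right_mono) (simp_all add: order.strict_implies_order)
    also have "(2::real) ^ k / 2 ^ (n + k + d) = 1 / 2 ^ (n + d)" by (simp add: power_add)
    finally have ny: "norm y \<le> norm e / 2 ^ (n + d)" using mult_right_mono[OF _ norm_ge_zero, of "real j / 2 ^ (n + k + d)" "1 / 2 ^ (n + d)" e]
      by (simp add: y_def)
    have A: "Iq 2 (\<lambda>x. D n (x + y) - D n x) \<le> 4 * (M * (norm e)\<^sup>2) / 4 ^ d"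
    proof -
      let ?a = "(1 / 2 ^ n) *\<^sub>R e"
      have e1: "D n (x + y) - D n x = (2^n::real) *\<^sub>R ((V ((x + ?a) + y) - V (x + ?a)) - (V (x + y) - V x))" for x
        by (simp add: D_def algebra_simps)
      have "Iq 2 (\<lambda>x. (V ((x + ?a) + y) - V (x + ?a)) - (V (x + y) - V x))
          \<le> 2 * Iq 2 (\<lambda>x. V ((x + ?a) + y) - V (x + ?a)) + 2 * Iq 2 (\<lambda>x. V (x + y) - V x)"
        by (rule Iq2_diff_le[OF Lq_translate(1)[OF VD[of y]] VD])
      also have "Iq 2 (\<lambda>x. V ((x + ?a) + y) - V (x + ?a)) = Iq 2 (\<lambda>x. V (x + y) - V x)"
        by (rule Lq_translate(2)[OF VD[of y]])
      also have "2 * Iq 2 (\<lambda>x. V (x + y) - V x) + 2 * Iq 2 (\<lambda>x. V (x + y) - V x) \<le> 4 * (M * (norm y)\<^sup>2)"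
        using M[of y] by simp
      finally have "Iq 2 (\<lambda>x. D n (x + y) - D n x) \<le> (2^n)\<^sup>2 * (4 * (M * (norm y)\<^sup>2))"
        unfolding e1 sc by (rule mult_left_mono) simp
      also have "\<dots> \<le> (2^n)\<^sup>2 * (4 * (M * (norm e / 2 ^ (n + d))\<^sup>2))"
      proof (cases "M \<ge> 0")
        case True
        then show ?thesis using ny by (intro mult_left_mono power_mono) auto
      next
        case False
        then have "norm e = 0" using M0 by (auto simp: zero_le_mult_iff)
        then show ?thesis using ny by simp
      qed
      also have "\<dots> = 4 * (M * (norm e)\<^sup>2) / 4 ^ d"
      proof -
        have "(2 ^ n)\<^sup>2 * (norm e / 2 ^ (n + d))\<^sup>2 = (norm e)\<^sup>2 / (2 ^ d)\<^sup>2"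
          by (simp add: power_add power_divide power_mult_distrib)
        also have "(2 ^ d)\<^sup>2 = (4::real) ^ d" by (simp add: power2_eq_square power_mult_distrib[symmetric])
        finally show ?thesis by (simp add: mult_ac)
      qed
      finally show ?thesis .
    qed
    have "Iq 2 (\<lambda>x. D n x - D (n + k + d) x) = Iq 2 (\<lambda>x. D n (x + y) - D (n + k + d) (x + y))"
      by (rule Lq_translate(2)[symmetric, OF Lq_diff(1)[OF LD LD]]) simp
    also have "\<dots> = Iq 2 (\<lambda>x. (D n (x + y) - D n x) - (T (n + k + d) j x - D n x))"
      by (simp add: T_def y_def)
    also have "\<dots> \<le> 2 * Iq 2 (\<lambda>x. D n (x + y) - D n x) + 2 * Iq 2 (\<lambda>x. T (n + k + d) j x - D n x)"
      by (rule Iq2_diff_le[OF Lq_diff(1)[OF Lq_translate(1)[OF LD] LD] LTD]) simp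
    also have "\<dots> \<le> 2 * (4 * (M * (norm e)\<^sup>2) / 4 ^ d) + 2 * (2 ^ d * (N (n + k + d) - N n))"
      using A j(2) by (intro add_mono mult_left_mono) auto
    finally show ?thesis by simp
  qed
  show "\<exists>N. \<forall>m\<ge>N. \<forall>n\<ge>N. Iq 2 (\<lambda>x. D m x - D n x) \<le> \<epsilon>" if \<epsilon>: "\<epsilon> > 0"
  proof -
    have "(\<lambda>d. 8 * (M * (norm e)\<^sup>2) * (1 / 4) ^ d) \<longlonglongrightarrow> 8 * (M * (norm e)\<^sup>2) * 0"
      by (intro tendsto_mult tendsto_const LIMSEQ_power_zero) simp
    moreover have "(\<lambda>d. 8 * (M * (norm e)\<^sup>2) * (1 / 4) ^ d) = (\<lambda>d. 8 * (M * (norm e)\<^sup>2) / 4 ^ d)"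
      by (rule ext) (simp add: power_one_over)
    ultimately have "(\<lambda>d. 8 * (M * (norm e)\<^sup>2) / 4 ^ d) \<longlonglongrightarrow> 0" by simp
    from order_tendstoD(2)[OF this, of "\<epsilon> / 8"] \<epsilon>
    obtain d where d: "8 * (M * (norm e)\<^sup>2) / 4 ^ d < \<epsilon> / 8" by (auto simp: eventually_sequentially)
    \<comment> \<open>With d already fixed by the shift term, the indices are taken so large that
      the increments of \<open>N\<close> absorb the factor 2^d.\<close>
    have "L - \<epsilon> / (16 * 2 ^ d) < L" using \<epsilon> by simp
    from order_tendstoD(1)[OF L this] obtain N0 where N0: "\<And>n. n \<ge> N0 \<Longrightarrow> N n > L - \<epsilon> / (16 * 2 ^ d)"
      by (auto simp: eventually_sequentially)
    have NL: "N n \<le> L" for n by (rule incseq_le[OF inc L])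
    have s: "Iq 2 (\<lambda>x. D n x - D (n + k + d) x) \<le> \<epsilon> / 4" if "n \<ge> N0" for n k
    proof -
      have "2 * 2 ^ d * (N (n + k + d) - N n) \<le> 2 * 2 ^ d * (\<epsilon> / (16 * 2 ^ d))"
        using NL[of "n + k + d"] N0[OF that] by (intro mult_left_mono) auto
      also have "\<dots> = \<epsilon> / 8" by simp
      finally show ?thesis using step[of n k d] d by linarith
    qed
    have "Iq 2 (\<lambda>x. D m x - D n x) \<le> \<epsilon>" if mn: "m \<ge> N0" "n \<ge> N0" for m n
    proof -
      define P where "P = m + n + d"
      have 1: "Iq 2 (\<lambda>x. D m x - D P x) \<le> \<epsilon> / 4" using s[OF mn(1), of n] by (simp add: P_def)
      have 2: "Iq 2 (\<lambda>x. D n x - D P x) \<le> \<epsilon> / 4" using s[OF mn(2), of m] by (simp add: P_def add.commute)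
      have "Iq 2 (\<lambda>x. (D m x - D P x) - (D n x - D P x)) \<le> 2 * Iq 2 (\<lambda>x. D m x - D P x) + 2 * Iq 2 (\<lambda>x. D n x - D P x)"
        by (rule Iq2_diff_le[OF Lq_diff(1)[OF LD LD] Lq_diff(1)[OF LD LD]]) simp_all
      then show ?thesis using 1 2 by simp
    qed
    then show ?thesis by blast
  qed
qed

text \<open>Indices are chosen with squared distances of consecutive members at most 4^(-k). Then
  the sum of 2^k |d k|^2 has finite integral, and |d k| \<le> 2^k |d k|^2 + 2^(-k) turns almost
  everywhere finiteness into absolute convergence of the telescoping series. The indices are common
  to the finite family.\<close>

lemma L2_Cauchy_AE_subseq:
  fixes F :: "'i \<Rightarrow> nat \<Rightarrow> 'a::euclidean_space \<Rightarrow> 'b::euclidean_space"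
  assumes I: "finite I" and F: "\<And>i n. i \<in> I \<Longrightarrow> Lq 2 (F i n)"
    and C: "\<And>i \<epsilon>. i \<in> I \<Longrightarrow> \<epsilon> > 0 \<Longrightarrow> \<exists>N. \<forall>m\<ge>N. \<forall>n\<ge>N. Iq 2 (\<lambda>x. F i m x - F i n x) \<le> \<epsilon>"
  obtains r :: "nat \<Rightarrow> nat" where "strict_mono r" "\<And>i. i \<in> I \<Longrightarrow> AE x in lborel. convergent (\<lambda>n. F i (r n) x)"
proof -
  have "\<exists>N. \<forall>i\<in>I. \<forall>m\<ge>N. \<forall>n\<ge>N. Iq 2 (\<lambda>x. F i m x - F i n x) \<le> (1/4)^k" for k :: nat
  proof -
    have "\<forall>i\<in>I. \<exists>N. \<forall>m\<ge>N. \<forall>n\<ge>N. Iq 2 (\<lambda>x. F i m x - F i n x) \<le> (1/4)^k" using C by simp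
    then obtain N where N: "\<And>i. i \<in> I \<Longrightarrow> \<forall>m\<ge>N i. \<forall>n\<ge>N i. Iq 2 (\<lambda>x. F i m x - F i n x) \<le> (1/4)^k" by metis
    have "N i \<le> Max (N ` I \<union> {0})" if "i \<in> I" for i using I that by (intro Max_ge) auto
    then show ?thesis using N by (intro exI[of _ "Max (N ` I \<union> {0})"]) (meson order_trans)
  qed
  then obtain N where N: "\<And>k i m n. i \<in> I \<Longrightarrow> m \<ge> N k \<Longrightarrow> n \<ge> N k \<Longrightarrow> Iq 2 (\<lambda>x. F i m x - F i n x) \<le> (1/4)^k" by metis
  \<comment> \<open>The sum makes r dominate \<open>N\<close>, and the summand k makes it strictly
    increasing.\<close>
  define r where "r k = k + (\<Sum>j\<le>k. N j)" for k
  have r: "strict_mono r" by (rule strict_monoI_Suc) (simp add: r_def)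
  have rN: "r k \<ge> N k" "r (Suc k) \<ge> N k" for k
  proof -
    have "N k \<le> (\<Sum>j\<le>k. N j)" by (intro member_le_sum) auto
    then show "r k \<ge> N k" "r (Suc k) \<ge> N k" by (auto simp: r_def)
  qed
  have "AE x in lborel. convergent (\<lambda>n. F i (r n) x)" if i: "i \<in> I" for i
  proof -
    have [measurable]: "\<And>n. F i n \<in> borel_measurable borel" using F[OF i] by (simp add: Lq_def)
    define d where "d k x = F i (r (Suc k)) x - F i (r k) x" for k x
    have Ld: "Lq 2 (d k)" "Iq 2 (d k) \<le> (1/4)^k" for k
      unfolding d_def using N[OF i rN(2) rN(1)] by (auto intro!: Lq_diff(1)[OF F[OF i] F[OF i]])
    have [measurable]: "\<And>k. d k \<in> borel_measurable borel" using Ld by (simp add: Lq_def)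
    have "(\<integral>\<^sup>+x. (\<Sum>k. ennreal (2^k * norm (d k x) powr 2)) \<partial>lborel) = (\<Sum>k. \<integral>\<^sup>+x. ennreal (2^k * norm (d k x) powr 2) \<partial>lborel)"
      by (rule nn_integral_suminf) measurable
    also have "\<dots> \<le> (\<Sum>k. ennreal ((1/2)^k))"
    proof (rule suminf_le)
      show "(\<integral>\<^sup>+x. ennreal (2^k * norm (d k x) powr 2) \<partial>lborel) \<le> ennreal ((1/2)^k)" for k
      proof -
        have "(\<integral>\<^sup>+x. ennreal (2^k * norm (d k x) powr 2) \<partial>lborel) = ennreal (LBINT x. 2^k * norm (d k x) powr 2)"
          using Lq_integrable[OF Ld(1)[of k]] by (intro nn_integral_eq_integral) auto
        also have "\<dots> = ennreal (2^k * Iq 2 (d k))" by simp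
        also have "\<dots> \<le> ennreal (2^k * (1/4)^k)" using Ld(2) by (intro ennreal_leI mult_left_mono) auto
        also have "(2::real)^k * (1/4)^k = (1/2)^k" by (simp add: power_mult_distrib[symmetric])
        finally show ?thesis .
      qed
    qed auto
    also have "\<dots> = ennreal (\<Sum>k. (1/2)^k)" by (intro suminf_ennreal2) (auto intro!: summable_geometric)
    also have "\<dots> < \<infinity>" by simp
    finally have "AE x in lborel. (\<Sum>k. ennreal (2^k * norm (d k x) powr 2)) \<noteq> \<infinity>"
      by (intro nn_integral_PInf_AE) auto
    then show ?thesis
    proof eventually_elim
      case (elim x)
      have sm: "summable (\<lambda>k. 2^k * norm (d k x) powr 2)"
        by (rule summable_suminf_not_top) (use elim in auto)
      have le: "norm (d k x) \<le> 2^k * norm (d k x) powr 2 + (1/2)^k" for k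
      proof -
        let ?a = "norm (d k x)"
        have "?a * 2 \<le> 2 ^ k * ?a\<^sup>2 + (1/2)^k"
        proof -
          have "0 \<le> (2^k * ?a - 1)\<^sup>2" by simp
          then have "2 * (2^k * ?a) \<le> (2^k * ?a)\<^sup>2 + 1" by (simp add: power2_diff)
          then have "(1/2)^k * (2 * (2^k * ?a)) \<le> (1/2)^k * ((2^k * ?a)\<^sup>2 + 1)" by (intro mult_left_mono) auto
          then show ?thesis by (simp add: power_one_over field_simps power2_eq_square)
        qed
        then show ?thesis unfolding norm_powr_2 using norm_ge_zero[of "d k x"] by linarith
      qed
      have "summable (\<lambda>k. d k x)"
        by (rule summable_comparison_test'[OF summable_add[OF sm summable_geometric[of "1/2::real"]], of 0]) (use le in auto)
      then have "convergent (\<lambda>n. \<Sum>k<n. d k x)" by (simp add: summable_iff_convergent)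
      moreover have "(\<Sum>k<n. d k x) = F i (r n) x - F i (r 0) x" for n
        unfolding d_def by (rule sum_lessThan_telescope)
      ultimately have "convergent (\<lambda>n. F i (r n) x - F i (r 0) x)" by simp
      then have "convergent (\<lambda>n. (F i (r n) x - F i (r 0) x) + F i (r 0) x)" by (intro convergent_add convergent_const)
      then show ?case by simp
    qed
  qed
  then show ?thesis using that r by blast
qed

text \<open>Pointwise convergence of the quotients along one sequence, common to all basis
  directions, is the aim: it allows nonlinear functions of V to be differentiated by the classical
  chain rule at almost every point. It comes from the L2 Cauchy property of the dyadic
  quotients.\<close>

lemma L2_lipschitz_AE_differentiable:
  fixes V :: "'a::euclidean_space \<Rightarrow> 'b::euclidean_space"
  assumes V: "Lq 2 V" and M: "\<And>h. Iq 2 (\<lambda>x. V (x + h) - V x) \<le> M * (norm h)\<^sup>2"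
  obtains t :: "nat \<Rightarrow> real" and W where "\<And>n. 0 < t n" "\<And>n. t n \<le> 1" "t \<longlonglongrightarrow> 0" "\<And>b. b \<in> Basis \<Longrightarrow> Lq 2 (W b)"
    "\<And>b. b \<in> Basis \<Longrightarrow> AE x in lborel. (\<lambda>n. (1 / t n) *\<^sub>R (V (x + t n *\<^sub>R b) - V x)) \<longlonglongrightarrow> W b x"
    "\<And>b n. b \<in> Basis \<Longrightarrow> Lq 2 (\<lambda>x. (1 / t n) *\<^sub>R (V (x + t n *\<^sub>R b) - V x))"
    "\<And>b n. b \<in> Basis \<Longrightarrow> Iq 2 (\<lambda>x. (1 / t n) *\<^sub>R (V (x + t n *\<^sub>R b) - V x)) \<le> M"
proof -
  define D where "D b n x = (2 ^ n :: real) *\<^sub>R (V (x + (1 / 2 ^ n) *\<^sub>R b) - V x)" for b n x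
  note C = dyadic_difference_quotients_Cauchy[OF V M, folded D_def]
  obtain r where r: "strict_mono r" "\<And>b. b \<in> (Basis::'a set) \<Longrightarrow> AE x in lborel. convergent (\<lambda>n. D b (r n) x)"
    using L2_Cauchy_AE_subseq[of Basis D, OF finite_Basis C(1,3)] by blast
  define W where "W b x = lim (\<lambda>n. D b (r n) x)" for b x
  define t where "t n = 1 / (2::real) ^ r n" for n
  have Dt: "(1 / t n) *\<^sub>R (V (x + t n *\<^sub>R b) - V x) = D b (r n) x" for n x b by (simp add: t_def D_def)
  have DM: "Iq 2 (D b n) \<le> M" if "b \<in> Basis" for b n using C(2)[of b n] that by simp
  have lim: "AE x in lborel. (\<lambda>n. D b (r n) x) \<longlonglongrightarrow> W b x" if "b \<in> Basis" for b
    using r(2)[OF that] by eventually_elim (simp add: W_def convergent_LIMSEQ_iff)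
  have [measurable]: "\<And>b n. D b n \<in> borel_measurable borel" using C(1) by (simp add: Lq_def)
  have Wm: "W b \<in> borel_measurable borel" for b
    unfolding W_def[abs_def] by measurable
  have "(\<lambda>n. (1/2::real) ^ r n) \<longlonglongrightarrow> 0"
    using LIMSEQ_subseq_LIMSEQ[OF LIMSEQ_power_zero[of "1/2::real"] r(1)] by (simp add: o_def)
  then have "t \<longlonglongrightarrow> 0" by (simp add: t_def[abs_def] power_one_over)
  moreover have "Lq 2 (W b)" if "b \<in> Basis" for b
    by (rule Lq_Fatou(1)[OF C(1) DM[OF that] Wm lim[OF that]]) simp
  ultimately show ?thesis
    using that[of t W] lim C(1) DM unfolding Dt by (simp add: t_def divide_le_eq)
qed

subsection \<open>Radial maps\<close>

text \<open>\<beta> = 0 gives a pure power, written with \<epsilon> = 1; \<beta> > 0 gives a power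
  regularised near 0. As \<open>0 powr \<alpha>\<close> is 0 for every \<alpha>, profiles and radial
  maps vanish at 0 even for negative exponents.\<close>

definition profile :: "real \<Rightarrow> real \<Rightarrow> real \<Rightarrow> real \<Rightarrow> real" where
  "profile \<alpha> \<beta> \<epsilon> s = s powr \<alpha> * (\<epsilon> + s) powr (- \<beta>)"

text \<open>The logarithmic derivative s \<phi>'(s) / \<phi>(s) of the profile \<phi>. It is bounded
  on s \<ge> 0 and governs both the increment bounds and the loss of ellipticity.\<close>

definition pslope :: "real \<Rightarrow> real \<Rightarrow> real \<Rightarrow> real \<Rightarrow> real" where
  "pslope \<alpha> \<beta> \<epsilon> s = \<alpha> - \<beta> * s / (\<epsilon> + s)"

definition rad :: "real \<Rightarrow> real \<Rightarrow> real \<Rightarrow> 'b::euclidean_space \<Rightarrow> 'b" where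
  "rad \<alpha> \<beta> \<epsilon> y = profile \<alpha> \<beta> \<epsilon> (norm y) *\<^sub>R y"

text \<open>The differential of \<open>rad\<close> away from 0: the profile scales h, and the
  component along y receives the additional factor 1 + pslope. At y = 0 the value is 0, which is the
  true differential for positive \<alpha> but not otherwise.\<close>

definition drad :: "real \<Rightarrow> real \<Rightarrow> real \<Rightarrow> 'b::euclidean_space \<Rightarrow> 'b \<Rightarrow> 'b" where
  "drad \<alpha> \<beta> \<epsilon> y h = profile \<alpha> \<beta> \<epsilon> (norm y) *\<^sub>R (h + (pslope \<alpha> \<beta> \<epsilon> (norm y) * (sgn y \<bullet> h)) *\<^sub>R sgn y)"

lemma profile_nonneg: "profile \<alpha> \<beta> \<epsilon> s \<ge> 0"
  by (simp add: profile_def)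

lemma profile_0 [simp]: "profile \<alpha> \<beta> \<epsilon> 0 = 0"
  by (simp add: profile_def)

lemma rad_0 [simp]: "rad \<alpha> \<beta> \<epsilon> 0 = 0"
  by (simp add: rad_def)

lemma drad_0 [simp]: "drad \<alpha> \<beta> \<epsilon> 0 h = 0"
  by (simp add: drad_def)

lemma profile_power: "s \<ge> 0 \<Longrightarrow> profile \<alpha> 0 1 s = s powr \<alpha>"
  by (auto simp: profile_def)

lemma pslope_power [simp]: "pslope \<alpha> 0 \<epsilon> s = \<alpha>"
  by (simp add: pslope_def)

lemma rad_power: "rad \<alpha> 0 1 y = norm y powr \<alpha> *\<^sub>R y"
  by (simp add: rad_def profile_power)

lemma norm_rad: "norm (rad \<alpha> \<beta> \<epsilon> y) = profile \<alpha> \<beta> \<epsilon> (norm y) * norm y"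
  by (simp add: rad_def profile_nonneg abs_of_nonneg)

lemma norm_rad_power: "norm (rad \<alpha> 0 1 y) = norm y powr (\<alpha> + 1)"
  by (cases "y = 0") (simp_all add: norm_rad profile_power powr_add)

lemma abs_pslope_le: "\<epsilon> > 0 \<Longrightarrow> s \<ge> 0 \<Longrightarrow> \<bar>pslope \<alpha> \<beta> \<epsilon> s\<bar> \<le> \<bar>\<alpha>\<bar> + \<bar>\<beta>\<bar>"
proof -
  assume a: "\<epsilon> > 0" "s \<ge> 0"
  then have "\<bar>\<beta> * s / (\<epsilon> + s)\<bar> \<le> \<bar>\<beta>\<bar>" by (simp add: abs_mult divide_le_eq mult_left_mono)
  then show ?thesis unfolding pslope_def by linarith
qed

lemma profile_has_derivative:
  assumes "s > 0" "\<epsilon> > 0"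
  shows "(profile \<alpha> \<beta> \<epsilon> has_real_derivative profile \<alpha> \<beta> \<epsilon> s * pslope \<alpha> \<beta> \<epsilon> s / s) (at s)"
proof -
  have 1: "((\<lambda>s. s powr \<alpha>) has_real_derivative \<alpha> * s powr (\<alpha> - 1)) (at s)"
    using assms by (intro has_real_derivative_powr)
  have 2: "((\<lambda>s. (\<epsilon> + s) powr (- \<beta>)) has_real_derivative (- \<beta>) * (\<epsilon> + s) powr (- \<beta> - 1) * (0 + 1)) (at s)"
    using assms by (intro DERIV_fun_powr derivative_intros) auto
  have "(profile \<alpha> \<beta> \<epsilon> has_real_derivative \<alpha> * s powr (\<alpha> - 1) * (\<epsilon> + s) powr (- \<beta>) + ((- \<beta>) * (\<epsilon> + s) powr (- \<beta> - 1) * (0 + 1)) * s powr \<alpha>) (at s)"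
    unfolding profile_def[abs_def] by (rule DERIV_mult[OF 1 2])
  moreover have "\<alpha> * s powr (\<alpha> - 1) * (\<epsilon> + s) powr (- \<beta>) + ((- \<beta>) * (\<epsilon> + s) powr (- \<beta> - 1) * (0 + 1)) * s powr \<alpha>
      = profile \<alpha> \<beta> \<epsilon> s * pslope \<alpha> \<beta> \<epsilon> s / s"
    using assms by (simp add: profile_def pslope_def powr_diff field_simps)
  ultimately show ?thesis by simp
qed

text \<open>With x the longer vector the increment is \<phi>(|x|)(x - y) + (\<phi>(|x|) -
  \<phi>(|y|)) y. If |y| < |x|/2 both profile values are estimated directly; otherwise the mean
  value theorem is used on an interval where s^d is comparable to |x|^d. Having the larger norm in
  the bound is essential for negative d, and d > -1 makes s^(d+1) monotone in the first
  case.\<close>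

lemma rad_diff_le:
  fixes x y :: "'b::euclidean_space"
  assumes \<epsilon>: "\<epsilon> > 0" and d: "d > -1" and C: "\<And>s. s > 0 \<Longrightarrow> profile \<alpha> \<beta> \<epsilon> s \<le> C * s powr d"
  shows "norm (rad \<alpha> \<beta> \<epsilon> x - rad \<alpha> \<beta> \<epsilon> y)
    \<le> C * (1 + \<bar>\<alpha>\<bar> + \<bar>\<beta>\<bar>) * (5 + 2 powr \<bar>d\<bar>) * max (norm x) (norm y) powr d * norm (x - y)"
proof -
  define K where "K = C * (1 + \<bar>\<alpha>\<bar> + \<bar>\<beta>\<bar>)"
  let ?\<phi> = "profile \<alpha> \<beta> \<epsilon>"
  have C0: "C \<ge> 0" using C[of 1] profile_nonneg[of \<alpha> \<beta> \<epsilon> 1] by simp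
  have K0: "K \<ge> 0" "C \<le> K" unfolding K_def using C0 by (auto simp: algebra_simps)
  have \<phi>K: "?\<phi> s \<le> K * s powr d" if "s > 0" for s
    using C[OF that] mult_right_mono[OF K0(2), of "s powr d"] by simp
  have \<phi>'K: "\<bar>?\<phi> s * pslope \<alpha> \<beta> \<epsilon> s\<bar> \<le> K * s powr d" if "s > 0" for s
  proof -
    have "\<bar>?\<phi> s * pslope \<alpha> \<beta> \<epsilon> s\<bar> \<le> (C * s powr d) * (\<bar>\<alpha>\<bar> + \<bar>\<beta>\<bar>)"
      unfolding abs_mult using that C[OF that] abs_pslope_le[OF \<epsilon>, of s] profile_nonneg[of \<alpha> \<beta> \<epsilon> s]
      by (intro mult_mono) auto
    also have "\<dots> \<le> (C * s powr d) * (1 + \<bar>\<alpha>\<bar> + \<bar>\<beta>\<bar>)" using C0 by (intro mult_left_mono) auto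
    finally show ?thesis by (simp add: K_def mult_ac)
  qed
  have main: "norm (rad \<alpha> \<beta> \<epsilon> x - rad \<alpha> \<beta> \<epsilon> y) \<le> K * (5 + 2 powr \<bar>d\<bar>) * norm x powr d * norm (x - y)"
    if le: "norm y \<le> norm x" for x y :: 'b
  proof (cases "x = 0")
    case False
    define a b where "a = norm x" and "b = norm y"
    have a: "a > 0" "b \<ge> 0" "b \<le> a" using False le by (auto simp: a_def b_def)
    have e: "rad \<alpha> \<beta> \<epsilon> x - rad \<alpha> \<beta> \<epsilon> y = ?\<phi> a *\<^sub>R (x - y) + (?\<phi> a - ?\<phi> b) *\<^sub>R y"
      by (simp add: rad_def a_def b_def algebra_simps)
    have ad: "a powr d \<ge> 0" by simp
    have B: "\<bar>?\<phi> a - ?\<phi> b\<bar> * b \<le> K * (4 + 2 powr \<bar>d\<bar>) * a powr d * (a - b)"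
    proof -
      consider "b = 0" | "b = a" | "b > 0" "b < a / 2" | "b \<ge> a / 2" "b < a" using a by linarith
      then show ?thesis
      proof cases
        case 3
        have "\<bar>?\<phi> a - ?\<phi> b\<bar> * b \<le> (?\<phi> a + ?\<phi> b) * b"
          using profile_nonneg[of \<alpha> \<beta> \<epsilon> a] profile_nonneg[of \<alpha> \<beta> \<epsilon> b] 3 by (intro mult_right_mono) auto
        also have "\<dots> \<le> (K * a powr d) * b + (K * b powr d) * b"
          using mult_right_mono[OF \<phi>K[OF a(1)], of b] mult_right_mono[OF \<phi>K[OF 3(1)], of b] a by (simp add: algebra_simps)
        also have "(K * b powr d) * b = K * b powr (d + 1)" using 3 by (simp add: powr_add)
        also have "\<dots> \<le> K * a powr (d + 1)" using K0 3 a d by (intro mult_left_mono powr_mono2) auto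
        also have "K * a powr (d + 1) = K * a powr d * a" using a by (simp add: powr_add)
        also have "(K * a powr d) * b \<le> K * a powr d * a" using K0 a by (intro mult_left_mono) auto
        finally have "\<bar>?\<phi> a - ?\<phi> b\<bar> * b \<le> K * a powr d * (2 * a)" by (simp add: mult_ac)
        also have "\<dots> \<le> K * a powr d * ((4 + 2 powr \<bar>d\<bar>) * (a - b))"
        proof (intro mult_left_mono)
          have "2 * a \<le> 4 * (a - b)" using 3 by simp
          also have "\<dots> \<le> (4 + 2 powr \<bar>d\<bar>) * (a - b)" using 3 a by (intro mult_right_mono) auto
          finally show "2 * a \<le> (4 + 2 powr \<bar>d\<bar>) * (a - b)" .
        qed (use K0 in simp)
        finally show ?thesis by (simp add: mult_ac)
      next
        case 4
        then have b: "b > 0" using a by linarith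
        obtain \<xi> where \<xi>: "b < \<xi>" "\<xi> < a" "?\<phi> a - ?\<phi> b = (a - b) * (?\<phi> \<xi> * pslope \<alpha> \<beta> \<epsilon> \<xi> / \<xi>)"
          using MVT2[OF 4(2), of ?\<phi> "\<lambda>\<xi>. ?\<phi> \<xi> * pslope \<alpha> \<beta> \<epsilon> \<xi> / \<xi>"] profile_has_derivative[OF _ \<epsilon>] b by auto
        have "\<bar>?\<phi> \<xi> * pslope \<alpha> \<beta> \<epsilon> \<xi> / \<xi>\<bar> * b \<le> \<bar>?\<phi> \<xi> * pslope \<alpha> \<beta> \<epsilon> \<xi>\<bar>"
        proof -
          have "\<bar>?\<phi> \<xi> * pslope \<alpha> \<beta> \<epsilon> \<xi>\<bar> * (b / \<xi>) \<le> \<bar>?\<phi> \<xi> * pslope \<alpha> \<beta> \<epsilon> \<xi>\<bar> * 1"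
            using \<xi> b by (intro mult_left_mono) auto
          then show ?thesis using \<xi> b by (simp add: abs_mult)
        qed
        also have "\<dots> \<le> K * \<xi> powr d" using \<xi> b by (intro \<phi>'K) simp
        also have "\<xi> powr d \<le> 2 powr \<bar>d\<bar> * a powr d"
        proof (cases "d \<ge> 0")
          case True
          have "\<xi> powr d \<le> 1 * a powr d" using \<xi> b True by (simp add: powr_mono2)
          also have "\<dots> \<le> 2 powr \<bar>d\<bar> * a powr d" by (intro mult_right_mono) (auto intro: ge_one_powr_ge_zero)
          finally show ?thesis .
        next
          case False
          have "\<xi> powr d \<le> (a / 2) powr d" using \<xi> 4 a False by (intro powr_mono2') auto
          also have "\<dots> = 2 powr \<bar>d\<bar> * a powr d" using a False by (simp add: powr_divide powr_minus_divide)
          finally show ?thesis .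
        qed
        finally have *: "\<bar>?\<phi> \<xi> * pslope \<alpha> \<beta> \<epsilon> \<xi> / \<xi>\<bar> * b \<le> K * (2 powr \<bar>d\<bar> * a powr d)"
          using K0 by (simp add: mult_left_mono)
        have "\<bar>?\<phi> a - ?\<phi> b\<bar> * b = (a - b) * (\<bar>?\<phi> \<xi> * pslope \<alpha> \<beta> \<epsilon> \<xi> / \<xi>\<bar> * b)"
          unfolding \<xi>(3) abs_mult using 4 by simp
        also have "\<dots> \<le> (a - b) * (K * (2 powr \<bar>d\<bar> * a powr d))" using 4 * by (intro mult_left_mono) auto
        also have "\<dots> \<le> (a - b) * (K * ((4 + 2 powr \<bar>d\<bar>) * a powr d))"
          using 4 K0 by (intro mult_left_mono mult_right_mono) auto
        finally show ?thesis by (simp add: mult_ac)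
      qed (use K0 a in auto)
    qed
    have "norm (rad \<alpha> \<beta> \<epsilon> x - rad \<alpha> \<beta> \<epsilon> y) \<le> ?\<phi> a * norm (x - y) + \<bar>?\<phi> a - ?\<phi> b\<bar> * b"
      unfolding e using norm_triangle_ineq[of "?\<phi> a *\<^sub>R (x - y)" "(?\<phi> a - ?\<phi> b) *\<^sub>R y"] profile_nonneg[of \<alpha> \<beta> \<epsilon> a]
      by (simp add: b_def)
    also have "\<dots> \<le> K * a powr d * norm (x - y) + K * (4 + 2 powr \<bar>d\<bar>) * a powr d * (a - b)"
      using B \<phi>K[OF a(1)] by (intro add_mono mult_right_mono) auto
    also have "\<dots> \<le> K * a powr d * norm (x - y) + K * (4 + 2 powr \<bar>d\<bar>) * a powr d * norm (x - y)"
    proof (intro add_left_mono mult_left_mono)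
      show "a - b \<le> norm (x - y)" unfolding a_def b_def by (rule norm_triangle_ineq2)
    qed (use K0 in auto)
    also have "\<dots> = K * (5 + 2 powr \<bar>d\<bar>) * norm x powr d * norm (x - y)" by (simp add: a_def algebra_simps)
    finally show ?thesis .
  qed (use le in simp)
  show ?thesis
  proof (cases "norm y \<le> norm x")
    case True
    then show ?thesis using main[OF True] by (simp add: K_def max_def)
  next
    case False
    then show ?thesis using main[of x y] by (simp add: K_def max_def norm_minus_commute)
  qed
qed

lemma rad_has_derivative:
  fixes y :: "'b::euclidean_space"
  assumes "\<epsilon> > 0" "y \<noteq> 0"
  shows "(rad \<alpha> \<beta> \<epsilon> has_derivative drad \<alpha> \<beta> \<epsilon> y) (at y)"
proof -
  have n: "(norm has_derivative (\<lambda>h. sgn y \<bullet> h)) (at y)"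
    using has_derivative_norm[OF assms(2)] by (simp add: inner_commute)
  have p: "(profile \<alpha> \<beta> \<epsilon> has_derivative (*) (profile \<alpha> \<beta> \<epsilon> (norm y) * pslope \<alpha> \<beta> \<epsilon> (norm y) / norm y)) (at (norm y))"
    using profile_has_derivative[of "norm y" \<epsilon> \<alpha> \<beta>] assms by (simp add: has_field_derivative_def)
  have c: "((\<lambda>y. profile \<alpha> \<beta> \<epsilon> (norm y)) has_derivative
      (\<lambda>h. profile \<alpha> \<beta> \<epsilon> (norm y) * pslope \<alpha> \<beta> \<epsilon> (norm y) / norm y * (sgn y \<bullet> h))) (at y)"
    by (rule has_derivative_compose[OF n p])
  have "(rad \<alpha> \<beta> \<epsilon> has_derivative (\<lambda>h. profile \<alpha> \<beta> \<epsilon> (norm y) *\<^sub>R h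
      + (profile \<alpha> \<beta> \<epsilon> (norm y) * pslope \<alpha> \<beta> \<epsilon> (norm y) / norm y * (sgn y \<bullet> h)) *\<^sub>R y)) (at y)"
    unfolding rad_def[abs_def] by (rule has_derivative_scaleR[OF c has_derivative_ident])
  moreover have "(\<lambda>h. profile \<alpha> \<beta> \<epsilon> (norm y) *\<^sub>R h
      + (profile \<alpha> \<beta> \<epsilon> (norm y) * pslope \<alpha> \<beta> \<epsilon> (norm y) / norm y * (sgn y \<bullet> h)) *\<^sub>R y) = drad \<alpha> \<beta> \<epsilon> y"
    by (rule ext) (simp add: drad_def sgn_div_norm algebra_simps divide_inverse)
  ultimately show ?thesis by simp
qed

text \<open>For positive \<alpha> the map is O(|h|^(1+\<alpha>)) near 0, so the origin is no longer
  exceptional.\<close>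

lemma rad_has_derivative_0:
  assumes "\<epsilon> > 0" "\<alpha> > 0" "\<beta> \<ge> 0"
  shows "(rad \<alpha> \<beta> \<epsilon> has_derivative drad \<alpha> \<beta> \<epsilon> (y::'b::euclidean_space)) (at y)"
proof (cases "y = 0")
  case True
  have "((\<lambda>h::'b. norm h powr \<alpha> * \<epsilon> powr (- \<beta>)) \<longlongrightarrow> norm (0::'b) powr \<alpha> * \<epsilon> powr (- \<beta>)) (at 0)"
    using assms by (intro tendsto_intros tendsto_powr2 tendsto_norm tendsto_ident_at) auto
  then have z: "((\<lambda>h::'b. norm h powr \<alpha> * \<epsilon> powr (- \<beta>)) \<longlongrightarrow> 0) (at 0)" by simp
  have "((\<lambda>h::'b. norm (rad \<alpha> \<beta> \<epsilon> (0 + h) - rad \<alpha> \<beta> \<epsilon> 0 - 0) / norm h) \<longlongrightarrow> 0) (at 0)"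
  proof (rule Lim_null_comparison[OF always_eventually z], rule allI)
    fix h :: 'b
    have "(\<epsilon> + norm h) powr (- \<beta>) \<le> \<epsilon> powr (- \<beta>)" using assms by (intro powr_mono2') auto
    then have "profile \<alpha> \<beta> \<epsilon> (norm h) \<le> norm h powr \<alpha> * \<epsilon> powr (- \<beta>)"
      unfolding profile_def by (intro mult_left_mono) auto
    then show "norm (norm (rad \<alpha> \<beta> \<epsilon> (0 + h) - rad \<alpha> \<beta> \<epsilon> 0 - 0) / norm h) \<le> norm h powr \<alpha> * \<epsilon> powr (- \<beta>)"
      by (cases "h = 0") (simp_all add: norm_rad abs_of_nonneg[OF profile_nonneg])
  qed
  then have "(rad \<alpha> \<beta> \<epsilon> has_derivative (\<lambda>h. 0)) (at (0::'b))"
    unfolding has_derivative_at by simp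
  moreover have "drad \<alpha> \<beta> \<epsilon> (0::'b) = (\<lambda>h. 0)" by (rule ext) simp
  ultimately show ?thesis using True by simp
qed (use rad_has_derivative assms in auto)

lemma rad_measurable [measurable]: "rad \<alpha> \<beta> \<epsilon> \<in> borel_measurable borel"
  unfolding rad_def[abs_def] profile_def[abs_def] by measurable

lemma drad_measurable [measurable]:
  assumes [measurable]: "f \<in> borel_measurable borel" "g \<in> borel_measurable borel"
  shows "(\<lambda>x. drad \<alpha> \<beta> \<epsilon> (f x) (g x)) \<in> borel_measurable borel"
  unfolding drad_def profile_def pslope_def sgn_div_norm by measurable

text \<open>The map with exponent \<alpha> has degree of homogeneity \<alpha> + 1, and degrees
  multiply under composition.\<close>

lemma rad_compose_power:
  fixes y :: "'b::euclidean_space"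
  shows "rad \<alpha> 0 1 (rad \<beta> 0 1 y) = rad ((\<beta> + 1) * \<alpha> + \<beta>) 0 1 y"
  by (cases "y = 0") (simp_all add: rad_power norm_rad_power[unfolded rad_power] powr_powr powr_add powr_mult algebra_simps)

lemma rad_zero_exponent: "rad 0 0 1 y = y"
  by (cases "y = 0") (simp_all add: rad_power)

text \<open>With the norms fixed, both sides are affine in the inner product, and the difference
  is smallest when the vectors are parallel.\<close>
lemma rad_monotone:
  fixes x y :: "'b::euclidean_space"
  assumes p: "p \<ge> 2"
  shows "(rad (p - 2) 0 1 x - rad (p - 2) 0 1 y) \<bullet> (x - y) \<ge> 4 / p\<^sup>2 * (norm (rad (p / 2 - 1) 0 1 x - rad (p / 2 - 1) 0 1 y))\<^sup>2"
proof -
  have main: "(rad (p - 2) 0 1 x - rad (p - 2) 0 1 y) \<bullet> (x - y) \<ge> 4 / p\<^sup>2 * (norm (rad (p / 2 - 1) 0 1 x - rad (p / 2 - 1) 0 1 y))\<^sup>2"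
    if le: "norm y \<le> norm x" and x: "x \<noteq> 0" and y: "y \<noteq> 0" for x y :: 'b
  proof -
    define a b i where "a = norm x" and "b = norm y" and "i = x \<bullet> y"
    have ab: "a > 0" "b > 0" "b \<le> a" using le x y by (auto simp: a_def b_def)
    have i: "i \<le> a * b" unfolding a_def b_def i_def by (rule norm_cauchy_schwarz)
    \<comment> \<open>The inverse square of the constant p/2 in the mean value bound
      \<open>mvt\<close>, exactly what the parallel case needs.\<close>
    define k where "k = 4 / p\<^sup>2"
    have k: "k \<le> 1" "k > 0" using p power_mono[of 2 p 2] by (auto simp: k_def divide_le_eq)
    define A B where "A = a powr (p / 2 - 1)" and "B = b powr (p / 2 - 1)"
    have AB: "a powr (p - 2) = A\<^sup>2" "b powr (p - 2) = B\<^sup>2" "A > 0" "B > 0"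
      using ab by (auto simp: A_def B_def powr_power power2_eq_square powr_add[symmetric])
    have BA: "B \<le> A" unfolding A_def B_def using ab p by (intro powr_mono2) auto
    have L: "(rad (p - 2) 0 1 x - rad (p - 2) 0 1 y) \<bullet> (x - y) = A\<^sup>2 * a\<^sup>2 + B\<^sup>2 * b\<^sup>2 - (A\<^sup>2 + B\<^sup>2) * i"
      using AB by (simp add: rad_power a_def[symmetric] b_def[symmetric] inner_diff_left inner_diff_right i_def inner_commute[of y x] algebra_simps)
         (simp add: a_def b_def power2_norm_eq_inner)
    have R: "(norm (rad (p / 2 - 1) 0 1 x - rad (p / 2 - 1) 0 1 y))\<^sup>2 = A\<^sup>2 * a\<^sup>2 + B\<^sup>2 * b\<^sup>2 - 2 * (A * B) * i"
      by (simp add: rad_power a_def[symmetric] b_def[symmetric] A_def[symmetric] B_def[symmetric] power2_norm_eq_inner inner_diff_left inner_diff_right i_def inner_commute[of y x] algebra_simps)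
         (simp add: a_def b_def power2_norm_eq_inner power2_eq_square[of "A"] power2_eq_square[of B])
    have amgm: "2 * (A * B) \<le> A\<^sup>2 + B\<^sup>2" using sum_squares_bound[of A B] by simp
    have co: "A\<^sup>2 + B\<^sup>2 - k * (2 * (A * B)) \<ge> 0"
    proof -
      have "k * (2 * (A * B)) \<le> 1 * (2 * (A * B))" using k AB by (intro mult_right_mono) auto
      then show ?thesis using amgm by simp
    qed
    have mvt: "A * a - B * b \<le> p / 2 * A * (a - b)"
    proof (cases "b < a")
      case True
      have dp: "((\<lambda>s. s powr (p / 2)) has_real_derivative p / 2 * s powr (p / 2 - 1)) (at s)" if "b \<le> s" "s \<le> a" for s
        using that ab by (intro has_real_derivative_powr) auto
      obtain s where s: "b < s" "s < a" "a powr (p / 2) - b powr (p / 2) = (a - b) * (p / 2 * s powr (p / 2 - 1))"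
        using MVT2[OF True dp] by blast
      have "s powr (p / 2 - 1) \<le> A" unfolding A_def using s ab p by (intro powr_mono2) auto
      then have "(a - b) * (p / 2 * s powr (p / 2 - 1)) \<le> (a - b) * (p / 2 * A)" using True p by (intro mult_left_mono) auto
      moreover have "a powr (p / 2) = A * a" "b powr (p / 2) = B * b"
        using ab powr_add[of a "p/2 - 1" 1] powr_add[of b "p/2 - 1" 1] by (auto simp: A_def B_def)
      ultimately show ?thesis using s(3) by (simp add: mult_ac)
    qed (use ab in \<open>simp add: A_def B_def\<close>)
    have mono: "B * b \<le> A * a" using ab AB BA by (intro mult_mono) auto
    have "k * (A * a - B * b)\<^sup>2 \<le> k * (p / 2 * A * (a - b))\<^sup>2"
      using mono mvt k by (intro mult_left_mono power_mono) auto
    also have "\<dots> = A\<^sup>2 * (a - b)\<^sup>2" using p by (simp add: k_def power_mult_distrib power_divide)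
    also have "\<dots> \<le> (A\<^sup>2 * a - B\<^sup>2 * b) * (a - b)"
    proof -
      have "B\<^sup>2 * b \<le> A\<^sup>2 * b" using BA AB ab by (intro mult_right_mono power_mono) auto
      then have "(A\<^sup>2 * (a - b)) * (a - b) \<le> (A\<^sup>2 * a - B\<^sup>2 * b) * (a - b)" using ab by (intro mult_right_mono) (auto simp: algebra_simps)
      then show ?thesis by (simp add: power2_eq_square mult_ac)
    qed
    finally have par: "k * (A * a - B * b)\<^sup>2 \<le> (A\<^sup>2 * a - B\<^sup>2 * b) * (a - b)" .
    have "(A\<^sup>2 + B\<^sup>2 - k * (2 * (A * B))) * i \<le> (A\<^sup>2 + B\<^sup>2 - k * (2 * (A * B))) * (a * b)"
      using co i by (intro mult_left_mono) auto
    then show ?thesis unfolding L R k_def[symmetric] using par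
      by (simp add: power2_eq_square algebra_simps)
  qed
  have sp: "(0::real) \<le> 1 - 4 / p\<^sup>2" using p power_mono[of 2 p 2] by (simp add: divide_le_eq)
  have z: "(rad (p - 2) 0 1 x - rad (p - 2) 0 1 y) \<bullet> (x - y) \<ge> 4 / p\<^sup>2 * (norm (rad (p / 2 - 1) 0 1 x - rad (p / 2 - 1) 0 1 y))\<^sup>2"
    if "x = 0 \<or> y = 0" for x y :: 'b
  proof -
    have e: "rad (p - 2) 0 1 z \<bullet> z = (norm (rad (p / 2 - 1) 0 1 z))\<^sup>2" for z :: 'b
    proof (cases "z = 0")
      case False
      then have "norm z powr (p - 2) = norm z powr (p / 2 - 1) * norm z powr (p / 2 - 1)" by (simp add: powr_add[symmetric])
      then show ?thesis by (simp add: rad_power power_mult_distrib power2_norm_eq_inner power2_eq_square[of "_ powr _"])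
    qed simp
    have "4 / p\<^sup>2 * (norm (rad (p / 2 - 1) 0 1 z))\<^sup>2 \<le> 1 * (norm (rad (p / 2 - 1) 0 1 z))\<^sup>2" for z :: 'b
      using sp by (intro mult_right_mono) auto
    then show ?thesis using that e[of x] e[of y] by auto
  qed
  consider "x = 0 \<or> y = 0" | "x \<noteq> 0" "y \<noteq> 0" "norm y \<le> norm x" | "x \<noteq> 0" "y \<noteq> 0" "norm x \<le> norm y" by linarith
  then show ?thesis
  proof cases
    case 3
    then show ?thesis using main[of x y]
      by (simp add: norm_minus_commute inner_diff_left inner_diff_right algebra_simps)
  qed (use z main in auto)
qed

text \<open>The power map is inverted by \<open>rad (- c)\<close> with c = 1 - 2/q, and
  \<open>rad_diff_le\<close> bounds the increment of the inverse by a multiple of max(|X|,|Y|)^(-c)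
  |X - Y|. As |X - Y| is at most twice that maximum, the negative power is at most a multiple of |X
  - Y|^(-c), and |X - Y|^(2/q) remains.\<close>

lemma rad_power_inverse_holder:
  fixes x y :: "'b::euclidean_space"
  assumes q: "q \<ge> 2"
  shows "norm (x - y) powr q \<le> (10 * (6 + 2 powr 1)) powr q * (norm (rad (q / 2 - 1) 0 1 x - rad (q / 2 - 1) 0 1 y))\<^sup>2"
proof (cases "x = y")
  case False
  define c where "c = 1 - 2 / q"
  have c: "0 \<le> c" "c < 1" using q by (auto simp: c_def)
  define X Y where "X = rad (q / 2 - 1) 0 1 x" and "Y = rad (q / 2 - 1) 0 1 y"
  have inv: "rad (- c) 0 1 (rad (q / 2 - 1) 0 1 z) = z" for z :: 'b
  proof -
    have "(q / 2 - 1 + 1) * (- c) + (q / 2 - 1) = 0" using q by (simp add: c_def field_simps)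
    then show ?thesis using rad_compose_power[of "- c" "q / 2 - 1" z] by (simp only: rad_zero_exponent)
  qed
  have XY: "X \<noteq> Y" using False inv by (metis X_def Y_def)
  have "norm (x - y) = norm (rad (- c) 0 1 X - rad (- c) 0 1 Y)" by (simp add: X_def Y_def inv)
  also have "\<dots> \<le> 1 * (1 + \<bar>- c\<bar> + \<bar>0\<bar>) * (5 + 2 powr \<bar>- c\<bar>) * max (norm X) (norm Y) powr (- c) * norm (X - Y)"
    by (rule rad_diff_le) (use c in \<open>auto simp: profile_power\<close>)
  also have "\<dots> \<le> (2 * (5 + 2 powr 1)) * ((norm (X - Y) / 2) powr (- c) * norm (X - Y))"
  proof -
    have "norm (X - Y) \<le> 2 * max (norm X) (norm Y)" using norm_triangle_ineq4[of X Y] by linarith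
    then have "max (norm X) (norm Y) powr (- c) \<le> (norm (X - Y) / 2) powr (- c)"
      using XY c by (intro powr_mono2') auto
    moreover have "(2::real) powr \<bar>- c\<bar> \<le> 2 powr 1" using c by (intro powr_mono) auto
    ultimately show ?thesis using c unfolding mult.assoc[symmetric]
      by (intro mult_mono mult_right_mono) auto
  qed
  also have "(norm (X - Y) / 2) powr (- c) * norm (X - Y) = 2 powr c * norm (X - Y) powr (2 / q)"
    using XY powr_add[of "norm (X - Y)" "- c" 1] powr_minus_divide[of 2 "2 / q - 1"] by (simp add: powr_divide powr_minus_divide c_def)
  also have "(2 * (5 + 2 powr 1)) * (2 powr c * norm (X - Y) powr (2 / q)) \<le> (10 * (6 + 2 powr 1)) * norm (X - Y) powr (2 / q)"
  proof -
    have "(2::real) powr c \<le> 2 powr 1" using c by (intro powr_mono) auto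
    then have "(2 * (5 + 2 powr 1)) * 2 powr c \<le> 10 * (6 + 2 powr (1::real))" by simp
    from mult_right_mono[OF this, of "norm (X - Y) powr (2 / q)"] show ?thesis by (simp add: mult_ac)
  qed
  finally have "norm (x - y) powr q \<le> ((10 * (6 + 2 powr 1)) * norm (X - Y) powr (2 / q)) powr q"
    using q by (intro powr_mono2) auto
  also have "\<dots> = (10 * (6 + 2 powr 1)) powr q * (norm (X - Y) powr 2)"
    using q by (simp only: powr_mult powr_powr) simp
  finally show ?thesis by (simp only: norm_powr_2 X_def Y_def)
qed simp

subsection \<open>Bounded sequences in Lebesgue spaces\<close>

text \<open>Membership and bound in one predicate, so that uniformly bounded sequences pass through
  sums, translates and limits with a single fact.\<close>

definition LqB :: "real \<Rightarrow> real \<Rightarrow> ('a::euclidean_space \<Rightarrow> 'b::euclidean_space) \<Rightarrow> bool" where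
  "LqB p B f \<longleftrightarrow> Lq p f \<and> Iq p f \<le> B"

lemma LqB_add: "LqB p B f \<Longrightarrow> LqB p C g \<Longrightarrow> p > 0 \<Longrightarrow> LqB p (2 powr p * (B + C)) (\<lambda>x. f x + g x)"
  unfolding LqB_def by (auto intro!: Lq_add(1) order_trans[OF Lq_add(2)] mult_left_mono add_mono)

lemma LqB_diff: "LqB p B f \<Longrightarrow> LqB p C g \<Longrightarrow> p > 0 \<Longrightarrow> LqB p (2 powr p * (B + C)) (\<lambda>x. f x - g x)"
  unfolding LqB_def by (auto intro!: Lq_diff(1) order_trans[OF Lq_diff(2)] mult_left_mono add_mono)

lemma LqB_translate: "LqB p B f \<Longrightarrow> LqB p B (\<lambda>x. f (x + c))"
  unfolding LqB_def using Lq_translate[of p f c] by simp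

lemma LqB_dominated:
  assumes "LqB p B f" "g \<in> borel_measurable borel" "\<And>x. norm (g x) \<le> C * norm (f x)" "C \<ge> 0" "p > 0"
  shows "LqB p (C powr p * B) g"
  using Lq_dominated[of p f g C] assms mult_left_mono[of "Iq p f" B "C powr p"] unfolding LqB_def by force

lemma LqB_conv:
  fixes w :: "'a::euclidean_space \<Rightarrow> 'b::euclidean_space"
  assumes "Lq p w" "integrable lborel w" "t > 0" "p > 1"
  shows "LqB p (Iq p w) (conv w (moll t))"
proof -
  have [measurable]: "w \<in> borel_measurable borel" using assms(1) by (simp add: Lq_def)
  have "(\<integral>\<^sup>+x. ennreal (norm (conv w (moll t) x) powr p) \<partial>lborel) \<le> ennreal (Iq p w)"
    using conv_Lq_bound[OF assms(2,3,4)] nn_integral_Lq[OF assms(1)] by simp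
  from LqI[OF _ this] show ?thesis by (simp add: LqB_def Iq_nonneg)
qed

lemma pairing_tendsto_LqB:
  fixes prod :: "'b::euclidean_space \<Rightarrow> 'c::euclidean_space \<Rightarrow> 'd::euclidean_space"
  assumes "bounded_bilinear prod" "\<And>n. LqB p B (f n)" "Lq q w" "g \<in> borel_measurable borel"
    "AE x in lborel. (\<lambda>n. f n x) \<longlonglongrightarrow> g x" "p > 1" "q > 1" "1 / p + 1 / q = 1"
  shows "(\<lambda>n. LBINT x. prod (w x) (f n x)) \<longlonglongrightarrow> (LBINT x. prod (w x) (g x))"
  using assms unfolding LqB_def by (intro pairing_tendsto[where p=p and q=q and B=B]) auto

lemma LqB_limit:
  assumes "\<And>n::nat. LqB p B (f n)" "g \<in> borel_measurable borel"
    "AE x in lborel. (\<lambda>n. f n x) \<longlonglongrightarrow> g x" "p > 0"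
  shows "LqB p B g"
  using Lq_Fatou[of p f B g] assms unfolding LqB_def by auto

subsection \<open>Gradients of vector-valued functions\<close>

definition outer :: "real^'N \<Rightarrow> real^'n \<Rightarrow> real^'n^'N" where
  "outer a b = (\<chi> \<alpha>. (a $ \<alpha>) *\<^sub>R b)"

lemma norm_outer: "norm (outer a b) = norm a * norm b"
proof -
  have "outer a b \<bullet> outer a b = (\<Sum>\<alpha>\<in>UNIV. (a $ \<alpha> *\<^sub>R b) \<bullet> (a $ \<alpha> *\<^sub>R b))"
    by (subst inner_vec_def) (simp add: outer_def)
  also have "\<dots> = (a \<bullet> a) * (b \<bullet> b)"
    by (simp add: inner_vec_def[of a a] sum_distrib_right mult.assoc)
  finally have "(norm (outer a b))\<^sup>2 = (norm a * norm b)\<^sup>2"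
    by (simp add: power2_norm_eq_inner power_mult_distrib)
  then show ?thesis by (simp add: power2_eq_iff_nonneg)
qed

lemma bounded_bilinear_outer: "bounded_bilinear outer"
proof
  show "\<exists>K. \<forall>a b. norm (outer a b :: real^'n^'N) \<le> norm a * norm b * K"
    by (rule exI[of _ 1]) (simp add: norm_outer)
qed (simp_all add: outer_def vec_eq_iff algebra_simps)

lemma norm_matrix_vector_mult_le:
  fixes A :: "real^'n^'N"
  shows "norm (A *v h) \<le> norm A * norm h"
proof -
  have "(A *v h) \<bullet> (A *v h) = (\<Sum>\<alpha>\<in>UNIV. (A $ \<alpha> \<bullet> h) * (A $ \<alpha> \<bullet> h))"
    by (subst inner_vec_def) (simp add: matrix_vector_mul_component)
  also have "\<dots> \<le> (\<Sum>\<alpha>\<in>UNIV. (A $ \<alpha> \<bullet> A $ \<alpha>) * (h \<bullet> h))"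
    using Cauchy_Schwarz_ineq[of _ h] by (intro sum_mono) (simp add: power2_eq_square)
  also have "\<dots> = (A \<bullet> A) * (h \<bullet> h)"
    by (simp add: inner_vec_def[of A A] sum_distrib_right)
  finally have "(norm (A *v h))\<^sup>2 \<le> (norm A * norm h)\<^sup>2"
    by (simp add: power2_norm_eq_inner power_mult_distrib)
  then show ?thesis by (rule power2_le_imp_le) simp
qed

lemma grad_nth: "grad \<phi> x $ i = dderiv (axis i 1) \<phi> x"
  by (simp add: grad_def dderiv_def)

lemma dderiv_grad:
  assumes "smooth \<phi>" shows "dderiv v \<phi> x = grad \<phi> x \<bullet> v"
proof -
  have "v = (\<Sum>i\<in>UNIV. v $ i *\<^sub>R axis i 1)"
    by (simp add: vec_eq_iff axis_def if_distrib cong: if_cong)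
  then have "dderiv v \<phi> x = dderiv (\<Sum>i\<in>UNIV. v $ i *\<^sub>R axis i 1) \<phi> x" by simp
  also have "\<dots> = (\<Sum>i\<in>UNIV. dderiv (v $ i *\<^sub>R axis i 1) \<phi> x)"
    using linear_sum[OF has_derivative_linear[OF smoothD_has_derivative[OF assms, of x]], of "\<lambda>i. v $ i *\<^sub>R axis i 1" UNIV] by simp
  also have "\<dots> = grad \<phi> x \<bullet> v"
    by (simp add: dderiv_linear[OF assms] inner_vec_def grad_nth mult.commute)
  finally show ?thesis .
qed

lemma grad_measurable:
  fixes \<phi> :: "real^'n \<Rightarrow> real"
  assumes "smooth \<phi>" shows "grad \<phi> \<in> borel_measurable borel"
proof -
  have "(\<lambda>x. grad \<phi> x \<bullet> b) \<in> borel_measurable borel" for b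
  proof -
    have "(\<lambda>x. grad \<phi> x \<bullet> b) = dderiv b \<phi>" by (rule ext) (simp add: dderiv_grad[OF assms])
    then show ?thesis using smooth_measurable[OF smooth_dderiv[OF assms, of b]] by simp
  qed
  then show ?thesis by (simp add: borel_measurable_euclidean_space[of "grad \<phi>"])
qed

lemma grad_bounded:
  fixes \<phi> :: "real^'n \<Rightarrow> real"
  assumes "test_function U \<phi>"
  obtains B where "B > 0" "\<And>x. norm (grad \<phi> x) \<le> B"
proof -
  obtain L where L: "L > 0" "\<And>x h. \<bar>dderiv h \<phi> x\<bar> \<le> L * norm h" using test_function_dderiv_bounded[OF assms] by blast
  have "norm (grad \<phi> x) \<le> L" for x
  proof (cases "grad \<phi> x = 0")
    case False
    have "grad \<phi> x \<bullet> grad \<phi> x \<le> L * norm (grad \<phi> x)"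
      using L(2)[of "grad \<phi> x" x] dderiv_grad[OF test_function_smooth[OF assms], of "grad \<phi> x" x] by simp
    then have "norm (grad \<phi> x) * norm (grad \<phi> x) \<le> L * norm (grad \<phi> x)"
      by (simp add: power2_norm_eq_inner[symmetric] power2_eq_square)
    then show ?thesis using False by simp
  qed (use L in simp)
  then show ?thesis using that L(1) by blast
qed

lemma measurable_vec_lambda:
  assumes "\<And>\<alpha>. (\<lambda>x. f x \<alpha>) \<in> borel_measurable M"
  shows "(\<lambda>x. (\<chi> \<alpha>. f x \<alpha>) :: 'b::euclidean_space^'N) \<in> borel_measurable M"
proof -
  have "(\<lambda>x. (\<chi> \<alpha>. f x \<alpha>) \<bullet> b) \<in> borel_measurable M" for b :: "'b^'N"
    using assms by (simp add: inner_vec_def)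
  then show ?thesis by (simp add: borel_measurable_euclidean_space[where f="\<lambda>x. (\<chi> \<alpha>. f x \<alpha>)"])
qed

lemma measurable_vec_nth [measurable]: "(\<lambda>A::'b::euclidean_space^'N. A $ \<alpha>) \<in> borel_measurable borel"
  by (intro borel_measurable_continuous_onI continuous_intros)

lemma integral_nth:
  fixes f :: "'a::euclidean_space \<Rightarrow> 'b::euclidean_space^'N"
  assumes "integrable lborel f"
  shows "(LBINT x. f x) $ \<alpha> = (LBINT x. f x $ \<alpha>)" "integrable lborel (\<lambda>x. f x $ \<alpha>)"
  using integral_bounded_linear[OF bounded_linear_vec_nth assms, of \<alpha>] integrable_bounded_linear[OF bounded_linear_vec_nth assms, of \<alpha>]
  by simp_all

lemma conv_nth:
  fixes w :: "'a::euclidean_space \<Rightarrow> 'b::euclidean_space^'N"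
  assumes "integrable lborel w" "test_function UNIV \<rho>"
  shows "conv w \<rho> x $ \<alpha> = conv (\<lambda>x. w x $ \<alpha>) \<rho> x"
  unfolding conv_def using integral_nth(1)[OF conv_integrable[OF assms(2,1)]] by simp

lemma weak_dderiv_direction:
  fixes u :: "real^'n \<Rightarrow> real^'N" and G :: "real^'n \<Rightarrow> real^'n^'N"
  assumes u: "integrable lborel u" and G: "integrable lborel G"
    and wu: "\<And>\<alpha> i. weak_dderiv U (axis i 1) (\<lambda>x. u x $ \<alpha>) (\<lambda>x. G x $ \<alpha> $ i)"
  shows "weak_dderiv U h u (\<lambda>x. G x *v h)" "integrable lborel (\<lambda>x. G x *v h)"
proof -
  have bl: "bounded_linear (\<lambda>A::real^'n^'N. A *v h)"
    by (rule bounded_linear_intro[where K="norm h"])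
       (auto simp: matrix_vector_mult_add_rdistrib scaleR_matrix_vector_assoc norm_matrix_vector_mult_le)
  show iG: "integrable lborel (\<lambda>x. G x *v h)" by (rule integrable_bounded_linear[OF bl G])
  show "weak_dderiv U h u (\<lambda>x. G x *v h)"
    unfolding weak_dderiv_def
  proof (intro allI impI)
    fix \<phi> :: "real^'n \<Rightarrow> real" assume \<phi>: "test_function U \<phi>"
    have sm: "smooth \<phi>" by (rule test_function_smooth[OF \<phi>])
    have i1: "integrable lborel (\<lambda>x. dderiv v \<phi> x *\<^sub>R u x)" for v
      by (rule integrable_test_function_scaleR[OF test_function_dderiv[OF \<phi>] u])
    have i2: "integrable lborel (\<lambda>x. \<phi> x *\<^sub>R (G x *v h))" by (rule integrable_test_function_scaleR[OF \<phi> iG])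
    have i3: "integrable lborel (\<lambda>x. \<phi> x *\<^sub>R G x)" by (rule integrable_test_function_scaleR[OF \<phi> G])
    have "(LBINT x. dderiv h \<phi> x *\<^sub>R u x) $ \<alpha> = (- (LBINT x. \<phi> x *\<^sub>R (G x *v h))) $ \<alpha>" for \<alpha>
    proof -
      have "(LBINT x. dderiv h \<phi> x *\<^sub>R u x) $ \<alpha> = (LBINT x. (\<Sum>i\<in>UNIV. h $ i * (dderiv (axis i 1) \<phi> x * u x $ \<alpha>)))"
        unfolding integral_nth(1)[OF i1]
        by (simp add: dderiv_grad[OF sm, of h] inner_vec_def grad_nth sum_distrib_right sum_distrib_left mult_ac)
      also have "\<dots> = (\<Sum>i\<in>UNIV. h $ i * (LBINT x. dderiv (axis i 1) \<phi> x * u x $ \<alpha>))"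
        using integral_nth(2)[OF i1] by (subst Bochner_Integration.integral_sum) simp_all
      also have "\<dots> = (\<Sum>i\<in>UNIV. h $ i * (- (LBINT x. \<phi> x * G x $ \<alpha> $ i)))"
        using wu[of _ \<alpha>] \<phi> unfolding weak_dderiv_def by simp
      also have "\<dots> = - (LBINT x. (\<Sum>i\<in>UNIV. h $ i * (\<phi> x * G x $ \<alpha> $ i)))"
      proof -
        have "integrable lborel (\<lambda>x. \<phi> x * G x $ \<alpha> $ i)" for i
          using integral_nth(2)[OF integral_nth(2)[OF i3, of \<alpha>], of i] by simp
        then show ?thesis by (subst Bochner_Integration.integral_sum) (simp_all add: sum_negf)
      qed
      also have "\<dots> = - ((LBINT x. \<phi> x *\<^sub>R (G x *v h)) $ \<alpha>)"
        unfolding integral_nth(1)[OF i2]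
        by (simp add: matrix_vector_mult_def sum_distrib_left mult_ac)
      finally show ?thesis by simp
    qed
    then show "(LBINT x. dderiv h \<phi> x *\<^sub>R u x) = - (LBINT x. \<phi> x *\<^sub>R (G x *v h))"
      by (simp add: vec_eq_iff)
  qed
qed

text \<open>The bound is uniform in h: |G *v h| \<le> |G| |h| cancels the division by |h|.\<close>

lemma LqB_difference_quotient:
  fixes u :: "real^'n \<Rightarrow> real^'N" and G :: "real^'n \<Rightarrow> real^'n^'N"
  assumes u: "integrable lborel u" and G: "integrable lborel G" "Lq q G"
    and wu: "\<And>\<alpha> i. weak_dderiv U (axis i 1) (\<lambda>x. u x $ \<alpha>) (\<lambda>x. G x $ \<alpha> $ i)"
    and U: "open U" and S: "S \<in> sets borel" and r: "r > 0"
    and sub: "\<And>x s. x \<in> S \<Longrightarrow> 0 \<le> s \<Longrightarrow> s \<le> 1 \<Longrightarrow> cball (x + s *\<^sub>R h) r \<subseteq> U" and q: "q > 1"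
    and h: "h \<noteq> 0"
  shows "LqB q (Iq q G) (\<lambda>x. indicator S x *\<^sub>R ((1 / norm h) *\<^sub>R (u (x + h) - u x)))"
proof -
  note d = weak_dderiv_direction[OF u G(1) wu, of h]
  have [measurable]: "u \<in> borel_measurable borel" "S \<in> sets borel" using borel_measurable_integrable[OF u] S by simp_all
  have "(\<integral>\<^sup>+x. ennreal (norm (indicator S x *\<^sub>R ((1 / norm h) *\<^sub>R (u (x + h) - u x))) powr q) \<partial>lborel)
      = (\<integral>\<^sup>+x. ennreal (1 / norm h powr q) * (indicator S x * ennreal (norm (u (x + h) - u x) powr q)) \<partial>lborel)"
    using q h by (intro nn_integral_cong) (auto simp: indicator_def powr_mult powr_divide ennreal_mult'[symmetric])
  also have "\<dots> = ennreal (1 / norm h powr q) * (\<integral>\<^sup>+x. indicator S x * ennreal (norm (u (x + h) - u x) powr q) \<partial>lborel)"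
    by (intro nn_integral_cmult) measurable
  also have "\<dots> \<le> ennreal (1 / norm h powr q) * (\<integral>\<^sup>+x. indicator U x * ennreal (norm (G x *v h) powr q) \<partial>lborel)"
    by (intro mult_left_mono diff_bound_weak_dderiv[OF u d(2) U d(1) S r sub q]) auto
  also have "\<dots> \<le> ennreal (1 / norm h powr q) * (\<integral>\<^sup>+x. ennreal (norm h powr q) * ennreal (norm (G x) powr q) \<partial>lborel)"
  proof (intro mult_left_mono nn_integral_mono)
    fix x
    have "norm (G x *v h) powr q \<le> (norm h * norm (G x)) powr q"
      using q norm_matrix_vector_mult_le[of "G x" h] by (intro powr_mono2) (auto simp: mult.commute)
    then show "indicator U x * ennreal (norm (G x *v h) powr q) \<le> ennreal (norm h powr q) * ennreal (norm (G x) powr q)"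
      by (auto simp: indicator_def powr_mult ennreal_mult'[symmetric] intro!: ennreal_leI)
  qed auto
  also have "\<dots> = ennreal (1 / norm h powr q) * (ennreal (norm h powr q) * ennreal (Iq q G))"
    using Lq_measurable[OF G(2)] by (subst nn_integral_cmult) (simp_all add: nn_integral_Lq[OF G(2)])
  also have "\<dots> = ennreal (Iq q G)"
    using h by (simp add: mult.assoc[symmetric] ennreal_mult'[symmetric])
  finally have le: "(\<integral>\<^sup>+x. ennreal (norm (indicator S x *\<^sub>R ((1 / norm h) *\<^sub>R (u (x + h) - u x))) powr q) \<partial>lborel) \<le> ennreal (Iq q G)" .
  from LqI[OF _ le] show ?thesis by (simp add: LqB_def Iq_nonneg)
qed

subsection \<open>Square-integrable difference quotients\<close>

text \<open>The doubled radius leaves room for two displacements of size r at once, a translation by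
  h and a mollification.\<close>

lemma compact_margin:
  fixes W K :: "(real^'n) set"
  assumes K: "compact K" "K \<subseteq> W" "open W"
  obtains r where "r > 0" "\<And>x y. x \<in> K \<Longrightarrow> norm (y - x) \<le> 2 * r \<Longrightarrow> y \<in> W"
proof -
  obtain e where e: "e > 0" "(\<Union>x\<in>K. ball x e) \<subseteq> W"
    using compact_subset_open_imp_ball_epsilon_subset[OF K(1,3,2)] by blast
  show ?thesis
  proof (rule that[of "e / 4"])
    show "y \<in> W" if "x \<in> K" "norm (y - x) \<le> 2 * (e / 4)" for x y
      using that e by (intro subsetD[OF e(2)]) (auto simp: dist_norm norm_minus_commute intro!: bexI[of _ x])
  qed (use e in simp)
qed

text \<open>The problem on a bounded open piece U, restated for Borel functions on the whole space
  that vanish off U; \<open>G\<close> and \<open>g\<close> stand for the gradients of u and f.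
  Extension by zero makes translations and mollifications total, and boundedness of U gives
  integrability to all lower exponents.\<close>

locale plap_data =
  fixes U :: "(real^'n) set" and p :: real and u f :: "real^'n \<Rightarrow> real^'N" and G g :: "real^'n \<Rightarrow> real^'n^'N"
  assumes p3: "p \<ge> 3" and U: "open U" "bounded U"
    and L: "Lq p u" "Lq p G" "Lq (p / (p - 1)) f" "Lq (p / (p - 1)) g"
    and zero: "\<And>x. x \<notin> U \<Longrightarrow> u x = 0" "\<And>x. x \<notin> U \<Longrightarrow> G x = 0" "\<And>x. x \<notin> U \<Longrightarrow> f x = 0" "\<And>x. x \<notin> U \<Longrightarrow> g x = 0"
    and wu: "\<And>\<alpha> i. weak_dderiv U (axis i 1) (\<lambda>x. u x $ \<alpha>) (\<lambda>x. G x $ \<alpha> $ i)"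
    and wf: "\<And>\<alpha> i. weak_dderiv U (axis i 1) (\<lambda>x. f x $ \<alpha>) (\<lambda>x. g x $ \<alpha> $ i)"
    and eqn: "\<And>\<alpha> \<phi>. test_function U \<phi> \<Longrightarrow>
       (LBINT x. rad (p - 2) 0 1 (G x) $ \<alpha> \<bullet> grad \<phi> x) = - (LBINT x. f x $ \<alpha> * \<phi> x)"
begin

abbreviation "p' \<equiv> p / (p - 1)"
abbreviation "c \<equiv> 1 - 2 / p"

definition "A x = rad (p - 2) 0 1 (G x)"
definition "V x = rad (p / 2 - 1) 0 1 (G x)"

lemma pp: "p > 1" "p' > 1" "1 / p + 1 / p' = 1" "1 / p' + 1 / p = 1" "p > 0" "p' > 0"
  using p3 by (auto simp: field_simps)

lemma cc: "0 < c" "c < 1" using p3 by (auto simp: field_simps)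

lemma [measurable]: "u \<in> borel_measurable borel" "G \<in> borel_measurable borel" "f \<in> borel_measurable borel" "g \<in> borel_measurable borel"
  using L by (auto simp: Lq_def)

lemma [measurable]: "A \<in> borel_measurable borel" "V \<in> borel_measurable borel"
  unfolding A_def[abs_def] V_def[abs_def] by measurable

lemma integrable_data: "integrable lborel u" "integrable lborel G" "integrable lborel f" "integrable lborel g"
  using Lq_imp_integrable[OF L(1) U(2) zero(1)] Lq_imp_integrable[OF L(2) U(2) zero(2)]
    Lq_imp_integrable[OF L(3) U(2) zero(3)] Lq_imp_integrable[OF L(4) U(2) zero(4)] pp by auto

lemma norm_A: "norm (A x) powr p' = norm (G x) powr p"
  using p3 by (simp add: A_def norm_rad_power powr_powr)

lemma norm_V: "norm (V x) powr 2 = norm (G x) powr p"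
  unfolding V_def norm_rad_power powr_powr by simp

lemma LA: "Lq p' A" using L(2) by (simp add: Lq_def norm_A)

lemma LV: "Lq 2 V" using L(2) unfolding Lq_def norm_V by simp

lemma A_zero: "x \<notin> U \<Longrightarrow> A x = 0" and V_zero: "x \<notin> U \<Longrightarrow> V x = 0"
  by (simp_all add: A_def V_def zero)

lemma integrable_A: "integrable lborel A"
  using Lq_imp_integrable[OF LA U(2) A_zero] pp by simp

lemma A_V: "A x = rad c 0 1 (V x)"
proof -
  have "(p / 2 - 1 + 1) * c + (p / 2 - 1) = p - 2" using p3 by (simp add: field_simps)
  then show ?thesis using rad_compose_power[of c "p / 2 - 1" "G x"] by (simp only: A_def V_def)
qed

lemma G_V: "G x = rad (- c) 0 1 (V x)"
proof -
  have "(p / 2 - 1 + 1) * (- c) + (p / 2 - 1) = 0" using p3 by (simp add: field_simps)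
  then show ?thesis using rad_compose_power[of "- c" "p / 2 - 1" "G x"] by (simp only: rad_zero_exponent V_def)
qed

definition "KA = (1 + \<bar>c\<bar> + \<bar>0\<bar>) * (5 + 2 powr \<bar>c\<bar>)"

lemma KA: "KA > 0" by (auto simp: KA_def intro!: mult_pos_pos add_pos_nonneg)

lemma A_diff_le: "norm (A x - A y) \<le> KA * max (norm (V x)) (norm (V y)) powr c * norm (V x - V y)"
  unfolding A_V KA_def using rad_diff_le[of 1 c c 0 1 "V x" "V y"] cc by (simp add: profile_power)

section \<open>The equation for differences\<close>

lemma integrable_nth_inner_grad:
  fixes B :: "real^'n \<Rightarrow> real^'n^'N"
  assumes \<phi>: "test_function S \<phi>" and B: "integrable lborel B"
  shows "integrable lborel (\<lambda>x. B x $ \<alpha> \<bullet> grad \<phi> x)"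
proof -
  have [measurable]: "B \<in> borel_measurable borel" using borel_measurable_integrable[OF B] by simp
  obtain K where K: "K > 0" "\<And>x. norm (grad \<phi> x) \<le> K" using grad_bounded[OF \<phi>] by blast
  have [measurable]: "grad \<phi> \<in> borel_measurable borel" by (rule grad_measurable[OF test_function_smooth[OF \<phi>]])
  have "integrable lborel (\<lambda>x. K * norm (B x $ \<alpha>))" using integral_nth(2)[OF B, of \<alpha>] by simp
  then show ?thesis
  proof (rule Bochner_Integration.integrable_bound)
    show "AE x in lborel. norm (B x $ \<alpha> \<bullet> grad \<phi> x) \<le> norm (K * norm (B x $ \<alpha>))"
      using K by (intro AE_I2) (auto intro!: order_trans[OF Cauchy_Schwarz_ineq2] simp: mult.commute mult_right_mono abs_of_pos)
  qed measurable
qed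

text \<open>Each component gets its own test function; summation over \<alpha> produces the
  Frobenius inner product of the flux with a full gradient.\<close>

lemma eqn_system:
  assumes \<psi>: "\<And>\<alpha>. test_function U (\<psi> \<alpha>)"
  shows "(LBINT x. A x \<bullet> (\<chi> \<alpha>. grad (\<psi> \<alpha>) x)) = - (LBINT x. f x \<bullet> (\<chi> \<alpha>. \<psi> \<alpha> x))"
proof -
  have i1: "integrable lborel (\<lambda>x. A x $ \<alpha> \<bullet> grad (\<psi> \<alpha>) x)" for \<alpha>
    by (rule integrable_nth_inner_grad[OF \<psi> integrable_A])
  have i2: "integrable lborel (\<lambda>x. f x $ \<alpha> * \<psi> \<alpha> x)" for \<alpha>
    using integrable_test_function_scaleR[OF \<psi> integral_nth(2)[OF integrable_data(3)], of \<alpha> \<alpha>] by (simp add: mult.commute)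
  have "(LBINT x. A x \<bullet> (\<chi> \<alpha>. grad (\<psi> \<alpha>) x)) = (LBINT x. (\<Sum>\<alpha>\<in>UNIV. A x $ \<alpha> \<bullet> grad (\<psi> \<alpha>) x))"
    by (subst inner_vec_def) simp
  also have "\<dots> = (\<Sum>\<alpha>\<in>UNIV. LBINT x. A x $ \<alpha> \<bullet> grad (\<psi> \<alpha>) x)" using i1 by simp
  also have "\<dots> = (\<Sum>\<alpha>\<in>UNIV. - (LBINT x. f x $ \<alpha> * \<psi> \<alpha> x))"
    using eqn[OF \<psi>] by (simp add: A_def)
  also have "\<dots> = - (LBINT x. (\<Sum>\<alpha>\<in>UNIV. f x $ \<alpha> * \<psi> \<alpha> x))" using i2 by (simp add: sum_negf)
  finally show ?thesis by (simp add: inner_vec_def)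
qed

lemma integrable_inner_grad:
  fixes B :: "real^'n \<Rightarrow> real^'n^'N"
  assumes \<psi>: "\<And>\<alpha>. test_function S (\<psi> \<alpha>)" and B: "integrable lborel B"
  shows "integrable lborel (\<lambda>x. B x \<bullet> (\<chi> \<alpha>. grad (\<psi> \<alpha>) x))"
  using integrable_nth_inner_grad[OF \<psi> B] by (subst inner_vec_def) (simp add: Bochner_Integration.integrable_sum)

lemma integrable_inner_test:
  fixes b :: "real^'n \<Rightarrow> real^'N"
  assumes \<psi>: "\<And>\<alpha>. test_function S (\<psi> \<alpha>)" and b: "integrable lborel b"
  shows "integrable lborel (\<lambda>x. b x \<bullet> (\<chi> \<alpha>. \<psi> \<alpha> x))"
  using integrable_test_function_scaleR[OF \<psi> integral_nth(2)[OF b]]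
  by (simp add: inner_vec_def mult.commute Bochner_Integration.integrable_sum)

text \<open>The shifted equation is the original one tested with \<psi>(x - h), so the translate of
  the test function has to be admissible as well.\<close>

lemma eqn_difference:
  assumes \<psi>: "\<And>\<alpha>. test_function U (\<psi> \<alpha>)" "\<And>\<alpha>. test_function U (\<lambda>x. \<psi> \<alpha> (x - h))"
  shows "(LBINT x. (A (x + h) - A x) \<bullet> (\<chi> \<alpha>. grad (\<psi> \<alpha>) x)) = - (LBINT x. (f (x + h) - f x) \<bullet> (\<chi> \<alpha>. \<psi> \<alpha> x))"
proof -
  have [measurable]: "\<psi> \<alpha> \<in> borel_measurable borel" "grad (\<psi> \<alpha>) \<in> borel_measurable borel" for \<alpha>
    by (rule smooth_measurable[OF test_function_smooth[OF \<psi>(1)]], rule grad_measurable[OF test_function_smooth[OF \<psi>(1)]])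
  have [measurable]: "(\<lambda>x. \<chi> \<alpha>. grad (\<psi> \<alpha>) x) \<in> borel_measurable borel" "(\<lambda>x. \<chi> \<alpha>. \<psi> \<alpha> x) \<in> borel_measurable borel"
    by (rule measurable_vec_lambda, measurable)+
  have g: "grad (\<lambda>x. \<psi> \<alpha> (x - h)) x = grad (\<psi> \<alpha>) (x - h)" for \<alpha> x
    using dderiv_translate[OF test_function_smooth[OF \<psi>(1)], of _ \<alpha> "- h" x] by (simp add: vec_eq_iff grad_nth)
  have e1: "(LBINT x. A x \<bullet> (\<chi> \<alpha>. grad (\<psi> \<alpha>) (x - h))) = - (LBINT x. f x \<bullet> (\<chi> \<alpha>. \<psi> \<alpha> (x - h)))"
    using eqn_system[OF \<psi>(2)] unfolding g .
  have t1: "(LBINT x. A x \<bullet> (\<chi> \<alpha>. grad (\<psi> \<alpha>) (x - h))) = (LBINT x. A (x + h) \<bullet> (\<chi> \<alpha>. grad (\<psi> \<alpha>) x))"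
    using integral_translate[of "\<lambda>x. A x \<bullet> (\<chi> \<alpha>. grad (\<psi> \<alpha>) (x - h))" h] by simp
  have t2: "(LBINT x. f x \<bullet> (\<chi> \<alpha>. \<psi> \<alpha> (x - h))) = (LBINT x. f (x + h) \<bullet> (\<chi> \<alpha>. \<psi> \<alpha> x))"
    using integral_translate[of "\<lambda>x. f x \<bullet> (\<chi> \<alpha>. \<psi> \<alpha> (x - h))" h] by simp
  show ?thesis
    using e1 eqn_system[OF \<psi>(1)] unfolding t1 t2 inner_diff_left
    using integrable_inner_grad[OF \<psi>(1) integrable_A] integrable_inner_grad[OF \<psi>(1) integrable_translate[OF integrable_A, of h]]
      integrable_inner_test[OF \<psi>(1) integrable_data(3)] integrable_inner_test[OF \<psi>(1) integrable_translate[OF integrable_data(3), of h]]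
    by simp
qed

text \<open>Formally the test function is \<eta>^2 (u(x+h) - u(x)), whose gradient is the bracket on
  the left. As u is not smooth, its mollifications are used. On the support of \<eta> their
  derivatives are the mollified G, because shift and kernel radius are both at most r; bounded Lp
  norms and almost everywhere convergence give the limit.\<close>

lemma difference_identity:
  assumes \<eta>: "test_function U \<eta>" "\<And>x. 0 \<le> \<eta> x" "\<And>x. \<eta> x \<le> 1" and K: "compact K" "\<And>x. x \<notin> K \<Longrightarrow> \<eta> x = 0"
    and r: "r > 0" "\<And>x y. x \<in> K \<Longrightarrow> norm (y - x) \<le> 2 * r \<Longrightarrow> y \<in> U" and h: "norm h \<le> r"
  shows "(LBINT x. (A (x + h) - A x) \<bullet> ((\<eta> x)\<^sup>2 *\<^sub>R (G (x + h) - G x) + (2 * \<eta> x) *\<^sub>R outer (u (x + h) - u x) (grad \<eta> x)))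
     = - (LBINT x. (f (x + h) - f x) \<bullet> ((\<eta> x)\<^sup>2 *\<^sub>R (u (x + h) - u x)))"
proof -
  interpret outer: bounded_bilinear outer by (rule bounded_bilinear_outer)
  have sm\<eta>: "smooth \<eta>" by (rule test_function_smooth[OF \<eta>(1)])
  have [measurable]: "\<eta> \<in> borel_measurable borel" "grad \<eta> \<in> borel_measurable borel"
    by (rule smooth_measurable[OF sm\<eta>], rule grad_measurable[OF sm\<eta>])
  obtain D where D: "D > 0" "\<And>x. norm (grad \<eta> x) \<le> D" using grad_bounded[OF \<eta>(1)] by blast
  have mo: "(\<lambda>x. outer (a x) (b x)) \<in> borel_measurable borel"
    if [measurable]: "a \<in> borel_measurable borel" "b \<in> borel_measurable borel"
    for a :: "real^'n \<Rightarrow> real^'N" and b :: "real^'n \<Rightarrow> real^'n"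
    by (rule borel_measurable_continuous_Pair) (auto intro!: continuous_intros outer.continuous_on that)
  define s where "s n = r / real (Suc n)" for n
  have sp: "s n > 0" "s n \<le> r" for n using r by (auto simp: s_def divide_le_eq)
  have s0: "s \<longlonglongrightarrow> 0"
    using tendsto_mult[OF tendsto_const[of r] LIMSEQ_inverse_real_of_nat] by (simp add: s_def[abs_def] divide_inverse)
  obtain k1 :: "nat \<Rightarrow> nat" where k1: "strict_mono k1" "AE x in lborel. (\<lambda>n. conv u (moll (s (k1 n))) x) \<longlonglongrightarrow> u x"
    using conv_AE_subseq[OF integrable_data(1) sp(1) s0] by blast
  have s1: "(\<lambda>n. s (k1 n)) \<longlonglongrightarrow> 0" using LIMSEQ_subseq_LIMSEQ[OF s0 k1(1)] by (simp add: o_def)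
  obtain k2 :: "nat \<Rightarrow> nat" where k2: "strict_mono k2" "AE x in lborel. (\<lambda>n. conv G (moll (s (k1 (k2 n)))) x) \<longlonglongrightarrow> G x"
    using conv_AE_subseq[OF integrable_data(2) sp(1) s1] by blast
  define t where "t n = s (k1 (k2 n))" for n
  have t: "t n > 0" "t n \<le> r" for n using sp by (auto simp: t_def)
  define un Gn where "un n = conv u (moll (t n))" and "Gn n = conv G (moll (t n))" for n
  have un: "AE x in lborel. (\<lambda>n. un n x) \<longlonglongrightarrow> u x"
    using k1(2) by eventually_elim (use LIMSEQ_subseq_LIMSEQ[OF _ k2(1)] in \<open>force simp: un_def t_def o_def\<close>)
  have Gn: "AE x in lborel. (\<lambda>n. Gn n x) \<longlonglongrightarrow> G x" using k2(2) by (simp add: Gn_def t_def)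
  have [measurable]: "un n \<in> borel_measurable borel" "Gn n \<in> borel_measurable borel" for n
    unfolding un_def Gn_def by measurable
  define \<psi> where "\<psi> n \<alpha> x = (\<eta> x)\<^sup>2 * (un n (x + h) $ \<alpha> - un n x $ \<alpha>)" for n \<alpha> x
  define F where "F n x = (\<eta> x)\<^sup>2 *\<^sub>R (Gn n (x + h) - Gn n x) + (2 * \<eta> x) *\<^sub>R outer (un n (x + h) - un n x) (grad \<eta> x)" for n x
  have comp: "(\<lambda>x. un n x $ \<alpha>) = conv (\<lambda>x. u x $ \<alpha>) (moll (t n))" for n \<alpha>
    unfolding un_def by (rule ext) (rule conv_nth[OF integrable_data(1) test_function_moll[OF t(1)]])
  have smu: "smooth (\<lambda>x. un n x $ \<alpha>)" for n \<alpha>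
    unfolding comp by (rule smooth_conv[OF test_function_moll[OF t(1)] integral_nth(2)[OF integrable_data(1)]])
  have du: "dderiv (axis i 1) (\<lambda>x. un n x $ \<alpha>) y = Gn n y $ \<alpha> $ i" if "x \<in> K" "norm (y - x) \<le> r" for n \<alpha> i x y
  proof -
    have mz: "norm z \<le> t n" if "moll (t n) z \<noteq> 0" for z :: "real^'n"
      using that moll_eq_0[OF t(1)[of n], of z] by force
    have sub: "cball y (t n) \<subseteq> U"
    proof
      fix z assume "z \<in> cball y (t n)"
      then have "norm (z - x) \<le> 2 * r"
        using norm_triangle_ineq[of "z - y" "y - x"] that(2) t(2)[of n] by (simp add: dist_norm norm_minus_commute)
      then show "z \<in> U" by (rule r(2)[OF that(1)])
    qed
    have "dderiv (axis i 1) (\<lambda>x. un n x $ \<alpha>) y = conv (\<lambda>x. G x $ \<alpha> $ i) (moll (t n)) y"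
      unfolding comp dderiv_conv[OF test_function_moll[OF t(1)] integral_nth(2)[OF integrable_data(1)]]
      by (rule conv_weak_dderiv[OF wu test_function_moll[OF t(1)] mz sub])
    also have "\<dots> = Gn n y $ \<alpha> $ i"
      unfolding Gn_def conv_nth[OF integrable_data(2) test_function_moll[OF t(1)]]
        conv_nth[OF integral_nth(2)[OF integrable_data(2)] test_function_moll[OF t(1)]] ..
    finally show ?thesis .
  qed
  have sm\<psi>: "smooth (\<psi> n \<alpha>)" for n \<alpha>
    unfolding \<psi>_def[abs_def] power2_eq_square
    by (intro smooth_mult smooth_diff sm\<eta> smu smooth_translate[OF smu])
  have "K \<subseteq> U" using r(2)[of _ _] r(1) by (metis cancel_comm_monoid_add_class.diff_cancel mult_nonneg_nonneg norm_zero order_less_imp_le subsetI zero_le_numeral)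
  have t\<psi>: "test_function U (\<psi> n \<alpha>)" for n \<alpha>
    by (rule test_functionI[OF sm\<psi> K(1) \<open>K \<subseteq> U\<close>]) (simp add: \<psi>_def K(2))
  have t\<psi>h: "test_function U (\<lambda>x. \<psi> n \<alpha> (x - h))" for n \<alpha>
  proof (rule test_functionI)
    show "smooth (\<lambda>x. \<psi> n \<alpha> (x - h))" using smooth_translate[OF sm\<psi>, of n \<alpha> "- h"] by simp
    show "compact ((\<lambda>x. x + h) ` K)" by (intro compact_continuous_image continuous_intros K)
    show "(\<lambda>x. x + h) ` K \<subseteq> U"
    proof
      fix z assume "z \<in> (\<lambda>x. x + h) ` K"
      then obtain x where "x \<in> K" "z = x + h" by blast
      then show "z \<in> U" using h r(1) by (intro r(2)[of x]) auto
    qed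
    show "\<psi> n \<alpha> (x - h) = 0" if "x \<notin> (\<lambda>x. x + h) ` K" for x
    proof -
      have "x - h \<notin> K" using that by (metis diff_add_cancel image_eqI)
      then show ?thesis by (simp add: \<psi>_def K(2))
    qed
  qed
  have grad\<psi>: "(\<chi> \<alpha>. grad (\<psi> n \<alpha>) x) = F n x" for n x
  proof -
    have "dderiv (axis i 1) (\<psi> n \<alpha>) x = F n x $ \<alpha> $ i" for \<alpha> i
    proof -
      have sq: "smooth (\<lambda>x. \<eta> x * \<eta> x)" by (rule smooth_mult[OF sm\<eta> sm\<eta>])
      have "dderiv (axis i 1) (\<psi> n \<alpha>) x = (\<eta> x * \<eta> x) * (dderiv (axis i 1) (\<lambda>x. un n x $ \<alpha>) (x + h) - dderiv (axis i 1) (\<lambda>x. un n x $ \<alpha>) x)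
          + (\<eta> x * dderiv (axis i 1) \<eta> x + dderiv (axis i 1) \<eta> x * \<eta> x) * (un n (x + h) $ \<alpha> - un n x $ \<alpha>)"
        unfolding \<psi>_def[abs_def] power2_eq_square
        by (simp only: dderiv_mult[OF sq smooth_diff[OF smooth_translate[OF smu] smu]] dderiv_mult[OF sm\<eta> sm\<eta>]
            dderiv_diff[OF smooth_translate[OF smu] smu] dderiv_translate[OF smu])
      also have "\<dots> = F n x $ \<alpha> $ i"
      proof (cases "x \<in> K")
        case True
        have "dderiv (axis i 1) (\<lambda>x. un n x $ \<alpha>) (x + h) = Gn n (x + h) $ \<alpha> $ i"
          "dderiv (axis i 1) (\<lambda>x. un n x $ \<alpha>) x = Gn n x $ \<alpha> $ i"
          using h r(1) by (auto intro!: du[OF True])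
        then show ?thesis by (simp add: F_def outer_def grad_nth power2_eq_square algebra_simps)
      qed (simp add: F_def K(2))
      finally show ?thesis .
    qed
    then show ?thesis by (simp add: vec_eq_iff grad_nth)
  qed
  have key: "(LBINT x. (A (x + h) - A x) \<bullet> F n x) = - (LBINT x. (f (x + h) - f x) \<bullet> ((\<eta> x)\<^sup>2 *\<^sub>R (un n (x + h) - un n x)))" for n
  proof -
    have "(\<chi> \<alpha>. \<psi> n \<alpha> x) = (\<eta> x)\<^sup>2 *\<^sub>R (un n (x + h) - un n x)" for x by (simp add: vec_eq_iff \<psi>_def)
    then show ?thesis using eqn_difference[of "\<psi> n" h, OF t\<psi> t\<psi>h] unfolding grad\<psi> by simp
  qed
  have \<eta>2: "(\<eta> x)\<^sup>2 \<le> 1" for x using \<eta>(2,3) by (simp add: power_le_one)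
  have Bu: "LqB p (2 powr p * (Iq p u + Iq p u)) (\<lambda>x. un n (x + h) - un n x)" for n
    unfolding un_def using pp by (intro LqB_diff LqB_translate[of p "Iq p u"] LqB_conv L integrable_data t) auto
  have BG: "LqB p (2 powr p * (Iq p G + Iq p G)) (\<lambda>x. Gn n (x + h) - Gn n x)" for n
    unfolding Gn_def using pp by (intro LqB_diff LqB_translate[of p "Iq p G"] LqB_conv L integrable_data t) auto
  have B1: "LqB p (1 powr p * (2 powr p * (Iq p u + Iq p u))) (\<lambda>x. (\<eta> x)\<^sup>2 *\<^sub>R (un n (x + h) - un n x))" for n
    by (rule LqB_dominated[OF Bu[of n]]) (use \<eta>2 pp in \<open>auto intro!: mult_right_mono simp: mult_left_le_one_le\<close>)
  have B2: "LqB p (1 powr p * (2 powr p * (Iq p G + Iq p G))) (\<lambda>x. (\<eta> x)\<^sup>2 *\<^sub>R (Gn n (x + h) - Gn n x))" for n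
    by (rule LqB_dominated[OF BG[of n]]) (use \<eta>2 pp in \<open>auto intro!: mult_right_mono simp: mult_left_le_one_le\<close>)
  have B3: "LqB p ((2 * D) powr p * (2 powr p * (Iq p u + Iq p u))) (\<lambda>x. (2 * \<eta> x) *\<^sub>R outer (un n (x + h) - un n x) (grad \<eta> x))" for n
  proof (rule LqB_dominated[OF Bu[of n]])
    fix x
    have "\<eta> x * norm (grad \<eta> x) \<le> 1 * D" using \<eta>(2,3) D by (intro mult_mono) auto
    from mult_left_mono[OF this, of "2 * norm (un n (x + h) - un n x)"]
    show "norm ((2 * \<eta> x) *\<^sub>R outer (un n (x + h) - un n x) (grad \<eta> x)) \<le> 2 * D * norm (un n (x + h) - un n x)"
      using \<eta>(2)[of x] by (simp add: norm_outer abs_mult mult_ac)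
  qed (use D pp in \<open>auto intro!: borel_measurable_scaleR mo\<close>)
  obtain BF where BF: "\<And>n. LqB p BF (F n)"
    unfolding F_def using LqB_add[OF B2 B3] pp by blast
  have lim1: "AE x in lborel. (\<lambda>n. (\<eta> x)\<^sup>2 *\<^sub>R (un n (x + h) - un n x)) \<longlonglongrightarrow> (\<eta> x)\<^sup>2 *\<^sub>R (u (x + h) - u x)"
    using un AE_translate[OF un, of h] by eventually_elim (intro tendsto_intros)
  have lim2: "AE x in lborel. (\<lambda>n. F n x) \<longlonglongrightarrow> (\<eta> x)\<^sup>2 *\<^sub>R (G (x + h) - G x) + (2 * \<eta> x) *\<^sub>R outer (u (x + h) - u x) (grad \<eta> x)"
    using un AE_translate[OF un, of h] Gn AE_translate[OF Gn, of h]
    unfolding F_def by eventually_elim (intro tendsto_intros outer.tendsto)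
  have LAd: "Lq p' (\<lambda>x. A (x + h) - A x)" by (rule Lq_diff(1)[OF Lq_translate(1)[OF LA] LA pp(6)])
  have Lfd: "Lq p' (\<lambda>x. f (x + h) - f x)" by (rule Lq_diff(1)[OF Lq_translate(1)[OF L(3)] L(3) pp(6)])
  have l1: "(\<lambda>n. LBINT x. (A (x + h) - A x) \<bullet> F n x) \<longlonglongrightarrow>
      (LBINT x. (A (x + h) - A x) \<bullet> ((\<eta> x)\<^sup>2 *\<^sub>R (G (x + h) - G x) + (2 * \<eta> x) *\<^sub>R outer (u (x + h) - u x) (grad \<eta> x)))"
    by (rule pairing_tendsto_LqB[OF bounded_bilinear_inner BF LAd _ lim2 pp(1,2,3)])
       (auto intro!: borel_measurable_add borel_measurable_scaleR mo)
  have l2: "(\<lambda>n. - (LBINT x. (f (x + h) - f x) \<bullet> ((\<eta> x)\<^sup>2 *\<^sub>R (un n (x + h) - un n x)))) \<longlonglongrightarrow>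
      - (LBINT x. (f (x + h) - f x) \<bullet> ((\<eta> x)\<^sup>2 *\<^sub>R (u (x + h) - u x)))"
    by (intro tendsto_minus pairing_tendsto_LqB[OF bounded_bilinear_inner B1 Lfd _ lim1 pp(1,2,3)]) measurable
  show ?thesis using LIMSEQ_unique[OF l1[unfolded key] l2] .
qed

text \<open>Difference quotient method. Monotonicity bounds the main term below by a multiple of the
  squared increment of V. In the cutoff term the increment of A is at most \<open>KA\<close> m^c
  times that of V, and Young's inequality absorbs half of the main term. What remains is quadratic
  in h: the increments of u and of f are both controlled by gradients.\<close>

lemma localized_V_difference_bound:
  assumes \<eta>: "test_function U \<eta>" "\<And>x. 0 \<le> \<eta> x" "\<And>x. \<eta> x \<le> 1" and K: "compact K" "\<And>x. x \<notin> K \<Longrightarrow> \<eta> x = 0"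
    and r: "r > 0" "\<And>x y. x \<in> K \<Longrightarrow> norm (y - x) \<le> 2 * r \<Longrightarrow> y \<in> U"
  shows "\<exists>M\<ge>0. \<forall>h. norm h \<le> r \<longrightarrow> Iq 2 (\<lambda>x. \<eta> x *\<^sub>R (V (x + h) - V x)) \<le> M * (norm h)\<^sup>2"
proof -
  interpret outer: bounded_bilinear outer by (rule bounded_bilinear_outer)
  have sm\<eta>: "smooth \<eta>" by (rule test_function_smooth[OF \<eta>(1)])
  have [measurable]: "\<eta> \<in> borel_measurable borel" "grad \<eta> \<in> borel_measurable borel" "K \<in> sets borel"
    using smooth_measurable[OF sm\<eta>] grad_measurable[OF sm\<eta>] K(1) by (auto simp: compact_imp_closed)
  obtain D where D: "D > 0" "\<And>x. norm (grad \<eta> x) \<le> D" using grad_bounded[OF \<eta>(1)] by blast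
  have mo: "(\<lambda>x. outer (a x) (b x)) \<in> borel_measurable borel"
    if [measurable]: "a \<in> borel_measurable borel" "b \<in> borel_measurable borel"
    for a :: "real^'n \<Rightarrow> real^'N" and b :: "real^'n \<Rightarrow> real^'n"
    by (rule borel_measurable_continuous_Pair) (auto intro!: continuous_intros outer.continuous_on that)
  define k0 where "k0 = 4 / p\<^sup>2"
  have k0: "k0 > 0" using p3 by (simp add: k0_def)
  \<comment> \<open>The factor 2 / k0 is what Young's inequality leaves when k0 / 2 is spent on the
    absorbed term.\<close>
  define C2 where "C2 = 2 / k0 * (KA * D)\<^sup>2"
  have C2: "C2 \<ge> 0" using k0 by (simp add: C2_def)
  define M where "M = 2 / k0 * (C2 * (2 * Iq 2 V + Iq p G) + (Iq p' g + Iq p G))"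
  have "Iq 2 (\<lambda>x. \<eta> x *\<^sub>R (V (x + h) - V x)) \<le> M * (norm h)\<^sup>2" if hr: "norm h \<le> r" and h0: "h \<noteq> 0" for h
  proof -
    let ?H = "norm h"
    have H: "?H > 0" using h0 by simp
    define m where "m x = max (norm (V (x + h))) (norm (V x))" for x
    define du df where "du x = indicator K x *\<^sub>R ((1 / ?H) *\<^sub>R (u (x + h) - u x))"
      and "df x = indicator K x *\<^sub>R ((1 / ?H) *\<^sub>R (f (x + h) - f x))" for x
    have sub: "cball (x + s *\<^sub>R h) r \<subseteq> U" if "x \<in> K" "0 \<le> s" "s \<le> 1" for x s
    proof
      fix z assume "z \<in> cball (x + s *\<^sub>R h) r"
      then have "norm (z - x) \<le> r + norm (s *\<^sub>R h)"
        using norm_triangle_ineq[of "z - (x + s *\<^sub>R h)" "s *\<^sub>R h"] by (simp add: dist_norm norm_minus_commute)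
      also have "norm (s *\<^sub>R h) \<le> r" using that hr mult_left_le_one_le[of "norm h" s] by simp
      finally show "z \<in> U" using r(2)[OF that(1), of z] by simp
    qed
    have du: "LqB p (Iq p G) du"
      unfolding du_def by (rule LqB_difference_quotient[OF integrable_data(1,2) L(2) wu U(1) _ r(1) sub pp(1) h0]) measurable
    have df: "LqB p' (Iq p' g) df"
      unfolding df_def by (rule LqB_difference_quotient[OF integrable_data(3,4) L(4) wf U(1) _ r(1) sub pp(2) h0]) measurable
    define a1 a2 a3 dV where "a1 x = (A (x + h) - A x) \<bullet> ((\<eta> x)\<^sup>2 *\<^sub>R (G (x + h) - G x))"
      and "a2 x = (A (x + h) - A x) \<bullet> ((2 * \<eta> x) *\<^sub>R outer (u (x + h) - u x) (grad \<eta> x))"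
      and "a3 x = (f (x + h) - f x) \<bullet> ((\<eta> x)\<^sup>2 *\<^sub>R (u (x + h) - u x))"
      and "dV x = norm (\<eta> x *\<^sub>R (V (x + h) - V x)) powr 2" for x
    have \<eta>2: "(\<eta> x)\<^sup>2 \<le> 1" for x using \<eta>(2,3) by (simp add: power_le_one)
    have LAd: "Lq p' (\<lambda>x. A (x + h) - A x)" by (rule Lq_diff(1)[OF Lq_translate(1)[OF LA] LA pp(6)])
    have Lfd: "Lq p' (\<lambda>x. f (x + h) - f x)" by (rule Lq_diff(1)[OF Lq_translate(1)[OF L(3)] L(3) pp(6)])
    have LGd: "Lq p (\<lambda>x. G (x + h) - G x)" by (rule Lq_diff(1)[OF Lq_translate(1)[OF L(2)] L(2) pp(5)])
    have Lud: "Lq p (\<lambda>x. u (x + h) - u x)" by (rule Lq_diff(1)[OF Lq_translate(1)[OF L(1)] L(1) pp(5)])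
    have LVd: "Lq 2 (\<lambda>x. V (x + h) - V x)" by (rule Lq_diff(1)[OF Lq_translate(1)[OF LV] LV]) simp
    have "Lq p (\<lambda>x. (\<eta> x)\<^sup>2 *\<^sub>R (G (x + h) - G x))"
      by (rule Lq_dominated(1)[OF LGd, of _ 1]) (use \<eta>2 pp in \<open>auto simp: mult_left_le_one_le\<close>)
    then have i1: "integrable lborel a1" unfolding a1_def by (rule Lq_prod_integrable[OF bounded_bilinear_inner LAd _ pp(2,1,4)])
    have "Lq p (\<lambda>x. (2 * \<eta> x) *\<^sub>R outer (u (x + h) - u x) (grad \<eta> x))"
    proof (rule Lq_dominated(1)[OF Lud, of _ "2 * D"])
      fix x
      have "\<eta> x * norm (grad \<eta> x) \<le> 1 * D" using \<eta>(2,3) D by (intro mult_mono) auto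
      from mult_left_mono[OF this, of "2 * norm (u (x + h) - u x)"]
      show "norm ((2 * \<eta> x) *\<^sub>R outer (u (x + h) - u x) (grad \<eta> x)) \<le> 2 * D * norm (u (x + h) - u x)"
        using \<eta>(2)[of x] by (simp add: norm_outer abs_mult mult_ac)
    qed (use D pp in \<open>auto intro!: borel_measurable_scaleR mo\<close>)
    then have i2: "integrable lborel a2" unfolding a2_def by (rule Lq_prod_integrable[OF bounded_bilinear_inner LAd _ pp(2,1,4)])
    have "Lq p (\<lambda>x. (\<eta> x)\<^sup>2 *\<^sub>R (u (x + h) - u x))"
      by (rule Lq_dominated(1)[OF Lud, of _ 1]) (use \<eta>2 pp in \<open>auto simp: mult_left_le_one_le\<close>)
    then have i3: "integrable lborel a3" unfolding a3_def by (rule Lq_prod_integrable[OF bounded_bilinear_inner Lfd _ pp(2,1,4)])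
    have "Lq 2 (\<lambda>x. \<eta> x *\<^sub>R (V (x + h) - V x))"
      by (rule Lq_dominated(1)[OF LVd, of _ 1]) (use \<eta> in \<open>auto simp: mult_left_le_one_le\<close>)
    then have iV: "integrable lborel dV" unfolding dV_def by (rule Lq_integrable)
    have id: "(LBINT x. a1 x) = - (LBINT x. a2 x) - (LBINT x. a3 x)"
    proof -
      have "(LBINT x. a1 x + a2 x) = - (LBINT x. a3 x)"
        unfolding a1_def a2_def a3_def inner_add_right[symmetric] by (rule difference_identity[OF \<eta> K r hr])
      then show ?thesis using i1 i2 by simp
    qed
    have p1: "k0 * dV x \<le> a1 x" for x
    proof -
      have "k0 * (norm (V (x + h) - V x))\<^sup>2 \<le> (A (x + h) - A x) \<bullet> (G (x + h) - G x)"
        unfolding k0_def A_def V_def using p3 by (intro rad_monotone) simp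
      from mult_left_mono[OF this, of "(\<eta> x)\<^sup>2"]
      show ?thesis unfolding dV_def a1_def norm_powr_2 by (simp add: power_mult_distrib mult_ac)
    qed
    have p2: "- a2 x \<le> k0 / 2 * dV x + C2 * ?H\<^sup>2 * (norm (V (x + h)) powr 2 + norm (V x) powr 2 + norm (du x) powr p)" for x
    proof (cases "x \<in> K")
      case True
      have du': "norm (u (x + h) - u x) = ?H * norm (du x)" using True H by (simp add: du_def)
      let ?a = "\<eta> x * norm (V (x + h) - V x)" and ?b = "KA * D * (m x powr c * norm (u (x + h) - u x))"
      have "- a2 x \<le> norm (A (x + h) - A x) * norm ((2 * \<eta> x) *\<^sub>R outer (u (x + h) - u x) (grad \<eta> x))"
        unfolding a2_def using Cauchy_Schwarz_ineq2[of "A (x + h) - A x" "(2 * \<eta> x) *\<^sub>R outer (u (x + h) - u x) (grad \<eta> x)"] by linarith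
      also have "\<dots> \<le> (KA * m x powr c * norm (V (x + h) - V x)) * (2 * \<eta> x * (norm (u (x + h) - u x) * D))"
      proof (rule mult_mono)
        show "norm (A (x + h) - A x) \<le> KA * m x powr c * norm (V (x + h) - V x)" unfolding m_def by (rule A_diff_le)
        show "norm ((2 * \<eta> x) *\<^sub>R outer (u (x + h) - u x) (grad \<eta> x)) \<le> 2 * \<eta> x * (norm (u (x + h) - u x) * D)"
          unfolding norm_scaleR norm_outer using \<eta>(2)[of x] D(2)[of x] by (auto simp: abs_mult intro!: mult_left_mono)
      qed (use KA in \<open>auto intro!: mult_nonneg_nonneg\<close>)
      also have "\<dots> = 2 * (?a * ?b)" by (simp add: mult_ac)
      also have "\<dots> \<le> k0 / 2 * ?a\<^sup>2 + 2 / k0 * ?b\<^sup>2"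
      proof -
        have "0 \<le> (k0 * ?a - 2 * ?b)\<^sup>2 / (2 * k0)" using k0 by simp
        also have "\<dots> = k0 / 2 * ?a\<^sup>2 + 2 / k0 * ?b\<^sup>2 - 2 * (?a * ?b)"
          using k0 by (simp add: power2_diff power2_eq_square field_simps)
        finally show ?thesis by simp
      qed
      also have "k0 / 2 * ?a\<^sup>2 = k0 / 2 * dV x" unfolding dV_def norm_powr_2 by (simp add: power_mult_distrib)
      finally have 1: "- a2 x \<le> k0 / 2 * dV x + 2 / k0 * ?b\<^sup>2" .
      have 2: "?b\<^sup>2 = (KA * D)\<^sup>2 * ?H\<^sup>2 * ((m x powr c)\<^sup>2 * (norm (du x))\<^sup>2)"
        unfolding du' by (simp add: power_mult_distrib)
      \<comment> \<open>With s = m^(2/p) the left side is s^(p-2) |du|^2 and m^2 is s^p; the larger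
        of s and |du| dominates the product by its p-th power.\<close>
      have "(m x powr c)\<^sup>2 * (norm (du x))\<^sup>2 \<le> m x powr 2 + norm (du x) powr p"
      proof -
        let ?s = "m x powr (2 / p)"
        have m0: "m x \<ge> 0" by (simp add: m_def le_max_iff_disj)
        have ex: "2 / p * (p - 2) = c + c" "2 / p * p = 2" using p3 by (simp_all add: right_diff_distrib)
        have e: "(m x powr c)\<^sup>2 = ?s powr (p - 2)" "m x powr 2 = ?s powr p"
          unfolding powr_powr ex by (simp_all only: power2_eq_square powr_add)
        show ?thesis
        proof (cases "norm (du x) \<le> ?s")
          case True
          have "?s powr (p - 2) * (norm (du x))\<^sup>2 \<le> ?s powr (p - 2) * ?s\<^sup>2"
            using True by (intro mult_left_mono power_mono) auto
          also have "\<dots> = ?s powr p" by (cases "m x = 0") (simp_all add: powr_diff powr_numeral)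
          finally show ?thesis unfolding e by (rule add_increasing2[OF powr_ge_zero])
        next
          case False
          then have d: "norm (du x) > 0" by (smt (verit) powr_ge_zero)
          have "?s powr (p - 2) * (norm (du x))\<^sup>2 \<le> norm (du x) powr (p - 2) * (norm (du x))\<^sup>2"
            using False p3 by (intro mult_right_mono powr_mono2) auto
          also have "\<dots> = norm (du x) powr p" using d by (simp add: powr_diff powr_numeral)
          finally show ?thesis unfolding e by (rule add_increasing[OF powr_ge_zero])
        qed
      qed
      moreover have "m x powr 2 \<le> norm (V (x + h)) powr 2 + norm (V x) powr 2" by (simp add: m_def max_def)
      ultimately have 3: "(m x powr c)\<^sup>2 * (norm (du x))\<^sup>2 \<le> norm (V (x + h)) powr 2 + norm (V x) powr 2 + norm (du x) powr p"
        by linarith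
      have "2 / k0 * ?b\<^sup>2 \<le> 2 / k0 * ((KA * D)\<^sup>2 * ?H\<^sup>2 * (norm (V (x + h)) powr 2 + norm (V x) powr 2 + norm (du x) powr p))"
        unfolding 2 using k0 by (intro mult_left_mono 3) auto
      also have "\<dots> = C2 * ?H\<^sup>2 * (norm (V (x + h)) powr 2 + norm (V x) powr 2 + norm (du x) powr p)"
        by (simp add: C2_def)
      finally show ?thesis using 1 by linarith
    next
      case False
      then have "a2 x = 0" by (simp add: a2_def K(2))
      moreover have "dV x \<ge> 0" by (simp add: dV_def)
      ultimately show ?thesis using k0 C2 by (auto intro!: add_nonneg_nonneg mult_nonneg_nonneg)
    qed
    have p3': "- a3 x \<le> ?H\<^sup>2 * (norm (df x) powr p' + norm (du x) powr p)" for x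
    proof (cases "x \<in> K")
      case True
      have du': "norm (u (x + h) - u x) = ?H * norm (du x)" "norm (f (x + h) - f x) = ?H * norm (df x)" using True H by (simp_all add: du_def df_def)
      have "- a3 x \<le> norm (f (x + h) - f x) * norm ((\<eta> x)\<^sup>2 *\<^sub>R (u (x + h) - u x))"
        unfolding a3_def using Cauchy_Schwarz_ineq2[of "f (x + h) - f x" "(\<eta> x)\<^sup>2 *\<^sub>R (u (x + h) - u x)"] by linarith
      also have "\<dots> \<le> norm (f (x + h) - f x) * norm (u (x + h) - u x)"
        using \<eta>2 by (intro mult_left_mono) (auto simp: mult_left_le_one_le)
      also have "\<dots> = ?H\<^sup>2 * (norm (df x) * norm (du x))" unfolding du' by (simp add: power2_eq_square)
      also have "\<dots> \<le> ?H\<^sup>2 * (norm (df x) powr p' + norm (du x) powr p)"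
        by (intro mult_left_mono Youngs_le pp norm_ge_zero) auto
      finally show ?thesis .
    next
      case False
      then have "a3 x = 0" by (simp add: a3_def K(2))
      then show ?thesis by (auto intro!: add_nonneg_nonneg mult_nonneg_nonneg)
    qed
    have iu: "integrable lborel (\<lambda>x. norm (du x) powr p)" "integrable lborel (\<lambda>x. norm (df x) powr p')"
      "integrable lborel (\<lambda>x. norm (V x) powr 2)" "integrable lborel (\<lambda>x. norm (V (x + h)) powr 2)"
      using du df Lq_integrable[OF LV] Lq_integrable[OF Lq_translate(1)[OF LV]] Lq_integrable unfolding LqB_def by auto
    have "k0 * (LBINT x. dV x) = (LBINT x. k0 * dV x)" by simp
    also have "\<dots> \<le> (LBINT x. a1 x)" using iV i1 p1 by (intro integral_mono) auto
    also have "\<dots> = (LBINT x. - a2 x) + (LBINT x. - a3 x)" unfolding id by simp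
    also have "(LBINT x. - a2 x) \<le> (LBINT x. k0 / 2 * dV x + C2 * ?H\<^sup>2 * (norm (V (x + h)) powr 2 + norm (V x) powr 2 + norm (du x) powr p))"
      using i2 iV iu p2 by (intro integral_mono Bochner_Integration.integrable_add integrable_mult_right integrable_minus) auto
    also have "\<dots> = k0 / 2 * (LBINT x. dV x) + C2 * ?H\<^sup>2 * (Iq 2 (\<lambda>x. V (x + h)) + Iq 2 V + Iq p du)"
      using iV iu by simp
    also have "(LBINT x. - a3 x) \<le> (LBINT x. ?H\<^sup>2 * (norm (df x) powr p' + norm (du x) powr p))"
      using i3 iu p3' by (intro integral_mono Bochner_Integration.integrable_add integrable_mult_right integrable_minus) auto
    also have "\<dots> = ?H\<^sup>2 * (Iq p' df + Iq p du)" using iu by simp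
    finally have "k0 / 2 * (LBINT x. dV x) \<le> C2 * ?H\<^sup>2 * (Iq 2 (\<lambda>x. V (x + h)) + Iq 2 V + Iq p du) + ?H\<^sup>2 * (Iq p' df + Iq p du)"
      by simp
    also have "\<dots> \<le> C2 * ?H\<^sup>2 * (Iq 2 V + Iq 2 V + Iq p G) + ?H\<^sup>2 * (Iq p' g + Iq p G)"
      using du df C2 unfolding LqB_def Lq_translate(2)[OF LV] by (intro add_mono mult_left_mono) auto
    finally have "k0 / 2 * (LBINT x. dV x) \<le> k0 / 2 * (M * ?H\<^sup>2)"
      unfolding M_def using k0 by (simp add: algebra_simps)
    then have "(LBINT x. dV x) \<le> M * ?H\<^sup>2" using k0 by (simp only: mult_le_cancel_left_pos half_gt_zero)
    then show ?thesis unfolding dV_def .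
  qed
  note main = this
  have "M \<ge> 0" unfolding M_def using k0 C2 by (auto intro!: add_nonneg_nonneg mult_nonneg_nonneg Iq_nonneg)
  then show ?thesis
  proof (intro exI[of _ M] conjI allI impI)
    fix h :: "real^'n" assume "norm h \<le> r"
    then show "Iq 2 (\<lambda>x. \<eta> x *\<^sub>R (V (x + h) - V x)) \<le> M * (norm h)\<^sup>2"
      using main[of h] by (cases "h = 0") simp_all
  qed
qed

text \<open>For |h| \<le> r the product rule for differences reduces to the localized bound. For |h|
  > r the trivial bound 4B is at most (4B / r^2) |h|^2. All h are covered because the
  differentiability argument works with translates on the whole space.\<close>

lemma cutoff_V_lipschitz:
  assumes \<eta>: "test_function U \<eta>" "\<And>x. 0 \<le> \<eta> x" "\<And>x. \<eta> x \<le> 1"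
  obtains M where "\<And>h. Iq 2 (\<lambda>x. \<eta> (x + h) *\<^sub>R V (x + h) - \<eta> x *\<^sub>R V x) \<le> M * (norm h)\<^sup>2"
proof -
  have [measurable]: "\<eta> \<in> borel_measurable borel" by (rule smooth_measurable[OF test_function_smooth[OF \<eta>(1)]])
  obtain K where K: "compact K" "K \<subseteq> U" "\<And>x. x \<notin> K \<Longrightarrow> \<eta> x = 0" using test_functionE[OF \<eta>(1)] by metis
  obtain r where r: "r > 0" "\<And>x y. x \<in> K \<Longrightarrow> norm (y - x) \<le> 2 * r \<Longrightarrow> y \<in> U"
    using compact_margin[OF K(1,2) U(1)] by metis
  from localized_V_difference_bound[OF \<eta> K(1,3) r]
  obtain M where "M \<ge> 0 \<and> (\<forall>h. norm h \<le> r \<longrightarrow> Iq 2 (\<lambda>x. \<eta> x *\<^sub>R (V (x + h) - V x)) \<le> M * (norm h)\<^sup>2)" ..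
  then have M: "M \<ge> 0" "\<And>h. norm h \<le> r \<Longrightarrow> Iq 2 (\<lambda>x. \<eta> x *\<^sub>R (V (x + h) - V x)) \<le> M * (norm h)\<^sup>2"
    by simp_all
  obtain D where D: "D > 0" "\<And>x h. \<bar>\<eta> (x + h) - \<eta> x\<bar> \<le> D * norm h" using test_function_lipschitz[OF \<eta>(1)] by blast
  have L\<eta>: "Lq 2 (\<lambda>x. \<eta> x *\<^sub>R W x)" if W: "Lq 2 W" for W :: "real^'n \<Rightarrow> real^'n^'N"
    by (rule Lq_dominated(1)[OF W, of _ 1]) (use \<eta> Lq_measurable[OF W] in \<open>auto simp: mult_left_le_one_le\<close>)
  have LVd: "Lq 2 (\<lambda>x. V (x + h) - V x)" for h by (rule Lq_diff(1)[OF Lq_translate(1)[OF LV] LV]) simp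
  define B where "B = Iq 2 (\<lambda>x. \<eta> x *\<^sub>R V x)"
  have B: "B \<ge> 0" unfolding B_def by (rule Iq_nonneg)
  show ?thesis
  proof (rule that[of "2 * M + 2 * (D\<^sup>2 * Iq 2 V) + 4 * B / r\<^sup>2"])
    fix h :: "real^'n"
    show "Iq 2 (\<lambda>x. \<eta> (x + h) *\<^sub>R V (x + h) - \<eta> x *\<^sub>R V x) \<le> (2 * M + 2 * (D\<^sup>2 * Iq 2 V) + 4 * B / r\<^sup>2) * (norm h)\<^sup>2"
    proof (cases "norm h \<le> r")
      case True
      have Ld: "Lq 2 (\<lambda>x. (\<eta> (x + h) - \<eta> x) *\<^sub>R V (x + h))" "Iq 2 (\<lambda>x. (\<eta> (x + h) - \<eta> x) *\<^sub>R V (x + h)) \<le> (D * norm h) powr 2 * Iq 2 (\<lambda>x. V (x + h))"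
        by (rule Lq_dominated[OF Lq_translate(1)[OF LV, of h], of _ "D * norm h"]; use D in \<open>auto intro!: mult_right_mono simp del: Lq_translate\<close>)+
      have "Iq 2 (\<lambda>x. \<eta> (x + h) *\<^sub>R V (x + h) - \<eta> x *\<^sub>R V x)
          = Iq 2 (\<lambda>x. \<eta> x *\<^sub>R (V (x + h) - V x) + (\<eta> (x + h) - \<eta> x) *\<^sub>R V (x + h))"
        by (simp add: algebra_simps)
      also have "\<dots> \<le> 2 * Iq 2 (\<lambda>x. \<eta> x *\<^sub>R (V (x + h) - V x)) + 2 * Iq 2 (\<lambda>x. (\<eta> (x + h) - \<eta> x) *\<^sub>R V (x + h))"
        by (rule Iq2_add_le[OF L\<eta>[OF LVd] Ld(1)])
      also have "\<dots> \<le> 2 * (M * (norm h)\<^sup>2) + 2 * ((D * norm h) powr 2 * Iq 2 (\<lambda>x. V (x + h)))"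
        using M(2)[OF True] Ld(2) by (intro add_mono mult_left_mono) auto
      also have "\<dots> = (2 * M + 2 * (D\<^sup>2 * Iq 2 V)) * (norm h)\<^sup>2"
        unfolding Lq_translate(2)[OF LV] using D(1) by (simp add: power_mult_distrib powr_numeral algebra_simps)
      also have "\<dots> \<le> (2 * M + 2 * (D\<^sup>2 * Iq 2 V) + 4 * B / r\<^sup>2) * (norm h)\<^sup>2"
        using B by (intro mult_right_mono) auto
      finally show ?thesis .
    next
      case False
      have "Iq 2 (\<lambda>x. \<eta> (x + h) *\<^sub>R V (x + h) - \<eta> x *\<^sub>R V x) \<le> 2 * Iq 2 (\<lambda>x. \<eta> (x + h) *\<^sub>R V (x + h)) + 2 * Iq 2 (\<lambda>x. \<eta> x *\<^sub>R V x)"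
        by (rule Iq2_diff_le[OF Lq_translate(1)[OF L\<eta>[OF LV]] L\<eta>[OF LV]])
      also have "Iq 2 (\<lambda>x. \<eta> (x + h) *\<^sub>R V (x + h)) = B" unfolding B_def by (rule Lq_translate(2)[OF L\<eta>[OF LV]])
      also have "2 * B + 2 * Iq 2 (\<lambda>x. \<eta> x *\<^sub>R V x) = 4 * B / r\<^sup>2 * r\<^sup>2" using r(1) by (simp add: B_def)
      also have "\<dots> \<le> 4 * B / r\<^sup>2 * (norm h)\<^sup>2" using False r(1) B by (intro mult_left_mono power_mono) auto
      also have "\<dots> \<le> (2 * M + 2 * (D\<^sup>2 * Iq 2 V) + 4 * B / r\<^sup>2) * (norm h)\<^sup>2"
        using M(1) Iq_nonneg[of V 2] by (intro mult_right_mono) auto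
      finally show ?thesis .
    qed
  qed
qed

end

text \<open>Differentiability of R at the single point y is enough: the linearisation error is E(k
  n) times the norm of a convergent quotient, with E continuous and zero at 0.\<close>

lemma difference_quotient_chain:
  fixes R :: "'b::euclidean_space \<Rightarrow> 'c::euclidean_space" and t :: "nat \<Rightarrow> real"
  assumes R: "(R has_derivative R') (at y)" and t: "\<And>n. t n > 0" "t \<longlonglongrightarrow> 0"
    and d: "(\<lambda>n. (1 / t n) *\<^sub>R (z n - y)) \<longlonglongrightarrow> w"
  shows "(\<lambda>n. (1 / t n) *\<^sub>R (R (z n) - R y)) \<longlonglongrightarrow> R' w"
proof -
  interpret R': bounded_linear R' by (rule has_derivative_bounded_linear[OF R])
  define E where "E k = norm (R (y + k) - R y - R' k) / norm k" for k
  have "isCont E 0" using R unfolding has_derivative_at isCont_def by (simp add: E_def[abs_def] R'.zero)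
  define k where "k n = z n - y" for n
  have kd: "k n = t n *\<^sub>R ((1 / t n) *\<^sub>R (z n - y))" for n using t(1)[of n] by (simp add: k_def)
  have "(\<lambda>n. t n *\<^sub>R ((1 / t n) *\<^sub>R (z n - y))) \<longlonglongrightarrow> 0 *\<^sub>R w" by (intro tendsto_intros t d)
  then have k0: "k \<longlonglongrightarrow> 0" unfolding kd[symmetric] by simp
  have "(\<lambda>n. E (k n)) \<longlonglongrightarrow> E 0" by (rule isCont_tendsto_compose[OF \<open>isCont E 0\<close> k0])
  then have "(\<lambda>n. E (k n) * norm ((1 / t n) *\<^sub>R (z n - y))) \<longlonglongrightarrow> 0 * norm w"
    by (intro tendsto_mult tendsto_norm d) (simp add: E_def)
  then have Ed: "(\<lambda>n. E (k n) * norm ((1 / t n) *\<^sub>R (z n - y))) \<longlonglongrightarrow> 0" by simp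
  have "(\<lambda>n. (1 / t n) *\<^sub>R (R (z n) - R y) - R' ((1 / t n) *\<^sub>R (z n - y))) \<longlonglongrightarrow> 0"
  proof (rule Lim_null_comparison[OF always_eventually Ed], rule allI)
    fix n
    have "(1 / t n) *\<^sub>R (R (z n) - R y) - R' ((1 / t n) *\<^sub>R (z n - y)) = (1 / t n) *\<^sub>R (R (y + k n) - R y - R' (k n))"
    proof -
      have zk: "y + k n = z n" by (simp add: k_def)
      show ?thesis unfolding zk by (simp only: R'.scaleR scaleR_diff_right[symmetric] k_def)
    qed
    also have "norm \<dots> = E (k n) * norm ((1 / t n) *\<^sub>R (z n - y))"
    proof (cases "k n = 0")
      case False
      then show ?thesis using t(1)[of n] by (simp add: E_def k_def)
    qed (simp add: E_def k_def[symmetric] R'.zero)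
    finally show "norm ((1 / t n) *\<^sub>R (R (z n) - R y) - R' ((1 / t n) *\<^sub>R (z n - y))) \<le> E (k n) * norm ((1 / t n) *\<^sub>R (z n - y))" by simp
  qed
  from tendsto_add[OF this R'.tendsto[OF d]] show ?thesis by simp
qed

section \<open>Testing and mollifying weak derivatives\<close>

lemma weak_dderiv_nth:
  fixes w Y :: "'a::euclidean_space \<Rightarrow> 'b::euclidean_space^'N"
  assumes "weak_dderiv U v w Y" "integrable lborel w" "integrable lborel Y"
  shows "weak_dderiv U v (\<lambda>x. w x $ \<alpha>) (\<lambda>x. Y x $ \<alpha>)"
  unfolding weak_dderiv_def
proof (intro allI impI)
  fix \<phi> :: "'a \<Rightarrow> real" assume \<phi>: "test_function U \<phi>"
  have "(LBINT x. dderiv v \<phi> x *\<^sub>R w x) $ \<alpha> = (- (LBINT x. \<phi> x *\<^sub>R Y x)) $ \<alpha>"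
    using assms(1) \<phi> unfolding weak_dderiv_def by simp
  then show "(LBINT x. dderiv v \<phi> x *\<^sub>R w x $ \<alpha>) = - (LBINT x. \<phi> x *\<^sub>R Y x $ \<alpha>)"
    using integral_nth(1)[OF integrable_test_function_scaleR[OF test_function_dderiv[OF \<phi>] assms(2)], of v \<alpha>]
      integral_nth(1)[OF integrable_test_function_scaleR[OF \<phi> assms(3)], of \<alpha>] by simp
qed

lemma weak_dderivD:
  fixes w Y :: "'a::euclidean_space \<Rightarrow> real"
  assumes "weak_dderiv U v w Y" "test_function U \<phi>"
  shows "(LBINT x. w x * dderiv v \<phi> x) = - (LBINT x. Y x * \<phi> x)"
  using assms unfolding weak_dderiv_def by (simp add: mult.commute)

lemma inverse_seq: "(\<lambda>n. 1 / real (Suc n)) \<longlonglongrightarrow> 0"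
  using LIMSEQ_inverse_real_of_nat by (simp add: inverse_eq_divide)

text \<open>A mollified value at x in U is a pairing with a reflected kernel, a test function of U
  once the radius is small. So the mollifications vanish eventually, and w is their almost
  everywhere limit along a subsequence.\<close>

lemma fundamental_lemma:
  fixes w :: "'a::euclidean_space \<Rightarrow> real"
  assumes w: "integrable lborel w" and U: "open U"
    and z: "\<And>\<phi>. test_function U \<phi> \<Longrightarrow> (LBINT x. w x * \<phi> x) = 0"
  shows "AE x in lborel. x \<in> U \<longrightarrow> w x = 0"
proof -
  obtain k :: "nat \<Rightarrow> nat" where k: "strict_mono k" "AE x in lborel. (\<lambda>n. conv w (moll (1 / real (Suc (k n)))) x) \<longlonglongrightarrow> w x"
    using conv_AE_subseq[OF w _ inverse_seq] by auto
  have s0: "(\<lambda>n. 1 / real (Suc (k n))) \<longlonglongrightarrow> 0" using LIMSEQ_subseq_LIMSEQ[OF inverse_seq k(1)] by (simp add: o_def)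
  show ?thesis using k(2)
  proof eventually_elim
    case (elim x)
    show ?case
    proof
      assume "x \<in> U"
      then obtain r where r: "r > 0" "cball x r \<subseteq> U" using U open_contains_cball by blast
      have "\<forall>\<^sub>F n in sequentially. conv w (moll (1 / real (Suc (k n)))) x = 0"
        using order_tendstoD(2)[OF s0 r(1)]
      proof eventually_elim
        case (elim n)
        let ?t = "1 / real (Suc (k n))"
        have t: "?t > 0" by simp
        have mz: "norm z \<le> ?t" if "moll ?t z \<noteq> 0" for z :: 'a
          using that moll_eq_0[OF t, of z] by force
        have "cball x ?t \<subseteq> U" using r(2) elim by auto
        from z[OF test_function_reflect[OF test_function_moll[OF t] mz this]]
        show ?case by (simp add: conv_def mult.commute)
      qed
      then have "(\<lambda>n. conv w (moll (1 / real (Suc (k n)))) x) \<longlonglongrightarrow> 0" by (rule tendsto_eventually)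
      then show "w x = 0" using elim LIMSEQ_unique by blast
    qed
  qed
qed

text \<open>The convolution of the kernel with the indicator of a large ball is constantly 1 near x;
  its derivative at x is the integral in question.\<close>

lemma integral_dderiv_moll:
  assumes t: "t > 0" shows "(LBINT y. dderiv e (moll t) (x - y)) = 0" "integrable lborel (\<lambda>y. dderiv e (moll t) (x - y :: 'a::euclidean_space))"
proof -
  let ?\<rho> = "moll t :: 'a \<Rightarrow> real"
  \<comment> \<open>Radius 3t suffices: for |y - x| < t a kernel centred at y reaches less than 2t
    from x.\<close>
  define w where "w y = (indicator (cball x (3 * t)) y :: real)" for y
  have w: "integrable lborel w"
    unfolding w_def using bounded_finite_measure[OF bounded_cball[of x "3 * t"]] by (intro integrable_real_indicator) auto
  have td: "test_function UNIV (dderiv e ?\<rho>)" by (rule test_function_dderiv[OF test_function_moll[OF t]])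
  have dz: "dderiv e ?\<rho> z = 0" if "norm z > t" for z
    by (rule test_function_dderiv_eq_0[OF smooth_moll compact_cball[of 0 t]]) (use that moll_eq_0[OF t] in \<open>auto simp: not_le\<close>)
  have mz: "norm z \<le> t" if "moll t z \<noteq> 0" for z :: 'a using that moll_eq_0[OF t, of z] by force
  have c: "conv w ?\<rho> y = 1" if "norm (y - x) < t" for y
  proof -
    have z: "?\<rho> (y - z) *\<^sub>R w z = ?\<rho> (y - z)" for z
    proof (cases "?\<rho> (y - z) = 0")
      case False
      then have "norm (y - z) \<le> t" by (rule mz)
      then have "norm (x - z) \<le> 3 * t" using norm_triangle_ineq[of "x - y" "y - z"] that t by (simp add: norm_minus_commute)
      then show ?thesis by (simp add: w_def dist_norm)
    qed simp
    have "(\<integral>\<^sup>+z. ennreal (?\<rho> (y - z)) \<partial>lborel) = 1"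
      using nn_integral_reflect[of "\<lambda>z::'a. ennreal (moll t z)" y] nn_integral_moll[OF t, where 'a='a] by simp
    then show ?thesis unfolding conv_def z using t by (simp add: integral_eq_nn_integral moll_nonneg)
  qed
  have "(conv w ?\<rho> has_derivative (\<lambda>_. 0)) (at x)"
    using has_derivative_transform_within_open[OF has_derivative_const[of 1] open_ball[of x t], of x "conv w ?\<rho>" UNIV] c t
    by (simp add: dist_norm norm_minus_commute)
  then have "dderiv e (conv w ?\<rho>) x = 0" by (rule dderiv_eqI)
  then have 0: "conv w (dderiv e ?\<rho>) x = 0" by (simp add: dderiv_conv[OF test_function_moll[OF t] w])
  have z: "dderiv e ?\<rho> (x - z) *\<^sub>R w z = dderiv e ?\<rho> (x - z)" for z
    using dz[of "x - z"] t by (cases "norm (x - z) > t") (auto simp: w_def dist_norm)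
  show "(LBINT y. dderiv e ?\<rho> (x - y)) = 0" using 0 unfolding conv_def z .
  show "integrable lborel (\<lambda>y. dderiv e ?\<rho> (x - y))" using conv_integrable[OF td w, of x] unfolding z .
qed

text \<open>Since the derivative of the mollifier has mean zero, the mollified derivative of \<open>F\<close> is
  controlled by increments of \<open>F\<close>, hence by those of \<open>V\<close>.\<close>
lemma LqB_weighted_mollified_derivative:
  fixes V F :: "'a::euclidean_space \<Rightarrow> 'b::euclidean_space"
  assumes V: "Lq 2 V" and M: "\<And>h. Iq 2 (\<lambda>x. V (x + h) - V x) \<le> M * (norm h)\<^sup>2"
    and F: "integrable lborel F" and m: "m \<in> borel_measurable borel" "\<And>x. m x \<ge> (0::real)"
    and C: "C \<ge> 0" "\<And>x y. m x * norm (F y - F x) \<le> C * norm (V y - V x)"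
  obtains B where "\<And>t. t > 0 \<Longrightarrow> LqB 2 B (\<lambda>x. m x *\<^sub>R conv F (dderiv e (moll t)) x)"
proof -
  have [measurable]: "V \<in> borel_measurable borel" "F \<in> borel_measurable borel" "m \<in> borel_measurable borel"
    using V m borel_measurable_integrable[OF F] by (auto simp: Lq_def)
  obtain K where K: "K > 0" "\<And>t. t > 0 \<Longrightarrow> (\<integral>\<^sup>+x. ennreal \<bar>dderiv e (moll t) (x::'a)\<bar> \<partial>lborel) \<le> ennreal (K / t)"
    using moll_dderiv_bound by blast
  define M' where "M' = max M 0"
  have M': "Iq 2 (\<lambda>x. V (x + h) - V x) \<le> M' * (norm h)\<^sup>2" "M' \<ge> 0" for h
    using M[of h] mult_right_mono[of M M' "(norm h)\<^sup>2"] by (auto simp: M'_def)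
  have LVd: "Lq 2 (\<lambda>x. V (x + h) - V x)" for h by (rule Lq_diff(1)[OF Lq_translate(1)[OF V] V]) simp
  have "LqB 2 (C\<^sup>2 * K\<^sup>2 * M') (\<lambda>x. m x *\<^sub>R conv F (dderiv e (moll t)) x)" if t: "t > 0" for t
  proof -
    define \<mu> where "\<mu> y = dderiv e (moll t) (- y)" for y :: 'a
    have [measurable]: "dderiv e (moll t :: 'a \<Rightarrow> real) \<in> borel_measurable borel"
      by (rule smooth_measurable[OF smooth_dderiv[OF smooth_moll]])
    have [measurable]: "\<mu> \<in> borel_measurable borel" unfolding \<mu>_def by measurable
    have td: "test_function UNIV (dderiv e (moll t :: 'a \<Rightarrow> real))" by (rule test_function_dderiv[OF test_function_moll[OF t]])
    have \<mu>0: "\<mu> z = 0" if "norm z > t" for z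
      unfolding \<mu>_def by (rule test_function_dderiv_eq_0[OF smooth_moll compact_cball[of 0 t]]) (use that moll_eq_0[OF t] in \<open>auto simp: not_le\<close>)
    have \<mu>1: "(\<integral>\<^sup>+y. ennreal \<bar>\<mu> y\<bar> \<partial>lborel) \<le> ennreal (K / t)"
      using nn_integral_reflect[of "\<lambda>y::'a. ennreal \<bar>dderiv e (moll t) y\<bar>" 0] K(2)[OF t] by (simp add: \<mu>_def)
    let ?J = "\<lambda>x. \<integral>\<^sup>+y. ennreal \<bar>\<mu> y\<bar> * ennreal (norm (V (x + y) - V x) powr 2) \<partial>lborel"
    have pt: "ennreal (norm (m x *\<^sub>R conv F (dderiv e (moll t)) x) powr 2) \<le> ennreal (C\<^sup>2 * (K / t)) * ?J x" for x
    proof -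
      have "conv F (dderiv e (moll t)) x = (LBINT y. dderiv e (moll t) (x - y) *\<^sub>R (F y - F x))"
        using conv_integrable[OF td F, of x] integral_dderiv_moll[OF t, of e x] unfolding conv_def
        by (simp add: scaleR_diff_right)
      also have "\<dots> = (LBINT y. \<mu> y *\<^sub>R (F (x + y) - F x))"
        using integral_translate[of "\<lambda>y. dderiv e (moll t) (x - y) *\<^sub>R (F y - F x)" x] by (simp add: \<mu>_def add.commute)
      finally have cx: "conv F (dderiv e (moll t)) x = (LBINT y. \<mu> y *\<^sub>R (F (x + y) - F x))" .
      have "integrable lborel (\<lambda>y. dderiv e (moll t) (x - y) *\<^sub>R (F y - F x))"
        using conv_integrable[OF td F, of x] integral_dderiv_moll(2)[OF t, of e x] by (simp add: scaleR_diff_right)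
      from integrable_translate[OF this, of x]
      have "integrable lborel (\<lambda>y. \<mu> y *\<^sub>R (F (x + y) - F x))" by (simp add: \<mu>_def add.commute)
      then have "m x *\<^sub>R conv F (dderiv e (moll t)) x = (LBINT y. m x *\<^sub>R (\<mu> y *\<^sub>R (F (x + y) - F x)))"
        unfolding cx by (intro integral_scaleR_right[symmetric])
      then have "ennreal (norm (m x *\<^sub>R conv F (dderiv e (moll t)) x)) \<le> (\<integral>\<^sup>+y. ennreal (norm (m x *\<^sub>R (\<mu> y *\<^sub>R (F (x + y) - F x)))) \<partial>lborel)"
        using integral_norm_bound_ennreal[of lborel "\<lambda>y. m x *\<^sub>R (\<mu> y *\<^sub>R (F (x + y) - F x))"]
        by (cases "integrable lborel (\<lambda>y. m x *\<^sub>R (\<mu> y *\<^sub>R (F (x + y) - F x)))") (auto simp: not_integrable_integral_eq)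
      \<comment> \<open>Splitting |\<mu>| into two square roots prepares Cauchy-Schwarz: one factor
        gives the L1 norm of \<mu>, the other a \<mu>-weighted mean of squared increments of
        V.\<close>
      also have "\<dots> \<le> (\<integral>\<^sup>+y. ennreal C * (ennreal (sqrt \<bar>\<mu> y\<bar>) * ennreal (sqrt \<bar>\<mu> y\<bar> * norm (V (x + y) - V x))) \<partial>lborel)"
      proof (rule nn_integral_mono)
        fix y
        have "norm (m x *\<^sub>R (\<mu> y *\<^sub>R (F (x + y) - F x))) = \<bar>\<mu> y\<bar> * (m x * norm (F (x + y) - F x))" using m(2)[of x] by (simp add: abs_mult mult_ac)
        also have "\<dots> \<le> \<bar>\<mu> y\<bar> * (C * norm (V (x + y) - V x))" by (intro mult_left_mono C) simp
        also have "\<dots> = C * (sqrt \<bar>\<mu> y\<bar> * (sqrt \<bar>\<mu> y\<bar> * norm (V (x + y) - V x)))" by (simp add: mult.assoc[symmetric])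
        finally show "ennreal (norm (m x *\<^sub>R (\<mu> y *\<^sub>R (F (x + y) - F x)))) \<le> ennreal C * (ennreal (sqrt \<bar>\<mu> y\<bar>) * ennreal (sqrt \<bar>\<mu> y\<bar> * norm (V (x + y) - V x)))"
          using C(1) by (simp add: ennreal_mult'[symmetric] ennreal_leI)
      qed
      also have "\<dots> = ennreal C * (\<integral>\<^sup>+y. ennreal (sqrt \<bar>\<mu> y\<bar>) * ennreal (sqrt \<bar>\<mu> y\<bar> * norm (V (x + y) - V x)) \<partial>lborel)"
        by (intro nn_integral_cmult) measurable
      finally have 1: "ennreal (norm (m x *\<^sub>R conv F (dderiv e (moll t)) x)) \<le> \<dots>" .
      have "ennreal (norm (m x *\<^sub>R conv F (dderiv e (moll t)) x) powr 2) = (ennreal (norm (m x *\<^sub>R conv F (dderiv e (moll t)) x)))\<^sup>2"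
        unfolding norm_powr_2 by (simp add: ennreal_power)
      also have "\<dots> \<le> (ennreal C * (\<integral>\<^sup>+y. ennreal (sqrt \<bar>\<mu> y\<bar>) * ennreal (sqrt \<bar>\<mu> y\<bar> * norm (V (x + y) - V x)) \<partial>lborel))\<^sup>2"
        by (intro power_mono 1) simp
      also have "\<dots> = (ennreal C)\<^sup>2 * (\<integral>\<^sup>+y. ennreal (sqrt \<bar>\<mu> y\<bar>) * ennreal (sqrt \<bar>\<mu> y\<bar> * norm (V (x + y) - V x)) \<partial>lborel)\<^sup>2"
        by (rule power_mult_distrib)
      also have "\<dots> \<le> (ennreal C)\<^sup>2 * ((\<integral>\<^sup>+y. (ennreal (sqrt \<bar>\<mu> y\<bar>))\<^sup>2 \<partial>lborel) * (\<integral>\<^sup>+y. (ennreal (sqrt \<bar>\<mu> y\<bar> * norm (V (x + y) - V x)))\<^sup>2 \<partial>lborel))"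
        by (intro mult_left_mono Cauchy_Schwarz_nn_integral) auto
      also have "(\<integral>\<^sup>+y. (ennreal (sqrt \<bar>\<mu> y\<bar>))\<^sup>2 \<partial>lborel) = (\<integral>\<^sup>+y. ennreal \<bar>\<mu> y\<bar> \<partial>lborel)" by (simp add: ennreal_power)
      also have "(\<integral>\<^sup>+y. (ennreal (sqrt \<bar>\<mu> y\<bar> * norm (V (x + y) - V x)))\<^sup>2 \<partial>lborel) = ?J x"
        unfolding norm_powr_2 by (simp add: ennreal_power power_mult_distrib ennreal_mult')
      also have "(ennreal C)\<^sup>2 * ((\<integral>\<^sup>+y. ennreal \<bar>\<mu> y\<bar> \<partial>lborel) * ?J x)
          \<le> (ennreal C)\<^sup>2 * (ennreal (K / t) * ?J x)"
        by (intro mult_left_mono mult_right_mono \<mu>1) auto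
      moreover have "ennreal (C\<^sup>2 * (K / t)) = (ennreal C)\<^sup>2 * ennreal (K / t)"
        unfolding ennreal_power[OF C(1)] by (rule ennreal_mult') simp
      ultimately show ?thesis by (simp only: mult.assoc)
    qed
    have "(\<integral>\<^sup>+x. ennreal (norm (m x *\<^sub>R conv F (dderiv e (moll t)) x) powr 2) \<partial>lborel)
      \<le> (\<integral>\<^sup>+x. ennreal (C\<^sup>2 * (K / t)) * ?J x \<partial>lborel)"
      by (intro nn_integral_mono pt)
    also have "\<dots> = ennreal (C\<^sup>2 * (K / t)) * (\<integral>\<^sup>+x. ?J x \<partial>lborel)"
      by (intro nn_integral_cmult) measurable
    also have "(\<integral>\<^sup>+x. ?J x \<partial>lborel)
      = (\<integral>\<^sup>+y. (\<integral>\<^sup>+x. ennreal \<bar>\<mu> y\<bar> * ennreal (norm (V (x + y) - V x) powr 2) \<partial>lborel) \<partial>lborel)"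
      by (rule lborel_pair.Fubini') measurable
    also have "\<dots> = (\<integral>\<^sup>+y. ennreal \<bar>\<mu> y\<bar> * ennreal (Iq 2 (\<lambda>x. V (x + y) - V x)) \<partial>lborel)"
      by (intro nn_integral_cong, subst nn_integral_cmult) (measurable, simp only: nn_integral_Lq[OF LVd])
    \<comment> \<open>Only |y| \<le> t contributes, where the squared increment is at most M' t^2.
      This cancels the two factors K / t and makes the bound independent of t.\<close>
    also have "\<dots> \<le> (\<integral>\<^sup>+y. ennreal \<bar>\<mu> y\<bar> * ennreal (M' * t\<^sup>2) \<partial>lborel)"
    proof (rule nn_integral_mono)
      fix y
      show "ennreal \<bar>\<mu> y\<bar> * ennreal (Iq 2 (\<lambda>x. V (x + y) - V x)) \<le> ennreal \<bar>\<mu> y\<bar> * ennreal (M' * t\<^sup>2)"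
      proof (cases "norm y > t")
        case False
        have "M' * (norm y)\<^sup>2 \<le> M' * t\<^sup>2" using False M'(2) by (intro mult_left_mono power_mono) auto
        then show ?thesis using M'(1)[of y] by (intro mult_left_mono ennreal_leI) auto
      qed (simp add: \<mu>0)
    qed
    also have "\<dots> = (\<integral>\<^sup>+y. ennreal \<bar>\<mu> y\<bar> \<partial>lborel) * ennreal (M' * t\<^sup>2)" by (intro nn_integral_multc) measurable
    also have "\<dots> \<le> ennreal (K / t) * ennreal (M' * t\<^sup>2)" by (intro mult_right_mono \<mu>1) auto
    finally have "(\<integral>\<^sup>+x. ennreal (norm (m x *\<^sub>R conv F (dderiv e (moll t)) x) powr 2) \<partial>lborel)
      \<le> ennreal (C\<^sup>2 * (K / t)) * (ennreal (K / t) * ennreal (M' * t\<^sup>2))" by (simp add: mult_left_mono)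
    also have "\<dots> = ennreal (C\<^sup>2 * K\<^sup>2 * M')"
      using t K(1) M'(2) C(1) by (simp add: ennreal_mult'[symmetric] power2_eq_square)
    finally have le: "(\<integral>\<^sup>+x. ennreal (norm (m x *\<^sub>R conv F (dderiv e (moll t)) x) powr 2) \<partial>lborel) \<le> ennreal (C\<^sup>2 * K\<^sup>2 * M')" .
    have me: "(\<lambda>x. m x *\<^sub>R conv F (dderiv e (moll t)) x) \<in> borel_measurable borel" by measurable
    from LqI[OF me le] M'(2) show ?thesis by (simp add: LqB_def)
  qed
  then show ?thesis using that by blast
qed

subsection \<open>The differentiated system\<close>

lemma LqB_nth:
  fixes f :: "'a::euclidean_space \<Rightarrow> 'b::euclidean_space^'N"
  assumes "LqB p B f" "p > 0" shows "LqB p B (\<lambda>x. f x $ \<alpha>)"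
proof -
  have [measurable]: "f \<in> borel_measurable borel" using assms by (simp add: LqB_def Lq_def)
  have "LqB p (1 powr p * B) (\<lambda>x. f x $ \<alpha>)"
    by (rule LqB_dominated[OF assms(1)]) (use assms in \<open>auto simp: Finite_Cartesian_Product.norm_nth_le\<close>)
  then show ?thesis by simp
qed

text \<open>What remains once V has been cut off: a field on the whole space with L2-Lipschitz
  translates and almost everywhere difference quotients W along one sequence t. The function u has
  disappeared; \<open>curl\<close> retains from it the distributional symmetry of the second
  derivatives.\<close>

locale plap_reg =
  fixes U :: "(real^'n) set" and S :: "(real^'n) set" and p M :: real and V :: "real^'n \<Rightarrow> real^'n^'N"
    and f :: "real^'n \<Rightarrow> real^'N" and g :: "real^'n \<Rightarrow> real^'n^'N" and W :: "'n \<Rightarrow> real^'n \<Rightarrow> real^'n^'N" and t :: "nat \<Rightarrow> real"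
  assumes p3: "p \<ge> 3" and U: "open U" and S: "bounded S"
    and VS: "\<And>x. x \<notin> S \<Longrightarrow> V x = 0" and LV: "Lq 2 V"
    and lip: "\<And>h. Iq 2 (\<lambda>x. V (x + h) - V x) \<le> M * (norm h)\<^sup>2"
    and t: "\<And>n. t n > 0" "t \<longlonglongrightarrow> 0"
    and LW: "\<And>k. Lq 2 (W k)" and WS: "\<And>k x. x \<notin> S \<Longrightarrow> W k x = 0"
    and dq: "\<And>k. AE x in lborel. (\<lambda>n. (1 / t n) *\<^sub>R (V (x + t n *\<^sub>R axis k 1) - V x)) \<longlonglongrightarrow> W k x"
    and dqL: "\<And>k n. LqB 2 M (\<lambda>x. (1 / t n) *\<^sub>R (V (x + t n *\<^sub>R axis k 1) - V x))"
    and f: "Lq (p / (p - 1)) f" "integrable lborel f" and g: "Lq (p / (p - 1)) g" "integrable lborel g"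
    and wf: "\<And>\<alpha> i. weak_dderiv U (axis i 1) (\<lambda>x. f x $ \<alpha>) (\<lambda>x. g x $ \<alpha> $ i)"
    and eqn: "\<And>\<alpha> \<phi>. test_function U \<phi> \<Longrightarrow>
       (LBINT x. rad (1 - 2 / p) 0 1 (V x) $ \<alpha> \<bullet> grad \<phi> x) = - (LBINT x. f x $ \<alpha> * \<phi> x)"
    and curl: "\<And>\<alpha> j k \<phi>. test_function U \<phi> \<Longrightarrow>
       (LBINT x. rad (- (1 - 2 / p)) 0 1 (V x) $ \<alpha> $ j * dderiv (axis k 1) \<phi> x)
         = (LBINT x. rad (- (1 - 2 / p)) 0 1 (V x) $ \<alpha> $ k * dderiv (axis j 1) \<phi> x)"
begin

abbreviation "p' \<equiv> p / (p - 1)"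
definition "c = 1 - 2 / p"

lemma pp: "p > 1" "p' > 1" "1 / p + 1 / p' = 1" "1 / p' + 1 / p = 1" "p > 0" "p' > 0"
  using p3 by (auto simp: field_simps)

lemma cc: "0 < c" "c < 1" using p3 by (auto simp: c_def field_simps)

lemma [measurable]: "V \<in> borel_measurable borel" "W k \<in> borel_measurable borel" "f \<in> borel_measurable borel" "g \<in> borel_measurable borel"
  using LV LW f g by (auto simp: Lq_def)

lemma M0: "M \<ge> 0"
proof -
  have "0 \<le> Iq 2 (\<lambda>x. (1 / t 0) *\<^sub>R (V (x + t 0 *\<^sub>R axis k 1) - V x))" for k by (rule Iq_nonneg)
  then show ?thesis using dqL[of 0] unfolding LqB_def by (meson order_trans)
qed

lemma integrable_supported:
  fixes w :: "real^'n \<Rightarrow> 'c::euclidean_space"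
  assumes "Lq q w" "q \<ge> 1" "\<And>x. x \<notin> S \<Longrightarrow> w x = 0"
  shows "integrable lborel w"
  by (rule Lq_imp_integrable[OF assms(1) S assms(3,2)])

text \<open>Along t the pointwise chain rule gives the limit of the difference quotients, and the
  Lipschitz bound keeps them bounded in L2, so the limit is the weak derivative. R(0) = 0 keeps the
  support bounded.\<close>

lemma weak_dderiv_Lipschitz_comp:
  fixes R :: "real^'n^'N \<Rightarrow> 'c::euclidean_space"
  assumes R: "\<And>y. (R has_derivative R' y) (at y)" "R 0 = 0" "\<And>x y. norm (R x - R y) \<le> C * norm (x - y)" "C \<ge> 0"
    and m: "R \<in> borel_measurable borel" "(\<lambda>x. R' (V x) (W k x)) \<in> borel_measurable borel"
  shows "weak_dderiv A (axis k 1) (\<lambda>x. R (V x)) (\<lambda>x. R' (V x) (W k x))"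
    "LqB 2 (C powr 2 * M) (\<lambda>x. R' (V x) (W k x))"
    "Lq 2 (\<lambda>x. R (V x))" "integrable lborel (\<lambda>x. R (V x))" "integrable lborel (\<lambda>x. R' (V x) (W k x))"
proof -
  have [measurable]: "R \<in> borel_measurable borel" by (rule m)
  have lin: "linear (R' y)" for y by (rule has_derivative_linear[OF R(1)])
  have lim: "AE x in lborel. (\<lambda>n. (1 / t n) *\<^sub>R (R (V (x + t n *\<^sub>R axis k 1)) - R (V x))) \<longlonglongrightarrow> R' (V x) (W k x)"
    using dq[of k] by eventually_elim (rule difference_quotient_chain[OF R(1) t])
  have B: "LqB 2 (C powr 2 * M) (\<lambda>x. (1 / t n) *\<^sub>R (R (V (x + t n *\<^sub>R axis k 1)) - R (V x)))" for n
  proof (rule LqB_dominated[OF dqL[of n k] _ _ R(4)])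
    fix x
    show "norm ((1 / t n) *\<^sub>R (R (V (x + t n *\<^sub>R axis k 1)) - R (V x))) \<le> C * norm ((1 / t n) *\<^sub>R (V (x + t n *\<^sub>R axis k 1) - V x))"
      using mult_left_mono[OF R(3)[of "V (x + t n *\<^sub>R axis k 1)" "V x"], of "1 / t n"] t(1)[of n] by (simp add: mult_ac)
  qed auto
  show L: "Lq 2 (\<lambda>x. R (V x))"
    by (rule Lq_dominated(1)[OF LV, of _ C]) (use R(2) R(3)[of _ 0] R(4) in auto)
  show i: "integrable lborel (\<lambda>x. R (V x))" by (rule integrable_supported[OF L]) (auto simp: VS R(2))
  show "weak_dderiv A (axis k 1) (\<lambda>x. R (V x)) (\<lambda>x. R' (V x) (W k x))"
    by (rule weak_dderivI_difference_quotient[where p=2 and t=t and B="C powr 2 * M", OF i _ t(2) m(2) lim])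
       (use B t(1) in \<open>auto simp: LqB_def less_imp_neq[symmetric]\<close>)
  show L2: "LqB 2 (C powr 2 * M) (\<lambda>x. R' (V x) (W k x))"
    by (rule LqB_limit[OF B m(2) lim]) simp
  then have "Lq 2 (\<lambda>x. R' (V x) (W k x))" by (simp add: LqB_def)
  then show "integrable lborel (\<lambda>x. R' (V x) (W k x))"
    by (rule integrable_supported) (auto simp: WS linear_0[OF lin])
qed

section \<open>Flux, gradient and their derivatives\<close>

definition "A x = rad c 0 1 (V x)"
definition "G x = rad (- c) 0 1 (V x)"
definition "X k x = drad c 0 1 (V x) (W k x)"
text \<open>Only a formal derivative of G: because of the negative exponent G need not be weakly
  differentiable. At zeros of V the value is 0, and H is used only under weights that vanish
  there.\<close>

definition "H k x = drad (- c) 0 1 (V x) (W k x)"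

lemma [measurable]: "A \<in> borel_measurable borel" "G \<in> borel_measurable borel" "X k \<in> borel_measurable borel" "H k \<in> borel_measurable borel"
  unfolding A_def[abs_def] G_def[abs_def] X_def[abs_def] H_def[abs_def] by measurable

lemma norm_A: "norm (A x) powr p' = norm (V x) powr 2"
proof -
  have "(c + 1) * p' = 2" using p3 by (simp add: c_def field_simps)
  then show ?thesis unfolding A_def norm_rad_power powr_powr by simp
qed

lemma norm_G: "norm (G x) powr p = norm (V x) powr 2"
proof -
  have "(- c + 1) * p = 2" using p3 by (simp add: c_def)
  then show ?thesis unfolding G_def norm_rad_power powr_powr by simp
qed

lemma LA: "Lq p' A" and LG: "Lq p G"
  using Lq_integrable[OF LV] unfolding Lq_def norm_A norm_G by auto

lemma integrable_A: "integrable lborel A" and integrable_G: "integrable lborel G"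
  using integrable_supported[OF LA] integrable_supported[OF LG] pp by (auto simp: A_def G_def VS)

text \<open>The square-integrable factor of X. The growth |V|^c is split off so that it can be moved
  to the other factor of a product.\<close>

definition "Wt k x = W k x + (c * (sgn (V x) \<bullet> W k x)) *\<^sub>R sgn (V x)"

lemma [measurable]: "Wt k \<in> borel_measurable borel"
  unfolding Wt_def[abs_def] sgn_div_norm by measurable

lemma X_Wt: "X k x = norm (V x) powr c *\<^sub>R Wt k x"
  by (simp add: X_def drad_def Wt_def profile_power)

lemma norm_Wt_le: "norm (Wt k x) \<le> 2 * norm (W k x)"
proof -
  have s: "norm (sgn (V x)) \<le> 1" by (simp add: norm_sgn)
  have "norm ((c * (sgn (V x) \<bullet> W k x)) *\<^sub>R sgn (V x)) \<le> (1 * (1 * norm (W k x))) * 1"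
    unfolding norm_scaleR real_norm_def abs_mult using cc s
    by (intro mult_mono order_trans[OF Cauchy_Schwarz_ineq2]) auto
  then show ?thesis unfolding Wt_def by (intro order_trans[OF norm_triangle_ineq]) simp
qed

lemma LWt: "Lq 2 (Wt k)"
  by (rule Lq_dominated(1)[OF LW[of k], of _ 2]) (auto simp: norm_Wt_le)

text \<open>Replacing both factors by the larger of m and b gives a power of exponent (c + 1) p' =
  2.\<close>

lemma powr_mix_le:
  assumes "m \<ge> 0" "b \<ge> 0"
  shows "(m powr c * b) powr p' \<le> m powr 2 + b powr 2"
proof -
  have "(c + 1) * p' = 2" using p3 by (simp add: c_def field_simps)
  then have h: "(a powr c * a) powr p' = a powr 2" if "a \<ge> 0" for a
  proof (cases "a = 0")
    case False
    then have "a powr c * a = a powr (c + 1)" using that by (simp add: powr_add)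
    then show ?thesis using \<open>(c + 1) * p' = 2\<close> by (simp only: powr_powr)
  qed simp
  show ?thesis
  proof (cases "b \<le> m")
    case True
    have "(m powr c * b) powr p' \<le> (m powr c * m) powr p'" using assms True pp cc by (intro powr_mono2 mult_left_mono) auto
    also have "\<dots> = m powr 2" by (rule h[OF assms(1)])
    finally show ?thesis by (rule add_increasing2[OF powr_ge_zero])
  next
    case False
    have "(m powr c * b) powr p' \<le> (b powr c * b) powr p'" using assms False pp cc by (intro powr_mono2 mult_right_mono) auto
    also have "\<dots> = b powr 2" by (rule h[OF assms(2)])
    finally show ?thesis by (rule add_increasing[OF powr_ge_zero])
  qed
qed

text \<open>The flux grows faster than linearly in V and is not Lipschitz, so the argument runs in
  L^p' instead of L2. Its quotients are at most a constant times max|V|^c times those of V, and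
  \<open>powr_mix_le\<close> bounds the p'-th power by squares of V and of its quotients.\<close>

lemma weak_dderiv_A: "weak_dderiv UNIV (axis k 1) A (X k)" and LX: "Lq p' (X k)" and integrable_X: "integrable lborel (X k)"
proof -
  define K where "K = (1 + \<bar>c\<bar> + \<bar>0\<bar>) * (5 + 2 powr \<bar>c\<bar>)"
  have K: "K \<ge> 0" by (simp add: K_def)
  have d: "norm (A x - A y) \<le> K * (max (norm (V x)) (norm (V y)) powr c * norm (V x - V y))" for x y
    unfolding A_def K_def using rad_diff_le[of 1 c c 0 1 "V x" "V y"] cc by (simp add: profile_power mult.assoc)
  have lim: "AE x in lborel. (\<lambda>n. (1 / t n) *\<^sub>R (A (x + t n *\<^sub>R axis k 1) - A x)) \<longlonglongrightarrow> X k x"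
    using dq[of k] unfolding A_def X_def
    by eventually_elim (rule difference_quotient_chain[OF rad_has_derivative_0 t], use cc in auto)
  have B: "LqB p' (K powr p' * (2 * Iq 2 V + M)) (\<lambda>x. (1 / t n) *\<^sub>R (A (x + t n *\<^sub>R axis k 1) - A x))" for n
  proof -
    let ?q = "\<lambda>x. (1 / t n) *\<^sub>R (V (x + t n *\<^sub>R axis k 1) - V x)"
    let ?m = "\<lambda>x. max (norm (V (x + t n *\<^sub>R axis k 1))) (norm (V x))"
    have iV: "integrable lborel (\<lambda>x. norm (V (x + t n *\<^sub>R axis k 1)) powr 2)" "integrable lborel (\<lambda>x. norm (V x) powr 2)" "integrable lborel (\<lambda>x. norm (?q x) powr 2)"
      using Lq_integrable[OF Lq_translate(1)[OF LV]] Lq_integrable[OF LV] dqL[of n k] unfolding LqB_def Lq_def by auto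
    let ?r = "\<lambda>x. K powr p' * (norm (V (x + t n *\<^sub>R axis k 1)) powr 2 + norm (V x) powr 2 + norm (?q x) powr 2)"
    have ir: "integrable lborel ?r" using iV by simp
    have le: "norm ((1 / t n) *\<^sub>R (A (x + t n *\<^sub>R axis k 1) - A x)) powr p' \<le> ?r x" for x
    proof -
      have "norm ((1 / t n) *\<^sub>R (A (x + t n *\<^sub>R axis k 1) - A x)) \<le> K * (?m x powr c * norm (?q x))"
        using mult_left_mono[OF d[of "x + t n *\<^sub>R axis k 1" x], of "1 / t n"] t(1)[of n] by (simp add: mult_ac)
      then have "norm ((1 / t n) *\<^sub>R (A (x + t n *\<^sub>R axis k 1) - A x)) powr p' \<le> (K * (?m x powr c * norm (?q x))) powr p'"
        using pp by (intro powr_mono2) auto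
      also have "\<dots> = K powr p' * (?m x powr c * norm (?q x)) powr p'" using K by (subst powr_mult) auto
      also have "\<dots> \<le> K powr p' * (?m x powr 2 + norm (?q x) powr 2)"
        by (intro mult_left_mono powr_mix_le) (auto simp: le_max_iff_disj)
      also have "\<dots> \<le> ?r x" by (intro mult_left_mono add_right_mono) (auto simp: max_def)
      finally show ?thesis .
    qed
    have L: "integrable lborel (\<lambda>x. norm ((1 / t n) *\<^sub>R (A (x + t n *\<^sub>R axis k 1) - A x)) powr p')"
      by (rule Bochner_Integration.integrable_bound[OF ir]) (use le in \<open>auto intro: order_trans[OF _ abs_ge_self]\<close>)
    have "Iq p' (\<lambda>x. (1 / t n) *\<^sub>R (A (x + t n *\<^sub>R axis k 1) - A x)) \<le> integral\<^sup>L lborel ?r"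
      by (rule integral_mono[OF L ir le])
    also have "\<dots> = K powr p' * (Iq 2 (\<lambda>x. V (x + t n *\<^sub>R axis k 1)) + Iq 2 V + Iq 2 ?q)" using iV by simp
    also have "\<dots> \<le> K powr p' * (2 * Iq 2 V + M)"
      using dqL[of n k] unfolding LqB_def Lq_translate(2)[OF LV] by (intro mult_left_mono) auto
    finally show ?thesis using L by (simp add: LqB_def Lq_def)
  qed
  show "weak_dderiv UNIV (axis k 1) A (X k)"
    by (rule weak_dderivI_difference_quotient[where p=p' and t=t and B="K powr p' * (2 * Iq 2 V + M)", OF integrable_A _ t(2) _ lim])
       (use B t(1) pp in \<open>auto simp: LqB_def less_imp_neq[symmetric]\<close>)
  have "LqB p' (K powr p' * (2 * Iq 2 V + M)) (X k)" by (rule LqB_limit[OF B _ lim]) (use pp in auto)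
  then show L: "Lq p' (X k)" by (simp add: LqB_def)
  show "integrable lborel (X k)" by (rule integrable_supported[OF L]) (use pp in \<open>auto simp: X_def VS\<close>)
qed

text \<open>The equation is tested with the k-th derivative of \<psi>; after exchanging the
  derivatives of \<psi>, the k-th one is moved onto A and onto f.\<close>

lemma eqn_derivative:
  assumes \<psi>: "test_function U \<psi>"
  shows "(LBINT x. X k x $ \<alpha> \<bullet> grad \<psi> x) = - (LBINT x. g x $ \<alpha> $ k * \<psi> x)"
proof -
  have sm: "smooth \<psi>" by (rule test_function_smooth[OF \<psi>])
  let ?\<phi> = "dderiv (axis k 1) \<psi>"
  have t\<phi>: "test_function U ?\<phi>" by (rule test_function_dderiv[OF \<psi>])
  have ti: "test_function U (dderiv (axis i 1) \<psi>)" for i by (rule test_function_dderiv[OF \<psi>])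
  have iA: "integrable lborel (\<lambda>x. A x $ \<alpha> $ i)" and iX: "integrable lborel (\<lambda>x. X k x $ \<alpha> $ i)" for i
    by (intro integral_nth(2) integrable_A integrable_X)+
  have j1: "integrable lborel (\<lambda>x. A x $ \<alpha> $ i * dderiv (axis k 1) (dderiv (axis i 1) \<psi>) x)" for i
    using integrable_test_function_scaleR[OF test_function_dderiv[OF ti[of i]] iA[of i], of "axis k 1"] by (simp add: mult.commute)
  have j2: "integrable lborel (\<lambda>x. X k x $ \<alpha> $ i * dderiv (axis i 1) \<psi> x)" for i
    using integrable_test_function_scaleR[OF ti[of i] iX[of i]] by (simp add: mult.commute)
  have w: "weak_dderiv UNIV (axis k 1) (\<lambda>x. A x $ \<alpha> $ i) (\<lambda>x. X k x $ \<alpha> $ i)" for i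
    by (intro weak_dderiv_nth weak_dderiv_A integral_nth(2) integrable_A integrable_X)
  have "- (LBINT x. f x $ \<alpha> * ?\<phi> x) = (LBINT x. A x $ \<alpha> \<bullet> grad ?\<phi> x)"
    using eqn[OF t\<phi>, of \<alpha>] by (simp add: A_def c_def)
  also have "\<dots> = (LBINT x. (\<Sum>i\<in>UNIV. A x $ \<alpha> $ i * dderiv (axis k 1) (dderiv (axis i 1) \<psi>) x))"
    by (simp add: inner_vec_def grad_nth dderiv_commute[OF sm, of _ "axis k 1"])
  also have "\<dots> = (\<Sum>i\<in>UNIV. LBINT x. A x $ \<alpha> $ i * dderiv (axis k 1) (dderiv (axis i 1) \<psi>) x)"
    using j1 by simp
  also have "\<dots> = (\<Sum>i\<in>UNIV. - (LBINT x. X k x $ \<alpha> $ i * dderiv (axis i 1) \<psi> x))"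
    using weak_dderivD[OF w test_function_mono[OF ti subset_UNIV]] by simp
  also have "\<dots> = - (LBINT x. (\<Sum>i\<in>UNIV. X k x $ \<alpha> $ i * dderiv (axis i 1) \<psi> x))" using j2 by (simp add: sum_negf)
  also have "\<dots> = - (LBINT x. X k x $ \<alpha> \<bullet> grad \<psi> x)" by (simp add: inner_vec_def grad_nth)
  finally show ?thesis using weak_dderivD[OF wf \<psi>, of \<alpha> k] by simp
qed

text \<open>The scalar factor \<open>\<omega>\<close> vanishes at the zeros of \<open>V\<close>, where \<open>G\<close> need not be
  differentiable, while both \<open>\<omega>\<close> and \<open>\<omega> G\<close> are Lipschitz functions of \<open>V\<close>.\<close>
definition "\<omega> y = profile 2 2 1 (norm (y :: real^'n^'N))"
definition "d\<omega> y h = profile 2 2 1 (norm y) * pslope 2 2 1 (norm y) / norm y * (sgn y \<bullet> (h :: real^'n^'N))"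

lemma [measurable]: "\<omega> \<in> borel_measurable borel" "(\<lambda>x. d\<omega> (V x) (W k x)) \<in> borel_measurable borel"
  unfolding \<omega>_def[abs_def] d\<omega>_def[abs_def] profile_def[abs_def] pslope_def[abs_def] sgn_div_norm by measurable

section \<open>Symmetry of the formal second derivatives\<close>

lemma \<omega>_has_derivative: "(\<omega> has_derivative d\<omega> y) (at y)"
proof (cases "y = 0")
  case False
  have n: "(norm has_derivative (\<lambda>h. sgn y \<bullet> h)) (at y)"
    using has_derivative_norm[OF False] by (simp add: inner_commute)
  have p: "(profile 2 2 1 has_derivative (*) (profile 2 2 1 (norm y) * pslope 2 2 1 (norm y) / norm y)) (at (norm y))"
    using profile_has_derivative[of "norm y" 1 2 2] False by (simp add: has_field_derivative_def)
  show ?thesis unfolding \<omega>_def[abs_def] d\<omega>_def[abs_def] by (rule has_derivative_compose[OF n p])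
next
  case True
  have "((\<lambda>h::real^'n^'N. norm h) \<longlongrightarrow> norm (0::real^'n^'N)) (at 0)" by (intro tendsto_norm tendsto_ident_at)
  then have z: "((\<lambda>h::real^'n^'N. norm h) \<longlongrightarrow> 0) (at 0)" by simp
  have "((\<lambda>h. norm (\<omega> (0 + h) - \<omega> 0 - 0) / norm h) \<longlongrightarrow> 0) (at 0)"
  proof (rule Lim_null_comparison[OF always_eventually z], rule allI)
    fix h :: "real^'n^'N"
    have "(1 + norm h) powr (- 2) \<le> 1 powr (- 2)" by (intro powr_mono2') auto
    then have "\<omega> h \<le> norm h powr 2 * 1" unfolding \<omega>_def profile_def by (intro mult_left_mono) auto
    moreover have "\<omega> h \<ge> 0" by (simp add: \<omega>_def profile_nonneg)
    ultimately show "norm (norm (\<omega> (0 + h) - \<omega> 0 - 0) / norm h) \<le> norm h"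
      by (cases "h = 0") (simp_all add: \<omega>_def[of 0] divide_le_eq norm_powr_2 power2_eq_square)
  qed
  moreover have "d\<omega> 0 = (\<lambda>h. 0)" by (rule ext) (simp add: d\<omega>_def)
  ultimately show ?thesis using True unfolding has_derivative_at by simp
qed

text \<open>For 0 \<le> \<alpha> \<le> \<beta> the profile is bounded by
  \<epsilon>^(\<alpha>-\<beta>), so \<open>rad_diff_le\<close> applies with d = 0; the factor 6 is 5
  + 2^0.\<close>

lemma rad_lipschitz:
  fixes x y :: "'b::euclidean_space"
  assumes \<epsilon>: "\<epsilon> > 0" and ab: "0 \<le> \<alpha>" "\<alpha> \<le> \<beta>"
  shows "norm (rad \<alpha> \<beta> \<epsilon> x - rad \<alpha> \<beta> \<epsilon> y) \<le> 6 * \<epsilon> powr (\<alpha> - \<beta>) * (1 + \<alpha> + \<beta>) * norm (x - y)"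
proof -
  have "profile \<alpha> \<beta> \<epsilon> s \<le> \<epsilon> powr (\<alpha> - \<beta>) * s powr 0" if "s > 0" for s
  proof -
    have "profile \<alpha> \<beta> \<epsilon> s \<le> (\<epsilon> + s) powr \<alpha> * (\<epsilon> + s) powr (- \<beta>)"
      unfolding profile_def using that \<epsilon> ab by (intro mult_right_mono powr_mono2) auto
    also have "\<dots> = (\<epsilon> + s) powr (\<alpha> - \<beta>)" using that \<epsilon> by (simp add: powr_add[symmetric])
    also have "\<dots> \<le> \<epsilon> powr (\<alpha> - \<beta>)" using that \<epsilon> ab by (intro powr_mono2') auto
    finally show ?thesis using that by simp
  qed
  from rad_diff_le[OF \<epsilon> _ this, of x y]
  have "norm (rad \<alpha> \<beta> \<epsilon> x - rad \<alpha> \<beta> \<epsilon> y) \<le> \<epsilon> powr (\<alpha> - \<beta>) * (1 + \<bar>\<alpha>\<bar> + \<bar>\<beta>\<bar>) * (5 + 2 powr \<bar>0\<bar>) * max (norm x) (norm y) powr 0 * norm (x - y)"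
    by simp
  also have "\<dots> \<le> \<epsilon> powr (\<alpha> - \<beta>) * (1 + \<bar>\<alpha>\<bar> + \<bar>\<beta>\<bar>) * 6 * 1 * norm (x - y)"
    using ab by (intro mult_right_mono mult_mono) auto
  finally show ?thesis using ab by (simp add: mult_ac)
qed

lemma \<omega>_lipschitz: "norm (\<omega> x - \<omega> y) \<le> 24 * norm (x - y)"
proof -
  \<comment> \<open>On the reals s^2 (1 + s)^(-2) is the radial map with profile s (1 + s)^(-2), and
    24 = 6 (1 + 1 + 2).\<close>
  have r: "\<omega> z = rad 1 2 1 (norm z)" for z
    by (cases "z = 0") (simp_all add: \<omega>_def rad_def profile_def powr_numeral power2_eq_square)
  show ?thesis using rad_lipschitz[of 1 1 2 "norm x" "norm y"] norm_triangle_ineq3[of x y] unfolding r by simp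
qed

text \<open>Both sides are the derivative in direction \<open>k\<close> of \<open>rad (\<alpha> - c) \<beta> \<epsilon> (V x) = profile \<alpha> \<beta> \<epsilon> (norm (V x)) *\<^sub>R G x\<close>.\<close>
lemma drad_via_H:
  "drad (\<alpha> - c) \<beta> \<epsilon> (V x) (W k x) = profile \<alpha> \<beta> \<epsilon> (norm (V x)) *\<^sub>R
     (H k x + (pslope \<alpha> \<beta> \<epsilon> (norm (V x)) * (norm (V x) powr (- c) * (sgn (V x) \<bullet> W k x))) *\<^sub>R sgn (V x))"
proof (cases "V x = 0")
  case False
  let ?s = "norm (V x)"
  have pr: "profile (\<alpha> - c) \<beta> \<epsilon> ?s = profile \<alpha> \<beta> \<epsilon> ?s * ?s powr (- c)"
    using False by (simp add: profile_def powr_diff powr_minus divide_inverse)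
  have ps: "pslope (\<alpha> - c) \<beta> \<epsilon> ?s = pslope \<alpha> \<beta> \<epsilon> ?s - c" by (simp add: pslope_def)
  show ?thesis unfolding drad_def H_def pr ps
    by (simp add: profile_power algebra_simps)
qed simp

text \<open>\<open>curl\<close> is tested with \<phi> times the mollified weight \<omega>(V). In the
  limit the derivative on the weight gives w G, while the derivative on \<phi> is integrated by
  parts against \<omega>(V) G, which is weakly differentiable with derivative \<omega>(V) H + w G.
  The terms w G cancel, and \<omega>(V) times the antisymmetric part of H vanishes. Where V is not 0
  the weight is positive, and where V = 0 so is H = 0.\<close>

lemma symmetric_H: "AE x in lborel. x \<in> U \<longrightarrow> (\<forall>\<alpha> j k. H k x $ \<alpha> $ j = H j x $ \<alpha> $ k)"
proof -
  note D\<omega> = weak_dderiv_Lipschitz_comp[where R=\<omega> and R'=d\<omega> and C=24, OF \<omega>_has_derivative _ \<omega>_lipschitz, simplified \<omega>_def[of 0] norm_zero profile_0, simplified]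
  have rl: "norm (rad (2 - c) 2 1 x - rad (2 - c) 2 1 y) \<le> 30 * norm (x - y)" for x y :: "real^'n^'N"
  proof -
    have "norm (rad (2 - c) 2 1 x - rad (2 - c) 2 1 y) \<le> 6 * 1 powr ((2 - c) - 2) * (1 + (2 - c) + 2) * norm (x - y)"
      using cc by (intro rad_lipschitz) auto
    also have "\<dots> \<le> 30 * norm (x - y)" using cc by (intro mult_right_mono) auto
    finally show ?thesis .
  qed
  have rd: "(rad (2 - c) 2 1 has_derivative drad (2 - c) 2 1 y) (at y)" for y :: "real^'n^'N"
    using cc by (intro rad_has_derivative_0) auto
  note DK = weak_dderiv_Lipschitz_comp[where R="rad (2 - c) 2 1" and R'="drad (2 - c) 2 1" and C=30, OF rd _ rl, simplified]
  define K where "K x = rad (2 - c) 2 1 (V x)" for x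
  define dK where "dK k x = drad (2 - c) 2 1 (V x) (W k x)" for k x
  define w where "w k x = d\<omega> (V x) (W k x)" for k x
  have [measurable]: "w k \<in> borel_measurable borel" for k unfolding w_def by measurable
  have KG: "K x = \<omega> (V x) *\<^sub>R G x" for x
    by (cases "V x = 0") (simp_all add: K_def G_def \<omega>_def rad_def profile_power, simp add: profile_def powr_diff powr_minus divide_inverse)
  have dKH: "dK k x = \<omega> (V x) *\<^sub>R H k x + w k x *\<^sub>R G x" for k x
  proof (cases "V x = 0")
    case False
    have "sgn (V x) = (1 / norm (V x)) *\<^sub>R V x" by (simp add: sgn_div_norm divide_inverse)
    then show ?thesis unfolding dK_def drad_via_H using False
      by (simp add: \<omega>_def w_def d\<omega>_def G_def rad_power scaleR_add_right mult_ac)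
  qed (simp add: dK_def \<omega>_def w_def d\<omega>_def)
  have iw: "integrable lborel (w k)" for k using D\<omega>(5) by (simp add: w_def[abs_def])
  obtain r :: "nat \<Rightarrow> nat" where r: "strict_mono r" "AE x in lborel. (\<lambda>n. conv (\<lambda>x. \<omega> (V x)) (moll (1 / real (Suc (r n)))) x) \<longlonglongrightarrow> \<omega> (V x)"
    using conv_AE_subseq[OF D\<omega>(4) _ inverse_seq] by auto
  have r0: "(\<lambda>n. 1 / real (Suc (r n))) \<longlonglongrightarrow> 0" using LIMSEQ_subseq_LIMSEQ[OF inverse_seq r(1)] by (simp add: o_def)
  obtain r' :: "nat \<Rightarrow> nat" where r': "strict_mono r'"
    "\<And>k. k \<in> UNIV \<Longrightarrow> AE x in lborel. (\<lambda>n. conv (w k) (moll (1 / real (Suc (r (r' n))))) x) \<longlonglongrightarrow> w k x"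
    using conv_AE_subseq_finite[of "UNIV :: 'n set" w "\<lambda>n. 1 / real (Suc (r n))", OF finite iw _ r0] by auto
  define s where "s n = 1 / real (Suc (r (r' n)))" for n
  have s: "s n > 0" for n by (simp add: s_def)
  define o' where "o' n = conv (\<lambda>x. \<omega> (V x)) (moll (s n))" for n
  have o1: "AE x in lborel. (\<lambda>n. o' n x) \<longlonglongrightarrow> \<omega> (V x)"
    using r(2) by eventually_elim (use LIMSEQ_subseq_LIMSEQ[OF _ r'(1)] in \<open>force simp: o'_def s_def o_def\<close>)
  have o2: "AE x in lborel. (\<lambda>n. conv (w k) (moll (s n)) x) \<longlonglongrightarrow> w k x" for k using r'(2)[of k] by (simp add: s_def)
  have smo: "smooth (o' n)" for n unfolding o'_def by (rule smooth_conv[OF test_function_moll[OF s] D\<omega>(4)])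
  have do': "dderiv (axis k 1) (o' n) x = conv (w k) (moll (s n)) x" for k n x
  proof -
    have mz: "norm z \<le> s n" if "moll (s n) z \<noteq> 0" for z :: "real^'n" using that moll_eq_0[OF s, of n z] by force
    show ?thesis unfolding o'_def dderiv_conv[OF test_function_moll[OF s] D\<omega>(4)] w_def
      by (rule conv_weak_dderiv[OF D\<omega>(1) test_function_moll[OF s] mz]) auto
  qed
  have L\<omega>: "Lq 2 (\<lambda>x. \<omega> (V x))" by (rule D\<omega>(3))
  have Lw: "Lq 2 (w k)" for k using D\<omega>(2)[of k] by (simp add: LqB_def w_def[abs_def])
  have Bo: "LqB 2 (Iq 2 (\<lambda>x. \<omega> (V x))) (o' n)" for n
    unfolding o'_def by (rule LqB_conv[OF L\<omega> D\<omega>(4) s]) simp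
  have Bw: "LqB 2 (Iq 2 (w k)) (conv (w k) (moll (s n)))" for k n by (rule LqB_conv[OF Lw iw s]) simp
  have LG2: "Lq 2 G" by (rule Lq_lower_exponent[OF LG S]) (use p3 in \<open>auto simp: G_def VS\<close>)
  have LG2': "Lq 2 (\<lambda>x. \<phi> x * G x $ \<alpha> $ j)" if \<phi>: "test_function U \<phi>" for \<phi> \<alpha> j
  proof -
    obtain B where B: "B > 0" "\<And>x. \<bar>\<phi> x\<bar> \<le> B" using test_function_bounded[OF \<phi>] by blast
    have [measurable]: "\<phi> \<in> borel_measurable borel" by (rule smooth_measurable[OF test_function_smooth[OF \<phi>]])
    show ?thesis
    proof (rule Lq_dominated(1)[OF LG2, of _ B])
      fix x
      have "\<bar>G x $ \<alpha> $ j\<bar> \<le> norm (G x)"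
        by (metis Finite_Cartesian_Product.norm_nth_le order_trans real_norm_def)
      then show "norm (\<phi> x * G x $ \<alpha> $ j) \<le> B * norm (G x)" using B by (simp add: abs_mult mult_mono)
    qed (use B in auto)
  qed
  have main: "(LBINT x. (\<omega> (V x) * (H k x $ \<alpha> $ j - H j x $ \<alpha> $ k)) * \<phi> x) = 0" if \<phi>: "test_function U \<phi>" for \<phi> \<alpha> j k
  proof -
    have sm\<phi>: "smooth \<phi>" by (rule test_function_smooth[OF \<phi>])
    note t\<phi>' = test_function_dderiv[OF \<phi>]
    define P where "P a b n = (LBINT x. (\<phi> x * G x $ \<alpha> $ a) * conv (w b) (moll (s n)) x) + (LBINT x. (dderiv (axis b 1) \<phi> x * G x $ \<alpha> $ a) * o' n x)" for a b n
    have Lo: "Lq 2 (o' n)" "Lq 2 (conv (w b) (moll (s n)))" for n b using Bo Bw by (auto simp: LqB_def)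
    have ii1: "integrable lborel (\<lambda>x. (\<phi> x * G x $ \<alpha> $ a) * conv (w b) (moll (s n)) x)" for a b n
      by (rule Lq_prod_integrable[OF bounded_bilinear_mult LG2'[OF \<phi>] Lo(2)]) auto
    have ii2: "integrable lborel (\<lambda>x. (dderiv (axis b 1) \<phi> x * G x $ \<alpha> $ a) * o' n x)" for a b n
      by (rule Lq_prod_integrable[OF bounded_bilinear_mult LG2'[OF t\<phi>'] Lo(1)]) auto
    have Pe: "P j k n = P k j n" for n
    proof -
      have th: "test_function U (\<lambda>x. \<phi> x * o' n x)" by (rule test_function_mult[OF smo \<phi>])
      have e: "(LBINT x. G x $ \<alpha> $ a * dderiv (axis b 1) (\<lambda>x. \<phi> x * o' n x) x) = P a b n" for a b
        unfolding P_def dderiv_mult[OF sm\<phi> smo] do' using ii1[of a b n] ii2[of b a n]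
        by (subst Bochner_Integration.integral_add[symmetric]) (auto simp: algebra_simps)
      show ?thesis using curl[OF th, of \<alpha> j k] unfolding c_def[symmetric] G_def[symmetric] e .
    qed
    have Pl: "(\<lambda>n. P a b n) \<longlonglongrightarrow> (LBINT x. (\<phi> x * G x $ \<alpha> $ a) * w b x) + (LBINT x. (dderiv (axis b 1) \<phi> x * G x $ \<alpha> $ a) * \<omega> (V x))" for a b
      unfolding P_def
      by (intro tendsto_add pairing_tendsto_LqB[OF bounded_bilinear_mult Bw LG2'[OF \<phi>] _ o2]
          pairing_tendsto_LqB[OF bounded_bilinear_mult Bo LG2'[OF t\<phi>'] _ o1]) auto
    have iwG: "integrable lborel (\<lambda>x. (\<phi> x * G x $ \<alpha> $ a) * w b x)" for a b
      using Lq_prod_integrable[OF bounded_bilinear_mult LG2'[OF \<phi>] Lw] by simp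
    have iK: "integrable lborel K" "integrable lborel (dK b)" for b using DK(4,5) by (auto simp: K_def[abs_def] dK_def[abs_def])
    have wK: "weak_dderiv UNIV (axis b 1) (\<lambda>x. K x $ \<alpha> $ a) (\<lambda>x. dK b x $ \<alpha> $ a)" for a b
      using DK(1)[of UNIV b] iK unfolding K_def[symmetric] dK_def[symmetric]
      by (intro weak_dderiv_nth integral_nth(2)) auto
    have i3: "integrable lborel (\<lambda>x. dK b x $ \<alpha> $ a * \<phi> x)" for a b
      using integrable_test_function_scaleR[OF \<phi> integral_nth(2)[OF integral_nth(2)[OF iK(2)]], of b \<alpha> a] by (simp add: mult.commute)
    have e2: "(LBINT x. (dderiv (axis b 1) \<phi> x * G x $ \<alpha> $ a) * \<omega> (V x)) = - (LBINT x. dK b x $ \<alpha> $ a * \<phi> x)" for a b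
      using weak_dderivD[OF wK test_function_mono[OF \<phi> subset_UNIV], of a b] by (simp add: KG mult_ac)
    have "(LBINT x. (\<phi> x * G x $ \<alpha> $ j) * w k x) - (LBINT x. dK k x $ \<alpha> $ j * \<phi> x)
        = (LBINT x. (\<phi> x * G x $ \<alpha> $ k) * w j x) - (LBINT x. dK j x $ \<alpha> $ k * \<phi> x)"
      using LIMSEQ_unique[OF Pl[of j k] Pl[of k j, folded Pe]] unfolding e2 by simp
    then have "(LBINT x. (dK k x $ \<alpha> $ j * \<phi> x - (\<phi> x * G x $ \<alpha> $ j) * w k x) - (dK j x $ \<alpha> $ k * \<phi> x - (\<phi> x * G x $ \<alpha> $ k) * w j x)) = 0"
      using iwG i3 by simp
    then show ?thesis by (simp add: dKH algebra_simps)
  qed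
  have iH: "integrable lborel (\<lambda>x. \<omega> (V x) * (H k x $ \<alpha> $ j - H j x $ \<alpha> $ k))" for \<alpha> j k
  proof -
    have "integrable lborel (\<lambda>x. w k x *\<^sub>R G x)" for k
      by (rule Lq_prod_integrable[OF bounded_bilinear_scaleR Lw LG2]) auto
    then have "integrable lborel (\<lambda>x. dK k x - w k x *\<^sub>R G x)" for k using DK(5)[of k] by (simp add: dK_def)
    then have "integrable lborel (\<lambda>x. \<omega> (V x) *\<^sub>R H k x)" for k unfolding dKH by simp
    from integral_nth(2)[OF integral_nth(2)[OF this]]
    have "integrable lborel (\<lambda>x. \<omega> (V x) * H k x $ \<alpha> $ j)" for k \<alpha> j by simp
    then show ?thesis unfolding right_diff_distrib by (intro Bochner_Integration.integrable_diff)
  qed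
  have "AE x in lborel. \<forall>\<alpha> j k. x \<in> U \<longrightarrow> \<omega> (V x) * (H k x $ \<alpha> $ j - H j x $ \<alpha> $ k) = 0"
    unfolding AE_all_countable by (intro allI fundamental_lemma[OF iH U main])
  then show ?thesis
  proof eventually_elim
    case (elim x)
    show ?case
    proof (intro impI allI)
      fix \<alpha> j k assume x: "x \<in> U"
      show "H k x $ \<alpha> $ j = H j x $ \<alpha> $ k"
      proof (cases "V x = 0")
        case False
        then have "\<omega> (V x) \<noteq> 0" using norm_ge_zero[of "V x"] by (simp add: \<omega>_def profile_def add_nonneg_eq_0_iff)
        then show ?thesis using elim x by auto
      qed (simp add: H_def)
    qed
  qed
qed

end

subsection \<open>The energy estimate\<close>

text \<open>Symmetry of \<open>H\<close> turns both mixed terms into \<open>\<Sum>k. (v \<bullet> H k)\<^sup>2\<close>.\<close>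
lemma symmetric_ellipticity:
  fixes H :: "'n::finite \<Rightarrow> real^'n^'N::finite" and v :: "real^'n^'N"
  assumes sym: "\<And>\<alpha> j k. H k $ \<alpha> $ j = H j $ \<alpha> $ k" and v: "norm v \<le> 1" and P: "P \<ge> 0"
    and \<gamma>: "0 \<le> \<gamma>" "\<gamma> \<le> 1" and \<mu>: "\<mu> \<ge> - \<gamma>"
  shows "(\<Sum>k\<in>UNIV. \<Sum>\<alpha>\<in>UNIV. \<Sum>j\<in>UNIV. (H k + (P * (v \<bullet> H k)) *\<^sub>R v) $ \<alpha> $ j * (H j + (\<mu> * (v \<bullet> H j)) *\<^sub>R v) $ \<alpha> $ k)
    \<ge> (1 - \<gamma>) * (\<Sum>k\<in>UNIV. (norm (H k))\<^sup>2)"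
proof -
  define a where "a k = v \<bullet> H k" for k
  define A where "A = (\<Sum>k\<in>UNIV. (a k)\<^sup>2)"
  define S where "S = (\<Sum>k\<in>UNIV. (norm (H k))\<^sup>2)"
  define Q where "Q = (\<Sum>\<alpha>\<in>UNIV. (\<Sum>j\<in>UNIV. a j * v $ \<alpha> $ j)\<^sup>2)"
  have in1: "X \<bullet> Y = (\<Sum>\<alpha>\<in>UNIV. \<Sum>j\<in>UNIV. X $ \<alpha> $ j * Y $ \<alpha> $ j)" for X Y :: "real^'n^'N"
    by (simp add: inner_vec_def)
  have T1: "(\<Sum>k\<in>UNIV. \<Sum>\<alpha>\<in>UNIV. \<Sum>j\<in>UNIV. H k $ \<alpha> $ j * H j $ \<alpha> $ k) = S"
    unfolding S_def power2_norm_eq_inner in1 using sym by (intro sum.cong refl) (metis (no_types, lifting))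
  have T2: "(\<Sum>k\<in>UNIV. \<Sum>\<alpha>\<in>UNIV. \<Sum>j\<in>UNIV. (P * a k) * v $ \<alpha> $ j * H j $ \<alpha> $ k) = P * A"
  proof -
    have "(\<Sum>\<alpha>\<in>UNIV. \<Sum>j\<in>UNIV. (P * a k) * v $ \<alpha> $ j * H j $ \<alpha> $ k) = P * (a k)\<^sup>2" for k
    proof -
      have "(\<Sum>\<alpha>\<in>UNIV. \<Sum>j\<in>UNIV. (P * a k) * v $ \<alpha> $ j * H j $ \<alpha> $ k) = (\<Sum>\<alpha>\<in>UNIV. \<Sum>j\<in>UNIV. (P * a k) * (v $ \<alpha> $ j * H k $ \<alpha> $ j))"
        by (intro sum.cong refl) (simp add: sym[of _ _ k] mult.assoc)
      also have "\<dots> = (P * a k) * (v \<bullet> H k)" unfolding in1 sum_distrib_left ..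
      finally show ?thesis by (simp add: a_def power2_eq_square)
    qed
    then show ?thesis by (simp add: A_def sum_distrib_left)
  qed
  have T3: "(\<Sum>k\<in>UNIV. \<Sum>\<alpha>\<in>UNIV. \<Sum>j\<in>UNIV. H k $ \<alpha> $ j * ((\<mu> * a j) * v $ \<alpha> $ k)) = \<mu> * A"
  proof -
    have "(\<Sum>k\<in>UNIV. \<Sum>\<alpha>\<in>UNIV. \<Sum>j\<in>UNIV. H k $ \<alpha> $ j * ((\<mu> * a j) * v $ \<alpha> $ k))
       = (\<Sum>j\<in>UNIV. \<Sum>\<alpha>\<in>UNIV. \<Sum>k\<in>UNIV. H k $ \<alpha> $ j * ((\<mu> * a j) * v $ \<alpha> $ k))"
      by (subst sum.swap, rule trans[OF _ sum.swap], intro sum.cong refl sum.swap)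
    also have "\<dots> = (\<Sum>j\<in>UNIV. \<mu> * (a j)\<^sup>2)"
    proof (rule sum.cong[OF refl])
      fix j
      have "(\<Sum>\<alpha>\<in>UNIV. \<Sum>k\<in>UNIV. H k $ \<alpha> $ j * ((\<mu> * a j) * v $ \<alpha> $ k)) = (\<Sum>\<alpha>\<in>UNIV. \<Sum>k\<in>UNIV. (\<mu> * a j) * (v $ \<alpha> $ k * H j $ \<alpha> $ k))"
        by (intro sum.cong refl) (simp add: sym[of _ _ j] mult_ac)
      also have "\<dots> = (\<mu> * a j) * (v \<bullet> H j)" unfolding in1 sum_distrib_left ..
      finally show "(\<Sum>\<alpha>\<in>UNIV. \<Sum>k\<in>UNIV. H k $ \<alpha> $ j * ((\<mu> * a j) * v $ \<alpha> $ k)) = \<mu> * (a j)\<^sup>2"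
        by (simp add: a_def power2_eq_square)
    qed
    finally show ?thesis by (simp add: A_def sum_distrib_left)
  qed
  have T4: "(\<Sum>k\<in>UNIV. \<Sum>\<alpha>\<in>UNIV. \<Sum>j\<in>UNIV. ((P * a k) * v $ \<alpha> $ j) * ((\<mu> * a j) * v $ \<alpha> $ k)) = P * \<mu> * Q"
  proof -
    have "(\<Sum>k\<in>UNIV. \<Sum>\<alpha>\<in>UNIV. \<Sum>j\<in>UNIV. ((P * a k) * v $ \<alpha> $ j) * ((\<mu> * a j) * v $ \<alpha> $ k))
      = (\<Sum>\<alpha>\<in>UNIV. \<Sum>k\<in>UNIV. \<Sum>j\<in>UNIV. P * \<mu> * ((a k * v $ \<alpha> $ k) * (a j * v $ \<alpha> $ j)))"
      by (subst sum.swap) (intro sum.cong refl, simp add: mult_ac)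
    also have "\<dots> = P * \<mu> * Q"
    proof -
      have "(\<Sum>j\<in>UNIV. a j * v $ \<alpha> $ j)\<^sup>2 = (\<Sum>k\<in>UNIV. \<Sum>j\<in>UNIV. (a k * v $ \<alpha> $ k) * (a j * v $ \<alpha> $ j))" for \<alpha>
        unfolding power2_eq_square by (rule sum_product)
      then show ?thesis by (simp only: Q_def sum_distrib_left)
    qed
    finally show ?thesis .
  qed
  have sum4: "(\<Sum>k\<in>UNIV. \<Sum>\<alpha>\<in>UNIV. \<Sum>j\<in>UNIV. (H k + (P * (v \<bullet> H k)) *\<^sub>R v) $ \<alpha> $ j * (H j + (\<mu> * (v \<bullet> H j)) *\<^sub>R v) $ \<alpha> $ k)
    = S + P * A + \<mu> * A + P * \<mu> * Q"
    unfolding T1[symmetric] T2[symmetric] T3[symmetric] T4[symmetric] sum.distrib[symmetric]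
    by (intro sum.cong refl) (simp add: a_def algebra_simps)
  have Q0: "Q \<ge> 0" unfolding Q_def by (intro sum_nonneg) simp
  have QA: "Q \<le> A"
  proof -
    have "Q = (norm (v *v (\<chi> j. a j)))\<^sup>2"
      unfolding Q_def power2_norm_eq_inner by (simp add: inner_vec_def matrix_vector_mult_def power2_eq_square mult.commute)
    also have "\<dots> \<le> (1 * norm (\<chi> j. a j))\<^sup>2"
      using v by (intro power_mono order_trans[OF norm_matrix_vector_mult_le] mult_right_mono) auto
    also have "\<dots> = (\<chi> j. a j) \<bullet> (\<chi> j. a j)" by (simp add: power2_norm_eq_inner)
    also have "\<dots> = A" by (simp add: inner_vec_def A_def power2_eq_square)
    finally show ?thesis .
  qed
  have A0: "A \<ge> 0" unfolding A_def by (intro sum_nonneg) simp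
  have AS: "A \<le> S"
  proof -
    have "\<bar>a k\<bar> \<le> norm (H k)" for k
      unfolding a_def using v by (intro order_trans[OF Cauchy_Schwarz_ineq2]) (simp add: mult_left_le_one_le)
    then show ?thesis unfolding A_def S_def by (intro sum_mono) (metis abs_norm_cancel power2_abs power_mono abs_ge_zero)
  qed
  \<comment> \<open>Only negative \<mu> can hurt: \<mu> A loses at most \<gamma> A \<le> \<gamma> S,
    and P \<mu> Q loses at most \<gamma> P A, which the term P A covers.\<close>
  have "(1 - \<gamma>) * S \<le> S + P * A + \<mu> * A + P * \<mu> * Q"
  proof (cases "\<mu> \<ge> 0")
    case True
    then have "0 \<le> \<gamma> * S + P * A + \<mu> * A + P * \<mu> * Q" using A0 Q0 P AS \<gamma> by (intro add_nonneg_nonneg mult_nonneg_nonneg) auto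
    then show ?thesis by (simp add: algebra_simps)
  next
    case False
    have "- (\<gamma> * A) \<le> \<mu> * A" using mult_right_mono[OF \<mu> A0] by simp
    moreover have "- (\<gamma> * (P * A)) \<le> P * \<mu> * Q"
    proof -
      have "\<mu> * (P * A) \<le> \<mu> * (P * Q)" using False QA P by (intro mult_left_mono_neg mult_left_mono) auto
      moreover have "- \<gamma> * (P * A) \<le> \<mu> * (P * A)" using \<mu> A0 P by (intro mult_right_mono) auto
      ultimately show ?thesis by (simp add: mult_ac)
    qed
    moreover have "\<gamma> * A \<le> \<gamma> * S" using AS \<gamma> by (intro mult_left_mono)
    moreover have "\<gamma> * (P * A) \<le> 1 * (P * A)" by (rule mult_right_mono) (use \<gamma> A0 P in auto)
    ultimately show ?thesis by (simp add: algebra_simps)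
  qed
  then show ?thesis unfolding sum4 S_def .
qed

section \<open>Derivatives expressed through H\<close>

context plap_reg
begin

text \<open>G has degree 1 - c = 2/p in V, so the radial component is multiplied by 2/p; inverting
  this factor produces the p/2 in \<open>drad_H\<close>.\<close>

lemma sgn_H: "sgn (V x) \<bullet> H k x = norm (V x) powr (- c) * ((1 - c) * (sgn (V x) \<bullet> W k x))"
proof (cases "V x = 0")
  case False
  then have "sgn (V x) \<bullet> sgn (V x) = 1" by (simp add: power2_norm_eq_inner[symmetric] norm_sgn)
  then show ?thesis by (simp add: H_def drad_def profile_power inner_add_right algebra_simps)
qed simp

text \<open>Puts every derivative of a radial function of V into the shape required by
  \<open>symmetric_ellipticity\<close>, a multiple of H with a correction along the direction of V.
  The slope of the profile with respect to |V| becomes p/2 times as large with respect to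
  |\<nabla>u|, since |V| = |\<nabla>u|^(p/2).\<close>

lemma drad_H:
  "drad (\<alpha> - c) \<beta> \<epsilon> (V x) (W k x) = profile \<alpha> \<beta> \<epsilon> (norm (V x)) *\<^sub>R
     (H k x + ((p / 2 * pslope \<alpha> \<beta> \<epsilon> (norm (V x))) * (sgn (V x) \<bullet> H k x)) *\<^sub>R sgn (V x))"
proof -
  have "1 - c = 2 / p" by (simp add: c_def)
  then have "p / 2 * (sgn (V x) \<bullet> H k x) = norm (V x) powr (- c) * (sgn (V x) \<bullet> W k x)"
    unfolding sgn_H using p3 by simp
  then show ?thesis unfolding drad_via_H by (simp add: mult_ac)
qed

lemma X_H: "X k x = norm (V x) powr (2 * c) *\<^sub>R (H k x + ((p - 2) * (sgn (V x) \<bullet> H k x)) *\<^sub>R sgn (V x))"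
proof -
  have "p / 2 * (2 * c) = p - 2" using p3 by (simp add: c_def field_simps)
  then show ?thesis using drad_H[of "2 * c" 0 1 x k] by (simp add: X_def profile_power)
qed

lemma norm_add_sgn_le:
  fixes w v :: "'b::real_inner"
  shows "norm (w + (\<mu> * (sgn v \<bullet> w)) *\<^sub>R sgn v) \<le> (1 + \<bar>\<mu>\<bar>) * norm w"
proof -
  have s: "norm (sgn v) \<le> 1" by (simp add: norm_sgn)
  have "norm ((\<mu> * (sgn v \<bullet> w)) *\<^sub>R sgn v) \<le> (\<bar>\<mu>\<bar> * (1 * norm w)) * 1"
    unfolding norm_scaleR real_norm_def abs_mult using s
    by (intro mult_mono mult_left_mono order_trans[OF Cauchy_Schwarz_ineq2]) auto
  then show ?thesis by (intro order_trans[OF norm_triangle_ineq]) (simp add: algebra_simps)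
qed

lemma norm_X_le: "norm (X k x) \<le> norm (V x) powr (2 * c) * ((p - 1) * norm (H k x))"
  unfolding X_H norm_scaleR using norm_add_sgn_le[of "H k x" "p - 2" "V x"] p3
  by (simp add: mult_left_mono)

lemma norm_H_le: "norm (V x) powr c * norm (H k x) \<le> 2 * norm (W k x)"
proof (cases "V x = 0")
  case False
  have "norm (H k x) = norm (V x) powr (- c) * norm (W k x + ((- c) * (sgn (V x) \<bullet> W k x)) *\<^sub>R sgn (V x))"
    by (simp add: H_def drad_def profile_power)
  then have "norm (V x) powr c * norm (H k x) = norm (W k x + ((- c) * (sgn (V x) \<bullet> W k x)) *\<^sub>R sgn (V x))"
    using False by (simp add: powr_minus)
  also have "\<dots> \<le> (1 + \<bar>- c\<bar>) * norm (W k x)" by (rule norm_add_sgn_le)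
  also have "\<dots> \<le> 2 * norm (W k x)" using cc by (intro mult_right_mono) auto
  finally show ?thesis .
qed simp

end

section \<open>The regularised test field\<close>

locale plap_reg_eps = plap_reg U S p M V f g W t
  for U S :: "(real^'n) set" and p M :: real and V :: "real^'n \<Rightarrow> real^'n^'N"
    and f :: "real^'n \<Rightarrow> real^'N" and g :: "real^'n \<Rightarrow> real^'n^'N" and W :: "'n \<Rightarrow> real^'n \<Rightarrow> real^'n^'N" and t :: "nat \<Rightarrow> real" +
  fixes \<gamma> \<epsilon> :: real
  assumes \<gamma>: "0 \<le> \<gamma>" "\<gamma> < 1" and \<epsilon>: "\<epsilon> > 0"
begin

text \<open>As |V| = |G|^(p/2), this exponent gives |V|^(-\<delta>) = |G|^(-\<gamma>).\<close>

definition "\<delta> = 2 * \<gamma> / p"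
text \<open>The product \<zeta> G of \<open>F_G\<close>, written as one radial map of V. Its
  exponent satisfies 0 < 2 - c \<le> 2 + \<delta>, which makes it Lipschitz and differentiable also
  at 0, unlike G alone.\<close>

definition "F x = rad (2 - c) (2 + \<delta>) \<epsilon> (V x)"
definition "Y k x = drad (2 - c) (2 + \<delta>) \<epsilon> (V x) (W k x)"
definition "\<zeta> x = profile 2 (2 + \<delta>) \<epsilon> (norm (V x))"

lemma \<delta>0: "\<delta> \<ge> 0" "\<delta> < 1 - c" "\<delta> < 1"
  using \<gamma> p3 by (auto simp: \<delta>_def c_def divide_less_eq field_simps)

lemma \<zeta>_le: "\<zeta> x \<le> \<epsilon> powr (- \<delta>)" "\<zeta> x \<le> norm (V x) powr (- \<delta>)" "\<zeta> x \<ge> 0"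
proof -
  let ?s = "norm (V x)"
  have "?s powr 2 * (\<epsilon> + ?s) powr (- (2 + \<delta>)) \<le> (\<epsilon> + ?s) powr 2 * (\<epsilon> + ?s) powr (- (2 + \<delta>))"
    using \<epsilon> by (intro mult_right_mono powr_mono2) auto
  also have "\<dots> = (\<epsilon> + ?s) powr (- \<delta>)" by (simp add: powr_add[symmetric])
  finally have le: "\<zeta> x \<le> (\<epsilon> + ?s) powr (- \<delta>)" by (simp add: \<zeta>_def profile_def)
  show "\<zeta> x \<le> \<epsilon> powr (- \<delta>)" using le powr_mono2'[of "- \<delta>" \<epsilon> "\<epsilon> + ?s"] \<delta>0 \<epsilon> by force
  show "\<zeta> x \<le> ?s powr (- \<delta>)"
  proof (cases "?s = 0")
    case False
    then show ?thesis using le powr_mono2'[of "- \<delta>" ?s "\<epsilon> + ?s"] \<delta>0 \<epsilon> by force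
  qed (simp add: \<zeta>_def)
  show "\<zeta> x \<ge> 0" by (simp add: \<zeta>_def profile_nonneg)
qed

lemma [measurable]: "F \<in> borel_measurable borel" "Y k \<in> borel_measurable borel" "\<zeta> \<in> borel_measurable borel"
  unfolding F_def[abs_def] Y_def[abs_def] \<zeta>_def[abs_def] profile_def by measurable

lemma Y_H: "Y k x = \<zeta> x *\<^sub>R (H k x + ((p / 2 * pslope 2 (2 + \<delta>) \<epsilon> (norm (V x))) * (sgn (V x) \<bullet> H k x)) *\<^sub>R sgn (V x))"
  unfolding Y_def \<zeta>_def by (rule drad_H)

lemma F_G: "F x = \<zeta> x *\<^sub>R G x"
  by (cases "V x = 0") (simp_all add: F_def G_def \<zeta>_def rad_def profile_power, simp add: profile_def powr_diff powr_minus divide_inverse)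

lemma norm_G_eq: "norm (G x) = norm (V x) powr (1 - c)"
  unfolding G_def norm_rad_power by simp

lemma F_lipschitz: "norm (rad (2 - c) (2 + \<delta>) \<epsilon> x - rad (2 - c) (2 + \<delta>) \<epsilon> y)
    \<le> 6 * \<epsilon> powr ((2 - c) - (2 + \<delta>)) * (1 + (2 - c) + (2 + \<delta>)) * norm (x - y)" for x y :: "real^'n^'N"
  using cc \<delta>0 \<epsilon> by (intro rad_lipschitz) auto

lemma F_deriv: "(rad (2 - c) (2 + \<delta>) \<epsilon> has_derivative drad (2 - c) (2 + \<delta>) \<epsilon> y) (at y)" for y :: "real^'n^'N"
  using cc \<delta>0 \<epsilon> by (intro rad_has_derivative_0) auto

lemma weak_F: "weak_dderiv A' (axis k 1) F (Y k)" "Lq 2 (Y k)" "integrable lborel F" "integrable lborel (Y k)"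
proof -
  have n: "6 * \<epsilon> powr ((2 - c) - (2 + \<delta>)) * (1 + (2 - c) + (2 + \<delta>)) \<ge> 0" using cc \<delta>0 by simp
  note D = weak_dderiv_Lipschitz_comp[where R="rad (2 - c) (2 + \<delta>) \<epsilon>" and R'="drad (2 - c) (2 + \<delta>) \<epsilon>", OF F_deriv rad_0 F_lipschitz n]
  have m: "(\<lambda>x. drad (2 - c) (2 + \<delta>) \<epsilon> (V x) (W k x)) \<in> borel_measurable borel" by measurable
  show "weak_dderiv A' (axis k 1) F (Y k)" "integrable lborel F" "integrable lborel (Y k)"
    using D(1,4,5)[OF rad_measurable m] by (simp_all add: F_def[abs_def] Y_def[abs_def])
  show "Lq 2 (Y k)" using D(2)[OF rad_measurable m] by (simp add: LqB_def Y_def[abs_def])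
qed

lemma LF: "Lq p F"
  by (rule Lq_dominated(1)[OF LG, of _ "\<epsilon> powr (- \<delta>)"])
     (use \<zeta>_le pp in \<open>auto simp: F_G intro!: mult_right_mono\<close>)

text \<open>Increments of F carry the weight max|V|^(-c), and the factor |V x|^c cancels it. This
  feeds \<open>LqB_weighted_mollified_derivative\<close>; the constant depends on \<epsilon>, which
  is harmless because \<epsilon> is fixed in that limit.\<close>

lemma weighted_F_increment:
  obtains C where "C \<ge> 0" "\<And>x y. norm (V x) powr c * norm (F y - F x) \<le> C * norm (V y - V x)"
proof -
  define C where "C = \<epsilon> powr (- \<delta>) * (1 + \<bar>2 - c\<bar> + \<bar>2 + \<delta>\<bar>) * (5 + 2 powr \<bar>- c\<bar>)"
  have C: "C \<ge> 0" by (simp add: C_def)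
  have pb: "profile (2 - c) (2 + \<delta>) \<epsilon> s \<le> \<epsilon> powr (- \<delta>) * s powr (- c)" if s: "s > 0" for s
  proof -
    have "s powr 2 * (\<epsilon> + s) powr (- (2 + \<delta>)) \<le> (\<epsilon> + s) powr 2 * (\<epsilon> + s) powr (- (2 + \<delta>))"
      using \<epsilon> s by (intro mult_right_mono powr_mono2) auto
    also have "\<dots> = (\<epsilon> + s) powr (- \<delta>)" by (simp add: powr_add[symmetric])
    also have "\<dots> \<le> \<epsilon> powr (- \<delta>)" using \<delta>0 \<epsilon> s by (intro powr_mono2') auto
    finally have "(s powr 2 * (\<epsilon> + s) powr (- (2 + \<delta>))) * s powr (- c) \<le> \<epsilon> powr (- \<delta>) * s powr (- c)"
      by (intro mult_right_mono) auto
    moreover have "profile (2 - c) (2 + \<delta>) \<epsilon> s = (s powr 2 * (\<epsilon> + s) powr (- (2 + \<delta>))) * s powr (- c)"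
      using s by (simp add: profile_def powr_diff powr_minus divide_inverse mult_ac)
    ultimately show ?thesis by simp
  qed
  have "norm (V x) powr c * norm (F y - F x) \<le> C * norm (V y - V x)" for x y
  proof (cases "V x = 0")
    case False
    let ?m = "max (norm (V y)) (norm (V x))"
    have "norm (F y - F x) \<le> C * ?m powr (- c) * norm (V y - V x)"
      unfolding F_def C_def by (rule rad_diff_le[OF \<epsilon> _ pb]) (use cc in auto)
    also have "\<dots> \<le> C * norm (V x) powr (- c) * norm (V y - V x)"
      using C False cc by (intro mult_right_mono mult_left_mono powr_mono2') auto
    finally have "norm (V x) powr c * norm (F y - F x) \<le> norm (V x) powr c * (C * norm (V x) powr (- c) * norm (V y - V x))"
      by (intro mult_left_mono) auto
    also have "\<dots> = C * norm (V y - V x)" using False by (simp add: powr_minus)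
    finally show ?thesis .
  qed (use C in simp)
  then show ?thesis using that C by blast
qed

text \<open>X is known only in L^p', so L2 bounds for the mollified derivatives of F are not enough
  for the limit. The growth |V|^c of X is moved to the other factor: \<open>Wt\<close> is in L2, and
  |V|^c times the mollified derivative is bounded in L2 uniformly. The component F \<alpha> k tests
  the equation differentiated in direction k, which is why j and k change places between X and
  Y.\<close>

lemma tested_component:
  assumes \<eta>: "test_function U \<eta>"
  shows "(\<Sum>j\<in>UNIV. LBINT x. (\<eta> x)\<^sup>2 * (X k x $ \<alpha> $ j * Y j x $ \<alpha> $ k)) + (LBINT x. (2 * \<eta> x * (X k x $ \<alpha> \<bullet> grad \<eta> x)) * F x $ \<alpha> $ k)
    = - (LBINT x. (g x $ \<alpha> $ k * (\<eta> x)\<^sup>2) * F x $ \<alpha> $ k)"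
    "\<And>j. integrable lborel (\<lambda>x. (\<eta> x)\<^sup>2 * (X k x $ \<alpha> $ j * Y j x $ \<alpha> $ k))"
    "integrable lborel (\<lambda>x. (2 * \<eta> x * (X k x $ \<alpha> \<bullet> grad \<eta> x)) * F x $ \<alpha> $ k)"
    "integrable lborel (\<lambda>x. (g x $ \<alpha> $ k * (\<eta> x)\<^sup>2) * F x $ \<alpha> $ k)"
proof -
  have sm\<eta>: "smooth \<eta>" by (rule test_function_smooth[OF \<eta>])
  have [measurable]: "\<eta> \<in> borel_measurable borel" "grad \<eta> \<in> borel_measurable borel"
    by (rule smooth_measurable[OF sm\<eta>], rule grad_measurable[OF sm\<eta>])
  obtain B where B: "B > 0" "\<And>x. \<bar>\<eta> x\<bar> \<le> B" using test_function_bounded[OF \<eta>] by blast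
  obtain D where D: "D > 0" "\<And>x. norm (grad \<eta> x) \<le> D" using grad_bounded[OF \<eta>] by blast
  have B2: "(\<eta> x)\<^sup>2 \<le> B\<^sup>2" for x using B(2)[of x] B(1) by (metis abs_le_square_iff abs_of_pos)
  obtain r where r: "strict_mono r" "AE x in lborel. (\<lambda>n. conv F (moll (1 / real (Suc (r n)))) x) \<longlonglongrightarrow> F x"
    using conv_AE_subseq[OF weak_F(3) _ inverse_seq] by auto
  have r0: "(\<lambda>n. 1 / real (Suc (r n))) \<longlonglongrightarrow> 0" using LIMSEQ_subseq_LIMSEQ[OF inverse_seq r(1)] by (simp add: o_def)
  obtain r' where r': "strict_mono r'"
    "\<And>k. k \<in> UNIV \<Longrightarrow> AE x in lborel. (\<lambda>n. conv (Y k) (moll (1 / real (Suc (r (r' n))))) x) \<longlonglongrightarrow> Y k x"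
    using conv_AE_subseq_finite[of "UNIV :: 'n set" Y "\<lambda>n. 1 / real (Suc (r n))", OF finite weak_F(4) _ r0] by auto
  define s where "s n = 1 / real (Suc (r (r' n)))" for n
  have s: "s n > 0" for n by (simp add: s_def)
  define Fn where "Fn n = conv F (moll (s n))" for n
  define Yn where "Yn j n = conv (Y j) (moll (s n))" for j n
  have [measurable]: "Fn n \<in> borel_measurable borel" "Yn j n \<in> borel_measurable borel" for n j
    unfolding Fn_def Yn_def by measurable
  have Fl: "AE x in lborel. (\<lambda>n. Fn n x) \<longlonglongrightarrow> F x"
    using r(2) by eventually_elim (use LIMSEQ_subseq_LIMSEQ[OF _ r'(1)] in \<open>force simp: Fn_def s_def o_def\<close>)
  have Yl: "AE x in lborel. (\<lambda>n. Yn j n x) \<longlonglongrightarrow> Y j x" for j using r'(2)[of j] by (simp add: Yn_def s_def)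
  have dF: "dderiv (axis j 1) (\<lambda>x. Fn n x $ \<alpha> $ k) x = Yn j n x $ \<alpha> $ k" and smF: "smooth (\<lambda>x. Fn n x $ \<alpha> $ k)" for j n x
  proof -
    have iF: "integrable lborel (\<lambda>x. F x $ \<alpha> $ k)" by (intro integral_nth(2) weak_F)
    have e: "(\<lambda>x. Fn n x $ \<alpha> $ k) = conv (\<lambda>x. F x $ \<alpha> $ k) (moll (s n))"
      unfolding Fn_def conv_nth[OF weak_F(3) test_function_moll[OF s]] conv_nth[OF integral_nth(2)[OF weak_F(3)] test_function_moll[OF s]] ..
    show "smooth (\<lambda>x. Fn n x $ \<alpha> $ k)" unfolding e by (rule smooth_conv[OF test_function_moll[OF s] iF])
    have mz: "norm z \<le> s n" if "moll (s n) z \<noteq> 0" for z :: "real^'n" using that moll_eq_0[OF s, of n z] by force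
    have w: "weak_dderiv UNIV (axis j 1) (\<lambda>x. F x $ \<alpha> $ k) (\<lambda>x. Y j x $ \<alpha> $ k)"
      by (intro weak_dderiv_nth weak_F integral_nth(2))
    show "dderiv (axis j 1) (\<lambda>x. Fn n x $ \<alpha> $ k) x = Yn j n x $ \<alpha> $ k"
      unfolding e dderiv_conv[OF test_function_moll[OF s] iF] Yn_def conv_nth[OF weak_F(4) test_function_moll[OF s]] conv_nth[OF integral_nth(2)[OF weak_F(4)] test_function_moll[OF s]]
      by (rule conv_weak_dderiv[OF w test_function_moll[OF s] mz]) auto
  qed
  obtain C where C: "C \<ge> 0" "\<And>x y. norm (V x) powr c * norm (F y - F x) \<le> C * norm (V y - V x)" using weighted_F_increment by blast
  have YnF: "Yn j n x = conv F (dderiv (axis j 1) (moll (s n))) x" for j n x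
  proof -
    have mz: "norm z \<le> s n" if "moll (s n) z \<noteq> 0" for z :: "real^'n" using that moll_eq_0[OF s, of n z] by force
    show ?thesis unfolding Yn_def by (rule conv_weak_dderiv[OF weak_F(1)[of UNIV] test_function_moll[OF s] mz, symmetric]) auto
  qed
  have "\<forall>j. \<exists>B. \<forall>n. LqB 2 B (\<lambda>x. norm (V x) powr c *\<^sub>R Yn j n x)"
  proof
    fix j
    obtain B where B: "\<And>t. t > 0 \<Longrightarrow> LqB 2 B (\<lambda>x. norm (V x) powr c *\<^sub>R conv F (dderiv (axis j 1) (moll t)) x)"
      by (rule LqB_weighted_mollified_derivative[OF LV lip weak_F(3) _ _ C(1), of "\<lambda>x. norm (V x) powr c"]) (use C(2) in auto)
    show "\<exists>B. \<forall>n. LqB 2 B (\<lambda>x. norm (V x) powr c *\<^sub>R Yn j n x)"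
    proof (intro exI allI)
      fix n show "LqB 2 B (\<lambda>x. norm (V x) powr c *\<^sub>R Yn j n x)" unfolding YnF by (rule B[OF s])
    qed
  qed
  from choice[OF this] obtain BY where BY: "\<And>j n. LqB 2 (BY j) (\<lambda>x. norm (V x) powr c *\<^sub>R Yn j n x)" by blast
  have BY': "LqB 2 (BY j) (\<lambda>x. norm (V x) powr c * Yn j n x $ \<alpha> $ k)" for j n
    using LqB_nth[OF LqB_nth[OF BY[of j n]], of \<alpha> k] by simp
  have Yl': "AE x in lborel. (\<lambda>n. norm (V x) powr c * Yn j n x $ \<alpha> $ k) \<longlonglongrightarrow> norm (V x) powr c * Y j x $ \<alpha> $ k" for j
    using Yl[of j] by eventually_elim (intro tendsto_intros)
  have BF: "LqB p (Iq p F) (\<lambda>x. Fn n x $ \<alpha> $ k)" for n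
    unfolding Fn_def using pp by (intro LqB_nth LqB_conv LF weak_F s) auto
  have Fl': "AE x in lborel. (\<lambda>n. Fn n x $ \<alpha> $ k) \<longlonglongrightarrow> F x $ \<alpha> $ k"
    using Fl by eventually_elim (intro tendsto_intros)
  have Lw1: "Lq 2 (\<lambda>x. (\<eta> x)\<^sup>2 * Wt k x $ \<alpha> $ j)" for j
  proof (rule Lq_dominated(1)[OF LWt[of k], of _ "B\<^sup>2"])
    fix x
    have "\<bar>Wt k x $ \<alpha> $ j\<bar> \<le> norm (Wt k x)" by (metis Finite_Cartesian_Product.norm_nth_le order_trans real_norm_def)
    then show "norm ((\<eta> x)\<^sup>2 * Wt k x $ \<alpha> $ j) \<le> B\<^sup>2 * norm (Wt k x)" using B2 by (simp add: abs_mult mult_mono)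
  qed auto
  have Lw2: "Lq p' (\<lambda>x. 2 * \<eta> x * (X k x $ \<alpha> \<bullet> grad \<eta> x))"
  proof (rule Lq_dominated(1)[OF LX[of k], of _ "2 * B * D"])
    fix x
    have "\<bar>X k x $ \<alpha> \<bullet> grad \<eta> x\<bar> \<le> norm (X k x) * D"
      using D by (intro order_trans[OF Cauchy_Schwarz_ineq2] mult_mono) (auto simp: Finite_Cartesian_Product.norm_nth_le)
    then have "\<bar>\<eta> x\<bar> * \<bar>X k x $ \<alpha> \<bullet> grad \<eta> x\<bar> \<le> B * (norm (X k x) * D)" using B by (intro mult_mono) auto
    then show "norm (2 * \<eta> x * (X k x $ \<alpha> \<bullet> grad \<eta> x)) \<le> 2 * B * D * norm (X k x)" by (simp add: abs_mult mult_ac)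
  qed (use B D pp in auto)
  have Lw3: "Lq p' (\<lambda>x. g x $ \<alpha> $ k * (\<eta> x)\<^sup>2)"
  proof (rule Lq_dominated(1)[OF g(1), of _ "B\<^sup>2"])
    fix x
    have "\<bar>g x $ \<alpha> $ k\<bar> \<le> norm (g x)" by (metis Finite_Cartesian_Product.norm_nth_le order_trans real_norm_def)
    then show "norm (g x $ \<alpha> $ k * (\<eta> x)\<^sup>2) \<le> B\<^sup>2 * norm (g x)" using B2[of x] mult_mono[of "\<bar>g x $ \<alpha> $ k\<bar>" "norm (g x)" "(\<eta> x)\<^sup>2" "B\<^sup>2"] by (simp add: abs_mult mult.commute)
  qed (use pp in auto)
  have two: "(1::real) < 2" "(1::real) / 2 + 1 / 2 = 1" by auto
  have XY: "(\<eta> x)\<^sup>2 * (X k x $ \<alpha> $ j * y) = ((\<eta> x)\<^sup>2 * Wt k x $ \<alpha> $ j) * (norm (V x) powr c * y)" for x j y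
    by (simp add: X_Wt mult_ac)
  have i1: "integrable lborel (\<lambda>x. (\<eta> x)\<^sup>2 * (X k x $ \<alpha> $ j * Yn j n x $ \<alpha> $ k))" for j n
    unfolding XY using BY'[of j n] unfolding LqB_def
    by (intro Lq_prod_integrable[OF bounded_bilinear_mult Lw1 _ two(1,1,2)]) simp
  have i2: "integrable lborel (\<lambda>x. (2 * \<eta> x * (X k x $ \<alpha> \<bullet> grad \<eta> x)) * Fn n x $ \<alpha> $ k)" for n
    using BF[of n] unfolding LqB_def by (intro Lq_prod_integrable[OF bounded_bilinear_mult Lw2 _ pp(2,1,4)]) simp
  have "LqB 2 (BY j) (\<lambda>x. norm (V x) powr c * Y j x $ \<alpha> $ k)" for j
    by (rule LqB_limit[OF BY' _ Yl']) auto
  then show I1: "\<And>j. integrable lborel (\<lambda>x. (\<eta> x)\<^sup>2 * (X k x $ \<alpha> $ j * Y j x $ \<alpha> $ k))"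
    unfolding XY LqB_def by (intro Lq_prod_integrable[OF bounded_bilinear_mult Lw1 _ two(1,1,2)]) simp
  have "LqB p (Iq p F) (\<lambda>x. F x $ \<alpha> $ k)" by (rule LqB_limit[OF BF _ Fl']) (use pp in auto)
  then have LFc: "Lq p (\<lambda>x. F x $ \<alpha> $ k)" by (simp add: LqB_def)
  show "integrable lborel (\<lambda>x. (2 * \<eta> x * (X k x $ \<alpha> \<bullet> grad \<eta> x)) * F x $ \<alpha> $ k)"
    by (rule Lq_prod_integrable[OF bounded_bilinear_mult Lw2 LFc pp(2,1,4)])
  show "integrable lborel (\<lambda>x. (g x $ \<alpha> $ k * (\<eta> x)\<^sup>2) * F x $ \<alpha> $ k)"
    by (rule Lq_prod_integrable[OF bounded_bilinear_mult Lw3 LFc pp(2,1,4)])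
  have key: "(\<Sum>j\<in>UNIV. LBINT x. (\<eta> x)\<^sup>2 * (X k x $ \<alpha> $ j * Yn j n x $ \<alpha> $ k)) + (LBINT x. (2 * \<eta> x * (X k x $ \<alpha> \<bullet> grad \<eta> x)) * Fn n x $ \<alpha> $ k)
    = - (LBINT x. (g x $ \<alpha> $ k * (\<eta> x)\<^sup>2) * Fn n x $ \<alpha> $ k)" for n
  proof -
    let ?w = "\<lambda>x. Fn n x $ \<alpha> $ k"
    let ?\<psi> = "\<lambda>x. \<eta> x * (\<eta> x * ?w x)"
    have sm2: "smooth (\<lambda>x. \<eta> x * ?w x)" by (rule smooth_mult[OF sm\<eta> smF])
    have t\<psi>: "test_function U ?\<psi>" by (rule test_function_mult[OF sm2 \<eta>])
    have gr: "X k x $ \<alpha> \<bullet> grad ?\<psi> x = (\<Sum>j\<in>UNIV. (\<eta> x)\<^sup>2 * (X k x $ \<alpha> $ j * Yn j n x $ \<alpha> $ k)) + (2 * \<eta> x * (X k x $ \<alpha> \<bullet> grad \<eta> x)) * ?w x" for x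
    proof -
      have "dderiv (axis j 1) ?\<psi> x = (\<eta> x)\<^sup>2 * Yn j n x $ \<alpha> $ k + (2 * \<eta> x * grad \<eta> x $ j) * ?w x" for j
        by (simp add: dderiv_mult[OF sm\<eta> sm2] dderiv_mult[OF sm\<eta> smF] dF grad_nth power2_eq_square algebra_simps)
      then have "X k x $ \<alpha> \<bullet> grad ?\<psi> x = (\<Sum>j\<in>UNIV. X k x $ \<alpha> $ j * ((\<eta> x)\<^sup>2 * Yn j n x $ \<alpha> $ k + (2 * \<eta> x * grad \<eta> x $ j) * ?w x))"
        by (simp add: inner_vec_def grad_nth)
      then show ?thesis by (simp add: inner_vec_def sum.distrib sum_distrib_left sum_distrib_right algebra_simps)
    qed
    have "(LBINT x. X k x $ \<alpha> \<bullet> grad ?\<psi> x) = - (LBINT x. g x $ \<alpha> $ k * ?\<psi> x)" by (rule eqn_derivative[OF t\<psi>])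
    then show ?thesis unfolding gr using i1[of _ n] i2[of n] by (simp add: power2_eq_square mult_ac)
  qed
  have l1: "(\<lambda>n. (\<Sum>j\<in>UNIV. LBINT x. (\<eta> x)\<^sup>2 * (X k x $ \<alpha> $ j * Yn j n x $ \<alpha> $ k)) + (LBINT x. (2 * \<eta> x * (X k x $ \<alpha> \<bullet> grad \<eta> x)) * Fn n x $ \<alpha> $ k))
     \<longlonglongrightarrow> (\<Sum>j\<in>UNIV. LBINT x. (\<eta> x)\<^sup>2 * (X k x $ \<alpha> $ j * Y j x $ \<alpha> $ k)) + (LBINT x. (2 * \<eta> x * (X k x $ \<alpha> \<bullet> grad \<eta> x)) * F x $ \<alpha> $ k)"
    unfolding XY
    by (intro tendsto_add tendsto_sum pairing_tendsto_LqB[OF bounded_bilinear_mult BY' Lw1 _ Yl' two(1,1,2)]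
        pairing_tendsto_LqB[OF bounded_bilinear_mult BF Lw2 _ Fl' pp(1,2,3)]) measurable
  have l2: "(\<lambda>n. - (LBINT x. (g x $ \<alpha> $ k * (\<eta> x)\<^sup>2) * Fn n x $ \<alpha> $ k)) \<longlonglongrightarrow> - (LBINT x. (g x $ \<alpha> $ k * (\<eta> x)\<^sup>2) * F x $ \<alpha> $ k)"
    by (intro tendsto_minus pairing_tendsto_LqB[OF bounded_bilinear_mult BF Lw3 _ Fl' pp(1,2,3)]) measurable
  show "(\<Sum>j\<in>UNIV. LBINT x. (\<eta> x)\<^sup>2 * (X k x $ \<alpha> $ j * Y j x $ \<alpha> $ k)) + (LBINT x. (2 * \<eta> x * (X k x $ \<alpha> \<bullet> grad \<eta> x)) * F x $ \<alpha> $ k)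
    = - (LBINT x. (g x $ \<alpha> $ k * (\<eta> x)\<^sup>2) * F x $ \<alpha> $ k)"
    using LIMSEQ_unique[OF l1[unfolded key] l2] .
qed

end

section \<open>Energy inequality and increments\<close>

lemma weak_dderiv_axis_sum:
  fixes w :: "real^'n \<Rightarrow> 'b::euclidean_space"
  assumes w: "integrable lborel w" and Y: "\<And>k. integrable lborel (Y k)"
    and d: "\<And>k. weak_dderiv A (axis k 1) w (Y k)"
  shows "weak_dderiv A h w (\<lambda>x. \<Sum>k\<in>UNIV. h $ k *\<^sub>R Y k x)"
  unfolding weak_dderiv_def
proof (intro allI impI)
  fix \<phi> :: "real^'n \<Rightarrow> real" assume \<phi>: "test_function A \<phi>"
  have i1: "integrable lborel (\<lambda>x. dderiv v \<phi> x *\<^sub>R w x)" for v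
    by (rule integrable_test_function_scaleR[OF test_function_dderiv[OF \<phi>] w])
  have i2: "integrable lborel (\<lambda>x. \<phi> x *\<^sub>R Y k x)" for k by (rule integrable_test_function_scaleR[OF \<phi> Y])
  have "(LBINT x. dderiv h \<phi> x *\<^sub>R w x) = (LBINT x. (\<Sum>k\<in>UNIV. h $ k *\<^sub>R (dderiv (axis k 1) \<phi> x *\<^sub>R w x)))"
    by (simp add: dderiv_grad[OF test_function_smooth[OF \<phi>], of h] inner_vec_def grad_nth scaleR_sum_left mult.commute)
  also have "\<dots> = (\<Sum>k\<in>UNIV. h $ k *\<^sub>R (LBINT x. dderiv (axis k 1) \<phi> x *\<^sub>R w x))"
    using i1 by (subst Bochner_Integration.integral_sum) (simp_all del: scaleR_scaleR)
  also have "\<dots> = (\<Sum>k\<in>UNIV. h $ k *\<^sub>R - (LBINT x. \<phi> x *\<^sub>R Y k x))"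
    using d \<phi> unfolding weak_dderiv_def by simp
  also have "\<dots> = - (LBINT x. (\<Sum>k\<in>UNIV. h $ k *\<^sub>R (\<phi> x *\<^sub>R Y k x)))" 
    using i2 by (subst Bochner_Integration.integral_sum) (simp_all add: sum_negf del: scaleR_scaleR)
  finally show "(LBINT x. dderiv h \<phi> x *\<^sub>R w x) = - (LBINT x. \<phi> x *\<^sub>R (\<Sum>k\<in>UNIV. h $ k *\<^sub>R Y k x))"
    by (simp add: scaleR_sum_right mult.commute)
qed

lemma norm_sum_scaleR_le:
  fixes z :: "'n::finite \<Rightarrow> 'b::euclidean_space" and h :: "real^'n"
  shows "(norm (\<Sum>k\<in>UNIV. h $ k *\<^sub>R z k))\<^sup>2 \<le> (norm h)\<^sup>2 * (\<Sum>k\<in>UNIV. (norm (z k))\<^sup>2)"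
proof -
  have "norm (\<Sum>k\<in>UNIV. h $ k *\<^sub>R z k) \<le> (\<Sum>k\<in>UNIV. \<bar>h $ k\<bar> * norm (z k))"
    using norm_sum[of "\<lambda>k. h $ k *\<^sub>R z k" UNIV] by simp
  then have "(norm (\<Sum>k\<in>UNIV. h $ k *\<^sub>R z k))\<^sup>2 \<le> (\<Sum>k\<in>UNIV. \<bar>h $ k\<bar> * norm (z k))\<^sup>2"
    by (intro power_mono) auto
  also have "\<dots> \<le> (\<Sum>k\<in>UNIV. \<bar>h $ k\<bar>\<^sup>2) * (\<Sum>k\<in>UNIV. (norm (z k))\<^sup>2)"
    by (rule Cauchy_Schwarz_ineq_sum)
  also have "(\<Sum>k\<in>UNIV. \<bar>h $ k\<bar>\<^sup>2) = (norm h)\<^sup>2"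
    unfolding power2_norm_eq_inner by (simp add: inner_vec_def power2_eq_square)
  finally show ?thesis .
qed

lemma two_mult_le:
  fixes a b k :: real
  assumes "k > 0" shows "2 * (a * b) \<le> k * a\<^sup>2 + (1 / k) * b\<^sup>2"
proof -
  have "0 \<le> (k * a - b)\<^sup>2 / k" using assms by simp
  also have "\<dots> = k * a\<^sup>2 + (1 / k) * b\<^sup>2 - 2 * (a * b)"
    using assms by (simp add: power2_diff power2_eq_square field_simps)
  finally show ?thesis by simp
qed

context plap_reg_eps
begin

text \<open>Regularised form of |\<nabla>u|^(p-2-\<gamma>) |D^2 u|^2, as |V|^(2c) =
  |\<nabla>u|^(p-2).\<close>

definition "e x = \<zeta> x * (norm (V x) powr (2 * c) * (\<Sum>k\<in>UNIV. (norm (H k x))\<^sup>2))"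

lemma [measurable]: "e \<in> borel_measurable borel"
  unfolding e_def[abs_def] by measurable

lemma e_nonneg: "e x \<ge> 0"
  unfolding e_def using \<zeta>_le by (intro mult_nonneg_nonneg sum_nonneg) auto

text \<open>Depends on \<epsilon> through the bound on \<zeta>; its purpose is the integrability of
  \<open>e\<close>, without which the absorption in \<open>energy_estimate\<close> would be
  meaningless.\<close>

lemma e_le: "e x \<le> \<epsilon> powr (- \<delta>) * (4 * (\<Sum>k\<in>UNIV. norm (W k x) powr 2))"
proof -
  have "norm (V x) powr (2 * c) * (norm (H k x))\<^sup>2 \<le> 4 * norm (W k x) powr 2" for k
  proof -
    have "norm (V x) powr (2 * c) * (norm (H k x))\<^sup>2 = (norm (V x) powr c * norm (H k x))\<^sup>2"
      by (simp add: power_mult_distrib power2_eq_square[of "_ powr _"] powr_add[symmetric])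
    also have "\<dots> \<le> (2 * norm (W k x))\<^sup>2" by (intro power_mono norm_H_le) auto
    finally show ?thesis by (simp add: power_mult_distrib norm_powr_2)
  qed
  then have "norm (V x) powr (2 * c) * (\<Sum>k\<in>UNIV. (norm (H k x))\<^sup>2) \<le> 4 * (\<Sum>k\<in>UNIV. norm (W k x) powr 2)"
    unfolding sum_distrib_left by (intro sum_mono)
  then show ?thesis unfolding e_def by (rule mult_mono[OF \<zeta>_le(1)]) (auto intro!: sum_nonneg mult_nonneg_nonneg)
qed

lemma integrable_e: "integrable lborel e"
proof -
  have "integrable lborel (\<lambda>x. \<epsilon> powr (- \<delta>) * (4 * (\<Sum>k\<in>UNIV. norm (W k x) powr 2)))"
    using Lq_integrable[OF LW] by simp
  then show ?thesis
    by (rule Bochner_Integration.integrable_bound)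
       (use e_le e_nonneg in \<open>auto intro: order_trans[OF _ abs_ge_self] simp: abs_of_nonneg\<close>)
qed

lemma pointwise_ellipticity:
  "AE x in lborel. x \<in> U \<longrightarrow> (1 - \<gamma>) * e x \<le> (\<Sum>k\<in>UNIV. \<Sum>\<alpha>\<in>UNIV. \<Sum>j\<in>UNIV. X k x $ \<alpha> $ j * Y j x $ \<alpha> $ k)"
  using symmetric_H
proof eventually_elim
  case (elim x)
  show ?case
  proof
    assume x: "x \<in> U"
    let ?v = "sgn (V x)" and ?\<mu> = "p / 2 * pslope 2 (2 + \<delta>) \<epsilon> (norm (V x))"
    \<comment> \<open>The slope 2 - (2 + \<delta>) s / (\<epsilon> + s) never falls below -\<delta>,
      and p/2 * \<delta> = \<gamma>.\<close>
    have sl: "?\<mu> \<ge> - \<gamma>"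
    proof -
      have "norm (V x) / (\<epsilon> + norm (V x)) \<le> 1" using \<epsilon> norm_ge_zero[of "V x"] by (subst divide_le_eq_1_pos) (linarith+)
      then have "(2 + \<delta>) * (norm (V x) / (\<epsilon> + norm (V x))) \<le> (2 + \<delta>) * 1" using \<delta>0 by (intro mult_left_mono) auto
      then have "pslope 2 (2 + \<delta>) \<epsilon> (norm (V x)) \<ge> - \<delta>" by (simp add: pslope_def)
      then have "p / 2 * (- \<delta>) \<le> ?\<mu>" using p3 by (intro mult_left_mono) auto
      then show ?thesis using p3 by (simp add: \<delta>_def)
    qed
    have "(1 - \<gamma>) * (\<Sum>k\<in>UNIV. (norm (H k x))\<^sup>2) \<le>
      (\<Sum>k\<in>UNIV. \<Sum>\<alpha>\<in>UNIV. \<Sum>j\<in>UNIV. (H k x + ((p - 2) * (?v \<bullet> H k x)) *\<^sub>R ?v) $ \<alpha> $ j * (H j x + (?\<mu> * (?v \<bullet> H j x)) *\<^sub>R ?v) $ \<alpha> $ k)"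
      by (rule symmetric_ellipticity[where H="\<lambda>k. H k x"]) (use elim x p3 \<gamma> sl in \<open>auto simp: norm_sgn\<close>)
    from mult_left_mono[OF this, of "\<zeta> x * norm (V x) powr (2 * c)"]
    have "(1 - \<gamma>) * e x \<le> \<zeta> x * norm (V x) powr (2 * c) *
      (\<Sum>k\<in>UNIV. \<Sum>\<alpha>\<in>UNIV. \<Sum>j\<in>UNIV. (H k x + ((p - 2) * (?v \<bullet> H k x)) *\<^sub>R ?v) $ \<alpha> $ j * (H j x + (?\<mu> * (?v \<bullet> H j x)) *\<^sub>R ?v) $ \<alpha> $ k)"
      using \<zeta>_le(3)[of x] by (simp add: e_def mult_ac)
    also have "\<dots> = (\<Sum>k\<in>UNIV. \<Sum>\<alpha>\<in>UNIV. \<Sum>j\<in>UNIV. X k x $ \<alpha> $ j * Y j x $ \<alpha> $ k)"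
      unfolding sum_distrib_left by (intro sum.cong refl) (simp add: X_H Y_H mult_ac)
    finally show "(1 - \<gamma>) * e x \<le> (\<Sum>k\<in>UNIV. \<Sum>\<alpha>\<in>UNIV. \<Sum>j\<in>UNIV. X k x $ \<alpha> $ j * Y j x $ \<alpha> $ k)" .
  qed
qed

lemma norm_F: "norm (F x) = \<zeta> x * norm (V x) powr (1 - c)"
  unfolding F_G norm_scaleR norm_G_eq using \<zeta>_le(3)[of x] by simp

text \<open>Young's inequality splits the cutoff term so that half of the coercivity 1 - \<gamma> is
  absorbed. On the right \<zeta> enters only through \<zeta> \<le> |V|^(-\<delta>), so the bound is
  free of \<epsilon>. In terms of the gradient the two weights are |\<nabla>u|^(p-\<gamma>) and
  |\<nabla>u|^(1-\<gamma>).\<close>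

lemma energy_estimate:
  assumes \<eta>: "test_function U \<eta>" "\<And>x. 0 \<le> \<eta> x"
  shows "(LBINT x. (\<eta> x)\<^sup>2 * e x) \<le> 2 / (1 - \<gamma>) * (2 * (p - 1)\<^sup>2 / (1 - \<gamma>) * real CARD('n) + 1) *
      ((LBINT x. (norm (grad \<eta> x))\<^sup>2 * norm (V x) powr (2 - \<delta>)) + (LBINT x. (\<eta> x)\<^sup>2 * (norm (g x) * norm (V x) powr (1 - c - \<delta>))))"
    "integrable lborel (\<lambda>x. (\<eta> x)\<^sup>2 * e x)"
    "integrable lborel (\<lambda>x. (norm (grad \<eta> x))\<^sup>2 * norm (V x) powr (2 - \<delta>))"
    "integrable lborel (\<lambda>x. (\<eta> x)\<^sup>2 * (norm (g x) * norm (V x) powr (1 - c - \<delta>)))"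
proof -
  have sm\<eta>: "smooth \<eta>" by (rule test_function_smooth[OF \<eta>(1)])
  have [measurable]: "\<eta> \<in> borel_measurable borel" "grad \<eta> \<in> borel_measurable borel"
    by (rule smooth_measurable[OF sm\<eta>], rule grad_measurable[OF sm\<eta>])
  obtain B where B: "B > 0" "\<And>x. \<bar>\<eta> x\<bar> \<le> B" using test_function_bounded[OF \<eta>(1)] by blast
  obtain D where D: "D > 0" "\<And>x. norm (grad \<eta> x) \<le> D" using grad_bounded[OF \<eta>(1)] by blast
  have B2: "(\<eta> x)\<^sup>2 \<le> B\<^sup>2" for x using B(2)[of x] B(1) by (metis abs_le_square_iff abs_of_pos)
  have D2: "(norm (grad \<eta> x))\<^sup>2 \<le> D\<^sup>2" for x using D by (intro power_mono) auto
  obtain K where K: "K \<subseteq> U" "\<And>x. x \<notin> K \<Longrightarrow> \<eta> x = 0" using test_functionE[OF \<eta>(1)] by metis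
  define k0 where "k0 = (1 - \<gamma>) / 2"
  have k0: "k0 > 0" using \<gamma> by (simp add: k0_def)
  have iE: "integrable lborel (\<lambda>x. (\<eta> x)\<^sup>2 * e x)"
    by (rule Bochner_Integration.integrable_bound[OF integrable_mult_right[OF integrable_e, of "B\<^sup>2"]])
       (use B2 e_nonneg in \<open>auto simp: abs_mult intro!: mult_right_mono\<close>)
  show "integrable lborel (\<lambda>x. (\<eta> x)\<^sup>2 * e x)" by (rule iE)
  have "Lq (2 - \<delta>) V" by (rule Lq_lower_exponent[OF LV S VS]) (use \<delta>0 in auto)
  then have iV: "integrable lborel (\<lambda>x. norm (V x) powr (2 - \<delta>))" by (rule Lq_integrable)
  show i1: "integrable lborel (\<lambda>x. (norm (grad \<eta> x))\<^sup>2 * norm (V x) powr (2 - \<delta>))"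
    by (rule Bochner_Integration.integrable_bound[OF integrable_mult_right[OF iV, of "D\<^sup>2"]])
       (use D2 in \<open>auto simp: abs_mult intro!: mult_right_mono\<close>)
  \<comment> \<open>As 2 (1 - \<gamma>) is at most 2, this puts |V|^(1-c-\<delta>) into Lp, dual to
    the space of g.\<close>
  have ex: "(1 - c - \<delta>) * p = 2 * (1 - \<gamma>)" using p3 by (simp add: c_def \<delta>_def algebra_simps)
  have "Lq (2 * (1 - \<gamma>)) V" by (rule Lq_lower_exponent[OF LV S VS]) (use \<gamma> in auto)
  then have "Lq p (\<lambda>x. norm (V x) powr (1 - c - \<delta>))"
    unfolding Lq_def by (simp add: powr_powr ex)
  from Lq_prod_integrable[OF bounded_bilinear_mult _ this pp(2,1,4), of "\<lambda>x. norm (g x)"]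
  have ig: "integrable lborel (\<lambda>x. norm (g x) * norm (V x) powr (1 - c - \<delta>))" using g by (simp add: Lq_def)
  show i2: "integrable lborel (\<lambda>x. (\<eta> x)\<^sup>2 * (norm (g x) * norm (V x) powr (1 - c - \<delta>)))"
    by (rule Bochner_Integration.integrable_bound[OF integrable_mult_right[OF ig, of "B\<^sup>2"]])
       (use B2 in \<open>auto simp: abs_mult intro!: mult_right_mono\<close>)
  define T0 where "T0 x = (\<Sum>k\<in>UNIV. \<Sum>\<alpha>\<in>UNIV. \<Sum>j\<in>UNIV. (\<eta> x)\<^sup>2 * (X k x $ \<alpha> $ j * Y j x $ \<alpha> $ k))" for x
  define T1 where "T1 x = (\<Sum>k\<in>UNIV. \<Sum>\<alpha>\<in>UNIV. (2 * \<eta> x * (X k x $ \<alpha> \<bullet> grad \<eta> x)) * F x $ \<alpha> $ k)" for x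
  define T2 where "T2 x = (\<Sum>k\<in>UNIV. \<Sum>\<alpha>\<in>UNIV. (g x $ \<alpha> $ k * (\<eta> x)\<^sup>2) * F x $ \<alpha> $ k)" for x
  note tc = tested_component[OF \<eta>(1)]
  have iT: "integrable lborel T0" "integrable lborel T1" "integrable lborel T2"
    unfolding T0_def[abs_def] T1_def[abs_def] T2_def[abs_def] using tc(2-4) by (auto intro!: Bochner_Integration.integrable_sum)
  have id: "(LBINT x. T0 x) = (LBINT x. - T1 x) + (LBINT x. - T2 x)"
  proof -
    have "(LBINT x. T0 x) + (LBINT x. T1 x) = (\<Sum>k\<in>UNIV. \<Sum>\<alpha>\<in>UNIV. (\<Sum>j\<in>UNIV. LBINT x. (\<eta> x)\<^sup>2 * (X k x $ \<alpha> $ j * Y j x $ \<alpha> $ k)) + (LBINT x. (2 * \<eta> x * (X k x $ \<alpha> \<bullet> grad \<eta> x)) * F x $ \<alpha> $ k))"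
      unfolding T0_def T1_def sum.distrib using tc(2,3)
      by (simp add: Bochner_Integration.integral_sum Bochner_Integration.integrable_sum)
    also have "\<dots> = - (LBINT x. T2 x)"
      unfolding tc(1) T2_def using tc(4) by (simp add: Bochner_Integration.integral_sum Bochner_Integration.integrable_sum sum_negf)
    finally show ?thesis by simp
  qed
  have q0: "AE x in lborel. (1 - \<gamma>) * ((\<eta> x)\<^sup>2 * e x) \<le> T0 x"
    using pointwise_ellipticity
  proof eventually_elim
    case (elim x)
    show ?case
    proof (cases "x \<in> K")
      case True
      then have "(\<eta> x)\<^sup>2 * ((1 - \<gamma>) * e x) \<le> (\<eta> x)\<^sup>2 * (\<Sum>k\<in>UNIV. \<Sum>\<alpha>\<in>UNIV. \<Sum>j\<in>UNIV. X k x $ \<alpha> $ j * Y j x $ \<alpha> $ k)"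
        using elim K by (intro mult_left_mono) auto
      then show ?thesis unfolding T0_def by (simp add: sum_distrib_left mult_ac)
    qed (simp add: T0_def K(2))
  qed
  have q1: "- T1 x \<le> k0 * ((\<eta> x)\<^sup>2 * e x) + 1 / k0 * ((p - 1)\<^sup>2 * real CARD('n)) * ((norm (grad \<eta> x))\<^sup>2 * norm (V x) powr (2 - \<delta>))" for x
  proof -
    have "- (\<Sum>\<alpha>\<in>UNIV. (2 * \<eta> x * (X k x $ \<alpha> \<bullet> grad \<eta> x)) * F x $ \<alpha> $ k)
       \<le> k0 * ((\<eta> x)\<^sup>2 * (\<zeta> x * (norm (V x) powr (2 * c) * (norm (H k x))\<^sup>2))) + 1 / k0 * ((p - 1)\<^sup>2 * ((norm (grad \<eta> x))\<^sup>2 * norm (V x) powr (2 - \<delta>)))" for k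
    proof -
      let ?s = "norm (V x)"
      \<comment> \<open>For fixed k the sum over \<alpha> pairs the vector X k applied to grad
        \<eta> with the k-th column of F.\<close>
      define col where "col = (\<chi> \<alpha>. F x $ \<alpha> $ k)"
      have col: "norm col \<le> norm (F x)"
      proof -
        have "norm col \<le> norm (F x *v axis k 1)" by (simp add: col_def matrix_vector_mul_component inner_axis matrix_vector_mult_def axis_def if_distrib cong: if_cong)
        also have "\<dots> \<le> norm (F x) * norm (axis k (1::real))" by (rule norm_matrix_vector_mult_le)
        finally show ?thesis by simp
      qed
      have "(\<Sum>\<alpha>\<in>UNIV. (2 * \<eta> x * (X k x $ \<alpha> \<bullet> grad \<eta> x)) * F x $ \<alpha> $ k) = 2 * \<eta> x * ((X k x *v grad \<eta> x) \<bullet> col)"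
        by (simp add: col_def inner_vec_def[of "X k x *v grad \<eta> x"] matrix_vector_mul_component sum_distrib_left mult_ac)
      moreover have "\<bar>(X k x *v grad \<eta> x) \<bullet> col\<bar> \<le> (norm (X k x) * norm (grad \<eta> x)) * norm (F x)"
        by (intro order_trans[OF Cauchy_Schwarz_ineq2] mult_mono norm_matrix_vector_mult_le col) auto
      ultimately have "- (\<Sum>\<alpha>\<in>UNIV. (2 * \<eta> x * (X k x $ \<alpha> \<bullet> grad \<eta> x)) * F x $ \<alpha> $ k) \<le> 2 * \<eta> x * ((norm (X k x) * norm (grad \<eta> x)) * norm (F x))"
      proof -
        assume 1: "(\<Sum>\<alpha>\<in>UNIV. (2 * \<eta> x * (X k x $ \<alpha> \<bullet> grad \<eta> x)) * F x $ \<alpha> $ k) = 2 * \<eta> x * ((X k x *v grad \<eta> x) \<bullet> col)"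
          and 2: "\<bar>(X k x *v grad \<eta> x) \<bullet> col\<bar> \<le> (norm (X k x) * norm (grad \<eta> x)) * norm (F x)"
        have "2 * \<eta> x * - ((X k x *v grad \<eta> x) \<bullet> col) \<le> 2 * \<eta> x * ((norm (X k x) * norm (grad \<eta> x)) * norm (F x))"
          by (rule mult_left_mono) (use 2 \<eta>(2)[of x] in linarith)+
        then show ?thesis unfolding 1 by (simp only: mult_minus_right)
      qed
      also have "\<dots> \<le> 2 * \<eta> x * (((?s powr (2 * c) * ((p - 1) * norm (H k x))) * norm (grad \<eta> x)) * (\<zeta> x * ?s powr (1 - c)))"
        unfolding norm_F using \<eta>(2)[of x] \<zeta>_le(3)[of x] by (intro mult_left_mono mult_right_mono norm_X_le) auto
      \<comment> \<open>\<zeta> is shared evenly: one root joins |V|^c |H| to form the energy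
        density, the other stays with |V| and the gradient of the cutoff.\<close>
      also have "\<dots> = 2 * ((\<eta> x * sqrt (\<zeta> x) * ?s powr c * norm (H k x)) * ((p - 1) * norm (grad \<eta> x) * (sqrt (\<zeta> x) * ?s)))"
      proof -
        have "?s powr (2 * c) * ?s powr (1 - c) = ?s powr c * ?s"
        proof (cases "?s = 0")
          case False
          then have "?s powr c * ?s = ?s powr c * ?s powr 1" by simp
          then show ?thesis by (simp only: powr_add[symmetric]) simp
        qed simp
        moreover have "\<zeta> x = sqrt (\<zeta> x) * sqrt (\<zeta> x)" using \<zeta>_le(3)[of x] by simp
        ultimately have "(?s powr (2 * c) * ?s powr (1 - c)) * \<zeta> x = (?s powr c * ?s) * (sqrt (\<zeta> x) * sqrt (\<zeta> x))" by simp
        then have "2 * \<eta> x * (p - 1) * norm (H k x) * norm (grad \<eta> x) * ((?s powr (2 * c) * ?s powr (1 - c)) * \<zeta> x) =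
          2 * \<eta> x * (p - 1) * norm (H k x) * norm (grad \<eta> x) * ((?s powr c * ?s) * (sqrt (\<zeta> x) * sqrt (\<zeta> x)))" by simp
        then show ?thesis by (simp only: mult_ac)
      qed
      also have "\<dots> \<le> k0 * (\<eta> x * sqrt (\<zeta> x) * ?s powr c * norm (H k x))\<^sup>2 + 1 / k0 * ((p - 1) * norm (grad \<eta> x) * (sqrt (\<zeta> x) * ?s))\<^sup>2"
        by (rule two_mult_le[OF k0])
      also have "(\<eta> x * sqrt (\<zeta> x) * ?s powr c * norm (H k x))\<^sup>2 = (\<eta> x)\<^sup>2 * (\<zeta> x * (?s powr (2 * c) * (norm (H k x))\<^sup>2))"
        using \<zeta>_le(3)[of x] by (simp add: power_mult_distrib power2_eq_square[of "_ powr _"] powr_add[symmetric] mult_ac)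
      also have "((p - 1) * norm (grad \<eta> x) * (sqrt (\<zeta> x) * ?s))\<^sup>2 = (p - 1)\<^sup>2 * ((norm (grad \<eta> x))\<^sup>2 * (\<zeta> x * ?s\<^sup>2))"
        using \<zeta>_le(3)[of x] by (simp add: power_mult_distrib mult_ac)
      finally have le: "- (\<Sum>\<alpha>\<in>UNIV. (2 * \<eta> x * (X k x $ \<alpha> \<bullet> grad \<eta> x)) * F x $ \<alpha> $ k) \<le> k0 * ((\<eta> x)\<^sup>2 * (\<zeta> x * (?s powr (2 * c) * (norm (H k x))\<^sup>2))) + 1 / k0 * ((p - 1)\<^sup>2 * ((norm (grad \<eta> x))\<^sup>2 * (\<zeta> x * ?s\<^sup>2)))" .
      have "\<zeta> x * ?s\<^sup>2 \<le> ?s powr (2 - \<delta>)"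
      proof (cases "?s = 0")
        case False
        have "\<zeta> x * ?s\<^sup>2 \<le> ?s powr (- \<delta>) * ?s\<^sup>2" by (intro mult_right_mono \<zeta>_le) auto
        also have "\<dots> = ?s powr (2 - \<delta>)" using False powr_add[of ?s "- \<delta>" 2] by (simp add: powr_numeral)
        finally show ?thesis .
      qed simp
      then have "1 / k0 * ((p - 1)\<^sup>2 * ((norm (grad \<eta> x))\<^sup>2 * (\<zeta> x * ?s\<^sup>2))) \<le> 1 / k0 * ((p - 1)\<^sup>2 * ((norm (grad \<eta> x))\<^sup>2 * ?s powr (2 - \<delta>)))"
        using k0 by (intro mult_left_mono) auto
      then show ?thesis using le by linarith
    qed
    then have "(\<Sum>k\<in>UNIV. - (\<Sum>\<alpha>\<in>UNIV. (2 * \<eta> x * (X k x $ \<alpha> \<bullet> grad \<eta> x)) * F x $ \<alpha> $ k))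
      \<le> (\<Sum>k\<in>UNIV. k0 * ((\<eta> x)\<^sup>2 * (\<zeta> x * (norm (V x) powr (2 * c) * (norm (H k x))\<^sup>2))) + 1 / k0 * ((p - 1)\<^sup>2 * ((norm (grad \<eta> x))\<^sup>2 * norm (V x) powr (2 - \<delta>))))"
      by (intro sum_mono)
    also have "\<dots> = k0 * ((\<eta> x)\<^sup>2 * e x) + 1 / k0 * ((p - 1)\<^sup>2 * real CARD('n)) * ((norm (grad \<eta> x))\<^sup>2 * norm (V x) powr (2 - \<delta>))"
      by (simp add: sum.distrib e_def sum_distrib_left[symmetric] mult_ac)
    finally show ?thesis by (simp only: T1_def sum_negf)
  qed
  have q2: "- T2 x \<le> (\<eta> x)\<^sup>2 * (norm (g x) * norm (V x) powr (1 - c - \<delta>))" for x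
  proof -
    have "T2 x = (\<eta> x)\<^sup>2 * (g x \<bullet> F x)"
      unfolding T2_def by (subst sum.swap) (simp add: inner_vec_def sum_distrib_left mult_ac)
    then have "- T2 x = (\<eta> x)\<^sup>2 * - (g x \<bullet> F x)" by simp
    also have "\<dots> \<le> (\<eta> x)\<^sup>2 * (norm (g x) * norm (F x))"
      using Cauchy_Schwarz_ineq2[of "g x" "F x"] by (intro mult_left_mono) auto
    also have "\<dots> \<le> (\<eta> x)\<^sup>2 * (norm (g x) * norm (V x) powr (1 - c - \<delta>))"
    proof (intro mult_left_mono)
      show "norm (F x) \<le> norm (V x) powr (1 - c - \<delta>)"
      proof (cases "norm (V x) = 0")
        case False
        have "norm (F x) \<le> norm (V x) powr (- \<delta>) * norm (V x) powr (1 - c)" unfolding norm_F by (intro mult_right_mono \<zeta>_le) auto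
        also have "\<dots> = norm (V x) powr (1 - c - \<delta>)" by (simp add: powr_add[symmetric])
        finally show ?thesis .
      qed (simp add: norm_F)
    qed auto
    finally show ?thesis .
  qed
  let ?E = "LBINT x. (\<eta> x)\<^sup>2 * e x"
  let ?I1 = "LBINT x. (norm (grad \<eta> x))\<^sup>2 * norm (V x) powr (2 - \<delta>)"
  let ?I2 = "LBINT x. (\<eta> x)\<^sup>2 * (norm (g x) * norm (V x) powr (1 - c - \<delta>))"
  define C where "C = 1 / k0 * ((p - 1)\<^sup>2 * real CARD('n))"
  have C: "C \<ge> 0" using k0 by (simp add: C_def)
  have "(1 - \<gamma>) * ?E = (LBINT x. (1 - \<gamma>) * ((\<eta> x)\<^sup>2 * e x))" by simp
  also have "\<dots> \<le> (LBINT x. T0 x)" using iE iT q0 by (intro integral_mono_AE) auto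
  also have "\<dots> = (LBINT x. - T1 x) + (LBINT x. - T2 x)" by (rule id)
  also have "(LBINT x. - T1 x) \<le> (LBINT x. k0 * ((\<eta> x)\<^sup>2 * e x) + C * ((norm (grad \<eta> x))\<^sup>2 * norm (V x) powr (2 - \<delta>)))"
    unfolding C_def using iE iT i1 q1 by (intro integral_mono Bochner_Integration.integrable_add integrable_mult_right integrable_minus) auto
  also have "\<dots> = k0 * ?E + C * ?I1" using iE i1 by simp
  also have "(LBINT x. - T2 x) \<le> ?I2" using iT i2 q2 by (intro integral_mono integrable_minus) auto
  finally have "(1 - \<gamma>) * ?E \<le> k0 * ?E + C * ?I1 + ?I2" by simp
  moreover have "(1 - \<gamma>) * ?E = k0 * ?E + k0 * ?E" by (simp add: k0_def field_simps)
  ultimately have "k0 * ?E \<le> C * ?I1 + ?I2" by linarith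
  also have "\<dots> \<le> (C + 1) * (?I1 + ?I2)"
  proof -
    have "?I1 \<ge> 0" "?I2 \<ge> 0" by (auto intro!: Bochner_Integration.integral_nonneg)
    then show ?thesis using C by (simp add: algebra_simps)
  qed
  finally have "?E \<le> 1 / k0 * ((C + 1) * (?I1 + ?I2))" using k0 by (simp add: field_simps)
  moreover have "1 / k0 = 2 / (1 - \<gamma>)" "C = 2 * (p - 1)\<^sup>2 / (1 - \<gamma>) * real CARD('n)" by (simp_all add: C_def k0_def)
  ultimately show "?E \<le> 2 / (1 - \<gamma>) * (2 * (p - 1)\<^sup>2 / (1 - \<gamma>) * real CARD('n) + 1) * (?I1 + ?I2)"
    by (simp only: mult.assoc)
qed

text \<open>The radial map is chosen so that the energy controls its derivative: expressed through H
  its profile has exponents 1 + c and 1 + \<delta>/2, and the square of this profile is exactly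
  \<zeta> |V|^(2c). The slope contributes at most p/2 * 4, whence the factor (1 + 2p)^2.\<close>

lemma Phi_increment:
  assumes \<eta>: "test_function U \<eta>" "\<And>x. 0 \<le> \<eta> x" and U2: "open U2" "\<And>x. x \<in> U2 \<Longrightarrow> \<eta> x = 1"
    and S0: "S0 \<in> sets borel" and r: "r > 0"
    and sub: "\<And>x s. x \<in> S0 \<Longrightarrow> 0 \<le> s \<Longrightarrow> s \<le> 1 \<Longrightarrow> cball (x + s *\<^sub>R h) r \<subseteq> U2"
  shows "(\<integral>\<^sup>+x. indicator S0 x * ennreal (norm (rad 1 (1 + \<delta> / 2) \<epsilon> (V (x + h)) - rad 1 (1 + \<delta> / 2) \<epsilon> (V x)) powr 2) \<partial>lborel)
    \<le> ennreal ((norm h)\<^sup>2 * ((1 + 2 * p)\<^sup>2 * (LBINT x. (\<eta> x)\<^sup>2 * e x)))"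
proof -
  have [measurable]: "\<eta> \<in> borel_measurable borel" "U2 \<in> sets borel" by (rule smooth_measurable[OF test_function_smooth[OF \<eta>(1)]]) (use U2 in simp)
  let ?R = "rad 1 (1 + \<delta> / 2) \<epsilon> :: real^'n^'N \<Rightarrow> real^'n^'N"
  define Z where "Z k x = drad 1 (1 + \<delta> / 2) \<epsilon> (V x) (W k x)" for k x
  have [measurable]: "Z k \<in> borel_measurable borel" for k unfolding Z_def by measurable
  have ld: "(?R has_derivative drad 1 (1 + \<delta> / 2) \<epsilon> y) (at y)" for y
    using \<delta>0 \<epsilon> by (intro rad_has_derivative_0) auto
  have ll: "norm (?R x - ?R y) \<le> 6 * \<epsilon> powr (1 - (1 + \<delta> / 2)) * (1 + 1 + (1 + \<delta> / 2)) * norm (x - y)" for x y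
    using \<delta>0 \<epsilon> by (intro rad_lipschitz) auto
  have n: "6 * \<epsilon> powr (1 - (1 + \<delta> / 2)) * (1 + 1 + (1 + \<delta> / 2)) \<ge> 0" using \<delta>0 by simp
  have m: "(\<lambda>x. drad 1 (1 + \<delta> / 2) \<epsilon> (V x) (W k x)) \<in> borel_measurable borel" for k by measurable
  note D = weak_dderiv_Lipschitz_comp[where R="?R" and R'="drad 1 (1 + \<delta> / 2) \<epsilon>", OF ld rad_0 ll n rad_measurable m, folded Z_def]
  have Zb: "(norm (Z k x))\<^sup>2 \<le> (1 + 2 * p)\<^sup>2 * (\<zeta> x * (norm (V x) powr (2 * c) * (norm (H k x))\<^sup>2))" for k x
  proof -
    let ?s = "norm (V x)"
    let ?\<mu> = "p / 2 * pslope (1 + c) (1 + \<delta> / 2) \<epsilon> ?s"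
    have Ze: "Z k x = profile (1 + c) (1 + \<delta> / 2) \<epsilon> ?s *\<^sub>R (H k x + (?\<mu> * (sgn (V x) \<bullet> H k x)) *\<^sub>R sgn (V x))"
      using drad_H[of "1 + c" "1 + \<delta> / 2" \<epsilon> x k] by (simp add: Z_def)
    have "\<bar>pslope (1 + c) (1 + \<delta> / 2) \<epsilon> ?s\<bar> \<le> \<bar>1 + c\<bar> + \<bar>1 + \<delta> / 2\<bar>" using \<epsilon> by (intro abs_pslope_le) auto
    also have "\<dots> \<le> 4" using cc \<delta>0 by simp
    finally have "p / 2 * \<bar>pslope (1 + c) (1 + \<delta> / 2) \<epsilon> ?s\<bar> \<le> p / 2 * 4" using p3 by (intro mult_left_mono) auto
    then have \<mu>: "1 + \<bar>?\<mu>\<bar> \<le> 1 + 2 * p" using p3 by (simp add: abs_mult)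
    have "norm (Z k x) \<le> profile (1 + c) (1 + \<delta> / 2) \<epsilon> ?s * ((1 + 2 * p) * norm (H k x))"
      unfolding Ze norm_scaleR real_norm_def abs_of_nonneg[OF profile_nonneg]
      using \<mu> by (intro mult_left_mono order_trans[OF norm_add_sgn_le] mult_right_mono profile_nonneg) auto
    then have "(norm (Z k x))\<^sup>2 \<le> (profile (1 + c) (1 + \<delta> / 2) \<epsilon> ?s * ((1 + 2 * p) * norm (H k x)))\<^sup>2"
      by (intro power_mono) auto
    also have "\<dots> = (1 + 2 * p)\<^sup>2 * ((profile (1 + c) (1 + \<delta> / 2) \<epsilon> ?s)\<^sup>2 * (norm (H k x))\<^sup>2)"
      by (simp add: power_mult_distrib)
    also have "(profile (1 + c) (1 + \<delta> / 2) \<epsilon> ?s)\<^sup>2 = \<zeta> x * ?s powr (2 * c)"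
    proof -
      have "(profile (1 + c) (1 + \<delta> / 2) \<epsilon> ?s)\<^sup>2 = (?s powr (1 + c) * ?s powr (1 + c)) * ((\<epsilon> + ?s) powr (- (1 + \<delta> / 2)) * (\<epsilon> + ?s) powr (- (1 + \<delta> / 2)))"
        by (simp add: profile_def power2_eq_square mult_ac)
      also have "\<dots> = ?s powr (2 + 2 * c) * (\<epsilon> + ?s) powr (- (2 + \<delta>))"
        unfolding powr_add[symmetric] by (simp add: algebra_simps)
      also have "\<dots> = \<zeta> x * ?s powr (2 * c)" by (simp add: \<zeta>_def profile_def powr_add mult_ac)
      finally show ?thesis .
    qed
    finally show ?thesis by (simp add: mult.assoc)
  qed
  have iZ: "integrable lborel (\<lambda>x. \<Sum>k\<in>UNIV. h $ k *\<^sub>R Z k x)" using D(5) by simp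
  have "(\<integral>\<^sup>+x. indicator S0 x * ennreal (norm (?R (V (x + h)) - ?R (V x)) powr 2) \<partial>lborel)
    \<le> (\<integral>\<^sup>+x. indicator U2 x * ennreal (norm (\<Sum>k\<in>UNIV. h $ k *\<^sub>R Z k x) powr 2) \<partial>lborel)"
    by (rule diff_bound_weak_dderiv[OF D(4) iZ U2(1) weak_dderiv_axis_sum[OF D(4) D(5) D(1)] S0 r sub]) auto
  also have "\<dots> \<le> (\<integral>\<^sup>+x. ennreal ((norm h)\<^sup>2 * ((1 + 2 * p)\<^sup>2 * ((\<eta> x)\<^sup>2 * e x))) \<partial>lborel)"
  proof (rule nn_integral_mono)
    fix x
    show "indicator U2 x * ennreal (norm (\<Sum>k\<in>UNIV. h $ k *\<^sub>R Z k x) powr 2) \<le> ennreal ((norm h)\<^sup>2 * ((1 + 2 * p)\<^sup>2 * ((\<eta> x)\<^sup>2 * e x)))"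
    proof (cases "x \<in> U2")
      case True
      have "norm (\<Sum>k\<in>UNIV. h $ k *\<^sub>R Z k x) powr 2 \<le> (norm h)\<^sup>2 * (\<Sum>k\<in>UNIV. (norm (Z k x))\<^sup>2)"
        unfolding norm_powr_2 by (rule norm_sum_scaleR_le)
      also have "\<dots> \<le> (norm h)\<^sup>2 * (\<Sum>k\<in>UNIV. (1 + 2 * p)\<^sup>2 * (\<zeta> x * (norm (V x) powr (2 * c) * (norm (H k x))\<^sup>2)))"
        by (intro mult_left_mono sum_mono Zb) auto
      also have "\<dots> = (norm h)\<^sup>2 * ((1 + 2 * p)\<^sup>2 * ((\<eta> x)\<^sup>2 * e x))"
        using U2(2)[OF True] by (simp add: e_def sum_distrib_left)
      finally show ?thesis using True by (simp add: ennreal_leI)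
    qed simp
  qed
  also have "\<dots> = ennreal (LBINT x. (norm h)\<^sup>2 * ((1 + 2 * p)\<^sup>2 * ((\<eta> x)\<^sup>2 * e x)))"
    using energy_estimate(2)[OF \<eta>] e_nonneg by (intro nn_integral_eq_integral) auto
  finally show ?thesis by simp
qed

end

section \<open>Removal of the regularisation\<close>

context plap_reg
begin

text \<open>After \<open>energy_estimate\<close> the right side no longer contains \<epsilon>, and
  as \<epsilon> tends to 0 the regularised maps converge pointwise to |V|^(-\<gamma>/p) V; Fatou
  gives the limit inequality.\<close>

lemma Psi_increment:
  assumes \<gamma>: "0 \<le> \<gamma>" "\<gamma> < 1" and \<eta>: "test_function U \<eta>" "\<And>x. 0 \<le> \<eta> x" and U2: "open U2" "\<And>x. x \<in> U2 \<Longrightarrow> \<eta> x = 1"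
    and S0: "S0 \<in> sets borel" and r: "r > 0"
    and sub: "\<And>x s. x \<in> S0 \<Longrightarrow> 0 \<le> s \<Longrightarrow> s \<le> 1 \<Longrightarrow> cball (x + s *\<^sub>R h) r \<subseteq> U2"
  shows "(\<integral>\<^sup>+x. indicator S0 x * ennreal (norm (rad (- (\<gamma> / p)) 0 1 (V (x + h)) - rad (- (\<gamma> / p)) 0 1 (V x)) powr 2) \<partial>lborel)
    \<le> ennreal ((norm h)\<^sup>2 * ((1 + 2 * p)\<^sup>2 * (2 / (1 - \<gamma>) * (2 * (p - 1)\<^sup>2 / (1 - \<gamma>) * real CARD('n) + 1) *
      ((LBINT x. (norm (grad \<eta> x))\<^sup>2 * norm (V x) powr (2 - 2 * \<gamma> / p)) + (LBINT x. (\<eta> x)\<^sup>2 * (norm (g x) * norm (V x) powr (2 / p * (1 - \<gamma>))))))))"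
    (is "_ \<le> ennreal ?B")
proof -
  let ?\<epsilon> = "\<lambda>n. 1 / real (Suc n)"
  have [measurable]: "S0 \<in> sets borel" by (rule S0)
  have ex: "1 - c - 2 * \<gamma> / p = 2 / p * (1 - \<gamma>)" using p3 by (simp add: c_def algebra_simps diff_divide_distrib)
  let ?d = "\<lambda>n x. rad 1 (1 + \<gamma> / p) (?\<epsilon> n) (V (x + h)) - rad 1 (1 + \<gamma> / p) (?\<epsilon> n) (V x)"
  let ?l = "\<lambda>x. rad (- (\<gamma> / p)) 0 1 (V (x + h)) - rad (- (\<gamma> / p)) 0 1 (V x)"
  have le: "(\<integral>\<^sup>+x. indicator S0 x * ennreal (norm (?d n x) powr 2) \<partial>lborel) \<le> ennreal ?B" for n
  proof -
    interpret E: plap_reg_eps U S p M V f g W t \<gamma> "?\<epsilon> n"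
      by unfold_locales (use \<gamma> in auto)
    have d: "E.\<delta> / 2 = \<gamma> / p" "E.\<delta> = 2 * \<gamma> / p" by (simp_all add: E.\<delta>_def)
    have "(\<integral>\<^sup>+x. indicator S0 x * ennreal (norm (?d n x) powr 2) \<partial>lborel)
       \<le> ennreal ((norm h)\<^sup>2 * ((1 + 2 * p)\<^sup>2 * (LBINT x. (\<eta> x)\<^sup>2 * E.e x)))"
      using E.Phi_increment[OF \<eta> U2 S0 r sub] unfolding d(1) .
    also have "\<dots> \<le> ennreal ?B"
      using E.energy_estimate(1)[OF \<eta>] unfolding d(2) ex by (intro ennreal_leI mult_left_mono) auto
    finally show ?thesis .
  qed
  have lim: "(\<lambda>n. rad 1 (1 + \<gamma> / p) (?\<epsilon> n) y) \<longlonglongrightarrow> rad (- (\<gamma> / p)) 0 1 y" for y :: "real^'n^'N"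
  proof (cases "y = 0")
    case False
    have "(\<lambda>n. (norm y powr 1 * (?\<epsilon> n + norm y) powr (- (1 + \<gamma> / p))) *\<^sub>R y) \<longlonglongrightarrow> (norm y powr 1 * (0 + norm y) powr (- (1 + \<gamma> / p))) *\<^sub>R y"
      using False by (intro tendsto_intros inverse_seq) auto
    moreover have "norm y powr 1 * (0 + norm y) powr (- (1 + \<gamma> / p)) = norm y powr (- (\<gamma> / p))"
      using False by (simp only: add_0 powr_add[symmetric]) simp
    ultimately have "(\<lambda>n. (norm y powr 1 * (?\<epsilon> n + norm y) powr (- (1 + \<gamma> / p))) *\<^sub>R y) \<longlonglongrightarrow> norm y powr (- (\<gamma> / p)) *\<^sub>R y"
      by (simp only:)
    then show ?thesis unfolding rad_power unfolding rad_def profile_def .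
  qed simp
  have "(\<integral>\<^sup>+x. indicator S0 x * ennreal (norm (?l x) powr 2) \<partial>lborel)
    = (\<integral>\<^sup>+x. liminf (\<lambda>n. indicator S0 x * ennreal (norm (?d n x) powr 2)) \<partial>lborel)"
  proof (rule nn_integral_cong)
    fix x
    have "(\<lambda>n. norm (?d n x) powr 2)
      \<longlonglongrightarrow> norm (?l x) powr 2"
      by (intro tendsto_powr2 tendsto_norm tendsto_diff lim tendsto_const) auto
    from lim_imp_Liminf[OF sequentially_bot tendsto_ennrealI[OF this]]
    show "indicator S0 x * ennreal (norm (?l x) powr 2)
      = liminf (\<lambda>n. indicator S0 x * ennreal (norm (?d n x) powr 2))"
      by (cases "x \<in> S0") (simp_all add: Liminf_const)
  qed
  also have "\<dots> \<le> liminf (\<lambda>n. \<integral>\<^sup>+x. indicator S0 x * ennreal (norm (?d n x) powr 2) \<partial>lborel)"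
    by (rule nn_integral_liminf) measurable
  also have "\<dots> \<le> ennreal ?B" by (intro Liminf_le always_eventually allI le) simp
  finally show ?thesis .
qed

end

subsection \<open>Increments of the gradient\<close>

lemma test_function_zero_outside:
  assumes "test_function U \<phi>" "x \<notin> U"
  shows "\<phi> x = 0" "dderiv v \<phi> x = 0"
proof -
  show "\<phi> x = 0" using assms test_functionE[OF assms(1)] by (metis subsetD)
  show "dderiv v \<phi> x = 0" using assms test_functionE[OF test_function_dderiv[OF assms(1)]] by (metis subsetD)
qed

lemma grad_zero_outside: "test_function U \<phi> \<Longrightarrow> x \<notin> U \<Longrightarrow> grad \<phi> x = 0"
  by (simp add: vec_eq_iff grad_nth test_function_zero_outside(2))

lemma weak_dderiv_mono: "weak_dderiv U v w Y \<Longrightarrow> U' \<subseteq> U \<Longrightarrow> weak_dderiv U' v w Y"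
  unfolding weak_dderiv_def using test_function_mono by blast

lemma powr_le_1_plus_powr:
  assumes "(a::real) \<ge> 0" "0 < r" "r \<le> s" shows "a powr r \<le> 1 + a powr s"
proof -
  have "(a powr r) \<le> 1 + (a powr r) powr (s / r)" using assms by (intro le_1_plus_powr) auto
  then show ?thesis using assms by (simp add: powr_powr)
qed

section \<open>The constants of the estimate\<close>

definition holder_const :: "real \<Rightarrow> real" where
  "holder_const q = (10 * (6 + 2 powr 1)) powr q"

text \<open>(1 + 2p)^2 is the slope factor of \<open>Phi_increment\<close>, the rest is the constant
  of \<open>energy_estimate\<close>; d is the space dimension.\<close>

definition energy_const :: "real \<Rightarrow> real \<Rightarrow> real \<Rightarrow> real" where
  "energy_const d p \<gamma> = (1 + 2 * p)\<^sup>2 * (2 / (1 - \<gamma>) * (2 * (p - 1)\<^sup>2 / (1 - \<gamma>) * d + 1))"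

text \<open>The first summand serves shifts |h| \<le> r, the second is the trivial bound for |h| >
  r. D bounds the gradient of the cutoff and m is the measure of the domain.\<close>

definition increment_const :: "real \<Rightarrow> real \<Rightarrow> real \<Rightarrow> real \<Rightarrow> real \<Rightarrow> real \<Rightarrow> real" where
  "increment_const d p \<gamma> D m r =
     holder_const (p - \<gamma>) * (energy_const d p \<gamma> * (D\<^sup>2 * (m + 1) + (m + 2))) + 2 powr (p - \<gamma>) * (2 * (m + 1)) / r\<^sup>2"

lemma const_nonneg:
  assumes "d \<ge> 0" "0 \<le> \<gamma>" "\<gamma> < 1" "m \<ge> 0"
  shows "holder_const q \<ge> 0" "energy_const d p \<gamma> \<ge> 0" "increment_const d p \<gamma> D m r \<ge> 0"
proof -
  show h: "holder_const q \<ge> 0" for q by (simp add: holder_const_def)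
  show e: "energy_const d p \<gamma> \<ge> 0" using assms by (auto simp: energy_const_def intro!: mult_nonneg_nonneg add_nonneg_nonneg divide_nonneg_nonneg)
  show "increment_const d p \<gamma> D m r \<ge> 0"
    unfolding increment_const_def using assms by (intro add_nonneg_nonneg mult_nonneg_nonneg divide_nonneg_nonneg h e) auto
qed

section \<open>Localisation and scaling\<close>

context plap_data
begin

lemma LG: "Lq p G" by (rule L(2))

text \<open>Multiplication by \<eta>1 makes V a field on the whole space without changing it on U1,
  so the equations survive for test functions of U1. \<open>curl\<close> holds because G is the
  gradient of u: both sides are minus the pairing of u with the same mixed derivative of
  \<phi>.\<close>

lemma localized_plap_reg:
  assumes U1: "open U1" "U1 \<subseteq> U" and \<eta>1: "test_function U \<eta>1" "\<And>x. 0 \<le> \<eta>1 x" "\<And>x. \<eta>1 x \<le> 1" "\<And>x. x \<in> U1 \<Longrightarrow> \<eta>1 x = 1"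
  obtains S M W t where "plap_reg U1 S p M (\<lambda>x. \<eta>1 x *\<^sub>R V x) f g W t"
proof -
  have [measurable]: "\<eta>1 \<in> borel_measurable borel" by (rule smooth_measurable[OF test_function_smooth[OF \<eta>1(1)]])
  define Vt where "Vt x = \<eta>1 x *\<^sub>R V x" for x
  have LVt: "Lq 2 Vt"
    by (rule Lq_dominated(1)[OF LV, of _ 1]) (use \<eta>1 Lq_measurable[OF LV] in \<open>auto simp: Vt_def[abs_def] mult_left_le_one_le\<close>)
  obtain M where M: "\<And>h. Iq 2 (\<lambda>x. Vt (x + h) - Vt x) \<le> M * (norm h)\<^sup>2"
    unfolding Vt_def using cutoff_V_lipschitz[OF \<eta>1(1-3)] by blast
  obtain t W where t: "\<And>n. 0 < t n" "\<And>n. t n \<le> 1" "t \<longlonglongrightarrow> 0" and W: "\<And>b. b \<in> Basis \<Longrightarrow> Lq 2 (W b)"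
    "\<And>b. b \<in> Basis \<Longrightarrow> AE x in lborel. (\<lambda>n. (1 / t n) *\<^sub>R (Vt (x + t n *\<^sub>R b) - Vt x)) \<longlonglongrightarrow> W b x"
    "\<And>b n. b \<in> Basis \<Longrightarrow> Lq 2 (\<lambda>x. (1 / t n) *\<^sub>R (Vt (x + t n *\<^sub>R b) - Vt x))"
    "\<And>b n. b \<in> Basis \<Longrightarrow> Iq 2 (\<lambda>x. (1 / t n) *\<^sub>R (Vt (x + t n *\<^sub>R b) - Vt x)) \<le> M"
    using L2_lipschitz_AE_differentiable[OF LVt M] by blast
  obtain R where R: "U \<subseteq> cball 0 R" using U(2) by (auto simp: bounded_iff subset_iff)
  \<comment> \<open>The margin 1 accommodates the shifts t n \<le> 1: off S the difference quotients
    vanish, so W may be set to 0 there.\<close>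
  define S where "S = cball (0::real^'n) (R + 1)"
  have S0: "Vt x = 0" "Vt (x + t n *\<^sub>R axis k 1) = 0" if "x \<notin> S" for x n k
  proof -
    have n: "norm x > R + 1" using that by (simp add: S_def)
    then have "x \<notin> U" using R by auto
    then show "Vt x = 0" by (simp add: Vt_def V_zero)
    have "norm (t n *\<^sub>R axis k (1::real)) \<le> 1" using t(1,2)[of n] by simp
    then have "norm (x + t n *\<^sub>R axis k 1) > R" using n norm_diff_ineq[of x "t n *\<^sub>R axis k 1"] by linarith
    then have "x + t n *\<^sub>R axis k 1 \<notin> U" using R by auto
    then show "Vt (x + t n *\<^sub>R axis k 1) = 0" by (simp add: Vt_def V_zero)
  qed
  define W' where "W' k x = indicator S x *\<^sub>R W (axis k (1::real)) x" for k :: 'n and x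
  have ax: "axis k (1::real) \<in> Basis" for k :: 'n by (simp add: axis_in_Basis_iff)
  have ex: "rad (1 - 2 / p) 0 1 (Vt x) = rad (p - 2) 0 1 (G x)" "rad (- (1 - 2 / p)) 0 1 (Vt x) = G x" if "x \<in> U1" for x
    using A_V[of x] G_V[of x] \<eta>1(4)[OF that] by (simp_all add: Vt_def A_def)
  have "plap_reg U1 S p M Vt f g W' t"
  proof
    show "Lq 2 (W' k)" for k
      by (rule Lq_dominated(1)[OF W(1)[OF ax[of k]], of _ 1])
         (use Lq_measurable[OF W(1)[OF ax[of k]]] in \<open>auto simp: W'_def[abs_def] S_def indicator_def\<close>)
    show "AE x in lborel. (\<lambda>n. (1 / t n) *\<^sub>R (Vt (x + t n *\<^sub>R axis k 1) - Vt x)) \<longlonglongrightarrow> W' k x" for k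
      using W(2)[OF ax[of k]] by eventually_elim (auto simp: W'_def indicator_def S0)
    show "LqB 2 M (\<lambda>x. (1 / t n) *\<^sub>R (Vt (x + t n *\<^sub>R axis k 1) - Vt x))" for k n
      unfolding LqB_def using W(3,4)[OF ax[of k]] by blast
    show "weak_dderiv U1 (axis i 1) (\<lambda>x. f x $ \<alpha>) (\<lambda>x. g x $ \<alpha> $ i)" for \<alpha> i
      by (rule weak_dderiv_mono[OF wf U1(2)])
    show "(LBINT x. rad (1 - 2 / p) 0 1 (Vt x) $ \<alpha> \<bullet> grad \<phi> x) = - (LBINT x. f x $ \<alpha> * \<phi> x)"
      if \<phi>: "test_function U1 \<phi>" for \<alpha> \<phi>
    proof -
      have "(LBINT x. rad (1 - 2 / p) 0 1 (Vt x) $ \<alpha> \<bullet> grad \<phi> x) = (LBINT x. rad (p - 2) 0 1 (G x) $ \<alpha> \<bullet> grad \<phi> x)"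
      proof (rule Bochner_Integration.integral_cong[OF refl])
        show "rad (1 - 2 / p) 0 1 (Vt x) $ \<alpha> \<bullet> grad \<phi> x = rad (p - 2) 0 1 (G x) $ \<alpha> \<bullet> grad \<phi> x" for x
          using ex(1)[of x] grad_zero_outside[OF \<phi>, of x] by (cases "x \<in> U1") simp_all
      qed
      then show ?thesis using eqn[OF test_function_mono[OF \<phi> U1(2)]] by simp
    qed
    show "(LBINT x. rad (- (1 - 2 / p)) 0 1 (Vt x) $ \<alpha> $ j * dderiv (axis k 1) \<phi> x)
         = (LBINT x. rad (- (1 - 2 / p)) 0 1 (Vt x) $ \<alpha> $ k * dderiv (axis j 1) \<phi> x)"
      if \<phi>: "test_function U1 \<phi>" for \<alpha> j k \<phi>
    proof -
      have \<phi>U: "test_function U \<phi>" by (rule test_function_mono[OF \<phi> U1(2)])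
      have e: "(LBINT x. rad (- (1 - 2 / p)) 0 1 (Vt x) $ \<alpha> $ j * dderiv (axis k 1) \<phi> x)
         = - (LBINT x. u x $ \<alpha> * dderiv (axis j 1) (dderiv (axis k 1) \<phi>) x)" for j k
      proof -
        have "(LBINT x. rad (- (1 - 2 / p)) 0 1 (Vt x) $ \<alpha> $ j * dderiv (axis k 1) \<phi> x) = (LBINT x. G x $ \<alpha> $ j * dderiv (axis k 1) \<phi> x)"
        proof (rule Bochner_Integration.integral_cong[OF refl])
          show "rad (- (1 - 2 / p)) 0 1 (Vt x) $ \<alpha> $ j * dderiv (axis k 1) \<phi> x = G x $ \<alpha> $ j * dderiv (axis k 1) \<phi> x" for x
            using ex(2)[of x] test_function_zero_outside(2)[OF \<phi>, of x] by (cases "x \<in> U1") simp_all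
        qed
        then show ?thesis using weak_dderivD[OF wu[of j \<alpha>] test_function_dderiv[OF \<phi>U, of "axis k 1"]] by simp
      qed
      show ?thesis unfolding e using dderiv_commute[OF test_function_smooth[OF \<phi>], of "axis j 1" "axis k 1"] by simp
    qed
  qed (use p3 U1 S0 LVt M t L integrable_data in \<open>auto simp: S_def W'_def\<close>)
  then show ?thesis unfolding Vt_def[abs_def] by (rule that)
qed

text \<open>The substitution is undone: |V| = |G|^(p/2) turns the weights into powers of G and
  |V|^(-\<gamma>/p) V into |G|^(q/2-1) G for q = p - \<gamma>, and the Hoelder bound for the inverse
  power map returns increments of G. On S0 and its translate \<eta>1 equals 1, so the cut-off field
  may stand for V.\<close>

lemma G_increment:
  assumes U1: "open U1" "U1 \<subseteq> U" and \<eta>1: "test_function U \<eta>1" "\<And>x. 0 \<le> \<eta>1 x" "\<And>x. \<eta>1 x \<le> 1" "\<And>x. x \<in> U1 \<Longrightarrow> \<eta>1 x = 1"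
    and \<gamma>: "0 \<le> \<gamma>" "\<gamma> < 1" and \<eta>: "test_function U1 \<eta>" "\<And>x. 0 \<le> \<eta> x" and U2: "open U2" "\<And>x. x \<in> U2 \<Longrightarrow> \<eta> x = 1"
    and S0: "S0 \<in> sets borel" and r: "r > 0"
    and sub: "\<And>x s. x \<in> S0 \<Longrightarrow> 0 \<le> s \<Longrightarrow> s \<le> 1 \<Longrightarrow> cball (x + s *\<^sub>R h) r \<subseteq> U2"
  shows "(\<integral>\<^sup>+x. indicator S0 x * ennreal (norm (G (x + h) - G x) powr (p - \<gamma>)) \<partial>lborel)
    \<le> ennreal (holder_const (p - \<gamma>) * ((norm h)\<^sup>2 * (energy_const (real CARD('n)) p \<gamma> *
        ((LBINT x. (norm (grad \<eta> x))\<^sup>2 * norm (G x) powr (p - \<gamma>)) + (LBINT x. (\<eta> x)\<^sup>2 * (norm (g x) * norm (G x) powr (1 - \<gamma>)))))))"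
proof -
  obtain S M W t where "plap_reg U1 S p M (\<lambda>x. \<eta>1 x *\<^sub>R V x) f g W t"
    using localized_plap_reg[OF U1 \<eta>1] .
  then interpret R: plap_reg U1 S p M "\<lambda>x. \<eta>1 x *\<^sub>R V x" f g W t .
  have U2U1: "U2 \<subseteq> U1" using U2(2) test_function_zero_outside(1)[OF \<eta>(1)] by force
  have [measurable]: "S0 \<in> sets borel" by (rule S0)
  have [measurable]: "\<eta>1 \<in> borel_measurable borel" by (rule smooth_measurable[OF test_function_smooth[OF \<eta>1(1)]])
  have e1: "(p / 2 - 1 + 1) * (2 - 2 * \<gamma> / p) = p - \<gamma>" "(p / 2 - 1 + 1) * (2 / p * (1 - \<gamma>)) = 1 - \<gamma>" using p3 by (simp_all add: field_simps)
  have q: "p - \<gamma> \<ge> 2" using p3 \<gamma> by simp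
  have "(p / 2 - 1 + 1) * (- (\<gamma> / p)) + (p / 2 - 1) = (p - \<gamma>) / 2 - 1" using p3 by (simp add: field_simps)
  then have rV: "rad (- (\<gamma> / p)) 0 1 (V x) = rad ((p - \<gamma>) / 2 - 1) 0 1 (G x)" for x
    unfolding V_def rad_compose_power by (simp only:)
  have nV: "norm (V x) powr (2 - 2 * \<gamma> / p) = norm (G x) powr (p - \<gamma>)" "norm (V x) powr (2 / p * (1 - \<gamma>)) = norm (G x) powr (1 - \<gamma>)" for x
    unfolding V_def norm_rad_power powr_powr e1 by (rule refl)+
  have i: "(LBINT x. (norm (grad \<eta> x))\<^sup>2 * norm (\<eta>1 x *\<^sub>R V x) powr (2 - 2 * \<gamma> / p)) = (LBINT x. (norm (grad \<eta> x))\<^sup>2 * norm (G x) powr (p - \<gamma>))"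
    "(LBINT x. (\<eta> x)\<^sup>2 * (norm (g x) * norm (\<eta>1 x *\<^sub>R V x) powr (2 / p * (1 - \<gamma>)))) = (LBINT x. (\<eta> x)\<^sup>2 * (norm (g x) * norm (G x) powr (1 - \<gamma>)))"
  proof -
    show "(LBINT x. (norm (grad \<eta> x))\<^sup>2 * norm (\<eta>1 x *\<^sub>R V x) powr (2 - 2 * \<gamma> / p)) = (LBINT x. (norm (grad \<eta> x))\<^sup>2 * norm (G x) powr (p - \<gamma>))"
    proof (rule Bochner_Integration.integral_cong[OF refl])
      show "(norm (grad \<eta> x))\<^sup>2 * norm (\<eta>1 x *\<^sub>R V x) powr (2 - 2 * \<gamma> / p) = (norm (grad \<eta> x))\<^sup>2 * norm (G x) powr (p - \<gamma>)" for x
        using grad_zero_outside[OF \<eta>(1), of x] \<eta>1(4)[of x] nV(1)[of x] by (cases "x \<in> U1") simp_all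
    qed
    show "(LBINT x. (\<eta> x)\<^sup>2 * (norm (g x) * norm (\<eta>1 x *\<^sub>R V x) powr (2 / p * (1 - \<gamma>)))) = (LBINT x. (\<eta> x)\<^sup>2 * (norm (g x) * norm (G x) powr (1 - \<gamma>)))"
    proof (rule Bochner_Integration.integral_cong[OF refl])
      show "(\<eta> x)\<^sup>2 * (norm (g x) * norm (\<eta>1 x *\<^sub>R V x) powr (2 / p * (1 - \<gamma>))) = (\<eta> x)\<^sup>2 * (norm (g x) * norm (G x) powr (1 - \<gamma>))" for x
        using test_function_zero_outside(1)[OF \<eta>(1), of x] \<eta>1(4)[of x] nV(2)[of x] by (cases "x \<in> U1") simp_all
    qed
  qed
  let ?J = "(LBINT x. (norm (grad \<eta> x))\<^sup>2 * norm (G x) powr (p - \<gamma>)) + (LBINT x. (\<eta> x)\<^sup>2 * (norm (g x) * norm (G x) powr (1 - \<gamma>)))"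
  have "(\<integral>\<^sup>+x. indicator S0 x * ennreal (norm (G (x + h) - G x) powr (p - \<gamma>)) \<partial>lborel)
    \<le> (\<integral>\<^sup>+x. ennreal (holder_const (p - \<gamma>)) * (indicator S0 x * ennreal (norm (rad (- (\<gamma> / p)) 0 1 (\<eta>1 (x + h) *\<^sub>R V (x + h)) - rad (- (\<gamma> / p)) 0 1 (\<eta>1 x *\<^sub>R V x)) powr 2)) \<partial>lborel)"
  proof (rule nn_integral_mono)
    fix x
    show "indicator S0 x * ennreal (norm (G (x + h) - G x) powr (p - \<gamma>)) \<le>
      ennreal (holder_const (p - \<gamma>)) * (indicator S0 x * ennreal (norm (rad (- (\<gamma> / p)) 0 1 (\<eta>1 (x + h) *\<^sub>R V (x + h)) - rad (- (\<gamma> / p)) 0 1 (\<eta>1 x *\<^sub>R V x)) powr 2))"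
    proof (cases "x \<in> S0")
      case True
      have "x \<in> U2" "x + h \<in> U2" using sub[OF True, of 0] sub[OF True, of 1] r by auto
      then have "\<eta>1 x = 1" "\<eta>1 (x + h) = 1" using U2U1 \<eta>1(4) by auto
      then show ?thesis using True rad_power_inverse_holder[OF q, of "G (x + h)" "G x"]
        by (simp add: rV norm_powr_2 holder_const_def ennreal_mult[symmetric] ennreal_leI)
    qed simp
  qed
  also have "\<dots> = ennreal (holder_const (p - \<gamma>)) * (\<integral>\<^sup>+x. indicator S0 x * ennreal (norm (rad (- (\<gamma> / p)) 0 1 (\<eta>1 (x + h) *\<^sub>R V (x + h)) - rad (- (\<gamma> / p)) 0 1 (\<eta>1 x *\<^sub>R V x)) powr 2) \<partial>lborel)"
    by (rule nn_integral_cmult) measurable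
  also have "\<dots> \<le> ennreal (holder_const (p - \<gamma>)) * ennreal ((norm h)\<^sup>2 * (energy_const (real CARD('n)) p \<gamma> * ?J))"
    using R.Psi_increment[OF \<gamma> \<eta> U2 S0 r sub] unfolding i energy_const_def by (intro mult_left_mono) (simp_all only: mult.assoc zero_le)
  also have "\<dots> = ennreal (holder_const (p - \<gamma>) * ((norm h)\<^sup>2 * (energy_const (real CARD('n)) p \<gamma> * ?J)))"
    by (simp add: ennreal_mult' holder_const_def)
  finally show ?thesis .
qed

text \<open>G is divided by T before a^r \<le> 1 + a^p is applied; this makes the bound homogeneous
  in T, as the final estimate requires.\<close>

lemma Iq_G_scaled_le:
  assumes T: "T > 0" "Iq p G \<le> T powr p" and r: "0 < r" "r \<le> p"
  shows "Iq r G \<le> T powr r * (measure lborel U + 1)" "Lq r G"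
proof -
  show L: "Lq r G" by (rule Lq_lower_exponent[OF L(2) U(2) zero(2) r])
  have [measurable]: "U \<in> sets borel" using U by simp
  have fin: "emeasure lborel U < \<infinity>" using bounded_finite_measure[OF U(2)] by simp
  have i: "integrable lborel (\<lambda>x. T powr r * (indicator U x + norm (G x) powr p / T powr p))"
    using fin Lq_integrable[OF LG] by simp
  have "Iq r G \<le> (LBINT x. T powr r * (indicator U x + norm (G x) powr p / T powr p))"
  proof (rule integral_mono[OF Lq_integrable[OF L] i])
    fix x
    show "norm (G x) powr r \<le> T powr r * (indicator U x + norm (G x) powr p / T powr p)"
    proof (cases "x \<in> U")
      case True
      have "norm (G x) powr r = T powr r * (norm (G x) / T) powr r" using T by (simp add: powr_divide)
      also have "\<dots> \<le> T powr r * (1 + (norm (G x) / T) powr p)"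
        using T r by (intro mult_left_mono powr_le_1_plus_powr) auto
      finally show ?thesis using True T by (simp add: powr_divide)
    qed (simp add: zero)
  qed
  also have "\<dots> = T powr r * (measure lborel U + Iq p G / T powr p)"
    using fin Lq_integrable[OF LG] by simp
  also have "\<dots> \<le> T powr r * (measure lborel U + 1)"
    using T by (intro mult_left_mono add_left_mono) (auto simp: divide_le_eq)
  finally show "Iq r G \<le> T powr r * (measure lborel U + 1)" .
qed

text \<open>T has the scale of G, and T^(p-1) that of g. After division by these scales the
  integrals of |G|^p and |g|^p' are at most 1, and the factor split off is T^(p-1) T^(1-\<gamma>) =
  T^(p-\<gamma>) in the second integral. Young's inequality and (1 - \<gamma>) p \<le> p bound what
  is left.\<close>

lemma weighted_terms_le:
  assumes T: "T > 0" "Iq p G \<le> T powr p" "Iq p' g \<le> T powr p" and \<gamma>: "0 \<le> \<gamma>" "\<gamma> < 1"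
    and \<eta>: "test_function U \<eta>" "\<And>x. 0 \<le> \<eta> x" "\<And>x. \<eta> x \<le> 1" and D: "\<And>x. norm (grad \<eta> x) \<le> D"
  shows "(LBINT x. (norm (grad \<eta> x))\<^sup>2 * norm (G x) powr (p - \<gamma>)) \<le> T powr (p - \<gamma>) * (D\<^sup>2 * (measure lborel U + 1))"
    "(LBINT x. (\<eta> x)\<^sup>2 * (norm (g x) * norm (G x) powr (1 - \<gamma>))) \<le> T powr (p - \<gamma>) * (measure lborel U + 2)"
proof -
  have [measurable]: "U \<in> sets borel" using U by simp
  have sm\<eta>: "smooth \<eta>" by (rule test_function_smooth[OF \<eta>(1)])
  have [measurable]: "\<eta> \<in> borel_measurable borel" "grad \<eta> \<in> borel_measurable borel"
    by (rule smooth_measurable[OF sm\<eta>], rule grad_measurable[OF sm\<eta>])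
  have fin: "emeasure lborel U < \<infinity>" using bounded_finite_measure[OF U(2)] by simp
  have D2: "(norm (grad \<eta> x))\<^sup>2 \<le> D\<^sup>2" for x using D by (intro power_mono) auto
  have \<eta>2: "(\<eta> x)\<^sup>2 \<le> 1" for x using \<eta>(2,3)[of x] by (simp add: power_le_one)
  note q = Iq_G_scaled_le[OF T(1,2), of "p - \<gamma>"]
  have pq: "0 < p - \<gamma>" "p - \<gamma> \<le> p" using p3 \<gamma> by auto
  have iD: "integrable lborel (\<lambda>x. D\<^sup>2 * norm (G x) powr (p - \<gamma>))" using Lq_integrable[OF q(2)[OF pq]] by simp
  have "(LBINT x. (norm (grad \<eta> x))\<^sup>2 * norm (G x) powr (p - \<gamma>)) \<le> (LBINT x. D\<^sup>2 * norm (G x) powr (p - \<gamma>))"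
  proof (rule integral_mono[OF _ iD])
    show "integrable lborel (\<lambda>x. (norm (grad \<eta> x))\<^sup>2 * norm (G x) powr (p - \<gamma>))"
      by (rule Bochner_Integration.integrable_bound[OF iD]) (use D2 in \<open>auto simp: abs_mult intro!: mult_right_mono\<close>)
  qed (use D2 in \<open>auto intro!: mult_right_mono\<close>)
  also have "\<dots> = D\<^sup>2 * Iq (p - \<gamma>) G" by simp
  also have "\<dots> \<le> D\<^sup>2 * (T powr (p - \<gamma>) * (measure lborel U + 1))" by (intro mult_left_mono q(1)[OF pq]) auto
  finally show "(LBINT x. (norm (grad \<eta> x))\<^sup>2 * norm (G x) powr (p - \<gamma>)) \<le> T powr (p - \<gamma>) * (D\<^sup>2 * (measure lborel U + 1))"
    by (simp add: mult_ac)
  define b where "b x = norm (g x) powr p' / T powr p + (indicator U x + norm (G x) powr p / T powr p)" for x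
  have b0: "b x \<ge> 0" for x by (simp add: b_def)
  have ib: "integrable lborel (\<lambda>x. T powr (p - \<gamma>) * b x)" unfolding b_def
    using fin Lq_integrable[OF LG] Lq_integrable[OF L(4)] by simp
  have le: "(\<eta> x)\<^sup>2 * (norm (g x) * norm (G x) powr (1 - \<gamma>)) \<le> T powr (p - \<gamma>) * b x" for x
  proof (cases "x \<in> U")
    case True
    have bT: "(norm (g x) / T powr (p - 1)) powr p' = norm (g x) powr p' / T powr p"
      using T p3 by (simp add: powr_divide powr_powr)
    have "(\<eta> x)\<^sup>2 * (norm (g x) * norm (G x) powr (1 - \<gamma>)) \<le> 1 * (norm (g x) * norm (G x) powr (1 - \<gamma>))"
      by (intro mult_right_mono \<eta>2) auto
    also have "\<dots> = T powr (p - 1) * T powr (1 - \<gamma>) * ((norm (g x) / T powr (p - 1)) * (norm (G x) / T) powr (1 - \<gamma>))"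
      using T by (simp add: powr_divide)
    also have "T powr (p - 1) * T powr (1 - \<gamma>) = T powr (p - \<gamma>)" by (simp add: powr_add[symmetric])
    also have "(norm (g x) / T powr (p - 1)) * (norm (G x) / T) powr (1 - \<gamma>)
        \<le> (norm (g x) / T powr (p - 1)) powr p' + ((norm (G x) / T) powr (1 - \<gamma>)) powr p"
      using T by (intro Youngs_le pp) auto
    also have "((norm (G x) / T) powr (1 - \<gamma>)) powr p = (norm (G x) / T) powr ((1 - \<gamma>) * p)" by (rule powr_powr)
    also have "\<dots> \<le> 1 + (norm (G x) / T) powr p"
      using T \<gamma> p3 by (intro powr_le_1_plus_powr) (auto simp: mult_le_cancel_right1)
    also have "(norm (G x) / T) powr p = norm (G x) powr p / T powr p" using T by (simp add: powr_divide)
    finally show ?thesis unfolding bT b_def using True by (simp add: mult_left_mono)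
  qed (simp add: zero b_def)
  have "(LBINT x. (\<eta> x)\<^sup>2 * (norm (g x) * norm (G x) powr (1 - \<gamma>))) \<le> (LBINT x. T powr (p - \<gamma>) * b x)"
  proof (rule integral_mono[OF _ ib le])
    show "integrable lborel (\<lambda>x. (\<eta> x)\<^sup>2 * (norm (g x) * norm (G x) powr (1 - \<gamma>)))"
      by (rule Bochner_Integration.integrable_bound[OF ib]) (use le b0 in \<open>auto simp: abs_mult\<close>)
  qed
  also have "\<dots> = T powr (p - \<gamma>) * (Iq p' g / T powr p + (measure lborel U + Iq p G / T powr p))"
    unfolding b_def using fin Lq_integrable[OF LG] Lq_integrable[OF L(4)] by simp
  also have "\<dots> \<le> T powr (p - \<gamma>) * (1 + (measure lborel U + 1))"
    using T by (intro mult_left_mono add_mono) (auto simp: divide_le_eq)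
  finally show "(LBINT x. (\<eta> x)\<^sup>2 * (norm (g x) * norm (G x) powr (1 - \<gamma>))) \<le> T powr (p - \<gamma>) * (measure lborel U + 2)"
    by (simp add: add.commute add.left_commute)
qed

text \<open>For |h| > r the integral bound for G itself is enough, as |h|^2 / r^2 exceeds 1.
  Covering all shifts is what allows an arbitrary \<delta> in the Nikol'skii norm.\<close>

lemma G_increment_le:
  assumes U1: "open U1" "U1 \<subseteq> U" and \<eta>1: "test_function U \<eta>1" "\<And>x. 0 \<le> \<eta>1 x" "\<And>x. \<eta>1 x \<le> 1" "\<And>x. x \<in> U1 \<Longrightarrow> \<eta>1 x = 1"
    and \<gamma>: "0 \<le> \<gamma>" "\<gamma> < 1" and \<eta>: "test_function U1 \<eta>" "\<And>x. 0 \<le> \<eta> x" "\<And>x. \<eta> x \<le> 1"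
    and U2: "open U2" "\<And>x. x \<in> U2 \<Longrightarrow> \<eta> x = 1" and D: "\<And>x. norm (grad \<eta> x) \<le> D"
    and S0: "S0 \<in> sets borel" and r: "r > 0" "\<And>x y. x \<in> S0 \<Longrightarrow> norm (y - x) \<le> 2 * r \<Longrightarrow> y \<in> U2"
    and T: "T > 0" "Iq p G \<le> T powr p" "Iq p' g \<le> T powr p"
  shows "(\<integral>\<^sup>+x. indicator S0 x * ennreal (norm (G (x + h) - G x) powr (p - \<gamma>)) \<partial>lborel)
    \<le> ennreal ((norm h)\<^sup>2 * (increment_const (real CARD('n)) p \<gamma> D (measure lborel U) r * T powr (p - \<gamma>)))"
proof (cases "norm h \<le> r")
  case True
  let ?m = "measure lborel U"
  have sub: "cball (x + s *\<^sub>R h) r \<subseteq> U2" if "x \<in> S0" "0 \<le> s" "s \<le> 1" for x s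
  proof
    fix y assume "y \<in> cball (x + s *\<^sub>R h) r"
    then have "norm (y - x - s *\<^sub>R h) \<le> r" by (simp add: dist_norm norm_minus_commute algebra_simps)
    moreover have "norm (s *\<^sub>R h) \<le> 1 * r" unfolding norm_scaleR using that True by (intro mult_mono) auto
    ultimately have "norm (y - x) \<le> 2 * r" using norm_triangle_sub[of "y - x" "s *\<^sub>R h"] by linarith
    then show "y \<in> U2" by (rule r(2)[OF that(1)])
  qed
  note w = weighted_terms_le[OF T \<gamma> test_function_mono[OF \<eta>(1) U1(2)] \<eta>(2,3) D]
  note c = const_nonneg[of "real CARD('n)" \<gamma> ?m, OF _ \<gamma> measure_nonneg, simplified]
  have "holder_const (p - \<gamma>) * ((norm h)\<^sup>2 * (energy_const (real CARD('n)) p \<gamma> *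
        ((LBINT x. (norm (grad \<eta> x))\<^sup>2 * norm (G x) powr (p - \<gamma>)) + (LBINT x. (\<eta> x)\<^sup>2 * (norm (g x) * norm (G x) powr (1 - \<gamma>))))))
    \<le> holder_const (p - \<gamma>) * ((norm h)\<^sup>2 * (energy_const (real CARD('n)) p \<gamma> *
        (T powr (p - \<gamma>) * (D\<^sup>2 * (?m + 1)) + T powr (p - \<gamma>) * (?m + 2))))"
    using c by (intro mult_left_mono add_mono w) auto
  also have "\<dots> = (norm h)\<^sup>2 * (holder_const (p - \<gamma>) * (energy_const (real CARD('n)) p \<gamma> * (D\<^sup>2 * (?m + 1) + (?m + 2))) * T powr (p - \<gamma>))"
    by (simp add: algebra_simps)
  also have "\<dots> \<le> (norm h)\<^sup>2 * (increment_const (real CARD('n)) p \<gamma> D ?m r * T powr (p - \<gamma>))"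
    unfolding increment_const_def by (intro mult_left_mono mult_right_mono) auto
  finally show ?thesis
    using G_increment[OF U1 \<eta>1 \<gamma> \<eta>(1,2) U2 S0 r(1) sub] by (meson ennreal_leI order_trans)
next
  case False
  let ?m = "measure lborel U"
  have pq: "0 < p - \<gamma>" "p - \<gamma> \<le> p" using p3 \<gamma> by auto
  note q = Iq_G_scaled_le[OF T(1,2) pq]
  note c = const_nonneg[of "real CARD('n)" \<gamma> ?m, OF _ \<gamma> measure_nonneg, simplified]
  have "(\<integral>\<^sup>+x. indicator S0 x * ennreal (norm (G (x + h) - G x) powr (p - \<gamma>)) \<partial>lborel)
     \<le> (\<integral>\<^sup>+x. ennreal (norm (G (x + h) - G x) powr (p - \<gamma>)) \<partial>lborel)"
    by (intro nn_integral_mono) (auto simp: indicator_def)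
  also have "\<dots> = ennreal (Iq (p - \<gamma>) (\<lambda>x. G (x + h) - G x))"
    by (rule nn_integral_Lq[OF Lq_diff(1)[OF Lq_translate(1)[OF q(2)] q(2) pq(1)]])
  also have "\<dots> \<le> ennreal ((norm h)\<^sup>2 * (increment_const (real CARD('n)) p \<gamma> D ?m r * T powr (p - \<gamma>)))"
  proof (rule ennreal_leI)
    have "Iq (p - \<gamma>) (\<lambda>x. G (x + h) - G x) \<le> 2 powr (p - \<gamma>) * (Iq (p - \<gamma>) (\<lambda>x. G (x + h)) + Iq (p - \<gamma>) G)"
      by (rule Lq_diff(2)[OF Lq_translate(1)[OF q(2)] q(2) pq(1)])
    also have "\<dots> \<le> 2 powr (p - \<gamma>) * (T powr (p - \<gamma>) * (?m + 1) + T powr (p - \<gamma>) * (?m + 1))"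
      unfolding Lq_translate(2)[OF q(2)] by (intro mult_left_mono add_mono q(1)) auto
    also have "\<dots> = 1 * (2 powr (p - \<gamma>) * (2 * (?m + 1)) * T powr (p - \<gamma>))" by (simp add: algebra_simps)
    also have "\<dots> \<le> (norm h)\<^sup>2 / r\<^sup>2 * (2 powr (p - \<gamma>) * (2 * (?m + 1)) * T powr (p - \<gamma>))"
      using False r(1) by (intro mult_right_mono mult_nonneg_nonneg) (auto simp: le_divide_eq intro!: power_mono)
    also have "\<dots> = (norm h)\<^sup>2 * (2 powr (p - \<gamma>) * (2 * (?m + 1)) / r\<^sup>2 * T powr (p - \<gamma>))" by simp
    also have "\<dots> \<le> (norm h)\<^sup>2 * (increment_const (real CARD('n)) p \<gamma> D ?m r * T powr (p - \<gamma>))"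
      unfolding increment_const_def using c by (intro mult_left_mono mult_right_mono) (auto intro!: mult_nonneg_nonneg)
    finally show "Iq (p - \<gamma>) (\<lambda>x. G (x + h) - G x) \<le> (norm h)\<^sup>2 * (increment_const (real CARD('n)) p \<gamma> D ?m r * T powr (p - \<gamma>))" .
  qed
  finally show ?thesis .
qed

end

subsection \<open>Borel representatives\<close>

lemma lebesgue_measurable_AE_eq:
  fixes w w' :: "'a::euclidean_space \<Rightarrow> 'b::euclidean_space"
  assumes ae: "AE x in lborel. w x = w' x" and w': "w' \<in> borel_measurable borel"
  shows "w \<in> borel_measurable lebesgue"
proof (rule measurableI)
  fix A :: "'b set" assume A: "A \<in> sets borel"
  have ae': "AE x in lebesgue. w x = w' x" by (rule AE_completion[OF ae])
  have "w' -` A \<in> sets lebesgue" using measurable_sets[OF w' A] by simp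
  then show "w -` A \<inter> space lebesgue \<in> sets lebesgue"
    by (rule completion.in_sets_AE[rotated]) (use ae' in \<open>auto elim: eventually_mono\<close>)
qed simp

text \<open>Bridge between Lebesgue measure on S, in which the spaces are defined, and Borel
  functions under \<open>lborel\<close>, to which the translation and Fubini arguments
  apply.\<close>

lemma lebesgue_on_transfer:
  fixes w w' :: "'a::euclidean_space \<Rightarrow> 'b::euclidean_space"
  assumes S: "S \<in> sets borel" and ae: "AE x in lborel. x \<in> S \<longrightarrow> w x = w' x"
    and w': "w' \<in> borel_measurable borel" "\<And>x. x \<notin> S \<Longrightarrow> w' x = 0"
  shows "w \<in> borel_measurable (lebesgue_on S)"
    "integrable (lebesgue_on S) w \<longleftrightarrow> integrable lborel w'"
    "(\<integral>x. w x \<partial>lebesgue_on S) = (LBINT x. w' x)"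
proof -
  have SL: "S \<inter> space lebesgue \<in> sets lebesgue" using S by simp
  have ae2: "AE x in lborel. indicator S x *\<^sub>R w x = w' x"
    using ae by eventually_elim (use w'(2) in \<open>auto simp: indicator_def\<close>)
  have m: "(\<lambda>x. indicator S x *\<^sub>R w x) \<in> borel_measurable lebesgue" by (rule lebesgue_measurable_AE_eq[OF ae2 w'(1)])
  have w'L: "w' \<in> borel_measurable lebesgue" using w'(1) by (simp add: measurable_completion)
  show "w \<in> borel_measurable (lebesgue_on S)" by (rule iffD2[OF borel_measurable_restrict_space_iff[OF SL] m])
  show "integrable (lebesgue_on S) w \<longleftrightarrow> integrable lborel w'"
    unfolding integrable_restrict_space[OF SL] integrable_cong_AE[OF m w'L AE_completion[OF ae2]]
    using w'(1) by (intro integrable_completion) simp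
  show "(\<integral>x. w x \<partial>lebesgue_on S) = (LBINT x. w' x)"
    unfolding integral_restrict_space[OF SL] integral_cong_AE[OF m w'L AE_completion[OF ae2]]
    using w'(1) by (intro integral_completion) simp
qed

text \<open>Real functions measurable for the completion have Borel versions; vector-valued ones are
  treated coordinate by coordinate.\<close>

lemma borel_representative:
  fixes w :: "'a::euclidean_space \<Rightarrow> 'b::euclidean_space"
  assumes S: "S \<in> sets borel" and w: "w \<in> borel_measurable (lebesgue_on S)"
  obtains w' where "w' \<in> borel_measurable borel" "\<And>x. x \<notin> S \<Longrightarrow> w' x = 0" "AE x in lborel. x \<in> S \<longrightarrow> w x = w' x"
proof -
  have SL: "S \<inter> space lebesgue \<in> sets lebesgue" using S by simp
  have m: "(\<lambda>x. indicator S x *\<^sub>R w x) \<in> borel_measurable lebesgue"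
    by (rule iffD1[OF borel_measurable_restrict_space_iff[OF SL] w])
  have "\<exists>v. \<forall>b\<in>Basis. v b \<in> borel_measurable lborel \<and> (AE x in lborel. (indicator S x *\<^sub>R w x) \<bullet> b = v b x)"
  proof (rule bchoice, rule ballI)
    fix b :: 'b assume "b \<in> Basis"
    have "(\<lambda>x. (indicator S x *\<^sub>R w x) \<bullet> b) \<in> borel_measurable lebesgue" using m by measurable
    then show "\<exists>v. v \<in> borel_measurable lborel \<and> (AE x in lborel. (indicator S x *\<^sub>R w x) \<bullet> b = v x)"
      using completion_ex_borel_measurable_real[of _ lborel] by auto
  qed
  then obtain v where v: "\<And>b. b \<in> Basis \<Longrightarrow> v b \<in> borel_measurable borel" "\<And>b. b \<in> Basis \<Longrightarrow> AE x in lborel. (indicator S x *\<^sub>R w x) \<bullet> b = v b x"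
    by auto
  define w' where "w' x = indicator S x *\<^sub>R (\<Sum>b\<in>Basis. v b x *\<^sub>R b)" for x
  show thesis
  proof
    have [measurable]: "S \<in> sets borel" by fact
    show "w' \<in> borel_measurable borel" unfolding w'_def[abs_def]
      by (intro borel_measurable_scaleR borel_measurable_sum borel_measurable_indicator v) (auto simp: S)
    have "AE x in lborel. \<forall>b\<in>Basis. (indicator S x *\<^sub>R w x) \<bullet> b = v b x"
      using v(2) by (intro AE_finite_allI) auto
    then show "AE x in lborel. x \<in> S \<longrightarrow> w x = w' x"
    proof eventually_elim
      case (elim x)
      have "w' x = (\<Sum>b\<in>Basis. (w x \<bullet> b) *\<^sub>R b)" if "x \<in> S"
        using elim that by (auto simp: w'_def intro!: sum.cong)
      then show ?case by (simp add: euclidean_representation)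
    qed
  qed (simp add: w'_def)
qed

lemma in_Lp_representative:
  fixes w :: "'a::euclidean_space \<Rightarrow> 'b::euclidean_space"
  assumes S: "open S" and w: "in_Lp q S w" and U: "open U" "U \<subseteq> S" and q: "q > 0"
  obtains w' where "Lq q w'" "Iq q w' \<le> Lp_norm q S w powr q" "\<And>x. x \<notin> U \<Longrightarrow> w' x = 0" "AE x in lborel. x \<in> U \<longrightarrow> w x = w' x"
proof -
  have SB: "S \<in> sets borel" and [measurable]: "U \<in> sets borel" using S U by simp_all
  have wm: "w \<in> borel_measurable (lebesgue_on S)" and wi: "integrable (lebesgue_on S) (\<lambda>x. norm (w x) powr q)"
    using w by (auto simp: in_Lp_def)
  obtain v where v: "v \<in> borel_measurable borel" "\<And>x. x \<notin> S \<Longrightarrow> v x = 0" "AE x in lborel. x \<in> S \<longrightarrow> w x = v x"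
    using borel_representative[OF SB wm] by blast
  have [measurable]: "v \<in> borel_measurable borel" by (rule v(1))
  have ae: "AE x in lborel. x \<in> S \<longrightarrow> norm (w x) powr q = norm (v x) powr q"
    using v(3) by eventually_elim auto
  note tr = lebesgue_on_transfer[OF SB ae, of]
  have Lv: "Lq q v" unfolding Lq_def using tr(2) wi v by simp
  have "Lp_norm q S w powr q = Iq q v"
  proof -
    have "(\<integral>x. norm (w x) powr q \<partial>lebesgue_on S) = Iq q v" by (rule tr(3)) (use v in auto)
    then show ?thesis using q Iq_nonneg[of v q] by (simp add: Lp_norm_def powr_powr)
  qed
  moreover have "Lq q (\<lambda>x. indicator U x *\<^sub>R v x)" "Iq q (\<lambda>x. indicator U x *\<^sub>R v x) \<le> 1 powr q * Iq q v"
    by (rule Lq_dominated[OF Lv, of _ 1]; use q in \<open>auto simp: indicator_def\<close>)+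
  moreover have "AE x in lborel. x \<in> U \<longrightarrow> w x = indicator U x *\<^sub>R v x"
    using v(3) by eventually_elim (use U in auto)
  ultimately show thesis by (intro that[of "\<lambda>x. indicator U x *\<^sub>R v x"]) auto
qed

text \<open>A compact ball inside S has a positive margin e, so its centre may move by less than e.
  Openness supplies the measurability of the domain in the Nikol'skii integrals.\<close>

lemma open_inner_set:
  assumes "open S" shows "open (inner_set S d)"
proof (cases "d \<ge> 0")
  case True
  show ?thesis unfolding open_contains_ball
  proof
    fix x assume x: "x \<in> inner_set S d"
    then obtain e where e: "e > 0" "(\<Union>y\<in>cball x d. ball y e) \<subseteq> S"
      using compact_subset_open_imp_ball_epsilon_subset[OF compact_cball assms, of x d] by (auto simp: inner_set_def)
    have "ball x e \<subseteq> inner_set S d"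
    proof
      fix y assume y: "y \<in> ball x e"
      have sub: "cball y d \<subseteq> S"
      proof
        fix z assume z: "z \<in> cball y d"
        have "z - y + x \<in> cball x d" using z by (simp add: dist_norm norm_minus_commute)
        moreover have "z \<in> ball (z - y + x) e" using y by (simp add: dist_norm norm_minus_commute)
        ultimately show "z \<in> S" using e(2) by blast
      qed
      then show "y \<in> inner_set S d" using True by (auto simp: inner_set_def)
    qed
    then show "\<exists>e>0. ball x e \<subseteq> inner_set S d" using e(1) by blast
  qed
next
  case False
  then have "inner_set S d = S" by (auto simp: inner_set_def)
  then show ?thesis using assms by simp
qed

lemma Lp_norm_le:
  fixes w w' :: "'a::euclidean_space \<Rightarrow> 'b::euclidean_space"
  assumes S: "S \<in> sets borel" and ae: "AE x in lborel. x \<in> S \<longrightarrow> w x = w' x" and w': "w' \<in> borel_measurable borel"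
    and le: "(\<integral>\<^sup>+x. indicator S x * ennreal (norm (w' x) powr q) \<partial>lborel) \<le> ennreal B" and B: "B \<ge> 0" and q: "q > 0"
  shows "Lp_norm q S w \<le> B powr (1 / q)" "in_Lp q S w"
proof -
  have [measurable]: "S \<in> sets borel" "w' \<in> borel_measurable borel" by fact+
  define v where "v x = indicator S x *\<^sub>R w' x" for x
  have [measurable]: "v \<in> borel_measurable borel" unfolding v_def by measurable
  have n: "norm (v x) powr q = indicator S x * norm (w' x) powr q" for x by (simp add: v_def indicator_def)
  have "(\<integral>\<^sup>+x. ennreal (norm (v x) powr q) \<partial>lborel) \<le> ennreal B"
    using le unfolding n by (simp add: ennreal_mult' ennreal_indicator)
  note v = LqI[OF \<open>v \<in> borel_measurable borel\<close> this]
  have ae': "AE x in lborel. x \<in> S \<longrightarrow> norm (w x) powr q = norm (v x) powr q"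
    using ae by eventually_elim (simp add: v_def)
  have ae'': "AE x in lborel. x \<in> S \<longrightarrow> w x = v x" using ae by eventually_elim (simp add: v_def)
  note tr = lebesgue_on_transfer[OF S ae']
  have "(\<integral>x. norm (w x) powr q \<partial>lebesgue_on S) = Iq q v" by (rule tr(3)) (auto simp: v_def)
  then show "Lp_norm q S w \<le> B powr (1 / q)"
    unfolding Lp_norm_def using v(2)[OF B] Iq_nonneg[of v q] q by (auto intro!: powr_mono2)
  have "integrable (lebesgue_on S) (\<lambda>x. norm (w x) powr q)"
    by (rule tr(2)[THEN iffD2]) (use Lq_integrable[OF v(1)] in \<open>auto simp: v_def\<close>)
  moreover have "w \<in> borel_measurable (lebesgue_on S)" by (rule lebesgue_on_transfer(1)[OF S ae'']) (auto simp: v_def)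
  ultimately show "in_Lp q S w" by (simp add: in_Lp_def)
qed

lemma has_weak_gradient_weak_gradient: "in_W1p q \<Omega> u \<Longrightarrow> has_weak_gradient \<Omega> u (weak_gradient \<Omega> u)"
  unfolding in_W1p_def weak_gradient_def using someI_ex[of "has_weak_gradient \<Omega> u"] by simp

lemma representative_weak_dderiv:
  fixes u u' :: "real^'n \<Rightarrow> real^'N" and G' :: "real^'n \<Rightarrow> real^'n^'N"
  assumes \<Omega>: "open \<Omega>" "U \<subseteq> \<Omega>" and wg: "has_weak_gradient \<Omega> u G"
    and u': "u' \<in> borel_measurable borel" "\<And>x. x \<notin> U \<Longrightarrow> u' x = 0" "AE x in lborel. x \<in> U \<longrightarrow> u x = u' x"
    and G': "G' \<in> borel_measurable borel" "\<And>x. x \<notin> U \<Longrightarrow> G' x = 0" "AE x in lborel. x \<in> U \<longrightarrow> G x = G' x"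
  shows "weak_dderiv U (axis i 1) (\<lambda>x. u' x $ \<alpha>) (\<lambda>x. G' x $ \<alpha> $ i)"
  unfolding weak_dderiv_def
proof (intro allI impI)
  fix \<phi> :: "real^'n \<Rightarrow> real" assume \<phi>: "test_function U \<phi>"
  have [measurable]: "u' \<in> borel_measurable borel" "G' \<in> borel_measurable borel" by fact+
  have [measurable]: "\<phi> \<in> borel_measurable borel" "dderiv (axis i 1) \<phi> \<in> borel_measurable borel"
    by (rule smooth_measurable[OF test_function_smooth[OF \<phi>]], rule smooth_measurable[OF test_function_smooth[OF test_function_dderiv[OF \<phi>]]])
  have B: "\<Omega> \<in> sets borel" using \<Omega> by simp
  have 1: "(\<integral>x. u x $ \<alpha> * grad \<phi> x $ i \<partial>lebesgue_on \<Omega>) = (LBINT x. dderiv (axis i 1) \<phi> x *\<^sub>R u' x $ \<alpha>)"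
  proof (rule lebesgue_on_transfer(3)[OF B])
    show "AE x in lborel. x \<in> \<Omega> \<longrightarrow> u x $ \<alpha> * grad \<phi> x $ i = dderiv (axis i 1) \<phi> x *\<^sub>R u' x $ \<alpha>"
      using u'(3) by eventually_elim (use test_function_zero_outside(2)[OF \<phi>] in \<open>force simp: grad_nth\<close>)
    show "dderiv (axis i 1) \<phi> x *\<^sub>R u' x $ \<alpha> = 0" if "x \<notin> \<Omega>" for x
    proof -
      have "x \<notin> U" using that \<Omega>(2) by blast
      then show ?thesis using u'(2) by simp
    qed
  qed measurable
  have 2: "(\<integral>x. G x $ \<alpha> $ i * \<phi> x \<partial>lebesgue_on \<Omega>) = (LBINT x. \<phi> x *\<^sub>R G' x $ \<alpha> $ i)"
  proof (rule lebesgue_on_transfer(3)[OF B])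
    show "AE x in lborel. x \<in> \<Omega> \<longrightarrow> G x $ \<alpha> $ i * \<phi> x = \<phi> x *\<^sub>R G' x $ \<alpha> $ i"
      using G'(3) by eventually_elim (use test_function_zero_outside(1)[OF \<phi>] in force)
    show "\<phi> x *\<^sub>R G' x $ \<alpha> $ i = 0" if "x \<notin> \<Omega>" for x
    proof -
      have "x \<notin> U" using that \<Omega>(2) by blast
      then show ?thesis using G'(2) by simp
    qed
  qed measurable
  show "(LBINT x. dderiv (axis i 1) \<phi> x *\<^sub>R u' x $ \<alpha>) = - (LBINT x. \<phi> x *\<^sub>R G' x $ \<alpha> $ i)"
    using wg test_function_mono[OF \<phi> \<Omega>(2)] unfolding has_weak_gradient_def 1[symmetric] 2[symmetric] by blast
qed

section \<open>From the original problem to the Nikol'skii estimate\<close>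

lemma plap_data_representative:
  fixes u f :: "real^'n \<Rightarrow> real^'N"
  assumes \<Omega>: "open \<Omega>" and U: "open U" "bounded U" "U \<subseteq> \<Omega>" and p: "p \<ge> 3"
    and u: "in_W1p p \<Omega> u" and f: "in_W1p (p / (p - 1)) \<Omega> f" and sol: "p_laplace_weak_solution p \<Omega> u f"
  obtains u' f' G' g' where "plap_data U p u' f' G' g'" "AE x in lborel. x \<in> U \<longrightarrow> weak_gradient \<Omega> u x = G' x"
    "Iq p G' \<le> Lp_norm p \<Omega> (weak_gradient \<Omega> u) powr p"
    "Iq (p / (p - 1)) g' \<le> Lp_norm (p / (p - 1)) \<Omega> (weak_gradient \<Omega> f) powr (p / (p - 1))"
proof -
  have pp: "p > 0" "p / (p - 1) > 0" using p by auto
  have Lp: "in_Lp p \<Omega> u" "in_Lp p \<Omega> (weak_gradient \<Omega> u)" "in_Lp (p / (p - 1)) \<Omega> f" "in_Lp (p / (p - 1)) \<Omega> (weak_gradient \<Omega> f)"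
    using u f by (auto simp: in_W1p_def)
  obtain u' where u': "Lq p u'" "Iq p u' \<le> Lp_norm p \<Omega> u powr p" "\<And>x. x \<notin> U \<Longrightarrow> u' x = 0" "AE x in lborel. x \<in> U \<longrightarrow> u x = u' x"
    by (rule in_Lp_representative[OF \<Omega> Lp(1) U(1,3) pp(1)]) blast
  obtain G' where G': "Lq p G'" "Iq p G' \<le> Lp_norm p \<Omega> (weak_gradient \<Omega> u) powr p" "\<And>x. x \<notin> U \<Longrightarrow> G' x = 0" "AE x in lborel. x \<in> U \<longrightarrow> weak_gradient \<Omega> u x = G' x"
    by (rule in_Lp_representative[OF \<Omega> Lp(2) U(1,3) pp(1)]) blast
  obtain f' where f': "Lq (p / (p - 1)) f'" "Iq (p / (p - 1)) f' \<le> Lp_norm (p / (p - 1)) \<Omega> f powr (p / (p - 1))" "\<And>x. x \<notin> U \<Longrightarrow> f' x = 0" "AE x in lborel. x \<in> U \<longrightarrow> f x = f' x"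
    by (rule in_Lp_representative[OF \<Omega> Lp(3) U(1,3) pp(2)]) blast
  obtain g' where g': "Lq (p / (p - 1)) g'" "Iq (p / (p - 1)) g' \<le> Lp_norm (p / (p - 1)) \<Omega> (weak_gradient \<Omega> f) powr (p / (p - 1))" "\<And>x. x \<notin> U \<Longrightarrow> g' x = 0" "AE x in lborel. x \<in> U \<longrightarrow> weak_gradient \<Omega> f x = g' x"
    by (rule in_Lp_representative[OF \<Omega> Lp(4) U(1,3) pp(2)]) blast
  note m = Lq_measurable[OF u'(1)] Lq_measurable[OF G'(1)] Lq_measurable[OF f'(1)] Lq_measurable[OF g'(1)]
  have [measurable]: "u' \<in> borel_measurable borel" "G' \<in> borel_measurable borel" "f' \<in> borel_measurable borel" "g' \<in> borel_measurable borel"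
    by (rule m)+
  have "plap_data U p u' f' G' g'"
  proof
    show "weak_dderiv U (axis i 1) (\<lambda>x. u' x $ \<alpha>) (\<lambda>x. G' x $ \<alpha> $ i)" for \<alpha> i
      by (rule representative_weak_dderiv[OF \<Omega> U(3) has_weak_gradient_weak_gradient[OF u] m(1) u'(3,4) m(2) G'(3,4)])
    show "weak_dderiv U (axis i 1) (\<lambda>x. f' x $ \<alpha>) (\<lambda>x. g' x $ \<alpha> $ i)" for \<alpha> i
      by (rule representative_weak_dderiv[OF \<Omega> U(3) has_weak_gradient_weak_gradient[OF f] m(3) f'(3,4) m(4) g'(3,4)])
    show "(LBINT x. rad (p - 2) 0 1 (G' x) $ \<alpha> \<bullet> grad \<phi> x) = - (LBINT x. f' x $ \<alpha> * \<phi> x)"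
      if \<phi>: "test_function U \<phi>" for \<alpha> \<phi>
    proof -
      have B: "\<Omega> \<in> sets borel" using \<Omega> by simp
      have [measurable]: "\<phi> \<in> borel_measurable borel" "grad \<phi> \<in> borel_measurable borel"
        by (rule smooth_measurable[OF test_function_smooth[OF \<phi>]], rule grad_measurable[OF test_function_smooth[OF \<phi>]])
      have "(\<integral>x. norm (weak_gradient \<Omega> u x) powr (p - 2) * (weak_gradient \<Omega> u x $ \<alpha> \<bullet> grad \<phi> x) \<partial>lebesgue_on \<Omega>)
        = (LBINT x. rad (p - 2) 0 1 (G' x) $ \<alpha> \<bullet> grad \<phi> x)"
      proof (rule lebesgue_on_transfer(3)[OF B])
        show "AE x in lborel. x \<in> \<Omega> \<longrightarrow> norm (weak_gradient \<Omega> u x) powr (p - 2) * (weak_gradient \<Omega> u x $ \<alpha> \<bullet> grad \<phi> x) = rad (p - 2) 0 1 (G' x) $ \<alpha> \<bullet> grad \<phi> x"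
          using G'(4)
        proof eventually_elim
          case (elim x)
          then show ?case using grad_zero_outside[OF \<phi>, of x] by (cases "x \<in> U") (auto simp: rad_power)
        qed
        show "rad (p - 2) 0 1 (G' x) $ \<alpha> \<bullet> grad \<phi> x = 0" if "x \<notin> \<Omega>" for x
        proof -
          have "x \<notin> U" using that U(3) by blast
          then show ?thesis using G'(3) by simp
        qed
      qed measurable
      moreover have "(\<integral>x. f x $ \<alpha> * \<phi> x \<partial>lebesgue_on \<Omega>) = (LBINT x. f' x $ \<alpha> * \<phi> x)"
      proof (rule lebesgue_on_transfer(3)[OF B])
        show "AE x in lborel. x \<in> \<Omega> \<longrightarrow> f x $ \<alpha> * \<phi> x = f' x $ \<alpha> * \<phi> x"
          using f'(4)
        proof eventually_elim
          case (elim x)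
          then show ?case using test_function_zero_outside(1)[OF \<phi>, of x] by (cases "x \<in> U") auto
        qed
        show "f' x $ \<alpha> * \<phi> x = 0" if "x \<notin> \<Omega>" for x
        proof -
          have "x \<notin> U" using that U(3) by blast
          then show ?thesis using f'(3) by simp
        qed
      qed measurable
      moreover have "(\<integral>x. norm (weak_gradient \<Omega> u x) powr (p - 2) * (weak_gradient \<Omega> u x $ \<alpha> \<bullet> grad \<phi> x) \<partial>lebesgue_on \<Omega>)
        = - (\<integral>x. f x $ \<alpha> * \<phi> x \<partial>lebesgue_on \<Omega>)"
        by (rule sol[unfolded p_laplace_weak_solution_def, rule_format, OF test_function_mono[OF \<phi> U(3)]])
      ultimately show ?thesis by (simp only:)
    qed
  qed (use p U u'(1,3) G'(1,3) f'(1,3) g'(1,3) in auto)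
  from that[OF this G'(4,2) g'(2)] show thesis .
qed

text \<open>The infimum is taken over a set bounded below: testing with a vector of length exactly
  \<delta> shows that every admissible constant is nonnegative.\<close>

lemma nikolskii_seminorm_le:
  fixes w :: "'a::euclidean_space \<Rightarrow> 'b::euclidean_space"
  assumes "nikolskii_bound \<delta> \<theta> q \<Omega> w A" "\<delta> > 0"
  shows "nikolskii_seminorm \<delta> \<theta> q \<Omega> w \<le> A"
  unfolding nikolskii_seminorm_def
proof (rule cInf_lower)
  show "bdd_below {A. nikolskii_bound \<delta> \<theta> q \<Omega> w A}"
  proof (rule bdd_belowI)
    fix A assume "A \<in> {A. nikolskii_bound \<delta> \<theta> q \<Omega> w A}"
    then have A: "nikolskii_bound \<delta> \<theta> q \<Omega> w A" by simp
    obtain v :: 'a where v: "norm v = \<delta>" using vector_choose_size[of \<delta>] assms(2) by auto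
    then have "0 \<le> A * norm v powr \<theta>"
      using A unfolding nikolskii_bound_def Lp_norm_def by (smt (verit) powr_ge_zero)
    then show "0 \<le> A" using v assms(2) by (simp add: zero_le_mult_iff)
  qed
qed (use assms in simp)

text \<open>The bounded piece, both cutoffs, the gradient bound D and the margin r are chosen before
  u and f appear, so the constant does not depend on the solution.\<close>

lemma nikolskii_estimate:
  fixes \<Omega> \<Omega>' :: "(real^'n) set"
  assumes \<Omega>: "open \<Omega>" and p: "p \<ge> 3" and \<delta>: "\<delta> > 0" and \<theta>: "2 / p \<le> \<theta>" "\<theta> < 2 / (p - 1)" and \<Omega>': "\<Omega>' \<Subset> \<Omega>"
  obtains C where "C \<ge> 0" "\<And>(u :: real^'n \<Rightarrow> real^'N) f. in_W1p p \<Omega> u \<Longrightarrow> in_W1p (p / (p - 1)) \<Omega> f \<Longrightarrow> p_laplace_weak_solution p \<Omega> u f \<Longrightarrow>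
      in_nikolskii \<delta> \<theta> (2 / \<theta>) \<Omega>' (weak_gradient \<Omega> u) \<and>
      nikolskii_norm \<delta> \<theta> (2 / \<theta>) \<Omega>' (weak_gradient \<Omega> u)
        \<le> C * (Lp_norm p \<Omega> (weak_gradient \<Omega> u) + Lp_norm (p / (p - 1)) \<Omega> (weak_gradient \<Omega> f) powr (1 / (p - 1)))"
proof -
  define \<gamma> where "\<gamma> = p - 2 / \<theta>"
  have \<theta>0: "\<theta> > 0" proof -
    have "0 < 2 / p" using p by simp
    then show ?thesis using \<theta>(1) by linarith
  qed
  have \<gamma>: "0 \<le> \<gamma>" "\<gamma> < 1" using \<theta> \<theta>0 p by (auto simp: \<gamma>_def field_simps)
  have q: "p - \<gamma> = 2 / \<theta>" by (simp add: \<gamma>_def)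
  have q0: "2 / \<theta> > 0" using \<theta>0 by simp
  have q1: "1 / (2 / \<theta>) = \<theta> / 2" by simp
  have o': "open \<Omega>'" and K: "compact (closure \<Omega>')" "closure \<Omega>' \<subseteq> \<Omega>" using \<Omega>' by (auto simp: compactly_inside_def)
  obtain R where R: "closure \<Omega>' \<subseteq> ball 0 R" using compact_imp_bounded[OF K(1)] bounded_subset_ballD by blast
  \<comment> \<open>\<Omega> may be unbounded; the ball makes the measure of U finite.\<close>
  define U where "U = \<Omega> \<inter> ball 0 R"
  have U: "open U" "bounded U" "U \<subseteq> \<Omega>" "closure \<Omega>' \<subseteq> U" using \<Omega> K R by (auto simp: U_def intro: bounded_subset[OF bounded_ball])
  obtain \<eta>1 U1 where \<eta>1: "test_function U \<eta>1" "\<And>x. 0 \<le> \<eta>1 x" "\<And>x. \<eta>1 x \<le> 1"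
    and U1: "open U1" "closure \<Omega>' \<subseteq> U1" "U1 \<subseteq> U" "\<And>x. x \<in> U1 \<Longrightarrow> \<eta>1 x = 1"
    by (rule compact_cutoff[OF K(1) U(1,4)]) blast
  obtain \<eta> U2 where \<eta>: "test_function U1 \<eta>" "\<And>x. 0 \<le> \<eta> x" "\<And>x. \<eta> x \<le> 1"
    and U2: "open U2" "closure \<Omega>' \<subseteq> U2" "U2 \<subseteq> U1" "\<And>x. x \<in> U2 \<Longrightarrow> \<eta> x = 1"
    by (rule compact_cutoff[OF K(1) U1(1,2)]) blast
  obtain D where D0: "D > 0" and D: "\<And>x. norm (grad \<eta> x) \<le> D" by (rule grad_bounded[OF \<eta>(1)]) blast
  obtain r where r: "r > 0" "\<And>x y. x \<in> closure \<Omega>' \<Longrightarrow> norm (y - x) \<le> 2 * r \<Longrightarrow> y \<in> U2"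
    by (rule compact_margin[OF K(1) U2(2,1)]) blast
  have r': "y \<in> U2" if "x \<in> \<Omega>'" "norm (y - x) \<le> 2 * r" for x y using r(2)[of x y] closure_subset that by blast
  define m where "m = measure lborel U"
  define C1 where "C1 = increment_const (real CARD('n)) p \<gamma> D m r"
  have m0: "m \<ge> 0" by (simp add: m_def)
  have C1: "C1 \<ge> 0" unfolding C1_def by (rule const_nonneg(3)) (use \<gamma> m0 in auto)
  have "\<Omega>' \<subseteq> U" using U(4) closure_subset by blast
  have B': "\<Omega>' \<in> sets borel" using o' by simp
  show thesis
  proof (rule that[of "C1 powr (\<theta> / 2) + (m + 1) powr (\<theta> / 2)"])
    fix u f :: "real^'n \<Rightarrow> real^'N"
    assume uf: "in_W1p p \<Omega> u" "in_W1p (p / (p - 1)) \<Omega> f" "p_laplace_weak_solution p \<Omega> u f"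
    let ?Du = "weak_gradient \<Omega> u" and ?Df = "weak_gradient \<Omega> f"
    obtain u' f' G' g' where pd: "plap_data U p u' f' G' g'" and G'ae: "AE x in lborel. x \<in> U \<longrightarrow> ?Du x = G' x"
      and n: "Iq p G' \<le> Lp_norm p \<Omega> ?Du powr p" "Iq (p / (p - 1)) g' \<le> Lp_norm (p / (p - 1)) \<Omega> ?Df powr (p / (p - 1))"
      by (rule plap_data_representative[OF \<Omega> U(1-3) p uf]) blast
    interpret plap_data U p u' f' G' g' by (rule pd)
    define T0 where "T0 = Lp_norm p \<Omega> ?Du + Lp_norm (p / (p - 1)) \<Omega> ?Df powr (1 / (p - 1))"
    have T0: "T0 \<ge> 0" by (simp add: T0_def Lp_norm_def)
    \<comment> \<open>The normalisation divides by T, while \<open>T0\<close> may be 0. So the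
      bounds are shown for every T > \<open>T0\<close>, and T decreases to \<open>T0\<close> at the
      end.\<close>
    have main: "nikolskii_bound \<delta> \<theta> (2 / \<theta>) \<Omega>' ?Du (C1 powr (\<theta> / 2) * T)"
      "in_Lp (2 / \<theta>) \<Omega>' ?Du" "Lp_norm (2 / \<theta>) \<Omega>' ?Du \<le> (m + 1) powr (\<theta> / 2) * T" if T: "T > T0" for T
    proof -
      have Tp: "T > 0" using T T0 by simp
      have nn: "Lp_norm p \<Omega> ?Du \<ge> 0" "Lp_norm (p / (p - 1)) \<Omega> ?Df powr (1 / (p - 1)) \<ge> 0" by (simp_all add: Lp_norm_def)
      have leT: "Lp_norm p \<Omega> ?Du \<le> T" "Lp_norm (p / (p - 1)) \<Omega> ?Df powr (1 / (p - 1)) \<le> T"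
        using T nn unfolding T0_def by linarith+
      have "Lp_norm p \<Omega> ?Du powr p \<le> T powr p"
        using p leT nn by (intro powr_mono2) auto
      then have T1: "Iq p G' \<le> T powr p" using n(1) by linarith
      have "Lp_norm (p / (p - 1)) \<Omega> ?Df powr (p / (p - 1)) = (Lp_norm (p / (p - 1)) \<Omega> ?Df powr (1 / (p - 1))) powr p"
        by (simp add: powr_powr)
      also have "\<dots> \<le> T powr p"
        using p leT nn by (intro powr_mono2) auto
      finally have T2: "Iq (p / (p - 1)) g' \<le> T powr p" using n(2) by linarith
      have inc: "(\<integral>\<^sup>+x. indicator \<Omega>' x * ennreal (norm (G' (x + v) - G' x) powr (2 / \<theta>)) \<partial>lborel)
          \<le> ennreal ((norm v)\<^sup>2 * (C1 * T powr (2 / \<theta>)))" for v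
        unfolding C1_def m_def q[symmetric]
        by (rule G_increment_le[where ?U1.0=U1 and ?\<eta>1.0=\<eta>1 and \<eta>=\<eta> and ?U2.0=U2])
           (fact U1 \<eta>1 \<gamma> \<eta> U2 D B' r(1) r' Tp T1 T2)+
      have Tq: "(T powr (2 / \<theta>)) powr (\<theta> / 2) = T" using Tp \<theta>0 by (simp add: powr_powr)
      show "nikolskii_bound \<delta> \<theta> (2 / \<theta>) \<Omega>' ?Du (C1 powr (\<theta> / 2) * T)"
        unfolding nikolskii_bound_def
      proof (intro allI impI)
        fix v :: "real^'n"
        let ?S = "inner_set \<Omega>' (norm v)"
        have S: "?S \<in> sets borel" using open_inner_set[OF o'] by simp
        have sub: "x \<in> U" "x + v \<in> U" "x \<in> \<Omega>'" if "x \<in> ?S" for x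
          using that \<open>\<Omega>' \<subseteq> U\<close> by (auto simp: inner_set_def subset_iff dist_norm)
        have "Lp_norm (2 / \<theta>) ?S (\<lambda>x. ?Du (x + v) - ?Du x) \<le> ((norm v)\<^sup>2 * (C1 * T powr (2 / \<theta>))) powr (1 / (2 / \<theta>))"
        proof (rule Lp_norm_le(1)[OF S _ _ _ _ q0, where w' = "\<lambda>x. G' (x + v) - G' x"])
          show "AE x in lborel. x \<in> ?S \<longrightarrow> ?Du (x + v) - ?Du x = G' (x + v) - G' x"
            using G'ae AE_translate[OF G'ae, of v] by eventually_elim (use sub in auto)
          have "(\<integral>\<^sup>+x. indicator ?S x * ennreal (norm (G' (x + v) - G' x) powr (2 / \<theta>)) \<partial>lborel)
            \<le> (\<integral>\<^sup>+x. indicator \<Omega>' x * ennreal (norm (G' (x + v) - G' x) powr (2 / \<theta>)) \<partial>lborel)"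
            by (intro nn_integral_mono mult_right_mono) (use sub in \<open>auto simp: indicator_def\<close>)
          also note inc
          finally show "(\<integral>\<^sup>+x. indicator ?S x * ennreal (norm (G' (x + v) - G' x) powr (2 / \<theta>)) \<partial>lborel)
            \<le> ennreal ((norm v)\<^sup>2 * (C1 * T powr (2 / \<theta>)))" .
        qed (use C1 in \<open>measurable, auto\<close>)
        also have "\<dots> = C1 powr (\<theta> / 2) * T * norm v powr \<theta>"
        proof -
          have "((norm v)\<^sup>2) powr (\<theta> / 2) = norm v powr \<theta>" unfolding norm_powr_2[symmetric] powr_powr by simp
          moreover have "((norm v)\<^sup>2 * (C1 * T powr (2 / \<theta>))) powr (\<theta> / 2) = ((norm v)\<^sup>2) powr (\<theta> / 2) * (C1 powr (\<theta> / 2) * (T powr (2 / \<theta>)) powr (\<theta> / 2))"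
            using C1 by (simp only: powr_mult zero_le_power2 powr_ge_zero mult_nonneg_nonneg)
          ultimately show ?thesis unfolding q1 Tq by (simp only: mult.commute)
        qed
        finally show "Lp_norm (2 / \<theta>) ?S (\<lambda>x. ?Du (x + v) - ?Du x) \<le> C1 powr (\<theta> / 2) * T * norm v powr \<theta>" .
      qed
      have pq: "0 < 2 / \<theta>" "2 / \<theta> \<le> p" using \<gamma> q q0 by auto
      note Lq' = Iq_G_scaled_le[OF Tp T1 pq, folded m_def]
      have "(\<integral>\<^sup>+x. indicator \<Omega>' x * ennreal (norm (G' x) powr (2 / \<theta>)) \<partial>lborel) \<le> (\<integral>\<^sup>+x. ennreal (norm (G' x) powr (2 / \<theta>)) \<partial>lborel)"
        by (intro nn_integral_mono) (auto simp: indicator_def)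
      also have "\<dots> = ennreal (Iq (2 / \<theta>) G')" by (rule nn_integral_Lq[OF Lq'(2)])
      also have "\<dots> \<le> ennreal (T powr (2 / \<theta>) * (m + 1))" by (rule ennreal_leI[OF Lq'(1)])
      finally have le: "(\<integral>\<^sup>+x. indicator \<Omega>' x * ennreal (norm (G' x) powr (2 / \<theta>)) \<partial>lborel) \<le> ennreal (T powr (2 / \<theta>) * (m + 1))" .
      have ae: "AE x in lborel. x \<in> \<Omega>' \<longrightarrow> ?Du x = G' x" using G'ae by eventually_elim (use \<open>\<Omega>' \<subseteq> U\<close> in auto)
      have Gm: "G' \<in> borel_measurable borel" by measurable
      have "T powr (2 / \<theta>) * (m + 1) \<ge> 0" using m0 by simp
      note Lp = Lp_norm_le[OF B' ae Gm le this q0]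
      show "in_Lp (2 / \<theta>) \<Omega>' ?Du" by (rule Lp(2))
      show "Lp_norm (2 / \<theta>) \<Omega>' ?Du \<le> (m + 1) powr (\<theta> / 2) * T"
      proof -
        have "(T powr (2 / \<theta>) * (m + 1)) powr (\<theta> / 2) = (T powr (2 / \<theta>)) powr (\<theta> / 2) * (m + 1) powr (\<theta> / 2)" by (rule powr_mult)
        then show ?thesis using Lp(1) unfolding q1 Tq by (simp only: mult.commute)
      qed
    qed
    show "in_nikolskii \<delta> \<theta> (2 / \<theta>) \<Omega>' ?Du \<and>
      nikolskii_norm \<delta> \<theta> (2 / \<theta>) \<Omega>' ?Du \<le> (C1 powr (\<theta> / 2) + (m + 1) powr (\<theta> / 2)) * (Lp_norm p \<Omega> ?Du + Lp_norm (p / (p - 1)) \<Omega> ?Df powr (1 / (p - 1)))"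
    proof
      show "in_nikolskii \<delta> \<theta> (2 / \<theta>) \<Omega>' ?Du" unfolding in_nikolskii_def using main(1,2)[of "T0 + 1"] by auto
      have le: "nikolskii_norm \<delta> \<theta> (2 / \<theta>) \<Omega>' ?Du \<le> (C1 powr (\<theta> / 2) + (m + 1) powr (\<theta> / 2)) * T" if "T > T0" for T
        unfolding nikolskii_norm_def
        using main(3)[OF that] nikolskii_seminorm_le[OF main(1)[OF that] \<delta>] by (simp add: algebra_simps)
      have "((\<lambda>T. (C1 powr (\<theta> / 2) + (m + 1) powr (\<theta> / 2)) * T) \<longlongrightarrow> (C1 powr (\<theta> / 2) + (m + 1) powr (\<theta> / 2)) * T0) (at_right T0)"
        by (intro tendsto_intros)
      then have "nikolskii_norm \<delta> \<theta> (2 / \<theta>) \<Omega>' ?Du \<le> (C1 powr (\<theta> / 2) + (m + 1) powr (\<theta> / 2)) * T0"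
        by (rule tendsto_lowerbound) (use le in \<open>auto simp: eventually_at_filter\<close>)
      then show "nikolskii_norm \<delta> \<theta> (2 / \<theta>) \<Omega>' ?Du \<le> (C1 powr (\<theta> / 2) + (m + 1) powr (\<theta> / 2)) * (Lp_norm p \<Omega> ?Du + Lp_norm (p / (p - 1)) \<Omega> ?Df powr (1 / (p - 1)))"
        by (simp add: T0_def)
    qed
  qed simp
qed

theorem theorem1p1:
  fixes \<Omega> :: "(real^'n) set" and p p' \<delta> :: real
  assumes "open \<Omega>" and "p \<ge> 3" and "p' = p / (p - 1)" and "\<delta> > 0"
  shows "(\<forall>(u :: real^'n \<Rightarrow> real^'N) f.
            in_W1p p \<Omega> u \<and> in_W1p p' \<Omega> f \<and> p_laplace_weak_solution p \<Omega> u f \<longrightarrow>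
            (\<forall>\<theta> \<in> {2 / p ..< 2 / (p - 1)}.
               in_nikolskii_loc \<delta> \<theta> (2 / \<theta>) \<Omega> (weak_gradient \<Omega> u)))
       \<and> (\<forall>\<theta> \<in> {2 / p ..< 2 / (p - 1)}. \<forall>\<Omega>'. \<Omega>' \<Subset> \<Omega> \<longrightarrow>
            (\<exists>C. \<forall>(u :: real^'n \<Rightarrow> real^'N) f.
               in_W1p p \<Omega> u \<and> in_W1p p' \<Omega> f \<and> p_laplace_weak_solution p \<Omega> u f \<longrightarrow>
               nikolskii_norm \<delta> \<theta> (2 / \<theta>) \<Omega>' (weak_gradient \<Omega> u)
                 \<le> C * (W1p_norm p \<Omega> u + W1p_norm p' \<Omega> f powr (1 / (p - 1)))))"
proof (intro conjI allI impI ballI)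
  fix u f :: "real^'n \<Rightarrow> real^'N" and \<theta>
  assume uf: "in_W1p p \<Omega> u \<and> in_W1p p' \<Omega> f \<and> p_laplace_weak_solution p \<Omega> u f" and "\<theta> \<in> {2 / p ..< 2 / (p - 1)}"
  then have \<theta>: "2 / p \<le> \<theta>" "\<theta> < 2 / (p - 1)" by auto
  show "in_nikolskii_loc \<delta> \<theta> (2 / \<theta>) \<Omega> (weak_gradient \<Omega> u)"
    unfolding in_nikolskii_loc_def
  proof (intro allI impI)
    fix \<Omega>' assume "\<Omega>' \<Subset> \<Omega>"
    obtain C where "C \<ge> 0" "\<And>(u :: real^'n \<Rightarrow> real^'N) f. in_W1p p \<Omega> u \<Longrightarrow> in_W1p (p / (p - 1)) \<Omega> f \<Longrightarrow> p_laplace_weak_solution p \<Omega> u f \<Longrightarrow>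
      in_nikolskii \<delta> \<theta> (2 / \<theta>) \<Omega>' (weak_gradient \<Omega> u) \<and>
      nikolskii_norm \<delta> \<theta> (2 / \<theta>) \<Omega>' (weak_gradient \<Omega> u)
        \<le> C * (Lp_norm p \<Omega> (weak_gradient \<Omega> u) + Lp_norm (p / (p - 1)) \<Omega> (weak_gradient \<Omega> f) powr (1 / (p - 1)))"
      by (rule nikolskii_estimate[OF assms(1,2,4) \<theta> \<open>\<Omega>' \<Subset> \<Omega>\<close>]) blast
    then show "in_nikolskii \<delta> \<theta> (2 / \<theta>) \<Omega>' (weak_gradient \<Omega> u)" using uf assms(3) by blast
  qed
next
  fix \<theta> \<Omega>' assume "\<theta> \<in> {2 / p ..< 2 / (p - 1)}" and \<Omega>': "\<Omega>' \<Subset> \<Omega>"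
  then have \<theta>: "2 / p \<le> \<theta>" "\<theta> < 2 / (p - 1)" by auto
  obtain C where C: "C \<ge> 0" "\<And>(u :: real^'n \<Rightarrow> real^'N) f. in_W1p p \<Omega> u \<Longrightarrow> in_W1p (p / (p - 1)) \<Omega> f \<Longrightarrow> p_laplace_weak_solution p \<Omega> u f \<Longrightarrow>
      in_nikolskii \<delta> \<theta> (2 / \<theta>) \<Omega>' (weak_gradient \<Omega> u) \<and>
      nikolskii_norm \<delta> \<theta> (2 / \<theta>) \<Omega>' (weak_gradient \<Omega> u)
        \<le> C * (Lp_norm p \<Omega> (weak_gradient \<Omega> u) + Lp_norm (p / (p - 1)) \<Omega> (weak_gradient \<Omega> f) powr (1 / (p - 1)))"
    by (rule nikolskii_estimate[OF assms(1,2,4) \<theta> \<Omega>']) blast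
  show "\<exists>C. \<forall>(u :: real^'n \<Rightarrow> real^'N) f. in_W1p p \<Omega> u \<and> in_W1p p' \<Omega> f \<and> p_laplace_weak_solution p \<Omega> u f \<longrightarrow>
      nikolskii_norm \<delta> \<theta> (2 / \<theta>) \<Omega>' (weak_gradient \<Omega> u) \<le> C * (W1p_norm p \<Omega> u + W1p_norm p' \<Omega> f powr (1 / (p - 1)))"
  proof (intro exI[of _ C] allI impI)
    fix u f :: "real^'n \<Rightarrow> real^'N"
    assume uf: "in_W1p p \<Omega> u \<and> in_W1p p' \<Omega> f \<and> p_laplace_weak_solution p \<Omega> u f"
    have "Lp_norm p \<Omega> (weak_gradient \<Omega> u) \<le> W1p_norm p \<Omega> u" by (simp add: W1p_norm_def Lp_norm_def)
    moreover have "Lp_norm p' \<Omega> (weak_gradient \<Omega> f) powr (1 / (p - 1)) \<le> W1p_norm p' \<Omega> f powr (1 / (p - 1))"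
      using assms(2) by (intro powr_mono2) (auto simp: W1p_norm_def Lp_norm_def)
    ultimately have "C * (Lp_norm p \<Omega> (weak_gradient \<Omega> u) + Lp_norm p' \<Omega> (weak_gradient \<Omega> f) powr (1 / (p - 1)))
      \<le> C * (W1p_norm p \<Omega> u + W1p_norm p' \<Omega> f powr (1 / (p - 1)))"
      using C(1) by (intro mult_left_mono add_mono)
    then show "nikolskii_norm \<delta> \<theta> (2 / \<theta>) \<Omega>' (weak_gradient \<Omega> u) \<le> C * (W1p_norm p \<Omega> u + W1p_norm p' \<Omega> f powr (1 / (p - 1)))"
      using C(2)[of u f] uf assms(3) by fastforce
  qed
qed

end
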